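(* Let $d\ge2$, $T\in(0,\infty)$, and let $\alpha,\beta$ be multi-indices (in the sense of the context) with $\mathrm{Ord}(\alpha)=k_1$ and $\mathrm{Ord}(\beta)=k_2$. There exists a constant $C>0$ (independent of $N,M$ and of the functions below) such that for all dyadic numbers $1\le M\le N$ and all $u_N(0),v_M(0)\in L^2(\mathbb R^d)$ with $\Delta_Nu_N(0)=u_N(0)$ and $\Delta_Mv_M(0)=v_M(0)$, $$\big\|P(\alpha)e^{itH}u_N(0)\cdot P(\beta)e^{itH}v_M(0)\big\|_{L^2_t([0,T],L^2_x(\mathbb R^d))}\le C\,N^{k_1}M^{k_2}\,\frac{M^{\frac{d-1}{2}}}{N^{\frac12}}\,\|u_N(0)\|_{L^2(\mathbb R^d)}\|v_M(0)\|_{L^2(\mathbb R^d)}.$$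
   Context: $H=-\Delta+|x|^2$ on $\mathbb R^d$, and $e^{itH}$ is the unitary group it generates on $L^2(\mathbb R^d)$. Dyadic numbers are numbers $2^j$, $j\in\mathbb Z$. Fix $\eta\in C_0^\infty(\mathbb R)$ with $\eta=1$ on $[0,1]$ and $\eta=0$ on $[2,\infty)$, and put $\psi(x)=\eta(x)-\eta(4x)$. For $N\ge1$, $\Delta_N=\psi(H/N^2)$ is defined by the functional calculus of $H$. Multi-indices and $P(\alpha)$: a multi-index of order $k$ is $\alpha=(\alpha_1,\dots,\alpha_k)$ with $\alpha_j\in\{1,2\}$, and $\mathrm{Ord}(\alpha)=k$. On scalar functions, $P(1)u=\nabla u$ and $P(2)u=xu$ (vector valued); on vector fields $\vec u:\mathbb R^d\to\mathbb C^d$, $P(1)\vec u=\mathrm{div}\,\vec u$ and $P(2)\vec u=x\cdot\vec u$ (scalar valued). For $k\ge2$, $P(\alpha)u=P(\alpha_1)P(\alpha_2)\cdots P(\alpha_k)u$ (the rightmost factor acts first), so for instance $P(1,1)u=\Delta u$, $P(2,1)u=x\cdot\nabla u$, $P(1,2)u=\mathrm{div}(xu)$, $P(2,2)u=|x|^2u$. For order $0$, $P(\alpha)$ is the identity. The product $P(\alpha)f\cdot P(\beta)g$ is the pointwise product, being the (bilinear) dot product when both factors are vector valued. *)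

theory Defs
  imports "HOL-Analysis.Analysis"
begin

section \<open>Smooth functions and test functions\<close>

definition dir_deriv :: "'a::euclidean_space \<Rightarrow> ('a \<Rightarrow> 'b::real_normed_vector) \<Rightarrow> 'a \<Rightarrow> 'b" where
  "dir_deriv b f x = frechet_derivative f (at x) b"

text \<open>Every iterated partial derivative is totally differentiable, hence continuous.\<close>

definition smooth :: "('a::euclidean_space \<Rightarrow> 'b::real_normed_vector) \<Rightarrow> bool" where
  "smooth f \<longleftrightarrow> (\<forall>bs. set bs \<subseteq> Basis \<longrightarrow> (\<forall>x. foldr dir_deriv bs f differentiable (at x)))"

definition test_function :: "('a::euclidean_space \<Rightarrow> 'b::real_normed_vector) \<Rightarrow> bool" where
  "test_function f \<longleftrightarrow> smooth f \<and> compact (closure {x. f x \<noteq> 0})"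

definition laplacian :: "('a::euclidean_space \<Rightarrow> 'b::real_normed_vector) \<Rightarrow> 'a \<Rightarrow> 'b" where
  "laplacian f x = (\<Sum>b\<in>Basis. dir_deriv b (dir_deriv b f) x)"


section \<open>The space L2\<close>

definition esqrt :: "ennreal \<Rightarrow> ennreal" where
  "esqrt a = (if a = \<infinity> then \<infinity> else ennreal (sqrt (enn2real a)))"

text \<open>The argument is the modulus of the function, possibly with the value infinity; this allows
  the norm to be iterated (first in space, then in time).\<close>

definition L2_norm_of :: "'a measure \<Rightarrow> ('a \<Rightarrow> ennreal) \<Rightarrow> ennreal" where
  "L2_norm_of M g = esqrt (\<integral>\<^sup>+ x. (g x)\<^sup>2 \<partial>M)"

definition L2norm :: "('a::euclidean_space \<Rightarrow> 'b::real_normed_vector) \<Rightarrow> ennreal" where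
  "L2norm u = L2_norm_of lborel (\<lambda>x. ennreal (norm (u x)))"

text \<open>Elements of L2 are represented by Borel functions; they are identified when they agree almost
  everywhere, so identities between elements of L2 are always stated almost everywhere.\<close>

definition L2 :: "('a::euclidean_space \<Rightarrow> complex) set" where
  "L2 = {u \<in> borel_measurable lborel. L2norm u < \<infinity>}"

definition L2_inner :: "('a::euclidean_space \<Rightarrow> complex) \<Rightarrow> ('a \<Rightarrow> complex) \<Rightarrow> complex" where
  "L2_inner u v = (\<integral> x. u x * cnj (v x) \<partial>lborel)"


section \<open>The harmonic oscillator and its functional calculus\<close>

text \<open>The graph of \<open>H = -\<Delta> + |x|\<^sup>2\<close> with its maximal domain: \<open>(u, w)\<close> belongs to it iff \<open>u\<close> and
  \<open>w\<close> are in L2 and \<open>H u = w\<close> in the sense of distributions.  Since \<open>-\<Delta> + |x|\<^sup>2\<close> is essentially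
  self-adjoint on the test functions, this is its unique self-adjoint realization.\<close>

definition harmonic_oscillator ::
  "(('a::euclidean_space \<Rightarrow> complex) \<times> ('a \<Rightarrow> complex)) set" where
  "harmonic_oscillator = {(u, w). u \<in> L2 \<and> w \<in> L2 \<and>
     (\<forall>\<phi>. test_function \<phi> \<longrightarrow>
        (\<integral> x. u x * (- laplacian \<phi> x + complex_of_real ((norm x)\<^sup>2) * \<phi> x) \<partial>lborel)
        = (\<integral> x. w x * \<phi> x \<partial>lborel))}"

definition bounded_borel :: "(real \<Rightarrow> complex) \<Rightarrow> bool" where
  "bounded_borel f \<longleftrightarrow> f \<in> borel_measurable borel \<and> bounded (range f)"

text \<open>\<open>\<Phi> f\<close> is the operator \<open>f(A)\<close> for bounded Borel \<open>f\<close>.  These are the properties which, by the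
  spectral theorem in functional calculus form (Reed and Simon, Methods of Modern Mathematical
  Physics I, Theorem VIII.5), are satisfied by exactly one \<open>\<Phi>\<close> (up to equality almost everywhere)
  when \<open>A\<close> is the graph of a self-adjoint operator: \<open>\<Phi>\<close> is a unital contractive *-homomorphism into
  the bounded operators, \<open>\<Phi> h\<^sub>n\<close> converges strongly to \<open>A\<close> on the domain of \<open>A\<close> if \<open>h\<^sub>n\<close> tends
  pointwise to the identity with \<open>|h\<^sub>n(s)| \<le> |s|\<close>, and \<open>\<Phi>\<close> is strongly continuous under bounded
  pointwise convergence.\<close>

definition borel_functional_calculus ::
  "(('a::euclidean_space \<Rightarrow> complex) \<times> ('a \<Rightarrow> complex)) set \<Rightarrow>
   ((real \<Rightarrow> complex) \<Rightarrow> ('a \<Rightarrow> complex) \<Rightarrow> ('a \<Rightarrow> complex)) \<Rightarrow> bool" where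
  "borel_functional_calculus A \<Phi> \<longleftrightarrow>
     (\<forall>f u. bounded_borel f \<longrightarrow> u \<in> L2 \<longrightarrow> \<Phi> f u \<in> L2) \<and>
     (\<forall>f u K. bounded_borel f \<longrightarrow> u \<in> L2 \<longrightarrow> (\<forall>s. cmod (f s) \<le> K) \<longrightarrow>
        L2norm (\<Phi> f u) \<le> ennreal K * L2norm u) \<and>
     (\<forall>f u v a b. bounded_borel f \<longrightarrow> u \<in> L2 \<longrightarrow> v \<in> L2 \<longrightarrow>
        (AE x in lborel. \<Phi> f (\<lambda>y. a * u y + b * v y) x = a * \<Phi> f u x + b * \<Phi> f v x)) \<and>
     (\<forall>f g u a b. bounded_borel f \<longrightarrow> bounded_borel g \<longrightarrow> u \<in> L2 \<longrightarrow>
        (AE x in lborel. \<Phi> (\<lambda>s. a * f s + b * g s) u x = a * \<Phi> f u x + b * \<Phi> g u x)) \<and>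
     (\<forall>f g u. bounded_borel f \<longrightarrow> bounded_borel g \<longrightarrow> u \<in> L2 \<longrightarrow>
        (AE x in lborel. \<Phi> (\<lambda>s. f s * g s) u x = \<Phi> f (\<Phi> g u) x)) \<and>
     (\<forall>u. u \<in> L2 \<longrightarrow> (AE x in lborel. \<Phi> (\<lambda>s. 1) u x = u x)) \<and>
     (\<forall>f u v. bounded_borel f \<longrightarrow> u \<in> L2 \<longrightarrow> v \<in> L2 \<longrightarrow>
        L2_inner (\<Phi> f u) v = L2_inner u (\<Phi> (\<lambda>s. cnj (f s)) v)) \<and>
     (\<forall>h u w. (\<forall>n::nat. bounded_borel (h n)) \<longrightarrow> (\<forall>s. (\<lambda>n. h n s) \<longlonglongrightarrow> complex_of_real s) \<longrightarrow>
        (\<forall>n s. cmod (h n s) \<le> \<bar>s\<bar>) \<longrightarrow> (u, w) \<in> A \<longrightarrow>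
        (\<lambda>n. L2norm (\<lambda>x. \<Phi> (h n) u x - w x)) \<longlonglongrightarrow> 0) \<and>
     (\<forall>h f u K. (\<forall>n::nat. bounded_borel (h n)) \<longrightarrow> bounded_borel f \<longrightarrow>
        (\<forall>n s. cmod (h n s) \<le> K) \<longrightarrow> (\<forall>s. (\<lambda>n. h n s) \<longlonglongrightarrow> f s) \<longrightarrow> u \<in> L2 \<longrightarrow>
        (\<lambda>n. L2norm (\<lambda>x. \<Phi> (h n) u x - \<Phi> f u x)) \<longlonglongrightarrow> 0)"

definition fun_of_H ::
  "(real \<Rightarrow> complex) \<Rightarrow> ('a::euclidean_space \<Rightarrow> complex) \<Rightarrow> ('a \<Rightarrow> complex)" where
  "fun_of_H = (SOME \<Phi>. borel_functional_calculus harmonic_oscillator \<Phi>)"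

definition exp_itH :: "real \<Rightarrow> ('a::euclidean_space \<Rightarrow> complex) \<Rightarrow> ('a \<Rightarrow> complex)" where
  "exp_itH t = fun_of_H (\<lambda>s. exp (\<i> * complex_of_real (t * s)))"

definition psi :: "(real \<Rightarrow> complex) \<Rightarrow> real \<Rightarrow> complex" where
  "psi \<eta> s = \<eta> s - \<eta> (4 * s)"

definition Delta_loc ::
  "(real \<Rightarrow> complex) \<Rightarrow> real \<Rightarrow> ('a::euclidean_space \<Rightarrow> complex) \<Rightarrow> ('a \<Rightarrow> complex)" where
  "Delta_loc \<eta> N = fun_of_H (\<lambda>s. psi \<eta> (s / N\<^sup>2))"

definition dyadic :: "real set" where
  "dyadic = {2 powi j | j :: int. True}"


section \<open>The operators P and products\<close>

text \<open>Elements of L2 have no preferred representative, so derivatives are taken in the sense of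
  distributions; \<open>weak_partial i f\<close> is determined almost everywhere whenever the distributional
  derivative is a locally integrable function, and is meaningless otherwise.\<close>

definition locally_integrable :: "('a::euclidean_space \<Rightarrow> complex) \<Rightarrow> bool" where
  "locally_integrable f \<longleftrightarrow> (\<forall>K. compact K \<longrightarrow> set_integrable lborel K f)"

definition has_weak_partial ::
  "'d::finite \<Rightarrow> (real^'d \<Rightarrow> complex) \<Rightarrow> (real^'d \<Rightarrow> complex) \<Rightarrow> bool" where
  "has_weak_partial i f g \<longleftrightarrow> locally_integrable f \<and> locally_integrable g \<and>
     (\<forall>\<phi>. test_function \<phi> \<longrightarrow>
        (\<integral> x. f x * dir_deriv (axis i 1) \<phi> x \<partial>lborel) = - (\<integral> x. g x * \<phi> x \<partial>lborel))"

definition weak_partial ::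
  "'d::finite \<Rightarrow> (real^'d \<Rightarrow> complex) \<Rightarrow> (real^'d \<Rightarrow> complex)" where
  "weak_partial i f = (SOME g. has_weak_partial i f g)"

datatype 'd sv_field =
    Scalar "real^'d \<Rightarrow> complex"
  | Vector "real^'d \<Rightarrow> complex^'d"

fun P1 :: "'d::finite sv_field \<Rightarrow> 'd sv_field" where
  "P1 (Scalar u) = Vector (\<lambda>x. \<chi> i. weak_partial i u x)"
| "P1 (Vector U) = Scalar (\<lambda>x. \<Sum>i\<in>UNIV. weak_partial i (\<lambda>y. U y $ i) x)"

fun P2 :: "'d::finite sv_field \<Rightarrow> 'd sv_field" where
  "P2 (Scalar u) = Vector (\<lambda>x. \<chi> i. complex_of_real (x $ i) * u x)"
| "P2 (Vector U) = Scalar (\<lambda>x. \<Sum>i\<in>UNIV. complex_of_real (x $ i) * U x $ i)"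

definition multi_index :: "nat list \<Rightarrow> bool" where
  "multi_index \<alpha> \<longleftrightarrow> set \<alpha> \<subseteq> {1, 2}"

definition P :: "nat list \<Rightarrow> (real^'d::finite \<Rightarrow> complex) \<Rightarrow> 'd sv_field" where
  "P \<alpha> u = foldr (\<lambda>j. if j = 1 then P1 else P2) \<alpha> (Scalar u)"

fun field_mult :: "'d::finite sv_field \<Rightarrow> 'd sv_field \<Rightarrow> 'd sv_field" where
  "field_mult (Scalar f) (Scalar g) = Scalar (\<lambda>x. f x * g x)"
| "field_mult (Scalar f) (Vector G) = Vector (\<lambda>x. f x *s G x)"
| "field_mult (Vector F) (Scalar g) = Vector (\<lambda>x. g x *s F x)"
| "field_mult (Vector F) (Vector G) = Scalar (\<lambda>x. \<Sum>i\<in>UNIV. F x $ i * G x $ i)"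

fun field_L2norm :: "'d::finite sv_field \<Rightarrow> ennreal" where
  "field_L2norm (Scalar f) = L2norm f"
| "field_L2norm (Vector F) = L2norm F"

definition L2t_L2x_norm :: "real \<Rightarrow> (real \<Rightarrow> 'd::finite sv_field) \<Rightarrow> ennreal" where
  "L2t_L2x_norm T F = L2_norm_of (restrict_space lborel {0..T}) (\<lambda>t. field_L2norm (F t))"

end

(*
  The oscillator is diagonal in the tensor products of Hermite functions, with eigenvalues 2 |k| + d, so
  localized data are finite Hermite sums, x_j and the partial derivatives act by creation and
  annihilation operators, and these commute with the flow up to phases: P(alpha) costs N^(Ord alpha),
  and it remains to bound products of two finite Hermite sums.  All energies of a product differ by
  even integers, so integration over a multiple of pi reduces the space-time norm to the spatial norm
  of sum w(k,l) H_k H_l over pairs of fixed total energy.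

  If M is comparable to N, the rotation (x + y, x - y) / sqrt 2 in every coordinate, which maps products
  of Hermite functions orthonormally to products of the same total degree, and restriction to the
  diagonal leave only the values h_n(0), with h_n(0)^2 of size at most n^(-1/2).  If M is much smaller than N,
  split the first factor by a coordinate j in which its degree is of order N^2.  In the direction j
  the same rotation, together with the number operator, gives a gain 1/N; in the d - 1 other
  directions the pointwise bound sum_{b <= K} h_b(x)^2 <= sqrt (2 (K + 1)) gives the factor M^(d-1).
*)

theory Submission
  imports Defs "HOL-Probability.Probability"
begin

section \<open>Hermite functions of one variable\<close>

text \<open>All estimates are for squared norms, so the target factor is M^(d-1) / N. The rotation
  alone yields N^(d-2), which has this size only for comparable M and N; this forces the two
  regimes. In the separated regime the decay of h_n(0)^2 does not suffice, because n may be small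
  after the rotation. The number operator repairs this: for h_(L-b) h_b with b much smaller than L,
  n equals L / 2 up to an off-diagonal term of size about sqrt (b L), so that small n carry little
  mass. The other burden is that no operator comes with a formula. \<open>fun_of_H\<close> and
  \<open>weak_partial\<close> are choices, and the oscillator is known only through compactly
  supported test functions. Each is pinned down almost everywhere: the calculus by its action on
  eigenfunctions, its existence by completeness of the Hermite functions, and the weak derivative by
  approximating indicators of boxes with test functions, which have to be built from the given
  \<eta>. Only then can \<open>P\<close> be computed on coefficients.\<close>

lemma integrable_poly_gaussian: "integrable lborel (\<lambda>x::real. poly p x * exp (- x\<^sup>2 / 2))"
proof -
  have *: "integrable lborel (\<lambda>x::real. x ^ k * exp (- x\<^sup>2 / 2))" for k
  proof -
    have "integrable lborel (\<lambda>x. sqrt (2 * pi) * (std_normal_density x * x ^ k))"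
      using integrable_std_normal_moment[of k] by (intro integrable_mult_right) auto
    then show ?thesis by (simp add: std_normal_density_def mult.commute)
  qed
  have "integrable lborel (\<lambda>x::real. \<Sum>i\<le>degree p. coeff p i * (x ^ i * exp (- x\<^sup>2 / 2)))"
    using * by (intro Bochner_Integration.integrable_sum integrable_mult_right) auto
  then show ?thesis by (simp add: poly_altdef sum_distrib_right mult.assoc)
qed

lemma tendsto_poly_gaussian_at_top: "((\<lambda>x::real. poly p x * exp (- x\<^sup>2 / 2)) \<longlongrightarrow> 0) at_top"
proof -
  have *: "((\<lambda>x::real. x ^ k * exp (- x\<^sup>2 / 2)) \<longlongrightarrow> 0) at_top" for k
  proof (rule tendsto_sandwich[OF _ _ tendsto_const tendsto_power_div_exp_0])
    show "\<forall>\<^sub>F x::real in at_top. x ^ k * exp (- x\<^sup>2 / 2) \<le> x ^ k / exp x"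
      using eventually_ge_at_top[of 2]
    proof eventually_elim
      case (elim x)
      have "2 * x \<le> x * x" using elim by (intro mult_right_mono) auto
      then have "exp (- x\<^sup>2 / 2) \<le> exp (- x)" by (simp add: power2_eq_square)
      then have "x ^ k * exp (- x\<^sup>2 / 2) \<le> x ^ k * exp (- x)" using elim by (intro mult_left_mono) auto
      also have "\<dots> = x ^ k / exp x" by (simp only: exp_minus divide_inverse)
      finally show ?case .
    qed
    show "\<forall>\<^sub>F x::real in at_top. 0 \<le> x ^ k * exp (- x\<^sup>2 / 2)"
      using eventually_ge_at_top[of 0] by eventually_elim auto
  qed
  have "((\<lambda>x::real. \<Sum>i\<le>degree p. coeff p i * (x ^ i * exp (- x\<^sup>2 / 2))) \<longlongrightarrow> (\<Sum>i\<le>degree p. coeff p i * 0)) at_top"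
    using * by (intro tendsto_sum tendsto_mult tendsto_const) auto
  then show ?thesis by (simp add: poly_altdef sum_distrib_right mult.assoc)
qed

lemma tendsto_poly_gaussian_at_bot: "((\<lambda>x::real. poly p x * exp (- x\<^sup>2 / 2)) \<longlongrightarrow> 0) at_bot"
  unfolding filterlim_at_bot_mirror
  using tendsto_poly_gaussian_at_top[of "pcompose p [:0, -1:]"] by (simp add: poly_pcompose)

text \<open>The \<open>L\<^sup>2\<close>-normalized Hermite functions, through their three-term recurrence.\<close>

fun hermite :: "nat \<Rightarrow> real \<Rightarrow> real" where
  "hermite 0 x = pi powr (- 1 / 4) * exp (- x\<^sup>2 / 2)"
| "hermite (Suc 0) x = sqrt 2 * x * hermite 0 x"
| "hermite (Suc (Suc n)) x =
    (sqrt 2 * x * hermite (Suc n) x - sqrt (real n + 1) * hermite n x) / sqrt (real n + 2)"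

text \<open>The recurrence in a form valid from n = 0 on: there the truncated n - 1 is 0 again, but
  its coefficient \<open>sqrt (real n)\<close> vanishes. The formulas for x h_n and h_n' rely on the
  same convention.\<close>

lemma hermite_Suc:
  "sqrt (real n + 1) * hermite (Suc n) x = sqrt 2 * x * hermite n x - sqrt (real n) * hermite (n - 1) x"
  by (cases n) (auto simp: field_simps)

lemma hermite_times_x:
  "x * hermite n x = sqrt ((real n + 1) / 2) * hermite (Suc n) x + sqrt (real n / 2) * hermite (n - 1) x"
proof -
  have "sqrt 2 * (x * hermite n x) = sqrt (real n + 1) * hermite (Suc n) x + sqrt (real n) * hermite (n - 1) x"
    using hermite_Suc[of n x] by simp
  then have "x * hermite n x = (sqrt (real n + 1) * hermite (Suc n) x + sqrt (real n) * hermite (n - 1) x) / sqrt 2"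
    by (simp add: field_simps)
  moreover have "sqrt ((real n + 1) / 2) = sqrt (real n + 1) / sqrt 2" "sqrt (real n / 2) = sqrt (real n) / sqrt 2"
    by (rule real_sqrt_divide)+
  ultimately show ?thesis by (simp only: add_divide_distrib times_divide_eq_left)
qed

text \<open>Only the lowering term and x h_n occur, so that the recurrence can be differentiated in
  the induction step. The symmetric two-sided form follows afterwards from
  \<open>hermite_times_x\<close>.\<close>

lemma hermite_deriv_aux:
  "(hermite n has_real_derivative sqrt (2 * real n) * hermite (n - 1) x - x * hermite n x) (at x)"
proof (induction n x rule: hermite.induct)
  case (1 x)
  show ?case unfolding hermite.simps[abs_def]
    by (auto intro!: derivative_eq_intros)
next
  case (2 x)
  note [derivative_intros] = 2[unfolded hermite.simps[abs_def]]
  show ?case unfolding hermite.simps[abs_def]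
    by (auto intro!: derivative_eq_intros simp: algebra_simps)
next
  case (3 n x)
  have IH1: "(hermite (Suc n) has_real_derivative sqrt (2 * real (Suc n)) * hermite n x - x * hermite (Suc n) x) (at x)"
    using 3(1) by simp
  \<comment> \<open>The recurrence removes h_(n-1) from the derivative of h_n, so that the step
    involves only h_n and h_(n+1).\<close>
  have "sqrt (2 * real n) * hermite (n - 1) x - x * hermite n x = x * hermite n x - sqrt (2 * (real n + 1)) * hermite (Suc n) x"
  proof -
    have "sqrt 2 * (sqrt (real n + 1) * hermite (Suc n) x) = sqrt 2 * (sqrt 2 * x * hermite n x - sqrt (real n) * hermite (n - 1) x)"
      using hermite_Suc[of n x] by simp
    moreover have "sqrt (2 * (real n + 1)) = sqrt 2 * sqrt (real n + 1)" "sqrt (2 * real n) = sqrt 2 * sqrt (real n)"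
      by (rule real_sqrt_mult)+
    moreover have "sqrt 2 * (sqrt 2 * x * hermite n x) = 2 * (x * hermite n x)" by simp
    ultimately show ?thesis by (simp add: right_diff_distrib del: hermite.simps)
  qed
  then have IH2: "(hermite n has_real_derivative x * hermite n x - sqrt (2 * (real n + 1)) * hermite (Suc n) x) (at x)"
    using 3(2) by simp
  have D: "(hermite (Suc (Suc n)) has_real_derivative
     (sqrt 2 * hermite (Suc n) x + sqrt 2 * x * (sqrt (2 * real (Suc n)) * hermite n x - x * hermite (Suc n) x)
      - sqrt (real n + 1) * (x * hermite n x - sqrt (2 * (real n + 1)) * hermite (Suc n) x)) / sqrt (real n + 2)) (at x)"
    unfolding hermite.simps[abs_def]
    by (rule DERIV_cdivide) (rule derivative_eq_intros IH1 IH2 refl | simp add: algebra_simps)+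
  define r s H K where rs: "r = sqrt (real n + 1)" "s = sqrt (real n + 2)" and HK: "H = hermite (Suc n) x" "K = hermite n x"
  have r2: "r * r = real n + 1" and s2: "s * s = real n + 2" and s0: "s > 0" unfolding rs by auto
  have t2: "sqrt 2 * sqrt 2 = (2::real)" by simp
  define t where "t = sqrt (2::real)"
  have "(t * H + t * x * (t * r * K - x * H) - r * (x * K - t * r * H)) / s
      = t * s * H - x * ((t * x * H - r * K) / s)"
  proof -
    have "t * H + t * x * (t * r * K - x * H) - r * (x * K - t * r * H)
       = (t * H + (t*t) * x * r * K - t * x * x * H - r * x * K + t * (r * r) * H)" by (simp add: algebra_simps)
    also have "\<dots> = t * H + 2 * x * r * K - t * x * x * H - r * x * K + t * (real n + 1) * H"
      using t2 r2 unfolding t_def by simp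
    also have "\<dots> = t * (s * s) * H - x * (t * x * H - r * K)" unfolding s2 by (simp add: algebra_simps)
    finally show ?thesis using s0 by (simp add: field_simps)
  qed
  moreover have "sqrt (2 * real (Suc n)) = t * r" "sqrt (2 * (real n + 1)) = t * r" "sqrt (2 * real (Suc (Suc n))) = t * s"
    unfolding t_def rs by (simp_all add: real_sqrt_mult[symmetric] add.commute)
  ultimately have "(hermite (Suc (Suc n)) has_real_derivative
    sqrt (2 * real (Suc (Suc n))) * hermite (Suc n) x - x * ((t * x * hermite (Suc n) x - r * hermite n x) / s)) (at x)"
    using D by (simp only: t_def[symmetric] rs[symmetric] HK mult.assoc)
  moreover have "hermite (Suc (Suc n)) x = (t * x * hermite (Suc n) x - r * hermite n x) / s"
    by (simp only: hermite.simps(3) rs t_def)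
  ultimately show ?case by (simp only: diff_Suc_1)
qed

lemma has_real_derivative_hermite:
  "(hermite n has_real_derivative
     sqrt (real n / 2) * hermite (n - 1) x - sqrt ((real n + 1) / 2) * hermite (Suc n) x) (at x)"
proof -
  have "sqrt (2 * real n) = 2 * sqrt (real n / 2)"
    by (rule real_sqrt_unique[symmetric, THEN sym]) (auto simp: power_mult_distrib)
  moreover have "2 * (sqrt (real n / 2) * hermite (n - 1) x) - x * hermite n x
      = sqrt (real n / 2) * hermite (n - 1) x - sqrt ((real n + 1) / 2) * hermite (Suc n) x"
    unfolding hermite_times_x by simp
  ultimately show ?thesis using hermite_deriv_aux[of n x] by (simp only: mult.assoc)
qed

text \<open>Source of the decay: limits, boundedness and integrability of Hermite functions are
  reduced to polynomials times a Gaussian.\<close>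

lemma hermite_poly: "\<exists>p. \<forall>x. hermite n x = poly p x * exp (- x\<^sup>2 / 2)"
proof (induction n rule: induct_nat_012)
  case 0
  show ?case by (rule exI[of _ "[:pi powr (- 1 / 4):]"]) auto
next
  case 1
  show ?case by (rule exI[of _ "[:0, sqrt 2 * pi powr (- 1 / 4):]"]) auto
next
  case (ge2 n)
  then obtain p q where p: "\<And>x. hermite (Suc n) x = poly p x * exp (- x\<^sup>2 / 2)" and q: "\<And>x. hermite n x = poly q x * exp (- x\<^sup>2 / 2)" by blast
  have "\<forall>x. hermite (Suc (Suc n)) x = poly (smult (1 / sqrt (real n + 2)) ([:0, sqrt 2:] * p - smult (sqrt (real n + 1)) q)) x * exp (- x\<^sup>2 / 2)"
    by (simp add: p q algebra_simps diff_divide_distrib)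
  then show ?case by blast
qed

declare hermite.simps [simp del]

lemma continuous_hermite [continuous_intros]:
  "continuous_on S f \<Longrightarrow> continuous_on S (\<lambda>x. hermite n (f x))"
  by (rule continuous_on_compose2[of UNIV "hermite n"])
    (auto intro!: DERIV_continuous_on hermite_deriv_aux)

lemma borel_measurable_hermite [measurable]: "hermite n \<in> borel_measurable borel"
  by (intro borel_measurable_continuous_onI continuous_intros)

lemma integrable_poly_hermite: "integrable lborel (\<lambda>x. poly p x * hermite n x)"
proof -
  obtain q where q: "\<And>x. hermite n x = poly q x * exp (- x\<^sup>2 / 2)" using hermite_poly by blast
  show ?thesis using integrable_poly_gaussian[of "p * q"] by (simp add: q mult.assoc)
qed

lemma bounded_hermite: "\<exists>B. \<forall>x. \<bar>hermite n x\<bar> \<le> B"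
proof -
  obtain p where p: "hermite n = (\<lambda>x. poly p x * exp (- x\<^sup>2 / 2))" using hermite_poly by blast
  have "(hermite n \<longlongrightarrow> 0) at_top" "(hermite n \<longlongrightarrow> 0) at_bot"
    unfolding p by (rule tendsto_poly_gaussian_at_top tendsto_poly_gaussian_at_bot)+
  then have "\<forall>\<^sub>F x in at_top. dist (hermite n x) 0 < 1" "\<forall>\<^sub>F x in at_bot. dist (hermite n x) 0 < 1"
    by (auto dest: tendstoD[where e=1])
  then obtain a b where ab: "\<And>x. x \<ge> a \<Longrightarrow> \<bar>hermite n x\<bar> < 1" "\<And>x. x \<le> b \<Longrightarrow> \<bar>hermite n x\<bar> < 1"
    by (auto simp: eventually_at_top_linorder eventually_at_bot_linorder)
  have "compact (hermite n ` {b..a})" by (intro compact_continuous_image continuous_intros) auto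
  then obtain B where B: "\<And>x. x \<in> {b..a} \<Longrightarrow> \<bar>hermite n x\<bar> \<le> B"
    by (metis bounded_iff compact_imp_bounded imageI real_norm_def)
  have "\<bar>hermite n x\<bar> \<le> max 1 B" for x
    using ab(1)[of x] ab(2)[of x] B[of x] by (cases "x \<ge> a"; cases "x \<le> b") auto
  then show ?thesis by blast
qed

lemma integrable_hermite_mult: "integrable lborel (\<lambda>x. hermite m x * hermite n x)"
proof -
  obtain B where B: "\<And>x. \<bar>hermite n x\<bar> \<le> B" using bounded_hermite by blast
  show ?thesis
  proof (rule Bochner_Integration.integrable_bound)
    show "integrable lborel (\<lambda>x. B * hermite m x)" using integrable_poly_hermite[of "[:B:]" m] by simp
    show "AE x in lborel. norm (hermite m x * hermite n x) \<le> norm (B * hermite m x)"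
    proof (intro AE_I2)
      fix x show "norm (hermite m x * hermite n x) \<le> norm (B * hermite m x)"
      using B[of x] by (auto simp: abs_mult mult.commute[of "\<bar>hermite m x\<bar>"] intro!: mult_right_mono) 
    qed
  qed measurable
qed

lemma tendsto_hermite_mult:
  "((\<lambda>x. hermite m x * hermite n x) \<longlongrightarrow> 0) at_top" "((\<lambda>x. hermite m x * hermite n x) \<longlongrightarrow> 0) at_bot"
proof -
  obtain p where p: "\<And>x. hermite m x = poly p x * exp (- x\<^sup>2 / 2)" using hermite_poly by blast
  obtain q where q: "\<And>x. hermite n x = poly q x * exp (- x\<^sup>2 / 2)" using hermite_poly by blast
  show "((\<lambda>x. hermite m x * hermite n x) \<longlongrightarrow> 0) at_top"
    using tendsto_mult[OF tendsto_poly_gaussian_at_top[of p] tendsto_poly_gaussian_at_top[of q]] by (simp add: p q)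
  show "((\<lambda>x. hermite m x * hermite n x) \<longlongrightarrow> 0) at_bot"
    using tendsto_mult[OF tendsto_poly_gaussian_at_bot[of p] tendsto_poly_gaussian_at_bot[of q]] by (simp add: p q)
qed

text \<open>The recurrences for \<open>x h\<^sub>n\<close> and \<open>h\<^sub>n'\<close> determine the Gram matrix up to \<open>hmul 0 0\<close>.\<close>

definition hmul :: "nat \<Rightarrow> nat \<Rightarrow> real" where
  "hmul m n = (\<integral>x. hermite m x * hermite n x \<partial>lborel)"

text \<open>Two relations are combined: the derivative of h_m h_n has integral zero, and
  multiplication by x is symmetric. Adding them cancels the terms with m + 1 and n - 1; what remains
  says that lowering and raising are adjoint.\<close>

lemma hmul_ladder: "sqrt (real m) * hmul (m - 1) n = sqrt (real n + 1) * hmul m (Suc n)"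
proof -
  define f where "f x = (sqrt (real m / 2) * hermite (m - 1) x - sqrt ((real m + 1) / 2) * hermite (Suc m) x) * hermite n x
     + hermite m x * (sqrt (real n / 2) * hermite (n - 1) x - sqrt ((real n + 1) / 2) * hermite (Suc n) x)" for x
  have f_alt: "f = (\<lambda>x. sqrt (real m / 2) * (hermite (m - 1) x * hermite n x) - sqrt ((real m + 1) / 2) * (hermite (Suc m) x * hermite n x)
     + (sqrt (real n / 2) * (hermite m x * hermite (n - 1) x) - sqrt ((real n + 1) / 2) * (hermite m x * hermite (Suc n) x)))"
    by (auto simp: f_def algebra_simps fun_eq_iff)
  have fi: "integrable lborel f" unfolding f_alt
    by (intro Bochner_Integration.integrable_add Bochner_Integration.integrable_diff integrable_mult_right integrable_hermite_mult)
  have "(LBINT x=-\<infinity>..\<infinity>. f x) = 0 - 0"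
  proof (rule interval_integral_FTC_integrable)
    fix x show "((\<lambda>x. hermite m x * hermite n x) has_vector_derivative f x) (at x)"
      unfolding has_real_derivative_iff_has_vector_derivative[symmetric] f_def
      by (rule derivative_eq_intros has_real_derivative_hermite refl | simp)+
    have "continuous_on UNIV f" unfolding f_alt by (intro continuous_intros)
    then show "isCont f x" by (simp add: continuous_on_eq_continuous_at)
  next
    show "set_integrable lborel (einterval (-\<infinity>) \<infinity>) f" using fi by (simp add: set_integrable_def)
    show "(((\<lambda>x. hermite m x * hermite n x) \<circ> real_of_ereal) \<longlongrightarrow> 0) (at_right (-\<infinity>))"
      "(((\<lambda>x. hermite m x * hermite n x) \<circ> real_of_ereal) \<longlongrightarrow> 0) (at_left \<infinity>)"
      unfolding ereal_tendsto_simps by (rule tendsto_hermite_mult)+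
  qed auto
  then have 0: "(\<integral>x. f x \<partial>lborel) = 0"
    by (simp add: interval_lebesgue_integral_def set_lebesgue_integral_def)
  have 1: "sqrt (real m / 2) * hmul (m - 1) n - sqrt ((real m + 1) / 2) * hmul (Suc m) n
     + (sqrt (real n / 2) * hmul m (n - 1) - sqrt ((real n + 1) / 2) * hmul m (Suc n)) = 0"
    using 0 unfolding f_alt hmul_def
    by (subst (asm) Bochner_Integration.integral_add Bochner_Integration.integral_diff; simp add: integrable_hermite_mult)+
  have "(\<integral>x. (x * hermite m x) * hermite n x \<partial>lborel) = (\<integral>x. hermite m x * (x * hermite n x) \<partial>lborel)"
    by (simp add: ac_simps)
  then have 2: "sqrt ((real m + 1) / 2) * hmul (Suc m) n + sqrt (real m / 2) * hmul (m - 1) n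
    = sqrt ((real n + 1) / 2) * hmul m (Suc n) + sqrt (real n / 2) * hmul m (n - 1)"
    unfolding hermite_times_x hmul_def distrib_left distrib_right
    by (simp add: mult.assoc mult.left_commute[of "hermite m _" "sqrt _"] integrable_hermite_mult)
  have "sqrt (real m / 2) * hmul (m - 1) n = sqrt ((real n + 1) / 2) * hmul m (Suc n)"
    using 1 2 by simp
  then show ?thesis by (simp add: real_sqrt_divide)
qed

lemma hmul_00: "hmul 0 0 = 1"
proof -
  have "has_bochner_integral lborel (\<lambda>x::real. exp (- x\<^sup>2)) (sqrt pi)"
    using has_bochner_integral_even_function[OF gaussian_moment_0] by simp
  then have "integral\<^sup>L lborel (\<lambda>x::real. pi powr (- 1 / 2) * exp (- x\<^sup>2)) = pi powr (- 1 / 2) * sqrt pi"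
    by (simp add: has_bochner_integral_iff)
  moreover have "hermite 0 x * hermite 0 x = pi powr (- 1 / 2) * exp (- x\<^sup>2)" for x
    by (simp add: hermite.simps powr_add[symmetric] exp_add[symmetric] mult.assoc mult.left_commute[of "exp _"])
  moreover have "pi powr (- 1 / 2) * sqrt pi = 1"
    by (simp add: powr_half_sqrt[symmetric] powr_add[symmetric])
  ultimately show ?thesis unfolding hmul_def by (simp)
qed

lemma hmul_eq: "hmul m n = (if m = n then 1 else 0)"
proof (induction n arbitrary: m)
  case 0
  have "hmul (Suc k) 0 = 0" for k
    using hmul_ladder[of 0 k] by (simp add: hmul_def mult.commute)
  then show ?case by (cases m) (auto simp: hmul_00)
next
  case (Suc n)
  have "sqrt (real m) * hmul (m - 1) n = sqrt (real n + 1) * hmul m (Suc n)" by (rule hmul_ladder)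
  then have "hmul m (Suc n) = sqrt (real m) * hmul (m - 1) n / sqrt (real n + 1)" by (simp add: field_simps)
  then show ?case using Suc[of "m - 1"] by (cases m) (auto simp: add.commute)
qed

text \<open>The derivative of the left-hand side telescopes to \<open>- sqrt (2 (K + 1)) h\<^sub>K h\<^sub>K\<^sub>+\<^sub>1\<close>, whose integral is controlled by
  the arithmetic-geometric mean inequality and the normalization.\<close>

lemma sum_hermite_sq_le: "(\<Sum>b\<le>K. (hermite b x)\<^sup>2) \<le> sqrt (2 * (real K + 1))"
proof -
  define S where "S x = (\<Sum>b\<le>K. (hermite b x)\<^sup>2)" for x
  define c where "c = sqrt (2 * (real K + 1))"
  have S': "(S has_real_derivative - c * (hermite K x * hermite (Suc K) x)) (at x)" for x
    unfolding S_def c_def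
  proof (induction K)
    case 0
    show ?case by (auto intro!: derivative_eq_intros has_real_derivative_hermite simp: real_sqrt_divide real_div_sqrt real_sqrt_mult field_simps)
  next
    case (Suc K)
    have "sqrt ((real K + 1) / 2) * 2 = sqrt (2 * (real K + 1))" for K
      by (rule real_sqrt_unique[symmetric]) (auto simp: power_mult_distrib)
    note s = this
    let ?D = "sqrt (real (Suc K) / 2) * hermite K x - sqrt ((real (Suc K) + 1) / 2) * hermite (Suc (Suc K)) x"
    have "((\<lambda>x. (hermite (Suc K) x)\<^sup>2) has_real_derivative of_nat 2 * (?D * hermite (Suc K) x ^ (2 - Suc 0))) (at x)"
      using has_real_derivative_hermite[of "Suc K" x] by (intro DERIV_power) (simp only: diff_Suc_1)
    from DERIV_add[OF Suc this]
    have "((\<lambda>x. \<Sum>b\<le>Suc K. (hermite b x)\<^sup>2) has_real_derivative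
       - sqrt (2 * (real K + 1)) * (hermite K x * hermite (Suc K) x) + of_nat 2 * (?D * hermite (Suc K) x ^ (2 - Suc 0))) (at x)"
      by (simp only: sum.atMost_Suc)
    moreover have "- sqrt (2 * (real K + 1)) * (hermite K x * hermite (Suc K) x) + of_nat 2 * (?D * hermite (Suc K) x ^ (2 - Suc 0))
      = - sqrt (2 * (real (Suc K) + 1)) * (hermite (Suc K) x * hermite (Suc (Suc K)) x)"
      unfolding s[symmetric] by (simp add: algebra_simps)
    ultimately show ?case by (simp only:)
  qed
  have lim: "(S \<longlongrightarrow> 0) at_top"
  proof -
    have "(S \<longlongrightarrow> (\<Sum>b\<le>K. 0)) at_top" unfolding S_def power2_eq_square
      by (intro tendsto_sum tendsto_hermite_mult)
    then show ?thesis by simp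
  qed
  have le: "S x - S y \<le> c" if "x \<le> y" for y
  proof -
    have "(\<integral>z. (- c * (hermite K z * hermite (Suc K) z)) * indicator {x .. y} z \<partial>lborel) = S y - S x"
    proof (rule integral_FTC_Icc_real[OF that S'])
      have "continuous_on UNIV (\<lambda>z. - c * (hermite K z * hermite (Suc K) z))" by (intro continuous_intros)
      then show "isCont (\<lambda>z. - c * (hermite K z * hermite (Suc K) z)) z" for z by (simp add: continuous_on_eq_continuous_at)
    qed
    then have "S x - S y = - (\<integral>z. (- c * (hermite K z * hermite (Suc K) z)) * indicator {x .. y} z \<partial>lborel)" by simp
    also have "\<dots> = (\<integral>z. c * (hermite K z * hermite (Suc K) z) * indicator {x .. y} z \<partial>lborel)"
      by (subst integral_minus[symmetric]) (simp add: algebra_simps)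
    also have "\<dots> \<le> (\<integral>z. c * ((hermite K z * hermite K z) / 2 + (hermite (Suc K) z * hermite (Suc K) z) / 2) \<partial>lborel)"
    proof (rule integral_mono)
      show "integrable lborel (\<lambda>z. c * (hermite K z * hermite (Suc K) z) * indicator {x..y} z)"
        by (intro integrable_real_mult_indicator integrable_mult_right integrable_hermite_mult) auto
      show "integrable lborel (\<lambda>z. c * ((hermite K z * hermite K z) / 2 + (hermite (Suc K) z * hermite (Suc K) z) / 2))"
        by (intro integrable_mult_right Bochner_Integration.integrable_add integrable_divide integrable_hermite_mult)
      fix z
      have "2 * (hermite K z * hermite (Suc K) z) \<le> (hermite K z * hermite K z) + (hermite (Suc K) z * hermite (Suc K) z)"
        using sum_squares_bound[of "hermite K z" "hermite (Suc K) z"] by (simp add: power2_eq_square)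
      moreover have "0 \<le> hermite K z * hermite K z + (hermite (Suc K) z * hermite (Suc K) z)" by simp
      moreover have "c \<ge> 0" unfolding c_def by simp
      ultimately show "c * (hermite K z * hermite (Suc K) z) * indicator {x..y} z \<le> c * ((hermite K z * hermite K z) / 2 + (hermite (Suc K) z * hermite (Suc K) z) / 2)"
        unfolding mult.assoc by (intro mult_left_mono) (auto simp: indicator_def)
    qed
    also have "\<dots> = c * (hmul K K / 2 + hmul (Suc K) (Suc K) / 2)"
      unfolding hmul_def by (simp add: integrable_hermite_mult)
    also have "\<dots> = c" by (simp add: hmul_eq)
    finally show ?thesis by simp
  qed
  \<comment> \<open>S decays at infinity, so the bound on increments becomes a pointwise bound as y
    tends to infinity.\<close>
  have "((\<lambda>y. S x - S y) \<longlongrightarrow> S x - 0) at_top" by (intro tendsto_intros lim)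
  then have "S x - 0 \<le> c"
    by (rule tendsto_upperbound) (auto intro: eventually_mono[OF eventually_ge_at_top[of x]] le)
  then show ?thesis unfolding S_def c_def by simp
qed

text \<open>At the origin the recurrence reads h_(n+2)(0)^2 = (n+1) / (n+2) h_n(0)^2, and odd values
  vanish. The bound is inherited because (n+1) (n+3) <= (n+2)^2.\<close>

lemma hermite_0_sq_le: "(hermite n 0)\<^sup>2 \<le> 1 / sqrt (real n + 1)"
proof -
  \<comment> \<open>The point 0 is turned into a variable because the induction rule of
    \<open>hermite\<close> carries the argument along.\<close>
  have "(hermite n x)\<^sup>2 \<le> 1 / sqrt (real n + 1)" if "x = 0" for x
    using that
  proof (induction n x rule: hermite.induct)
    case (1 x)
    have "pi powr (-1/4) \<le> pi powr 0" using pi_gt3 by (intro powr_mono) auto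
    then show ?case using 1 by (simp add: hermite.simps power_le_one)
  next
    case (2 x)
    then show ?case by (simp add: hermite.simps)
  next
    case (3 n x)
    have "(hermite (Suc (Suc n)) x)\<^sup>2 = (real n + 1) / (real n + 2) * (hermite n x)\<^sup>2"
      using 3(3) by (simp add: hermite.simps power_divide power_mult_distrib)
    also have "\<dots> \<le> (real n + 1) / (real n + 2) * (1 / sqrt (real n + 1))"
      using 3 by (intro mult_left_mono) auto
    also have "\<dots> = (real n + 1) / sqrt (real n + 1) / (real n + 2)"
      by (simp add: mult.commute)
    also have "\<dots> = sqrt (real n + 1) / (real n + 2)"
      by (subst real_div_sqrt) auto
    also have "\<dots> \<le> 1 / sqrt (real n + 3)"
    proof -
      have "sqrt (real n + 1) * sqrt (real n + 3) = sqrt ((real n + 1) * (real n + 3))" by (simp add: real_sqrt_mult)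
      also have "\<dots> \<le> sqrt ((real n + 2)\<^sup>2)" by (intro real_sqrt_le_mono) (simp add: power2_eq_square algebra_simps)
      finally show ?thesis by (simp add: field_simps)
    qed
    finally show ?case by (simp add: add.commute)
  qed
  then show ?thesis by simp
qed

section \<open>Rotation of products of Hermite functions\<close>

text \<open>Finite Pythagoras for real orthonormal rows. Applied to the rotation coefficients, it
  turns sums over rotated indices back into sums over the original weights.\<close>

lemma sum_norm_sq_orthonormal:
  fixes w :: "'i \<Rightarrow> complex" and r :: "'i \<Rightarrow> 'x \<Rightarrow> real"
  assumes "finite I"
    and ort: "\<And>i j. i \<in> I \<Longrightarrow> j \<in> I \<Longrightarrow> (\<Sum>x\<in>X. r i x * r j x) = (if i = j then 1 else 0)"
  shows "(\<Sum>x\<in>X. (cmod (\<Sum>i\<in>I. w i * of_real (r i x)))\<^sup>2) = (\<Sum>i\<in>I. (cmod (w i))\<^sup>2)"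
proof -
  have "complex_of_real (\<Sum>x\<in>X. (cmod (\<Sum>i\<in>I. w i * of_real (r i x)))\<^sup>2)
     = (\<Sum>x\<in>X. (\<Sum>i\<in>I. w i * of_real (r i x)) * (\<Sum>j\<in>I. cnj (w j) * of_real (r j x)))"
    by (simp only: of_real_sum complex_norm_square cnj_sum complex_cnj_mult complex_cnj_complex_of_real)
  also have "\<dots> = (\<Sum>x\<in>X. \<Sum>i\<in>I. \<Sum>j\<in>I. w i * cnj (w j) * of_real (r i x * r j x))"
    by (simp add: sum_product algebra_simps)
  also have "\<dots> = (\<Sum>i\<in>I. \<Sum>j\<in>I. w i * cnj (w j) * of_real (\<Sum>x\<in>X. r i x * r j x))"
    by (subst sum.swap, intro sum.cong refl, subst sum.swap) (simp add: sum_distrib_left)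
  also have "\<dots> = (\<Sum>i\<in>I. \<Sum>j\<in>I. if j = i then w i * cnj (w i) else 0)"
    by (intro sum.cong refl) (simp add: ort)
  also have "\<dots> = (\<Sum>i\<in>I. w i * cnj (w i))" using assms(1) by simp
  also have "\<dots> = complex_of_real (\<Sum>i\<in>I. (cmod (w i))\<^sup>2)"
    by (simp only: of_real_sum complex_norm_square)
  finally show ?thesis by (simp only: of_real_eq_iff)
qed

text \<open>The squared norms \<open>K i\<close> are kept free: on the diagonal the Hermite
  functions are rescaled by sqrt 2, and in \<open>L2sq_Hrest\<close> each index carries its own
  norm.\<close>

lemma integral_norm_sq_orthogonal:
  fixes w :: "'i \<Rightarrow> complex" and \<phi> :: "'i \<Rightarrow> 'x \<Rightarrow> complex"
  assumes "finite I"
    and int: "\<And>i j. i \<in> I \<Longrightarrow> j \<in> I \<Longrightarrow> integrable M (\<lambda>x. \<phi> i x * cnj (\<phi> j x))"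
    and ort: "\<And>i j. i \<in> I \<Longrightarrow> j \<in> I \<Longrightarrow> (\<integral>x. \<phi> i x * cnj (\<phi> j x) \<partial>M) = (if i = j then of_real (K i) else 0)"
  shows "integrable M (\<lambda>x. (cmod (\<Sum>i\<in>I. w i * \<phi> i x))\<^sup>2)" (is ?A)
    and "(\<integral>x. (cmod (\<Sum>i\<in>I. w i * \<phi> i x))\<^sup>2 \<partial>M) = (\<Sum>i\<in>I. K i * (cmod (w i))\<^sup>2)" (is ?B)
proof -
  have eq: "complex_of_real ((cmod (\<Sum>i\<in>I. w i * \<phi> i x))\<^sup>2)
     = (\<Sum>i\<in>I. \<Sum>j\<in>I. w i * cnj (w j) * (\<phi> i x * cnj (\<phi> j x)))" for x
    by (simp only: complex_norm_square cnj_sum complex_cnj_mult sum_product) (simp add: algebra_simps)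
  have *: "has_bochner_integral M (\<lambda>x. complex_of_real ((cmod (\<Sum>i\<in>I. w i * \<phi> i x))\<^sup>2))
     (\<Sum>i\<in>I. \<Sum>j\<in>I. w i * cnj (w j) * (if i = j then of_real (K i) else 0))"
    unfolding eq
    by (intro has_bochner_integral_sum has_bochner_integral_mult_right)
      (auto simp: has_bochner_integral_iff int ort)
  have "(\<Sum>i\<in>I. \<Sum>j\<in>I. w i * cnj (w j) * (if i = j then of_real (K i) else 0))
     = (\<Sum>i\<in>I. \<Sum>j\<in>I. if j = i then w i * cnj (w i) * of_real (K i) else 0)"
    by (intro sum.cong refl) auto
  also have "\<dots> = of_real (\<Sum>i\<in>I. K i * (cmod (w i))\<^sup>2)"
    using assms(1) by (simp only: sum.delta of_real_sum of_real_mult complex_norm_square) (simp add: mult.commute)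
  finally have "has_bochner_integral M (\<lambda>x. complex_of_real ((cmod (\<Sum>i\<in>I. w i * \<phi> i x))\<^sup>2)) (of_real (\<Sum>i\<in>I. K i * (cmod (w i))\<^sup>2))"
    using * by simp
  then have "has_bochner_integral M (\<lambda>x. Re (complex_of_real ((cmod (\<Sum>i\<in>I. w i * \<phi> i x))\<^sup>2))) (Re (of_real (\<Sum>i\<in>I. K i * (cmod (w i))\<^sup>2)))"
    by (rule has_bochner_integral_bounded_linear[OF bounded_linear_Re])
  then have "has_bochner_integral M (\<lambda>x. ((cmod (\<Sum>i\<in>I. w i * \<phi> i x))\<^sup>2)) (\<Sum>i\<in>I. K i * (cmod (w i))\<^sup>2)"
    by (simp only: Re_complex_of_real)
  then show ?A ?B by (auto simp: has_bochner_integral_iff)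
qed

section \<open>Ladder operators on coefficient arrays and the rotation matrix\<close>

definition up :: "(nat \<Rightarrow> 'a::real_algebra_1) \<Rightarrow> nat \<Rightarrow> 'a" where
  "up f n = (if n = 0 then 0 else of_real (sqrt (real n)) * f (n - 1))"

definition dn :: "(nat \<Rightarrow> 'a::real_algebra_1) \<Rightarrow> nat \<Rightarrow> 'a" where
  "dn f n = of_real (sqrt (real n + 1)) * f (Suc n)"

text \<open>Raising and lowering are adjoint. On a finite range this requires f K = 0, since
  \<open>up\<close> would otherwise move mass from K to K + 1, out of the range.\<close>

lemma sum_up:
  fixes f g :: "nat \<Rightarrow> real"
  assumes "f K = 0"
  shows "(\<Sum>m\<le>K. up f m * g m) = (\<Sum>m\<le>K. f m * dn g m)"
proof (cases K)
  case 0
  then show ?thesis using assms by (simp add: up_def)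
next
  case (Suc k)
  have "(\<Sum>m\<le>Suc k. up f m * g m) = (\<Sum>m\<le>k. f m * dn g m)"
    by (subst sum.atMost_Suc_shift) (simp add: up_def dn_def algebra_simps)
  then show ?thesis using assms Suc by simp
qed

lemma up_dn: "up (dn f) n = of_nat n * f n"
proof -
  have s': "of_real (sqrt x) * (of_real (sqrt x) * (y::'a)) = of_real x * y" if "x \<ge> 0" for x y
    using that by (simp flip: mult.assoc of_real_mult)
  show ?thesis by (cases n) (simp_all add: up_def dn_def s' algebra_simps)
qed

lemma sqrt_mult_left: "0 \<le> x \<Longrightarrow> sqrt x * (sqrt x * y) = x * y"
  by (simp flip: mult.assoc)

text \<open>Creation and annihilation operators in the rotated variables \<open>(x \<plusminus> y) / sqrt 2\<close>, acting on
  coefficients of \<open>h\<^sub>m h\<^sub>n\<close>.\<close>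

definition upX :: "(nat \<Rightarrow> nat \<Rightarrow> real) \<Rightarrow> nat \<Rightarrow> nat \<Rightarrow> real" where
  "upX c m n = (up (\<lambda>m. c m n) m + up (c m) n) / sqrt 2"
definition upY :: "(nat \<Rightarrow> nat \<Rightarrow> real) \<Rightarrow> nat \<Rightarrow> nat \<Rightarrow> real" where
  "upY c m n = (up (\<lambda>m. c m n) m - up (c m) n) / sqrt 2"
definition dnX :: "(nat \<Rightarrow> nat \<Rightarrow> real) \<Rightarrow> nat \<Rightarrow> nat \<Rightarrow> real" where
  "dnX c m n = (dn (\<lambda>m. c m n) m + dn (c m) n) / sqrt 2"
definition dnY :: "(nat \<Rightarrow> nat \<Rightarrow> real) \<Rightarrow> nat \<Rightarrow> nat \<Rightarrow> real" where
  "dnY c m n = (dn (\<lambda>m. c m n) m - dn (c m) n) / sqrt 2"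

text \<open>The rotation is orthogonal, so the rotated ladder operators again obey the canonical
  commutation relations; this lemma and the next four record them. Where a factor 2 appears, it
  clears the product of two factors 1 / sqrt 2.\<close>

lemma dnX_upX: "dnX (upX c) = (\<lambda>m n. upX (dnX c) m n + c m n)"
proof (intro ext)
  fix m n
  have "2 * dnX (upX c) m n = 2 * (upX (dnX c) m n + c m n)"
    by (cases m; cases n) (auto simp: sqrt_mult_left dnX_def upX_def up_def dn_def field_simps)
  then show "dnX (upX c) m n = upX (dnX c) m n + c m n" by simp
qed

lemma dnY_upY: "dnY (upY c) = (\<lambda>m n. upY (dnY c) m n + c m n)"
proof (intro ext)
  fix m n
  have "2 * dnY (upY c) m n = 2 * (upY (dnY c) m n + c m n)"
    by (cases m; cases n) (auto simp: sqrt_mult_left dnY_def upY_def up_def dn_def field_simps)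
  then show "dnY (upY c) m n = upY (dnY c) m n + c m n" by simp
qed

lemma dnX_upY: "dnX (upY c) = upY (dnX c)"
proof (intro ext)
  fix m n
  have "2 * dnX (upY c) m n = 2 * upY (dnX c) m n"
    by (cases m; cases n) (auto simp: sqrt_mult_left dnX_def upY_def up_def dn_def field_simps)
  then show "dnX (upY c) m n = upY (dnX c) m n" by simp
qed

lemma dnY_upX: "dnY (upX c) = upX (dnY c)"
proof (intro ext)
  fix m n
  have "2 * dnY (upX c) m n = 2 * upX (dnY c) m n"
    by (cases m; cases n) (auto simp: sqrt_mult_left dnY_def upX_def up_def dn_def field_simps)
  then show "dnY (upX c) m n = upX (dnY c) m n" by simp
qed

lemma upX_upY: "upX (upY c) = upY (upX c)"
proof (intro ext)
  fix m n
  show "upX (upY c) m n = upY (upX c) m n"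
    by (cases m; cases n) (auto simp: upX_def upY_def up_def field_simps)
qed

lemma lin_ops:
  "upX (\<lambda>m n. s * c m n) = (\<lambda>m n. s * upX c m n)" "upY (\<lambda>m n. s * c m n) = (\<lambda>m n. s * upY c m n)"
  "dnX (\<lambda>m n. s * c m n) = (\<lambda>m n. s * dnX c m n)" "dnY (\<lambda>m n. s * c m n) = (\<lambda>m n. s * dnY c m n)"
  by (auto simp: upX_def upY_def dnX_def dnY_def up_def dn_def fun_eq_iff algebra_simps)

text \<open>\<open>rot a b m n\<close> is the coefficient of \<open>h\<^sub>m((x + y) / sqrt 2) h\<^sub>n((x - y) / sqrt 2)\<close> in
  \<open>h\<^sub>a(x) h\<^sub>b(y)\<close>; it is obtained from the ground state by creation operators.\<close>

fun rot :: "nat \<Rightarrow> nat \<Rightarrow> nat \<Rightarrow> nat \<Rightarrow> real" where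
  "rot 0 0 = (\<lambda>m n. if m = 0 \<and> n = 0 then 1 else 0)"
| "rot 0 (Suc b) = (\<lambda>m n. (1 / sqrt (real b + 1)) * upY (rot 0 b) m n)"
| "rot (Suc a) b = (\<lambda>m n. (1 / sqrt (real a + 1)) * upX (rot a b) m n)"

text \<open>Every raising operator adds one to the total degree, so the rotation respects the energy
  shells m + n = a + b.\<close>

lemma rot_supp: "m + n \<noteq> a + b \<Longrightarrow> rot a b m n = 0"
  by (induction a b arbitrary: m n rule: rot.induct) (auto simp: upX_def upY_def up_def)

lemma upX_rot: "upX (rot a b) m n = sqrt (real a + 1) * rot (Suc a) b m n"
  by simp

text \<open>The recursion of \<open>rot\<close> raises in Y only while a = 0; commutativity of
  \<open>upX\<close> and \<open>upY\<close> extends the rule to every a.\<close>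

lemma upY_rot: "upY (rot a b) = (\<lambda>m n. sqrt (real b + 1) * rot a (Suc b) m n)"
proof (induction a)
  case (Suc a)
  have "upY (rot (Suc a) b) = (\<lambda>m n. (1 / sqrt (real a + 1)) * upX (upY (rot a b)) m n)"
    by (simp only: rot.simps lin_ops upX_upY)
  then show ?case unfolding Suc lin_ops by (simp add: fun_eq_iff)
qed (simp add: fun_eq_iff)

text \<open>The lowering operator is commuted past the raising operators until it meets the ground
  state, which it annihilates.\<close>

lemma dnX_rot: "dnX (rot a b) = (\<lambda>m n. sqrt (real a) * rot (a - 1) b m n)"
proof (induction a)
  case 0
  show ?case
  proof (induction b)
    case 0 show ?case by (auto simp: dnX_def dn_def fun_eq_iff)
  next
    case (Suc b)
    then show ?case by (simp only: rot.simps lin_ops dnX_upY) (auto simp: fun_eq_iff lin_ops upY_def up_def)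
  qed
next
  case (Suc a)
  have *: "dnX (rot (Suc a) b) = (\<lambda>m n. (1 / sqrt (real a + 1)) * (upX (dnX (rot a b)) m n + rot a b m n))"
    by (simp only: rot.simps lin_ops dnX_upX)
  have "dnX (rot (Suc a) b) m n = sqrt (real a + 1) * rot a b m n" for m n
  proof (cases a)
    case 0
    then show ?thesis unfolding * Suc by (simp add: upX_def up_def)
  next
    case (Suc a')
    have "(1 / sqrt (real a + 1)) * (upX (dnX (rot a b)) m n + rot a b m n)
       = (1 / sqrt (real a + 1)) * (sqrt (real a) * (sqrt (real a) * rot a b m n) + rot a b m n)"
      unfolding Suc.IH lin_ops upX_rot using Suc by (simp add: add.commute)
    also have "\<dots> = (1 / sqrt (real a + 1)) * ((real a + 1) * rot a b m n)"
      by (simp add: algebra_simps flip: mult.assoc)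
    also have "\<dots> = sqrt (real a + 1) * rot a b m n"
      using real_div_sqrt[of "real a + 1"] by (simp flip: mult.assoc)
    finally show ?thesis unfolding * .
  qed
  then show ?case by (simp add: fun_eq_iff add.commute)
qed

lemma dnY_rot: "dnY (rot a b) = (\<lambda>m n. sqrt (real b) * rot a (b - 1) m n)"
proof (induction a)
  case 0
  show ?case
  proof (induction b)
    case 0 show ?case by (auto simp: dnY_def dn_def fun_eq_iff)
  next
    case (Suc b)
    have *: "dnY (rot 0 (Suc b)) = (\<lambda>m n. (1 / sqrt (real b + 1)) * (upY (dnY (rot 0 b)) m n + rot 0 b m n))"
      by (simp only: rot.simps lin_ops dnY_upY)
    have "dnY (rot 0 (Suc b)) m n = sqrt (real b + 1) * rot 0 b m n" for m n
    proof (cases b)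
      case 0
      then show ?thesis unfolding * Suc by (simp add: upY_def up_def)
    next
      case (Suc b')
      have "(1 / sqrt (real b + 1)) * (upY (dnY (rot 0 b)) m n + rot 0 b m n)
         = (1 / sqrt (real b + 1)) * (sqrt (real b) * (sqrt (real b) * rot 0 b m n) + rot 0 b m n)"
        unfolding Suc.IH lin_ops upY_rot using Suc by (simp add: add.commute)
      also have "\<dots> = (1 / sqrt (real b + 1)) * ((real b + 1) * rot 0 b m n)"
        by (simp add: algebra_simps flip: mult.assoc)
      also have "\<dots> = sqrt (real b + 1) * rot 0 b m n"
        using real_div_sqrt[of "real b + 1"] by (simp flip: mult.assoc)
      finally show ?thesis unfolding * .
    qed
    then show ?case by (simp add: fun_eq_iff add.commute)
  qed
next
  case (Suc a)
  show ?case by (simp only: rot.simps lin_ops dnY_upX Suc) (simp add: ac_simps)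
qed

text \<open>With Q = (X - Y) / sqrt 2 for lowering operators X and Y, twice the number operator of
  the second rotated variable is X^+ X + Y^+ Y - X^+ Y - Y^+ X. On \<open>rot a b\<close> this
  operator acts as 2 n, its diagonal part is a + b, and the mixed terms exchange one quantum between
  a and b.\<close>

lemma rot_number_operator:
  "2 * real n * rot a b m n = real (a + b) * rot a b m n
     - sqrt (real b) * sqrt (real a + 1) * rot (Suc a) (b - 1) m n
     - sqrt (real a) * sqrt (real b + 1) * rot (a - 1) (Suc b) m n"
proof -
  have Q: "up (c m) n = (upX c m n - upY c m n) / sqrt 2" for c
    by (simp add: upX_def upY_def field_simps)
  have Q': "dn (c m) = (\<lambda>n. (1 / sqrt 2) * (dnX c m n + (-1) * dnY c m n))" for c
    by (simp add: dnX_def dnY_def field_simps fun_eq_iff)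
  have add: "upX (\<lambda>m n. c m n + d m n) = (\<lambda>m n. upX c m n + upX d m n)"
    "upY (\<lambda>m n. c m n + d m n) = (\<lambda>m n. upY c m n + upY d m n)" for c d
    by (auto simp: upX_def upY_def up_def fun_eq_iff add_divide_distrib diff_divide_distrib distrib_left)
  let ?D = "\<lambda>m n. (1 / sqrt 2) * (sqrt (real a) * rot (a - 1) b m n + (-1) * (sqrt (real b) * rot a (b - 1) m n))"
  have "real n * rot a b m n = up (dn (rot a b m)) n" by (simp add: up_dn)
  also have "\<dots> = (upX ?D m n - upY ?D m n) / sqrt 2"
    unfolding Q' dnX_rot dnY_rot by (rule Q)
  finally have E: "real n * rot a b m n = (upX ?D m n - upY ?D m n) / sqrt 2" .
  have "2 * (z / sqrt 2) = sqrt 2 * z" for z by (simp add: field_simps sqrt_mult_left)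
  from this[of "upX ?D m n - upY ?D m n"] have E: "2 * (real n * rot a b m n) = sqrt 2 * (upX ?D m n - upY ?D m n)"
    unfolding E .
  \<comment> \<open>For a = 0 the truncated index does no harm, since both sides vanish; the same
    holds for b below.\<close>
  have c1: "sqrt (real a) * (sqrt (real (a - 1) + 1) * rot (Suc (a - 1)) b m n) = real a * rot a b m n"
    by (cases a) (auto simp del: rot.simps simp: add.commute simp flip: mult.assoc)
  have c2: "sqrt (real b) * (sqrt (real (b - 1) + 1) * rot a (Suc (b - 1)) m n) = real b * rot a b m n"
    by (cases b) (auto simp del: rot.simps simp: add.commute simp flip: mult.assoc)
  have "sqrt 2 * (upX ?D m n - upY ?D m n)
     = sqrt (real a) * (sqrt (real (a - 1) + 1) * rot (Suc (a - 1)) b m n)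
       - sqrt (real b) * (sqrt (real a + 1) * rot (Suc a) (b - 1) m n)
       - (sqrt (real a) * (sqrt (real b + 1) * rot (a - 1) (Suc b) m n)
         - sqrt (real b) * (sqrt (real (b - 1) + 1) * rot a (Suc (b - 1)) m n))"
    unfolding lin_ops add upY_rot upX_rot by (simp add: right_diff_distrib del: rot.simps)
  then show ?thesis using E unfolding c1 c2 by (simp add: algebra_simps del: rot.simps)
qed

text \<open>Raising operators are moved to the other factor as lowering operators, down to the
  ground state. The bound a + b < K keeps the arrays zero on the border of the square, as
  adjointness on a finite range demands.\<close>

lemma rot_orthonormal:
  assumes "a + b < K" "a' + b' < K"
  shows "(\<Sum>(m, n)\<in>{..K}\<times>{..K}. rot a b m n * rot a' b' m n) = (if a = a' \<and> b = b' then 1 else 0)"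
proof -
  define ip where "ip f g = (\<Sum>m\<le>K. \<Sum>n\<le>K. f m n * (g m n :: real))" for f g
  have adjP: "ip (\<lambda>m n. up (\<lambda>m. f m n) m) g = ip f (\<lambda>m n. dn (\<lambda>m. g m n) m)" if "\<And>n. f K n = 0" for f g
    unfolding ip_def by (subst (1 2) sum.swap) (intro sum.cong refl sum_up that)
  have adjQ: "ip (\<lambda>m n. up (f m) n) g = ip f (\<lambda>m n. dn (g m) n)" if "\<And>m. f m K = 0" for f g
    unfolding ip_def by (intro sum.cong refl sum_up that)
  have adjX: "ip (upX f) g = ip f (dnX g)" if "\<And>n. f K n = 0" "\<And>m. f m K = 0" for f g
  proof -
    have "ip (upX f) g = (ip (\<lambda>m n. up (\<lambda>m. f m n) m) g + ip (\<lambda>m n. up (f m) n) g) / sqrt 2"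
      by (simp add: ip_def upX_def sum.distrib add_divide_distrib sum_divide_distrib distrib_right)
    also have "\<dots> = ip f (dnX g)" unfolding adjP[of f g, OF that(1)] adjQ[of f g, OF that(2)]
      by (simp add: ip_def dnX_def sum.distrib add_divide_distrib sum_divide_distrib distrib_left)
    finally show ?thesis .
  qed
  have adjY: "ip (upY f) g = ip f (dnY g)" if "\<And>n. f K n = 0" "\<And>m. f m K = 0" for f g
  proof -
    have "ip (upY f) g = (ip (\<lambda>m n. up (\<lambda>m. f m n) m) g - ip (\<lambda>m n. up (f m) n) g) / sqrt 2"
      by (simp add: ip_def upY_def sum_subtractf diff_divide_distrib sum_divide_distrib left_diff_distrib)
    also have "\<dots> = ip f (dnY g)" unfolding adjP[of f g, OF that(1)] adjQ[of f g, OF that(2)]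
      by (simp add: ip_def dnY_def sum_subtractf diff_divide_distrib sum_divide_distrib right_diff_distrib)
    finally show ?thesis .
  qed
  have ip_l: "ip (\<lambda>m n. s * f m n) g = s * ip f g" "ip f (\<lambda>m n. s * g m n) = s * ip f g" for s f g
    by (auto simp: ip_def sum_distrib_left algebra_simps)
  have main: "ip (rot a b) (rot a' b') = (if a = a' \<and> b = b' then 1 else 0)"
    using assms(1)
  proof (induction a b arbitrary: a' b' rule: rot.induct)
    case 1
    have "ip (rot 0 0) g = g 0 0" for g :: "nat \<Rightarrow> nat \<Rightarrow> real"
    proof -
      have "ip (rot 0 0) g = (\<Sum>m\<le>K. \<Sum>n\<le>K. if m = 0 then if n = 0 then g 0 0 else 0 else 0)"
        unfolding ip_def by (intro sum.cong refl) auto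
      also have "\<dots> = (\<Sum>m\<le>K. if m = 0 then (\<Sum>n\<le>K. if n = 0 then g 0 0 else 0) else 0)"
        by (intro sum.cong refl) auto
      finally show ?thesis by simp
    qed
    then show ?case using rot_supp[of 0 0 a' b'] by (cases "a' = 0 \<and> b' = 0") (auto simp del: rot.simps simp: rot.simps(1))
  next
    case (2 b)
    have "rot 0 b K n = 0" "rot 0 b m K = 0" for m n using 2 by (auto intro!: rot_supp)
    then have "ip (rot 0 (Suc b)) (rot a' b') = 1 / sqrt (real b + 1) * (sqrt (real b') * ip (rot 0 b) (rot a' (b' - 1)))"
      unfolding rot.simps ip_l by (subst adjY) (auto simp: dnY_rot ip_l)
    then show ?case using 2 by (cases b') (auto simp: add.commute)
  next
    case (3 a b)
    have "rot a b K n = 0" "rot a b m K = 0" for m n using 3 by (auto intro!: rot_supp)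
    then have "ip (rot (Suc a) b) (rot a' b') = 1 / sqrt (real a + 1) * (sqrt (real a') * ip (rot a b) (rot (a' - 1) b'))"
      unfolding rot.simps ip_l by (subst adjX) (auto simp: dnX_rot ip_l)
    then show ?case using 3 by (cases a') (auto simp: add.commute)
  qed
  then show ?thesis unfolding ip_def by (simp add: sum.cartesian_product)
qed

text \<open>Evaluating an array at the rotated point turns \<open>upX\<close> plus
  \<open>dnX\<close> into multiplication by sqrt 2 x, and likewise for Y and y. Hence the evaluated
  arrays \<open>rot a b\<close> obey the same three-term recurrences as h_a(x) h_b(y), and both
  start from the rotation invariant Gaussian.\<close>

lemma hermite_rotation:
  assumes "a + b < K"
  shows "hermite a x * hermite b y =
    (\<Sum>(m, n)\<in>{..K}\<times>{..K}. rot a b m n * (hermite m ((x + y) / sqrt 2) * hermite n ((x - y) / sqrt 2)))"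
proof -
  define p q where "p = (x + y) / sqrt 2" and "q = (x - y) / sqrt 2"
  define ev where "ev f = (\<Sum>m\<le>K. \<Sum>n\<le>K. f m n * (hermite m p * hermite n q))" for f
  \<comment> \<open>The Hermite recurrence summed by parts. The term \<open>dn f K\<close> reads f
    at K + 1, whence the second condition.\<close>
  have one: "(\<Sum>m\<le>K. up f m * hermite m z) + (\<Sum>m\<le>K. dn f m * hermite m z) = (\<Sum>m\<le>K. f m * (sqrt 2 * z * hermite m z))"
    if "f K = 0" "f (Suc K) = 0" for f :: "nat \<Rightarrow> real" and z
  proof -
    have "(\<Sum>m\<le>K. dn f m * hermite m z) = (\<Sum>m\<le>K. f m * (sqrt (real m) * hermite (m - 1) z))"
    proof (cases K)
      case 0 then show ?thesis using that by (simp add: dn_def)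
    next
      case (Suc k)
      have "(\<Sum>m\<le>Suc k. f m * (sqrt (real m) * hermite (m - 1) z)) = (\<Sum>m\<le>k. dn f m * hermite m z)"
        by (subst sum.atMost_Suc_shift) (simp add: dn_def algebra_simps)
      then show ?thesis using that Suc by (simp add: dn_def)
    qed
    moreover have "(\<Sum>m\<le>K. up f m * hermite m z) = (\<Sum>m\<le>K. f m * (sqrt (real m + 1) * hermite (Suc m) z))"
      using sum_up[of f K "\<lambda>m. hermite m z"] that by (simp add: dn_def)
    moreover have "f m * (sqrt (real m + 1) * hermite (Suc m) z) + f m * (sqrt (real m) * hermite (m - 1) z)
        = f m * (sqrt 2 * z * hermite m z)" for m
      using hermite_Suc[of m z] by (simp flip: distrib_left)
    ultimately show ?thesis by (simp only: flip: sum.distrib)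
  qed
  have evX: "ev (upX f) + ev (dnX f) = sqrt 2 * x * ev f" "ev (upY f) + ev (dnY f) = sqrt 2 * y * ev f"
    if "\<And>n. f K n = 0" "\<And>m. f m K = 0" "\<And>n. f (Suc K) n = 0" "\<And>m. f m (Suc K) = 0" for f
  proof -
    have P: "ev (\<lambda>m n. up (\<lambda>m. f m n) m) + ev (\<lambda>m n. dn (\<lambda>m. f m n) m) = sqrt 2 * p * ev f"
    proof -
      have "ev (\<lambda>m n. up (\<lambda>m. f m n) m) + ev (\<lambda>m n. dn (\<lambda>m. f m n) m)
        = (\<Sum>n\<le>K. ((\<Sum>m\<le>K. up (\<lambda>m. f m n) m * hermite m p) + (\<Sum>m\<le>K. dn (\<lambda>m. f m n) m * hermite m p)) * hermite n q)"
        unfolding ev_def by (subst (1 2) sum.swap) (simp add: distrib_right sum.distrib sum_distrib_right mult.assoc)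
      also have "\<dots> = (\<Sum>n\<le>K. (\<Sum>m\<le>K. f m n * (sqrt 2 * p * hermite m p)) * hermite n q)"
        by (intro sum.cong refl arg_cong2[where f="(*)"] one that)
      also have "\<dots> = sqrt 2 * p * ev f"
        unfolding ev_def sum.swap[of "\<lambda>m n. f m n * (hermite m p * hermite n q)" "{..K}" "{..K}"]
        by (simp add: sum_distrib_left sum_distrib_right algebra_simps)
      finally show ?thesis .
    qed
    have Q: "ev (\<lambda>m n. up (f m) n) + ev (\<lambda>m n. dn (f m) n) = sqrt 2 * q * ev f"
    proof -
      have "ev (\<lambda>m n. up (f m) n) + ev (\<lambda>m n. dn (f m) n)
        = (\<Sum>m\<le>K. ((\<Sum>n\<le>K. up (f m) n * hermite n q) + (\<Sum>n\<le>K. dn (f m) n * hermite n q)) * hermite m p)"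
        unfolding ev_def by (simp add: distrib_right sum.distrib sum_distrib_right mult.assoc mult.commute[of "hermite _ p"])
      also have "\<dots> = (\<Sum>m\<le>K. (\<Sum>n\<le>K. f m n * (sqrt 2 * q * hermite n q)) * hermite m p)"
        by (intro sum.cong refl arg_cong2[where f="(*)"] one that)
      also have "\<dots> = sqrt 2 * q * ev f"
        unfolding ev_def by (simp add: sum_distrib_left sum_distrib_right algebra_simps)
      finally show ?thesis .
    qed
    have pq: "sqrt 2 * x = p + q" "sqrt 2 * y = p - q" unfolding p_def q_def by (auto simp: field_simps)
    have lin: "ev (upX f) = (ev (\<lambda>m n. up (\<lambda>m. f m n) m) + ev (\<lambda>m n. up (f m) n)) / sqrt 2"
      "ev (dnX f) = (ev (\<lambda>m n. dn (\<lambda>m. f m n) m) + ev (\<lambda>m n. dn (f m) n)) / sqrt 2"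
      "ev (upY f) = (ev (\<lambda>m n. up (\<lambda>m. f m n) m) - ev (\<lambda>m n. up (f m) n)) / sqrt 2"
      "ev (dnY f) = (ev (\<lambda>m n. dn (\<lambda>m. f m n) m) - ev (\<lambda>m n. dn (f m) n)) / sqrt 2"
      unfolding ev_def upX_def dnX_def upY_def dnY_def
      by (simp_all add: sum.distrib sum_subtractf add_divide_distrib diff_divide_distrib sum_divide_distrib distrib_right left_diff_distrib)
    have "ev (upX f) + ev (dnX f) = (sqrt 2 * p * ev f + sqrt 2 * q * ev f) / sqrt 2"
      unfolding lin P[symmetric] Q[symmetric] by (simp add: add_divide_distrib)
    then show "ev (upX f) + ev (dnX f) = sqrt 2 * x * ev f" unfolding pq by (simp add: algebra_simps add_divide_distrib)
    have "ev (upY f) + ev (dnY f) = (sqrt 2 * p * ev f - sqrt 2 * q * ev f) / sqrt 2"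
      unfolding lin P[symmetric] Q[symmetric] by (simp add: add_divide_distrib diff_divide_distrib)
    then show "ev (upY f) + ev (dnY f) = sqrt 2 * y * ev f" unfolding pq by (simp add: algebra_simps diff_divide_distrib)
  qed
  have ev_l: "ev (\<lambda>m n. s * f m n) = s * ev f" for s f
    by (simp add: ev_def sum_distrib_left mult.assoc)
  have "hermite a x * hermite b y = ev (rot a b)"
    using assms
  \<comment> \<open>Strong induction, because the recurrence reaches two steps back.\<close>
  proof (induction "a + b" arbitrary: a b rule: less_induct)
    case less
    have z: "rot c d K n = 0" "rot c d m K = 0" "rot c d (Suc K) n = 0" "rot c d m (Suc K) = 0" if "c + d < K" for c d m n
      using that by (auto intro!: rot_supp)
    consider "a = 0" "b = 0" | b' where "a = 0" "b = Suc b'" | a' where "a = Suc a'" by (cases a; cases b) auto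
    then show ?case
    proof cases
      case 1
      have "ev (rot 0 0) = (\<Sum>m\<le>K. \<Sum>n\<le>K. if m = 0 then if n = 0 then hermite 0 p * hermite 0 q else 0 else 0)"
        unfolding ev_def by (intro sum.cong refl) auto
      also have "\<dots> = (\<Sum>m\<le>K. if m = 0 then (\<Sum>n\<le>K. if n = 0 then hermite 0 p * hermite 0 q else 0) else 0)"
        by (intro sum.cong refl) auto
      also have "\<dots> = hermite 0 p * hermite 0 q" by simp
      also have "p\<^sup>2 + q\<^sup>2 = x\<^sup>2 + y\<^sup>2" unfolding p_def q_def by (simp add: power_divide power2_sum power2_diff add_divide_distrib diff_divide_distrib)
      then have "hermite 0 p * hermite 0 q = hermite 0 x * hermite 0 y"
        by (simp add: hermite.simps algebra_simps flip: exp_add add_divide_distrib)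
      finally show ?thesis using 1 by simp
    next
      case 2
      have IH: "hermite 0 x * hermite b' y = ev (rot 0 b')" using less 2 by auto
      have "sqrt (real b' + 1) * ev (rot 0 (Suc b')) = ev (upY (rot 0 b'))"
        unfolding upY_rot ev_l ..
      also have "\<dots> = sqrt 2 * y * ev (rot 0 b') - ev (dnY (rot 0 b'))"
        using evX(2)[of "rot 0 b'"] z less.prems 2 by (simp del: rot.simps)
      also have "ev (dnY (rot 0 b')) = sqrt (real b') * (hermite 0 x * hermite (b' - 1) y)"
        unfolding dnY_rot ev_l using less 2 by (cases b') (auto simp del: rot.simps)
      also have "sqrt 2 * y * ev (rot 0 b') - \<dots> = hermite 0 x * (sqrt 2 * y * hermite b' y - sqrt (real b') * hermite (b' - 1) y)"
        unfolding IH[symmetric] by (simp add: algebra_simps)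
      also have "\<dots> = sqrt (real b' + 1) * (hermite 0 x * hermite (Suc b') y)"
        unfolding hermite_Suc[symmetric] by simp
      finally have "sqrt (real b' + 1) * (hermite 0 x * hermite (Suc b') y) = sqrt (real b' + 1) * ev (rot 0 (Suc b'))" ..
      moreover have "sqrt (real b' + 1) \<noteq> 0" by simp
      ultimately show ?thesis using 2 mult_left_cancel by blast
    next
      case 3
      have IH: "hermite a' x * hermite b y = ev (rot a' b)" using less 3 by auto
      have "sqrt (real a' + 1) * ev (rot (Suc a') b) = ev (upX (rot a' b))"
        unfolding ev_l[symmetric] upX_rot[symmetric] ..
      also have "\<dots> = sqrt 2 * x * ev (rot a' b) - ev (dnX (rot a' b))"
        using evX(1)[of "rot a' b"] z less.prems 3 by (simp del: rot.simps)
      also have "ev (dnX (rot a' b)) = sqrt (real a') * (hermite (a' - 1) x * hermite b y)"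
        unfolding dnX_rot ev_l using less 3 by (cases a') (auto simp del: rot.simps)
      also have "sqrt 2 * x * ev (rot a' b) - \<dots> = (sqrt 2 * x * hermite a' x - sqrt (real a') * hermite (a' - 1) x) * hermite b y"
        unfolding IH[symmetric] by (simp add: algebra_simps)
      also have "\<dots> = sqrt (real a' + 1) * (hermite (Suc a') x * hermite b y)"
        unfolding hermite_Suc[symmetric] by simp
      finally have "sqrt (real a' + 1) * (hermite (Suc a') x * hermite b y) = sqrt (real a' + 1) * ev (rot (Suc a') b)" ..
      moreover have "sqrt (real a' + 1) \<noteq> 0" by simp
      ultimately show ?thesis using 3 mult_left_cancel by blast
    qed
  qed
  then show ?thesis unfolding ev_def p_def q_def by (simp add: sum.cartesian_product)
qed

section \<open>Traces of functions of fixed energy on the diagonal\<close>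

text \<open>On the diagonal \<open>x = y\<close> only the values \<open>h\<^sub>n(0)\<close> of the second factor survive, so \<open>trace_sq L w\<close> is, up to
  the factor \<open>sqrt 2\<close>, the squared norm of \<open>\<Sum> w\<^sub>b h\<^sub>L\<^sub>-\<^sub>b h\<^sub>b\<close>; see \<open>integral_hermite_products\<close>.\<close>

definition rotc :: "nat \<Rightarrow> (nat \<Rightarrow> complex) \<Rightarrow> nat \<times> nat \<Rightarrow> complex" where
  "rotc L w = (\<lambda>(m, n). \<Sum>b\<le>L. w b * of_real (rot (L - b) b m n))"

definition trace_sq :: "nat \<Rightarrow> (nat \<Rightarrow> complex) \<Rightarrow> real" where
  "trace_sq L w = (\<Sum>(m, n)\<in>{..Suc L}\<times>{..Suc L}. (hermite n 0)\<^sup>2 * (cmod (rotc L w (m, n)))\<^sup>2)"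

lemma sum_rotc_sq:
  "(\<Sum>x\<in>{..Suc L}\<times>{..Suc L}. (cmod (rotc L w x))\<^sup>2) = (\<Sum>b\<le>L. (cmod (w b))\<^sup>2)"
proof -
  have "(\<Sum>x\<in>{..Suc L}\<times>{..Suc L}. (cmod (\<Sum>b\<in>{..L}. w b * of_real ((\<lambda>b (m, n). rot (L - b) b m n) b x)))\<^sup>2) = (\<Sum>b\<in>{..L}. (cmod (w b))\<^sup>2)"
  proof (rule sum_norm_sq_orthonormal)
    fix b c assume "b \<in> {..L}" "c \<in> {..L}"
    then show "(\<Sum>x\<in>{..Suc L} \<times> {..Suc L}. (case x of (m, n) \<Rightarrow> rot (L - b) b m n) * (case x of (m, n) \<Rightarrow> rot (L - c) c m n)) = (if b = c then 1 else 0)"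
      using rot_orthonormal[of "L - b" b "Suc L" "L - c" c] by (auto simp: case_prod_beta del: rot.simps)
  qed simp
  then show ?thesis by (simp add: rotc_def case_prod_beta)
qed

lemma rotc_supp: "m + n \<noteq> L \<Longrightarrow> rotc L w (m, n) = 0"
  unfolding rotc_def by (auto intro!: sum.neutral rot_supp simp del: rot.simps)

text \<open>The mixed terms of \<open>rot_number_operator\<close>, transposed from the arrays to the
  weights: a symmetric tridiagonal matrix with entries of size about sqrt (c L).\<close>

definition shiftw :: "nat \<Rightarrow> (nat \<Rightarrow> complex) \<Rightarrow> nat \<Rightarrow> complex" where
  "shiftw L w c = of_real (sqrt (real c + 1) * sqrt (real (L - c))) * w (Suc c)
     + of_real (sqrt (real c) * sqrt (real (L - c) + 1)) * w (c - 1)"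

text \<open>\<open>rot_number_operator\<close> summed against the weights, with the mixed terms
  reindexed by b = c + 1 and b = c - 1. Terms leaving the range 0, ..., L are killed by the square
  roots.\<close>

lemma rotc_shiftw:
  assumes w: "\<And>b. b > b0 \<Longrightarrow> w b = 0" and b0: "b0 < L"
  shows "of_nat L * rotc L w (m, n) = 2 * of_nat n * rotc L w (m, n) + rotc L (shiftw L w) (m, n)"
proof -
  let ?R = "\<lambda>a b. complex_of_real (rot a b m n)"
  let ?s = "\<lambda>x. complex_of_real (sqrt x)"
  have R: "2 * of_nat n * ?R (L - b) b = of_nat L * ?R (L - b) b
     - ?s (real b) * ?s (real (L - b) + 1) * ?R (Suc (L - b)) (b - 1)
     - ?s (real (L - b)) * ?s (real b + 1) * ?R (L - b - 1) (Suc b)" if "b \<le> L" for b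
    using rot_number_operator[of n "L - b" b m, THEN arg_cong[where f=complex_of_real]] that
    by (simp del: rot.simps)
  have "(\<Sum>b\<le>L. w b * (?s (real b) * ?s (real (L - b) + 1) * ?R (Suc (L - b)) (b - 1)))
     = (\<Sum>c\<le>L. ?s (real c + 1) * ?s (real (L - c)) * w (Suc c) * ?R (L - c) c)"
  proof -
    obtain l where l: "L = Suc l" using b0 by (cases L) auto
    have "(\<Sum>b\<le>Suc l. w b * (?s (real b) * ?s (real (L - b) + 1) * ?R (Suc (L - b)) (b - 1)))
      = (\<Sum>c\<le>l. w (Suc c) * (?s (real c + 1) * ?s (real (L - Suc c) + 1) * ?R (Suc (L - Suc c)) c))"
      by (subst sum.atMost_Suc_shift) (simp add: add.commute del: rot.simps)
    also have "\<dots> = (\<Sum>c\<le>l. ?s (real c + 1) * ?s (real (L - c)) * w (Suc c) * ?R (L - c) c)"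
      using l by (intro sum.cong refl) (auto simp del: rot.simps simp: Suc_diff_le)
    finally show ?thesis using l by (simp del: rot.simps)
  qed
  moreover have "(\<Sum>b\<le>L. w b * (?s (real (L - b)) * ?s (real b + 1) * ?R (L - b - 1) (Suc b)))
     = (\<Sum>c\<le>L. ?s (real c) * ?s (real (L - c) + 1) * w (c - 1) * ?R (L - c) c)"
  proof -
    obtain l where l: "L = Suc l" using b0 by (cases L) auto
    have "(\<Sum>c\<le>Suc l. ?s (real c) * ?s (real (L - c) + 1) * w (c - 1) * ?R (L - c) c)
      = (\<Sum>b\<le>l. ?s (real b + 1) * ?s (real (L - Suc b) + 1) * w b * ?R (L - Suc b) (Suc b))"
      by (subst sum.atMost_Suc_shift) (simp add: add.commute del: rot.simps)
    also have "\<dots> = (\<Sum>b\<le>l. w b * (?s (real (L - b)) * ?s (real b + 1) * ?R (L - b - 1) (Suc b)))"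
      using l by (intro sum.cong refl) (auto simp del: rot.simps simp: Suc_diff_le)
    finally show ?thesis using l by (simp del: rot.simps)
  qed
  ultimately have "rotc L (shiftw L w) (m, n) = 
     (\<Sum>b\<le>L. w b * (?s (real b) * ?s (real (L - b) + 1) * ?R (Suc (L - b)) (b - 1)))
     + (\<Sum>b\<le>L. w b * (?s (real (L - b)) * ?s (real b + 1) * ?R (L - b - 1) (Suc b)))"
    by (simp add: rotc_def shiftw_def distrib_right sum.distrib del: rot.simps)
  moreover have "2 * of_nat n * rotc L w (m, n) = (\<Sum>b\<le>L. w b * (2 * of_nat n * ?R (L - b) b))"
    unfolding rotc_def by (simp add: sum_distrib_left algebra_simps del: rot.simps)
  moreover have "(\<Sum>b\<le>L. w b * (2 * of_nat n * ?R (L - b) b)) =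
    (\<Sum>b\<le>L. w b * (of_nat L * ?R (L - b) b
     - ?s (real b) * ?s (real (L - b) + 1) * ?R (Suc (L - b)) (b - 1)
     - ?s (real (L - b)) * ?s (real b + 1) * ?R (L - b - 1) (Suc b)))"
    by (intro sum.cong refl arg_cong2[where f="(*)"] R) auto
  moreover have "of_nat L * rotc L w (m, n) = (\<Sum>b\<le>L. w b * (of_nat L * ?R (L - b) b))"
    unfolding rotc_def by (simp add: sum_distrib_left algebra_simps del: rot.simps)
  ultimately show ?thesis by (simp only: right_diff_distrib sum_subtractf) simp
qed

lemma power2_add_le: "(x + y)\<^sup>2 \<le> 2 * x\<^sup>2 + 2 * (y::real)\<^sup>2"
  using sum_squares_bound[of x y] by (simp add: power2_sum)

lemma norm_add_sq_le: "(norm (x + y))\<^sup>2 \<le> 2 * (norm x)\<^sup>2 + 2 * (norm (y::'a::real_normed_vector))\<^sup>2"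
  by (rule order_trans[OF power_mono[OF norm_triangle_ineq norm_ge_zero] power2_add_le])

text \<open>Each weight is sent to two neighbours with squared entries at most (b0 + 1) L; a further
  factor 2 comes from squaring a sum of two terms. Compared with L^2 the result is small as soon as
  b0 is small against L.\<close>

lemma sum_shiftw_sq:
  assumes w: "\<And>b. b > b0 \<Longrightarrow> w b = 0" and b0: "b0 < L"
  shows "(\<Sum>b\<le>L. (cmod (shiftw L w b))\<^sup>2) \<le> 4 * (real b0 + 1) * real L * (\<Sum>b\<le>L. (cmod (w b))\<^sup>2)"
proof -
  obtain l where l: "L = Suc l" using b0 by (cases L) auto
  have "(\<Sum>c\<le>L. (cmod (shiftw L w c))\<^sup>2)
     \<le> (\<Sum>c\<le>L. 2 * ((real c + 1) * real (L - c) * (cmod (w (Suc c)))\<^sup>2) + 2 * (real c * (real (L - c) + 1) * (cmod (w (c - 1)))\<^sup>2))"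
  proof (intro sum_mono)
    fix c
    show "(cmod (shiftw L w c))\<^sup>2 \<le> 2 * ((real c + 1) * real (L - c) * (cmod (w (Suc c)))\<^sup>2) + 2 * (real c * (real (L - c) + 1) * (cmod (w (c - 1)))\<^sup>2)"
      unfolding shiftw_def by (rule order_trans[OF norm_add_sq_le]) (simp add: norm_mult power_mult_distrib)
  qed
  also have "\<dots> = 2 * (\<Sum>c\<le>L. (real c + 1) * real (L - c) * (cmod (w (Suc c)))\<^sup>2) + 2 * (\<Sum>c\<le>L. real c * (real (L - c) + 1) * (cmod (w (c - 1)))\<^sup>2)"
    by (simp add: sum.distrib sum_distrib_left)
  also have "(\<Sum>c\<le>L. (real c + 1) * real (L - c) * (cmod (w (Suc c)))\<^sup>2) = (\<Sum>b\<le>L. real b * (real (L - b) + 1) * (cmod (w b))\<^sup>2)"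
  proof -
    have "(\<Sum>b\<le>Suc l. real b * (real (L - b) + 1) * (cmod (w b))\<^sup>2) = (\<Sum>c\<le>l. (real c + 1) * real (L - c) * (cmod (w (Suc c)))\<^sup>2)"
      using l by (subst sum.atMost_Suc_shift) (auto intro!: sum.cong simp: Suc_diff_le add.commute)
    then show ?thesis using l by simp
  qed
  also have "(\<Sum>c\<le>L. real c * (real (L - c) + 1) * (cmod (w (c - 1)))\<^sup>2) = (\<Sum>b\<le>L. (real b + 1) * real (L - b) * (cmod (w b))\<^sup>2)"
  proof -
    have "(\<Sum>c\<le>Suc l. real c * (real (L - c) + 1) * (cmod (w (c - 1)))\<^sup>2) = (\<Sum>b\<le>l. (real b + 1) * real (L - b) * (cmod (w b))\<^sup>2)"
      using l by (subst sum.atMost_Suc_shift) (auto intro!: sum.cong simp: Suc_diff_le add.commute)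
    then show ?thesis using l by simp
  qed
  also have "(\<Sum>b\<le>L. real b * (real (L - b) + 1) * (cmod (w b))\<^sup>2) \<le> (\<Sum>b\<le>L. (real b0 + 1) * real L * (cmod (w b))\<^sup>2)"
  proof (intro sum_mono)
    fix b assume "b \<in> {..L}"
    show "real b * (real (L - b) + 1) * (cmod (w b))\<^sup>2 \<le> (real b0 + 1) * real L * (cmod (w b))\<^sup>2"
    proof (cases "b = 0 \<or> b > b0")
      case False
      then have "real b * (real (L - b) + 1) \<le> (real b0 + 1) * real L"
        using b0 by (intro mult_mono) (auto simp: of_nat_diff)
      then show ?thesis by (rule mult_right_mono) simp
    qed (auto simp: w)
  qed
  also have "(\<Sum>b\<le>L. (real b + 1) * real (L - b) * (cmod (w b))\<^sup>2) \<le> (\<Sum>b\<le>L. (real b0 + 1) * real L * (cmod (w b))\<^sup>2)"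
  proof (intro sum_mono)
    fix b assume "b \<in> {..L}"
    show "(real b + 1) * real (L - b) * (cmod (w b))\<^sup>2 \<le> (real b0 + 1) * real L * (cmod (w b))\<^sup>2"
    proof (cases "b > b0")
      case False
      then have "(real b + 1) * real (L - b) \<le> (real b0 + 1) * real L"
        using b0 by (intro mult_mono) auto
      then show ?thesis by (rule mult_right_mono) simp
    qed (auto simp: w)
  qed
  finally show ?thesis by (simp flip: sum_distrib_left) (simp add: algebra_simps)
qed

text \<open>The bound \<open>h\<^sub>n(0)\<^sup>2 \<le> 1 / sqrt (n + 1)\<close> is of the right size only for \<open>n\<close> comparable to \<open>L\<close>. By \<open>rotc_shiftw\<close>, each
  coefficient is \<open>2 n / L\<close> times itself plus \<open>1 / L\<close> times that of the shifted weights: the first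
  part supplies the missing smallness for small \<open>n\<close>, and the shift divided by \<open>L\<close> is a contraction when \<open>w\<close> lives on \<open>b \<le> L / 32\<close>.\<close>

lemma trace_sq_step:
  assumes w: "\<And>b. b > b0 \<Longrightarrow> w b = 0" and b0: "b0 < L"
  shows "trace_sq L w \<le> 8 / sqrt (real L) * (\<Sum>b\<le>L. (cmod (w b))\<^sup>2) + 2 / (real L)\<^sup>2 * trace_sq L (shiftw L w)"
proof -
  let ?B = "{..Suc L}\<times>{..Suc L}"
  have L: "real L > 0" using b0 by simp
  have "(real L)\<^sup>2 * trace_sq L w = (\<Sum>(m, n)\<in>?B. (hermite n 0)\<^sup>2 * (cmod (of_nat L * rotc L w (m, n)))\<^sup>2)"
    unfolding trace_sq_def sum_distrib_left by (intro sum.cong refl) (auto simp: norm_mult power_mult_distrib)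
  also have "\<dots> \<le> (\<Sum>(m, n)\<in>?B. 8 * real L * sqrt (real L) * (cmod (rotc L w (m, n)))\<^sup>2 + 2 * ((hermite n 0)\<^sup>2 * (cmod (rotc L (shiftw L w) (m, n)))\<^sup>2))"
  proof (intro sum_mono, clarify)
    fix m n
    have "(cmod (of_nat L * rotc L w (m, n)))\<^sup>2 \<le> 2 * (2 * real n * cmod (rotc L w (m, n)))\<^sup>2 + 2 * (cmod (rotc L (shiftw L w) (m, n)))\<^sup>2"
      by (subst rotc_shiftw[OF w b0], assumption, rule order_trans[OF norm_add_sq_le]) (simp add: norm_mult)
    then have "(hermite n 0)\<^sup>2 * (cmod (of_nat L * rotc L w (m, n)))\<^sup>2
       \<le> (hermite n 0)\<^sup>2 * (2 * (2 * real n * cmod (rotc L w (m, n)))\<^sup>2 + 2 * (cmod (rotc L (shiftw L w) (m, n)))\<^sup>2)"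
      by (intro mult_left_mono) auto
    also have "\<dots> = 8 * ((hermite n 0)\<^sup>2 * (real n)\<^sup>2 * (cmod (rotc L w (m, n)))\<^sup>2) + 2 * ((hermite n 0)\<^sup>2 * (cmod (rotc L (shiftw L w) (m, n)))\<^sup>2)"
      by (simp add: algebra_simps)
    \<comment> \<open>The factor n^2 from the number operator outweighs the decay (n + 1)^(-1/2):
      the product is at most n^(3/2), hence at most L^(3/2) on the support n <= L.\<close>
    also have "(hermite n 0)\<^sup>2 * (real n)\<^sup>2 * (cmod (rotc L w (m, n)))\<^sup>2 \<le> real L * sqrt (real L) * (cmod (rotc L w (m, n)))\<^sup>2"
    proof (cases "n \<le> L")
      case True
      have "(hermite n 0)\<^sup>2 * (real n)\<^sup>2 \<le> 1 / sqrt (real n + 1) * (real n)\<^sup>2"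
        by (intro mult_right_mono hermite_0_sq_le) auto
      also have "\<dots> \<le> real n * sqrt (real n)"
      proof -
        have "real n / sqrt (real n + 1) \<le> sqrt (real n)"
        proof -
          have "sqrt (real n) * sqrt (real n) \<le> sqrt (real n) * sqrt (real n + 1)" by (intro mult_left_mono) auto
          then show ?thesis by (simp add: divide_le_eq)
        qed
        from mult_left_mono[OF this, of "real n"] show ?thesis by (simp add: power2_eq_square)
      qed
      also have "\<dots> \<le> real L * sqrt (real L)" using True by (intro mult_mono) auto
      finally show ?thesis by (rule mult_right_mono) simp
    next
      case False
      then show ?thesis using rotc_supp[of m n L w] by simp
    qed
    finally show "(hermite n 0)\<^sup>2 * (cmod (of_nat L * rotc L w (m, n)))\<^sup>2 \<le> 8 * real L * sqrt (real L) * (cmod (rotc L w (m, n)))\<^sup>2 + 2 * ((hermite n 0)\<^sup>2 * (cmod (rotc L (shiftw L w) (m, n)))\<^sup>2)"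
      by simp
  qed
  also have "\<dots> = 8 * real L * sqrt (real L) * (\<Sum>b\<le>L. (cmod (w b))\<^sup>2) + 2 * trace_sq L (shiftw L w)"
    unfolding sum_rotc_sq[symmetric] trace_sq_def by (simp add: case_prod_beta sum.distrib sum_distrib_left)
  finally have "trace_sq L w \<le> (8 * real L * sqrt (real L) * (\<Sum>b\<le>L. (cmod (w b))\<^sup>2) + 2 * trace_sq L (shiftw L w)) / (real L)\<^sup>2"
    using L by (simp add: field_simps)
  also have "\<dots> = 8 / sqrt (real L) * (\<Sum>b\<le>L. (cmod (w b))\<^sup>2) + 2 / (real L)\<^sup>2 * trace_sq L (shiftw L w)"
  proof -
    have "8 * real L * sqrt (real L) / (real L)\<^sup>2 = 8 / sqrt (real L)"
      using L by (simp add: power2_eq_square field_simps)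
    moreover have "(8 * real L * sqrt (real L) * S + 2 * t) / (real L)\<^sup>2 = 8 * real L * sqrt (real L) / (real L)\<^sup>2 * S + 2 / (real L)\<^sup>2 * t" for S t
      by (simp add: add_divide_distrib)
    ultimately show ?thesis by simp
  qed
  finally show ?thesis .
qed

text \<open>Each shift enlarges the support by one, so 16 (b0 + j) <= L leaves room for j rounds. A
  round halves the remainder, because 2 / L^2 times 4 (b0 + 1) L is at most 1 / 2, and it reproduces
  the constant as 8 + 16 / 2 = 16. The iteration ends with the trivial bound h_n(0)^2 <= 1.\<close>

lemma trace_sq_iterate:
  assumes "\<And>b. b > b0 \<Longrightarrow> w b = 0" and "16 * (b0 + j) \<le> L" "L > 0"
  shows "trace_sq L w \<le> (16 / sqrt (real L) + 1 / 2 ^ j) * (\<Sum>b\<le>L. (cmod (w b))\<^sup>2)"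
  using assms
proof (induction j arbitrary: b0 w)
  case 0
  have "trace_sq L w \<le> (\<Sum>x\<in>{..Suc L}\<times>{..Suc L}. (cmod (rotc L w x))\<^sup>2)"
    unfolding trace_sq_def
  proof (intro sum_mono, clarify)
    fix m n
    have "(hermite n 0)\<^sup>2 \<le> 1" using hermite_0_sq_le[of n] by (rule order_trans) simp
    then show "(hermite n 0)\<^sup>2 * (cmod (rotc L w (m, n)))\<^sup>2 \<le> (cmod (rotc L w (m, n)))\<^sup>2"
      by (intro mult_left_le_one_le) auto
  qed
  also have "\<dots> \<le> (16 / sqrt (real L) + 1 / 2 ^ 0) * (\<Sum>b\<le>L. (cmod (w b))\<^sup>2)"
    unfolding sum_rotc_sq by (simp add: distrib_right sum_nonneg)
  finally show ?case .
next
  case (Suc j)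
  define S where "S = (\<Sum>b\<le>L. (cmod (w b))\<^sup>2)"
  have b0: "b0 < L" using Suc.prems by simp
  have S0: "S \<ge> 0" unfolding S_def by (simp add: sum_nonneg)
  have "shiftw L w b = 0" if "b > Suc b0" for b
    using that Suc.prems(1) by (auto simp: shiftw_def)
  then have IH: "trace_sq L (shiftw L w) \<le> (16 / sqrt (real L) + 1 / 2 ^ j) * (\<Sum>b\<le>L. (cmod (shiftw L w b))\<^sup>2)"
    using Suc.prems by (intro Suc.IH[of "Suc b0"]) auto
  have "trace_sq L w \<le> 8 / sqrt (real L) * S + 2 / (real L)\<^sup>2 * trace_sq L (shiftw L w)"
    unfolding S_def by (rule trace_sq_step[OF Suc.prems(1) b0])
  also have "\<dots> \<le> 8 / sqrt (real L) * S + 2 / (real L)\<^sup>2 * ((16 / sqrt (real L) + 1 / 2 ^ j) * (4 * (real b0 + 1) * real L * S))"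
    using sum_shiftw_sq[OF Suc.prems(1) b0] unfolding S_def
    by (intro add_left_mono mult_left_mono order_trans[OF IH]) auto
  also have "\<dots> = 8 / sqrt (real L) * S + 8 * (real b0 + 1) / real L * ((16 / sqrt (real L) + 1 / 2 ^ j) * S)"
    using Suc.prems(3) by (simp add: power2_eq_square field_simps)
  also have "\<dots> \<le> 8 / sqrt (real L) * S + 1 / 2 * ((16 / sqrt (real L) + 1 / 2 ^ j) * S)"
  proof (intro add_left_mono mult_right_mono)
    have "16 * (b0 + 1) \<le> L" using Suc.prems(2) by auto
    then have "real (16 * (b0 + 1)) \<le> real L" by (simp only: of_nat_le_iff)
    then have "16 * (real b0 + 1) \<le> real L" by simp
    then show "8 * (real b0 + 1) / real L \<le> 1 / 2" using Suc.prems(3) by (simp add: divide_le_eq)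
    show "(16 / sqrt (real L) + 1 / 2 ^ j) * S \<ge> 0" using S0 by simp
  qed
  also have "\<dots> = (16 / sqrt (real L) + 1 / 2 ^ Suc j) * S" by (simp add: field_simps)
  finally show ?case unfolding S_def .
qed

lemma trace_sq_le:
  assumes "\<And>b. b > b0 \<Longrightarrow> w b = 0" and "32 * b0 \<le> L" "L > 0"
  shows "trace_sq L w \<le> 48 / sqrt (real L) * (\<Sum>b\<le>L. (cmod (w b))\<^sup>2)"
proof -
  \<comment> \<open>Half of L is reserved for b0 and half for the rounds. Then 2^j >= L / 32, so the
    remainder is at most 32 / sqrt L, and 16 + 32 = 48.\<close>
  define j where "j = L div 32"
  have "trace_sq L w \<le> (16 / sqrt (real L) + 1 / 2 ^ j) * (\<Sum>b\<le>L. (cmod (w b))\<^sup>2)"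
    using assms by (intro trace_sq_iterate[of b0]) (auto simp: j_def)
  also have "\<dots> \<le> (48 / sqrt (real L)) * (\<Sum>b\<le>L. (cmod (w b))\<^sup>2)"
  proof (rule mult_right_mono)
    have "L < 32 * (j + 1)" unfolding j_def by simp
    also have "j + 1 \<le> 2 ^ j" using less_exp[of j] by (simp add: Suc_leI)
    finally have "real L \<le> 32 * 2 ^ j"
      by (metis (mono_tags) less_or_eq_imp_le mult_le_mono2 of_nat_le_iff of_nat_mult of_nat_numeral of_nat_power)
    moreover have "sqrt (real L) \<le> real L" using \<open>L > 0\<close> by (simp add: sqrt_le_D real_le_lsqrt power2_eq_square)
    ultimately have "sqrt (real L) \<le> 32 * 2 ^ j" by linarith
    then have "1 / 2 ^ j \<le> 32 / sqrt (real L)" using \<open>L > 0\<close> by (simp add: field_simps)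
    then show "16 / sqrt (real L) + 1 / 2 ^ j \<le> 48 / sqrt (real L)"
      using add_left_mono[of "1 / 2 ^ j" "32 / sqrt (real L)" "16 / sqrt (real L)"] by (simp flip: add_divide_distrib)
  qed (simp add: sum_nonneg)
  finally show ?thesis .
qed

section \<open>Norms on the diagonal as trace sums\<close>

lemma integral_hermite_scaled:
  "integrable lborel (\<lambda>s. hermite m (sqrt 2 * s) * hermite n (sqrt 2 * s))"
  "(\<integral>s. hermite m (sqrt 2 * s) * hermite n (sqrt 2 * s) \<partial>lborel) = (if m = n then 1 / sqrt 2 else 0)"
proof -
  have "has_bochner_integral lborel (\<lambda>x. hermite m x * hermite n x) (if m = n then 1 else 0)"
    using integrable_hermite_mult[of m n] hmul_eq[of m n] by (simp add: has_bochner_integral_iff hmul_def)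
  then have "has_bochner_integral lborel (\<lambda>s. hermite m (0 + sqrt 2 * s) * hermite n (0 + sqrt 2 * s)) ((if m = n then 1 else 0) /\<^sub>R \<bar>sqrt 2\<bar>)"
    by (subst (asm) lborel_has_bochner_integral_real_affine_iff[of "sqrt 2" _ _ 0]) auto
  then show "integrable lborel (\<lambda>s. hermite m (sqrt 2 * s) * hermite n (sqrt 2 * s))"
    "(\<integral>s. hermite m (sqrt 2 * s) * hermite n (sqrt 2 * s) \<partial>lborel) = (if m = n then 1 / sqrt 2 else 0)"
    by (auto simp: has_bochner_integral_iff field_simps)
qed

lemma sum_swap3: "(\<Sum>a\<in>A. \<Sum>b\<in>B. \<Sum>c\<in>C. f a b c) = (\<Sum>b\<in>B. \<Sum>c\<in>C. \<Sum>a\<in>A. f a b c)"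
  by (rule trans[OF sum.swap], rule sum.cong[OF refl], rule sum.swap)

text \<open>On the diagonal the rotated variables are sqrt 2 s and 0. For each m only n = L - m
  survives, so the square of the inner sum over n equals the sum of the squares.\<close>

lemma integral_hermite_products:
  fixes w :: "nat \<Rightarrow> complex" and L :: nat
  defines "F \<equiv> \<lambda>s. \<Sum>b\<le>L. w b * of_real (hermite (L - b) s * hermite b s)"
  shows "integrable lborel (\<lambda>s. (cmod (F s))\<^sup>2)"
    and "(\<integral>s. (cmod (F s))\<^sup>2 \<partial>lborel) = trace_sq L w / sqrt 2"
proof -
  define \<gamma> where "\<gamma> m = (\<Sum>n\<le>Suc L. rotc L w (m, n) * of_real (hermite n 0))" for m
  have "hermite (L - b) s * hermite b s = (\<Sum>m\<le>Suc L. (\<Sum>n\<le>Suc L. rot (L - b) b m n * hermite n 0) * hermite m (sqrt 2 * s))" if "b \<le> L" for b s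
  proof -
    have "(s + s) / sqrt 2 = sqrt 2 * s" by (simp add: field_simps)
    then show ?thesis using hermite_rotation[of "L - b" b "Suc L" s s] that
      by (simp add: sum.cartesian_product[symmetric] sum_distrib_right sum_distrib_left mult_ac del: rot.simps sum.atMost_Suc)
  qed
  then have "F s = (\<Sum>b\<le>L. w b * of_real (\<Sum>m\<le>Suc L. (\<Sum>n\<le>Suc L. rot (L - b) b m n * hermite n 0) * hermite m (sqrt 2 * s)))" for s
    unfolding F_def by (intro sum.cong refl) (simp only: atMost_iff)
  also have "\<dots> s = (\<Sum>m\<le>Suc L. \<gamma> m * of_real (hermite m (sqrt 2 * s)))" for s
    unfolding \<gamma>_def rotc_def of_real_sum of_real_mult sum_distrib_left sum_distrib_right case_prod_conv
    by (rule trans[OF sum_swap3], intro sum.cong refl) (simp add: mult_ac)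
  finally have F: "F s = (\<Sum>m\<le>Suc L. \<gamma> m * of_real (hermite m (sqrt 2 * s)))" for s .
  have c: "complex_of_real x * cnj (complex_of_real y) = of_real (x * y)" for x y by simp
  have 1: "integrable lborel (\<lambda>s. complex_of_real (hermite i (sqrt 2 * s)) * cnj (complex_of_real (hermite j (sqrt 2 * s))))" for i j
    unfolding c by (intro integrable_of_real integral_hermite_scaled)
  have 2: "(\<integral>s. complex_of_real (hermite i (sqrt 2 * s)) * cnj (complex_of_real (hermite j (sqrt 2 * s))) \<partial>lborel) = (if i = j then of_real (1 / sqrt 2) else 0)" for i j
    unfolding c integral_complex_of_real integral_hermite_scaled(2) by simp
  show "integrable lborel (\<lambda>s. (cmod (F s))\<^sup>2)"
    unfolding F by (rule integral_norm_sq_orthogonal(1)[OF _ 1 2]) simp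
  have "(\<integral>s. (cmod (F s))\<^sup>2 \<partial>lborel) = (\<Sum>m\<le>Suc L. 1 / sqrt 2 * (cmod (\<gamma> m))\<^sup>2)"
    unfolding F by (rule integral_norm_sq_orthogonal(2)[OF _ 1 2]) simp
  also have "\<dots> = (\<Sum>m\<le>Suc L. (\<Sum>n\<le>Suc L. (hermite n 0)\<^sup>2 * (cmod (rotc L w (m, n)))\<^sup>2)) / sqrt 2"
    unfolding sum_divide_distrib
  proof (intro sum.cong refl)
    fix m assume m: "m \<in> {..Suc L}"
    have "(cmod (\<gamma> m))\<^sup>2 = (\<Sum>n\<le>Suc L. (hermite n 0)\<^sup>2 * (cmod (rotc L w (m, n)))\<^sup>2)"
    proof (cases "m \<le> L")
      case True
      have z: "rotc L w (m, n) = 0" if "n \<noteq> L - m" for n using that True by (intro rotc_supp) auto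
      have "\<gamma> m = (\<Sum>n\<in>{L - m}. rotc L w (m, n) * of_real (hermite n 0))"
        unfolding \<gamma>_def by (intro sum.mono_neutral_right) (auto simp: z)
      moreover have "(\<Sum>n\<le>Suc L. (hermite n 0)\<^sup>2 * (cmod (rotc L w (m, n)))\<^sup>2) = (\<Sum>n\<in>{L - m}. (hermite n 0)\<^sup>2 * (cmod (rotc L w (m, n)))\<^sup>2)"
        by (intro sum.mono_neutral_right) (auto simp: z)
      ultimately show ?thesis by (simp add: norm_mult power_mult_distrib mult.commute)
    next
      case False
      then have z: "rotc L w (m, n) = 0" for n by (intro rotc_supp) auto
      show ?thesis unfolding \<gamma>_def z by simp
    qed
    then show "1 / sqrt 2 * (cmod (\<gamma> m))\<^sup>2 = (\<Sum>n\<le>Suc L. (hermite n 0)\<^sup>2 * (cmod (rotc L w (m, n)))\<^sup>2 / sqrt 2)"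
      by (simp add: sum_divide_distrib del: sum.atMost_Suc)
  qed
  finally show "(\<integral>s. (cmod (F s))\<^sup>2 \<partial>lborel) = trace_sq L w / sqrt 2"
    unfolding trace_sq_def by (simp add: sum.cartesian_product del: sum.atMost_Suc)
qed

lemma borel_measurable_cnj [measurable (raw)]:
  "f \<in> borel_measurable M \<Longrightarrow> (\<lambda>x. cnj (f x)) \<in> borel_measurable M"
  by (rule measurable_compose[of f M borel cnj]) (auto intro!: borel_measurable_continuous_onI continuous_intros)

section \<open>Completeness of the Hermite functions\<close>

text \<open>\<open>lborel\<close> on vectors is the image of a product measure indexed by
  \<open>Basis\<close>, where Fubini for products applies; the factors are re-indexed along the map
  from i to \<open>axis i 1\<close>.\<close>

lemma tensor_integral:
  fixes f :: "'d::finite \<Rightarrow> real \<Rightarrow> complex"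
  assumes "\<And>i. integrable lborel (f i)"
  shows "integrable lborel (\<lambda>x::real^'d. \<Prod>i\<in>UNIV. f i (x $ i))"
    and "(\<integral>x. (\<Prod>i\<in>UNIV. f i (x $ i)) \<partial>(lborel :: (real^'d) measure)) = (\<Prod>i\<in>UNIV. \<integral>s. f i s \<partial>lborel)"
proof -
  interpret product_sigma_finite "\<lambda>_::real^'d. lborel :: real measure" by standard
  define g where "g b = f (SOME i. b = axis i 1)" for b :: "real^'d"
  have g: "g (axis i 1) = f i" for i unfolding g_def by (simp add: axis_eq_axis)
  have inj: "inj (\<lambda>i::'d. axis i (1::real))" by (auto simp: inj_def axis_eq_axis)
  have B: "Basis = range (\<lambda>i::'d. axis i (1::real))" by (auto simp: Basis_vec_def)
  have coord: "(\<Sum>b\<in>Basis. y b *\<^sub>R b) $ i = y (axis i 1)" for y :: "real^'d \<Rightarrow> real" and i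
    unfolding B by (subst sum.reindex[OF inj]) (simp add: axis_def if_distrib cong: if_cong)
  have prod: "(\<Prod>i\<in>UNIV. f i ((\<Sum>b\<in>Basis. y b *\<^sub>R b) $ i)) = (\<Prod>b\<in>Basis. g b (y b))" for y :: "real^'d \<Rightarrow> real"
    unfolding coord unfolding B by (subst prod.reindex[OF inj]) (simp add: g)
  have gi: "integrable lborel (g b)" if "b \<in> Basis" for b using that assms unfolding B by (auto simp: g)
  have [measurable]: "f i \<in> borel_measurable borel" for i using assms[of i] by (auto dest: borel_measurable_integrable)
  have m: "(\<lambda>x::real^'d. \<Prod>i\<in>UNIV. f i (x $ i)) \<in> borel_measurable borel" by measurable
  have m': "(\<lambda>y. \<Sum>b\<in>Basis. y b *\<^sub>R b) \<in> (\<Pi>\<^sub>M b\<in>Basis. lborel) \<rightarrow>\<^sub>M (borel :: (real^'d) measure)" by measurable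
  have "integrable (\<Pi>\<^sub>M b\<in>Basis. lborel) (\<lambda>y. \<Prod>b\<in>Basis. g b (y b))"
    by (intro product_integrable_prod gi) auto
  then show "integrable lborel (\<lambda>x::real^'d. \<Prod>i\<in>UNIV. f i (x $ i))"
    unfolding lborel_eq[where 'a="real^'d"] by (subst integrable_distr_eq[OF m' m]) (simp only: prod)
  have "(\<integral>x. (\<Prod>i\<in>UNIV. f i (x $ i)) \<partial>(lborel :: (real^'d) measure)) = (\<integral>y. (\<Prod>b\<in>Basis. g b (y b)) \<partial>(\<Pi>\<^sub>M b\<in>(Basis::(real^'d) set). lborel))"
    unfolding lborel_eq[where 'a="real^'d"] by (subst integral_distr[OF m' m]) (simp only: prod)
  also have "\<dots> = (\<Prod>b\<in>Basis. \<integral>s. g b s \<partial>lborel)"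
    by (intro product_integral_prod gi) auto
  also have "\<dots> = (\<Prod>i\<in>UNIV. \<integral>s. f i s \<partial>lborel)"
    unfolding B by (subst prod.reindex[OF inj]) (simp add: g)
  finally show "(\<integral>x. (\<Prod>i\<in>UNIV. f i (x $ i)) \<partial>(lborel :: (real^'d) measure)) = (\<Prod>i\<in>UNIV. \<integral>s. f i s \<partial>lborel)" .
qed

definition Herm :: "('d::finite \<Rightarrow> nat) \<Rightarrow> real^'d \<Rightarrow> real" where
  "Herm k x = (\<Prod>i\<in>UNIV. hermite (k i) (x $ i))"

lemma borel_measurable_Herm [measurable]: "Herm k \<in> borel_measurable borel"
  unfolding Herm_def[abs_def] by measurable

lemma integrable_Herm_mult: "integrable lborel (\<lambda>x. complex_of_real (Herm k x * Herm l x))"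
  using tensor_integral(1)[of "\<lambda>i s. complex_of_real (hermite (k i) s * hermite (l i) s)", OF integrable_of_real[OF integrable_hermite_mult]]
  by (simp add: Herm_def prod.distrib)

lemma integral_Herm_mult: "(\<integral>x. complex_of_real (Herm k x * Herm l x) \<partial>lborel) = (if k = l then 1 else 0)"
proof -
  have "(\<integral>x. complex_of_real (Herm k x * Herm l x) \<partial>lborel) = (\<Prod>i\<in>UNIV. \<integral>s. complex_of_real (hermite (k i) s * hermite (l i) s) \<partial>lborel)"
    using tensor_integral(2)[of "\<lambda>i s. complex_of_real (hermite (k i) s * hermite (l i) s)", OF integrable_of_real[OF integrable_hermite_mult]]
    by (simp add: Herm_def prod.distrib)
  also have "\<dots> = (\<Prod>i\<in>UNIV. if k i = l i then 1 else 0)"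
    using hmul_eq unfolding hmul_def by (intro prod.cong refl) (simp only: integral_complex_of_real, simp)
  also have "\<dots> = (if k = l then 1 else 0)"
    by (auto simp: fun_eq_iff)
  finally show ?thesis .
qed

text \<open>An enumeration of the multi-degrees, since abstract orthonormal bases are indexed by
  natural numbers below.\<close>

lemma exists_bij_index: "\<exists>\<iota>::nat \<Rightarrow> ('d::finite \<Rightarrow> nat). bij \<iota>"
proof -
  have "infinite (UNIV :: ('d \<Rightarrow> nat) set)"
  proof
    assume "finite (UNIV :: ('d \<Rightarrow> nat) set)"
    then have "finite (range (\<lambda>n (_::'d). n::nat))" by (rule rev_finite_subset) auto
    then have "finite (UNIV :: nat set)" by (rule finite_imageD) (auto simp: inj_on_def fun_eq_iff)
    then show False by simp
  qed
  then have "bij_betw (from_nat_into (UNIV :: ('d \<Rightarrow> nat) set)) UNIV UNIV"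
    by (intro bij_betw_from_nat_into) auto
  then show ?thesis by blast
qed

text \<open>Boxes form an intersection-stable generator of the Borel sets. The measures with the
  positive and the negative part as densities therefore coincide, and so do the two parts almost
  everywhere.\<close>

lemma AE_zero_of_box:
  fixes F :: "real^'d::finite \<Rightarrow> complex"
  assumes F: "integrable lborel F"
    and box: "\<And>a b. (\<integral>x. indicator (box a b) x *\<^sub>R F x \<partial>lborel) = 0"
  shows "AE x in lborel. F x = 0"
proof -
  have [measurable]: "F \<in> borel_measurable borel" using F by (auto dest: borel_measurable_integrable)
  have real: "AE x in lborel. G x = 0" if G: "integrable lborel G" and Gb: "\<And>a b. (\<integral>x. indicator (box a b) x *\<^sub>R G x \<partial>lborel) = 0"
    for G :: "real^'d \<Rightarrow> real"
  proof -
    have [measurable]: "G \<in> borel_measurable borel" using G by (auto dest: borel_measurable_integrable)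
    define M1 where "M1 = density lborel (\<lambda>x. ennreal (max 0 (G x)))"
    define M2 where "M2 = density lborel (\<lambda>x. ennreal (max 0 (- G x)))"
    have i1: "integrable lborel (\<lambda>x. max 0 (G x))" using G by (intro integrable_max) auto
    have i2: "integrable lborel (\<lambda>x. max 0 (- G x))" using G by (intro integrable_max) auto
    have fin1: "emeasure M1 A \<noteq> \<infinity>" if A: "A \<in> sets borel" for A
    proof -
      have "emeasure M1 A \<le> emeasure M1 UNIV" using A by (intro emeasure_mono) (auto simp: M1_def)
      also have "\<dots> = (\<integral>\<^sup>+x. ennreal (max 0 (G x)) \<partial>lborel)" unfolding M1_def by (subst emeasure_density) auto
      also have "\<dots> < \<infinity>" using i1 by (subst nn_integral_eq_integral) auto
      finally show ?thesis by auto
    qed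
    have eqb: "emeasure M1 (box a b) = emeasure M2 (box a b)" for a b
    proof -
      have e1: "integrable lborel (\<lambda>x. indicator (box a b) x * max 0 (G x))" "integrable lborel (\<lambda>x. indicator (box a b) x * max 0 (- G x))"
        using i1 i2 by (auto intro!: integrable_real_mult_indicator simp: mult.commute[of "indicator _ _"])
      have "0 = (\<integral>x. indicator (box a b) x * G x \<partial>lborel)" using Gb by simp
      also have "\<dots> = (\<integral>x. indicator (box a b) x * max 0 (G x) - indicator (box a b) x * max 0 (- G x) \<partial>lborel)"
        by (intro Bochner_Integration.integral_cong refl) (auto simp: max_def)
      also have "\<dots> = (\<integral>x. indicator (box a b) x * max 0 (G x) \<partial>lborel) - (\<integral>x. indicator (box a b) x * max 0 (- G x) \<partial>lborel)"
        by (rule Bochner_Integration.integral_diff[OF e1])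
      finally have "(\<integral>x. indicator (box a b) x * max 0 (G x) \<partial>lborel) = (\<integral>x. indicator (box a b) x * max 0 (- G x) \<partial>lborel)" by simp
      moreover have "emeasure M1 (box a b) = ennreal (\<integral>x. indicator (box a b) x * max 0 (G x) \<partial>lborel)"
      proof -
        have "emeasure M1 (box a b) = (\<integral>\<^sup>+x. ennreal (indicator (box a b) x * max 0 (G x)) \<partial>lborel)"
          unfolding M1_def by (subst emeasure_density) (auto intro!: nn_integral_cong split: split_indicator)
        then show ?thesis using e1(1) by (subst (asm) nn_integral_eq_integral) auto
      qed
      moreover have "emeasure M2 (box a b) = ennreal (\<integral>x. indicator (box a b) x * max 0 (- G x) \<partial>lborel)"
      proof -
        have "emeasure M2 (box a b) = (\<integral>\<^sup>+x. ennreal (indicator (box a b) x * max 0 (- G x)) \<partial>lborel)"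
          unfolding M2_def by (subst emeasure_density) (auto intro!: nn_integral_cong split: split_indicator)
        then show ?thesis using e1(2) by (subst (asm) nn_integral_eq_integral) auto
      qed
      ultimately show ?thesis by simp
    qed
    have "M1 = M2"
    proof (rule measure_eqI_generator_eq[where E="range (\<lambda>(a, b). box a b)" and \<Omega>=UNIV and A="\<lambda>n. box (- (real n *\<^sub>R One)) (real n *\<^sub>R One)"])
      show "Int_stable (range (\<lambda>(a, b). box a b :: (real^'d) set))"
      proof (rule Int_stableI, clarsimp)
        fix a b c d :: "real^'d"
        have "box a b \<inter> box c d = box (\<Sum>i\<in>Basis. max (a \<bullet> i) (c \<bullet> i) *\<^sub>R i) (\<Sum>i\<in>Basis. min (b \<bullet> i) (d \<bullet> i) *\<^sub>R i)" by (rule box_Int_box)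
        then show "box a b \<inter> box c d \<in> range (\<lambda>(a, b). box a b)" by auto
      qed
      show "sets M1 = sigma_sets UNIV (range (\<lambda>(a, b). box a b))" "sets M2 = sigma_sets UNIV (range (\<lambda>(a, b). box a b))"
        by (auto simp: M1_def M2_def borel_eq_box)
      show "(\<Union>n. box (- (real n *\<^sub>R One)) (real n *\<^sub>R One)) = (UNIV :: (real^'d) set)"
        by (rule UN_box_eq_UNIV)
      show "emeasure M1 (box (- (real n *\<^sub>R One)) (real n *\<^sub>R One)) \<noteq> \<infinity>" for n
        by (rule fin1) simp
    qed (auto simp: eqb)
    then have "AE x in lborel. ennreal (max 0 (G x)) = ennreal (max 0 (- G x))"
      unfolding M1_def M2_def by (subst (asm) sigma_finite_measure.density_unique_iff) (auto intro: sigma_finite_lborel)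
    then show ?thesis by eventually_elim (auto simp: max_def split: if_splits)
  qed
  have "AE x in lborel. Re (F x) = 0"
  proof (rule real)
    show "integrable lborel (\<lambda>x. Re (F x))" using F by auto
    fix a b
    have i: "integrable lborel (\<lambda>x. indicator (box a b) x *\<^sub>R F x)" using F by (intro integrable_mult_indicator) auto
    have "(\<integral>x. indicator (box a b) x *\<^sub>R Re (F x) \<partial>lborel) = Re (\<integral>x. indicator (box a b) x *\<^sub>R F x \<partial>lborel)"
      using integral_Re[OF i] by simp
    then show "(\<integral>x. indicator (box a b) x *\<^sub>R Re (F x) \<partial>lborel) = 0" unfolding box by simp
  qed
  moreover have "AE x in lborel. Im (F x) = 0"
  proof (rule real)
    show "integrable lborel (\<lambda>x. Im (F x))" using F by auto
    fix a b
    have i: "integrable lborel (\<lambda>x. indicator (box a b) x *\<^sub>R F x)" using F by (intro integrable_mult_indicator) auto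
    have "(\<integral>x. indicator (box a b) x *\<^sub>R Im (F x) \<partial>lborel) = Im (\<integral>x. indicator (box a b) x *\<^sub>R F x \<partial>lborel)"
      using integral_Im[OF i] by simp
    then show "(\<integral>x. indicator (box a b) x *\<^sub>R Im (F x) \<partial>lborel) = 0" unfolding box by simp
  qed
  ultimately show ?thesis by eventually_elim (auto simp: complex_eq_iff)
qed

text \<open>By the exponential weight the Fourier transform of the distribution of \<open>X\<close> under the signed density \<open>f\<close> is the
  sum of its moment series, so it vanishes; uniqueness is applied to positive and negative parts.\<close>

lemma integral_indicator_zero_of_moments:
  fixes f :: "'a \<Rightarrow> complex" and X :: "'a \<Rightarrow> real"
  assumes [measurable]: "X \<in> borel_measurable M"
    and ex: "\<And>c. integrable M (\<lambda>x. exp (c * \<bar>X x\<bar>) *\<^sub>R f x)"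
    and mom: "\<And>n. (\<integral>x. X x ^ n *\<^sub>R f x \<partial>M) = 0"
    and [measurable]: "A \<in> sets borel"
  shows "(\<integral>x. indicator A (X x) *\<^sub>R f x \<partial>M) = 0"
proof -
  have f: "integrable M f" using ex[of 0] by simp
  then have [measurable]: "f \<in> borel_measurable M" by auto
  have fourier: "(\<integral>x. iexp (\<xi> * X x) * f x \<partial>M) = 0" for \<xi>
  proof -
    \<comment> \<open>Partial sums of the exponential series times f: they are dominated by the
      exponential weight, and their integrals are combinations of moments.\<close>
    define s where "s N x = (\<Sum>n<N. (\<i> * of_real (\<xi> * X x)) ^ n /\<^sub>R fact n) * f x" for N x
    have "(\<lambda>N. \<integral>x. s N x \<partial>M) \<longlonglongrightarrow> (\<integral>x. iexp (\<xi> * X x) * f x \<partial>M)"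
    proof (rule integral_dominated_convergence)
      show "integrable M (\<lambda>x. norm (exp (\<bar>\<xi>\<bar> * \<bar>X x\<bar>) *\<^sub>R f x))" using ex by (intro integrable_norm)
      show "AE x in M. (\<lambda>N. s N x) \<longlonglongrightarrow> iexp (\<xi> * X x) * f x"
        unfolding s_def by (intro AE_I2 tendsto_mult tendsto_const exp_converges[unfolded sums_def])
      show "AE x in M. norm (s N x) \<le> norm (exp (\<bar>\<xi>\<bar> * \<bar>X x\<bar>) *\<^sub>R f x)" for N
      proof (intro AE_I2)
        fix x
        have "norm (\<Sum>n<N. (\<i> * of_real (\<xi> * X x)) ^ n /\<^sub>R fact n) \<le> (\<Sum>n<N. (\<bar>\<xi>\<bar> * \<bar>X x\<bar>) ^ n /\<^sub>R fact n)"
          by (rule sum_norm_le) (simp add: norm_mult norm_power abs_mult)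
        also have "\<dots> \<le> exp (\<bar>\<xi>\<bar> * \<bar>X x\<bar>)"
          unfolding exp_def by (intro sum_le_suminf summable_exp_generic) auto
        finally show "norm (s N x) \<le> norm (exp (\<bar>\<xi>\<bar> * \<bar>X x\<bar>) *\<^sub>R f x)"
          unfolding s_def by (simp add: norm_mult mult_right_mono)
      qed
    qed (auto simp: s_def)
    moreover have "(\<integral>x. s N x \<partial>M) = 0" for N
    proof -
      have int: "integrable M (\<lambda>x. X x ^ n *\<^sub>R f x)" for n
      proof (rule Bochner_Integration.integrable_bound)
        show "integrable M (\<lambda>x. fact n *\<^sub>R (exp (1 * \<bar>X x\<bar>) *\<^sub>R f x))" using ex by (intro integrable_scaleR_right)
        show "AE x in M. norm (X x ^ n *\<^sub>R f x) \<le> norm (fact n *\<^sub>R (exp (1 * \<bar>X x\<bar>) *\<^sub>R f x))"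
        proof (intro AE_I2)
          fix x
          have "(\<Sum>k\<in>{n}. \<bar>X x\<bar> ^ k /\<^sub>R fact k) \<le> exp \<bar>X x\<bar>"
            unfolding exp_def by (intro sum_le_suminf summable_exp_generic) auto
          then have "\<bar>X x\<bar> ^ n \<le> fact n * exp \<bar>X x\<bar>" by (simp add: field_simps)
          from mult_right_mono[OF this, of "norm (f x)"]
          show "norm (X x ^ n *\<^sub>R f x) \<le> norm (fact n *\<^sub>R (exp (1 * \<bar>X x\<bar>) *\<^sub>R f x))" by (simp add: power_abs)
        qed
      qed auto
      have "s N = (\<lambda>x. \<Sum>n<N. ((\<i> * of_real \<xi>) ^ n /\<^sub>R fact n) * (X x ^ n *\<^sub>R f x))"
        by (auto simp: s_def sum_distrib_right sum_distrib_left power_mult_distrib scaleR_conv_of_real fun_eq_iff mult_ac)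
      have "(\<integral>x. s N x \<partial>M) = (\<Sum>n<N. ((\<i> * of_real \<xi>) ^ n /\<^sub>R fact n) * (\<integral>x. X x ^ n *\<^sub>R f x \<partial>M))"
        unfolding \<open>s N = _\<close> by (subst Bochner_Integration.integral_sum) (intro integrable_mult_right int, simp only: integral_mult_right_zero)
      then show ?thesis by (simp add: mom)
    qed
    ultimately show ?thesis by (simp add: LIMSEQ_const_iff)
  qed
  have real: "(\<integral>x. indicator A (X x) * g x \<partial>M) = 0" if g: "integrable M g" and four: "\<And>\<xi>. (\<integral>x. iexp (\<xi> * X x) * of_real (g x) \<partial>M) = 0" for g :: "'a \<Rightarrow> real"
  proof -
    have [measurable]: "g \<in> borel_measurable M" using g by auto
    define g1 g2 where "g1 x = max 0 (g x)" and "g2 x = max 0 (- g x)" for x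
    have [measurable]: "g1 \<in> borel_measurable M" "g2 \<in> borel_measurable M" unfolding g1_def[abs_def] g2_def[abs_def] by measurable
    have i: "integrable M g1" "integrable M g2" using g unfolding g1_def[abs_def] g2_def[abs_def] by (auto intro!: integrable_max)
    have g12: "g x = g1 x - g2 x" for x by (auto simp: g1_def g2_def max_def)
    have pos: "g1 x \<ge> 0" "g2 x \<ge> 0" for x by (auto simp: g1_def g2_def)
    have ie: "integrable M (\<lambda>x. iexp (\<xi> * X x) * complex_of_real (h x))" if "integrable M h" for \<xi> and h :: "'a \<Rightarrow> real"
    proof (rule Bochner_Integration.integrable_bound[OF that])
      have [measurable]: "h \<in> borel_measurable M" using that by auto
      show "(\<lambda>x. iexp (\<xi> * X x) * complex_of_real (h x)) \<in> borel_measurable M" by measurable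
    qed (auto simp: norm_mult)
    have eqf: "(\<integral>x. iexp (\<xi> * X x) * of_real (g1 x) \<partial>M) = (\<integral>x. iexp (\<xi> * X x) * of_real (g2 x) \<partial>M)" for \<xi>
    proof -
      have "0 = (\<integral>x. iexp (\<xi> * X x) * of_real (g1 x) - iexp (\<xi> * X x) * of_real (g2 x) \<partial>M)"
        using four[of \<xi>] unfolding g12 by (simp add: right_diff_distrib)
      also have "\<dots> = (\<integral>x. iexp (\<xi> * X x) * of_real (g1 x) \<partial>M) - (\<integral>x. iexp (\<xi> * X x) * of_real (g2 x) \<partial>M)"
        by (rule Bochner_Integration.integral_diff[OF ie[OF i(1)] ie[OF i(2)]])
      finally show ?thesis by simp
    qed
    \<comment> \<open>Both parts have the same mass m, by the Fourier identity at 0. Division by m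
      gives probability distributions, to which \<open>Levy_uniqueness\<close> applies; if m = 0,
      both parts vanish.\<close>
    define m where "m = (\<integral>x. g1 x \<partial>M)"
    have m2: "(\<integral>x. g2 x \<partial>M) = m"
      using eqf[of 0] unfolding m_def by simp
    have "m \<ge> 0" unfolding m_def by (intro integral_nonneg_AE AE_I2 pos)
    show ?thesis
    proof (cases "m = 0")
      case True
      then have "AE x in M. g1 x = 0" "AE x in M. g2 x = 0"
        using integral_nonneg_eq_0_iff_AE[OF i(1)] integral_nonneg_eq_0_iff_AE[OF i(2)] pos m2 unfolding m_def by auto
      then have "AE x in M. indicator A (X x) * g x = 0" by eventually_elim (simp add: g12)
      then show ?thesis by (rule integral_eq_zero_AE)
    next
      case False
      then have "m > 0" using \<open>m \<ge> 0\<close> by simp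
      define D where "D h = distr (density M (\<lambda>x. ennreal (h x / m))) borel X" for h :: "'a \<Rightarrow> real"
      have D_dist: "real_distribution (D h)" if "integrable M h" "\<And>x. h x \<ge> 0" "(\<integral>x. h x \<partial>M) = m" for h
      proof -
        have [measurable]: "h \<in> borel_measurable M" using that by auto
        have "emeasure (density M (\<lambda>x. ennreal (h x / m))) (space M) = (\<integral>\<^sup>+x. ennreal (h x / m) \<partial>M)"
          by (subst emeasure_density) (auto intro!: nn_integral_cong)
        also have "\<dots> = ennreal (\<integral>x. h x / m \<partial>M)"
          using that \<open>m > 0\<close> by (intro nn_integral_eq_integral) auto
        also have "\<dots> = 1" using that \<open>m > 0\<close> by simp
        finally interpret prob_space "density M (\<lambda>x. ennreal (h x / m))" by (intro prob_spaceI) simp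
        show ?thesis unfolding D_def by (rule real_distribution_distr) simp
      qed
      have D_char: "char (D h) \<xi> = (\<integral>x. iexp (\<xi> * X x) * of_real (h x) \<partial>M) / m" if "integrable M h" "\<And>x. h x \<ge> 0" for h \<xi>
      proof -
        have [measurable]: "h \<in> borel_measurable M" using that by auto
        have "char (D h) \<xi> = (\<integral>x. (h x / m) *\<^sub>R iexp (\<xi> * X x) \<partial>M)"
          unfolding char_def D_def using that \<open>m > 0\<close> by (subst integral_distr) (auto simp: integral_density)
        also have "\<dots> = (\<integral>x. (iexp (\<xi> * X x) * of_real (h x)) / m \<partial>M)"
          by (intro Bochner_Integration.integral_cong refl) (simp add: scaleR_conv_of_real)
        finally show ?thesis by simp
      qed
      have D_int: "measure (D h) A = (\<integral>x. indicator A (X x) * h x \<partial>M) / m" if "integrable M h" "\<And>x. h x \<ge> 0" for h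
      proof -
        have [measurable]: "h \<in> borel_measurable M" using that by auto
        have "measure (D h) A = (\<integral>x. indicator A x \<partial>(D h))" by (simp add: D_def)
        also have "\<dots> = (\<integral>x. (h x / m) *\<^sub>R (indicator A (X x)) \<partial>M)"
          unfolding D_def using that \<open>m > 0\<close> by (subst integral_distr) (auto simp: integral_density)
        finally show ?thesis by (simp add: mult.commute)
      qed
      have "D g1 = D g2"
      proof (rule Levy_uniqueness)
        show "char (D g1) = char (D g2)"
          by (rule ext) (simp only: D_char[OF i(1) pos(1)] D_char[OF i(2) pos(2)] eqf)
      qed (auto intro!: D_dist i pos m2 simp: m_def)
      then have "(\<integral>x. indicator A (X x) * g1 x \<partial>M) = (\<integral>x. indicator A (X x) * g2 x \<partial>M)"
        using D_int[OF i(1) pos(1)] D_int[OF i(2) pos(2)] \<open>m > 0\<close> by simp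
      moreover have "integrable M (\<lambda>x. indicator A (X x) * h x)" if "integrable M h" for h :: "'a \<Rightarrow> real"
      proof (rule Bochner_Integration.integrable_bound[OF that])
        have [measurable]: "h \<in> borel_measurable M" using that by auto
        show "(\<lambda>x. indicator A (X x) * h x) \<in> borel_measurable M" by measurable
      qed (auto split: split_indicator)
      ultimately show ?thesis unfolding g12 by (simp add: right_diff_distrib i)
    qed
  qed
  have ief: "integrable M (\<lambda>x. iexp (\<xi> * X x) * f x)" for \<xi>
    by (rule Bochner_Integration.integrable_bound[OF f]) (auto simp: norm_mult)
  \<comment> \<open>All frequencies of both signs are covered, so the conjugate of f has vanishing
    Fourier integrals too, and with it the real and the imaginary part.\<close>
  have fourier': "(\<integral>x. iexp (\<xi> * X x) * cnj (f x) \<partial>M) = 0" for \<xi>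
  proof -
    have "(\<integral>x. iexp (\<xi> * X x) * cnj (f x) \<partial>M) = (\<integral>x. cnj (iexp (- \<xi> * X x) * f x) \<partial>M)"
      by (intro Bochner_Integration.integral_cong refl) (simp add: exp_cnj)
    also have "\<dots> = cnj (\<integral>x. iexp (- \<xi> * X x) * f x \<partial>M)" by (rule Bochner_Integration.integral_cnj)
    finally show ?thesis unfolding fourier by simp
  qed
  have ief': "integrable M (\<lambda>x. iexp (\<xi> * X x) * cnj (f x))" for \<xi>
    by (rule Bochner_Integration.integrable_bound[OF f]) (auto simp: norm_mult)
  have R: "(\<integral>x. indicator A (X x) * Re (f x) \<partial>M) = 0"
  proof (rule real)
    show "integrable M (\<lambda>x. Re (f x))" using f by auto
    fix \<xi>
    have "(\<integral>x. iexp (\<xi> * X x) * of_real (Re (f x)) \<partial>M) = (\<integral>x. (iexp (\<xi> * X x) * f x + iexp (\<xi> * X x) * cnj (f x)) / 2 \<partial>M)"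
      by (intro Bochner_Integration.integral_cong refl) (simp add: complex_add_cnj flip: distrib_left)
    also have "\<dots> = ((\<integral>x. iexp (\<xi> * X x) * f x \<partial>M) + (\<integral>x. iexp (\<xi> * X x) * cnj (f x) \<partial>M)) / 2"
      unfolding integral_divide_zero Bochner_Integration.integral_add[OF ief ief'] ..
    finally show "(\<integral>x. iexp (\<xi> * X x) * of_real (Re (f x)) \<partial>M) = 0"
      unfolding fourier fourier' by (simp only: add_0_left diff_0_right div_0)
  qed
  have I: "(\<integral>x. indicator A (X x) * Im (f x) \<partial>M) = 0"
  proof (rule real)
    show "integrable M (\<lambda>x. Im (f x))" using f by auto
    fix \<xi>
    have "(\<integral>x. iexp (\<xi> * X x) * of_real (Im (f x)) \<partial>M) = (\<integral>x. (iexp (\<xi> * X x) * f x - iexp (\<xi> * X x) * cnj (f x)) / (2 * \<i>) \<partial>M)"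
    proof (intro Bochner_Integration.integral_cong refl)
      fix x
      have "complex_of_real (Im (f x)) = (f x - cnj (f x)) / (2 * \<i>)"
        by (subst nonzero_eq_divide_eq) (auto simp: complex_eq_iff)
      then show "iexp (\<xi> * X x) * complex_of_real (Im (f x)) = (iexp (\<xi> * X x) * f x - iexp (\<xi> * X x) * cnj (f x)) / (2 * \<i>)"
        by (simp only: right_diff_distrib[symmetric] times_divide_eq_right)
    qed
    also have "\<dots> = ((\<integral>x. iexp (\<xi> * X x) * f x \<partial>M) - (\<integral>x. iexp (\<xi> * X x) * cnj (f x) \<partial>M)) / (2 * \<i>)"
      unfolding integral_divide_zero Bochner_Integration.integral_diff[OF ief ief'] ..
    finally show "(\<integral>x. iexp (\<xi> * X x) * of_real (Im (f x)) \<partial>M) = 0"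
      unfolding fourier fourier' by (simp only: add_0_left diff_0_right div_0)
  qed
  have ii: "integrable M (\<lambda>x. indicator A (X x) *\<^sub>R f x)"
    by (rule Bochner_Integration.integrable_bound[OF f]) (auto split: split_indicator)
  show ?thesis
    using integral_Re[OF ii] integral_Im[OF ii] R I by (simp add: complex_eq_iff)
qed


text \<open>Multiplication by x raises or lowers the index by one, so induction on the exponent
  stays within the span of the Hermite functions.\<close>

lemma gaussian_monomial_span:
  "\<exists>c. \<forall>x. x ^ n * exp (- x\<^sup>2 / 2) = (\<Sum>k\<le>n. c k * hermite k x)"
proof (induction n)
  case 0
  have "x ^ 0 * exp (- x\<^sup>2 / 2) = (\<Sum>k\<le>0. pi powr (1 / 4) * hermite k x)" for x
    by (simp add: hermite.simps flip: mult.assoc powr_add)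
  then show ?case by (intro exI[of _ "\<lambda>_. pi powr (1 / 4)"]) blast
next
  case (Suc n)
  then obtain c where c: "\<And>x. x ^ n * exp (- x\<^sup>2 / 2) = (\<Sum>k\<le>n. c k * hermite k x)" by blast
  define a where "a k = c k * sqrt ((real k + 1) / 2)" for k
  define b where "b k = c k * sqrt (real k / 2)" for k
  have "x ^ Suc n * exp (- x\<^sup>2 / 2) = (\<Sum>k\<le>Suc n. ((if k = 0 then 0 else a (k - 1)) + (if k < n then b (Suc k) else 0)) * hermite k x)" for x
  proof -
    have "x ^ Suc n * exp (- x\<^sup>2 / 2) = (\<Sum>k\<le>n. c k * (x * hermite k x))"
      using c[of x] by (simp add: sum_distrib_left mult.assoc mult.left_commute)
    also have "\<dots> = (\<Sum>k\<le>n. a k * hermite (Suc k) x) + (\<Sum>k\<le>n. b k * hermite (k - 1) x)"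
      unfolding hermite_times_x by (simp add: a_def b_def distrib_left mult.assoc sum.distrib)
    also have "(\<Sum>k\<le>n. a k * hermite (Suc k) x) = (\<Sum>k\<le>Suc n. (if k = 0 then 0 else a (k - 1)) * hermite k x)"
      by (subst sum.atMost_Suc_shift) simp
    also have "(\<Sum>k\<le>n. b k * hermite (k - 1) x) = (\<Sum>k\<le>Suc n. (if k < n then b (Suc k) else 0) * hermite k x)"
    proof (cases n)
      case (Suc m)
      have "(\<Sum>k\<le>Suc m. b k * hermite (k - 1) x) = (\<Sum>k\<le>m. b (Suc k) * hermite k x)"
        by (subst sum.atMost_Suc_shift) (simp add: b_def)
      also have "\<dots> = (\<Sum>k\<le>m. (if k < n then b (Suc k) else 0) * hermite k x)"
        using Suc by (intro sum.cong refl) auto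
      finally show ?thesis using Suc by simp
    qed (simp add: b_def)
    finally show ?thesis by (simp only: sum.distrib distrib_right)
  qed
  then show ?case
    by (intro exI[of _ "\<lambda>k. (if k = 0 then 0 else a (k - 1)) + (if k < n then b (Suc k) else 0)"] allI)
qed

text \<open>Completing the square, 2 c |s| <= 2 c^2 + s^2 / 2, absorbs the exponential and leaves
  half of the Gaussian for the polynomial.\<close>

lemma integrable_gaussian_weight:
  "integrable lborel (\<lambda>s::real. ((1 + \<bar>s\<bar> ^ n) * exp (c * \<bar>s\<bar>) * exp (- s\<^sup>2 / 2))\<^sup>2)"
proof (rule Bochner_Integration.integrable_bound)
  show "integrable lborel (\<lambda>s::real. exp (2 * c\<^sup>2) * ((poly ([:2:] + monom 2 (2 * n)) s) * exp (- s\<^sup>2 / 2)))"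
    by (intro integrable_mult_right integrable_poly_gaussian)
  show "AE s in lborel. norm (((1 + \<bar>s\<bar> ^ n) * exp (c * \<bar>s\<bar>) * exp (- s\<^sup>2 / 2))\<^sup>2)
      \<le> norm (exp (2 * c\<^sup>2) * ((poly ([:2:] + monom 2 (2 * n)) s) * exp (- s\<^sup>2 / 2)))"
  proof (intro AE_I2)
    fix s :: real
    have 1: "(1 + \<bar>s\<bar> ^ n)\<^sup>2 \<le> poly ([:2:] + monom 2 (2 * n)) s"
      using sum_squares_bound[of 1 "\<bar>s\<bar> ^ n"] by (simp add: poly_monom power2_sum power_mult power_even_abs flip: power_mult power_even_abs[of "2 * n"] mult.commute[of n])
    have "2 * (2 * c) * \<bar>s\<bar> \<le> (2 * c)\<^sup>2 + \<bar>s\<bar>\<^sup>2" by (rule sum_squares_bound)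
    then have "2 * (c * \<bar>s\<bar>) + 2 * (- s\<^sup>2 / 2) \<le> 2 * c\<^sup>2 + (- s\<^sup>2 / 2)" by (simp add: power_mult_distrib)
    then have 2: "(exp (c * \<bar>s\<bar>) * exp (- s\<^sup>2 / 2))\<^sup>2 \<le> exp (2 * c\<^sup>2) * exp (- s\<^sup>2 / 2)"
      by (simp add: power2_eq_square flip: exp_add)
    have "((1 + \<bar>s\<bar> ^ n) * exp (c * \<bar>s\<bar>) * exp (- s\<^sup>2 / 2))\<^sup>2 = (1 + \<bar>s\<bar> ^ n)\<^sup>2 * (exp (c * \<bar>s\<bar>) * exp (- s\<^sup>2 / 2))\<^sup>2"
      by (simp add: power_mult_distrib mult.assoc)
    also have "\<dots> \<le> poly ([:2:] + monom 2 (2 * n)) s * (exp (2 * c\<^sup>2) * exp (- s\<^sup>2 / 2))"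
      by (intro mult_mono 1 2 order_trans[OF _ 1]) auto
    finally show "norm (((1 + \<bar>s\<bar> ^ n) * exp (c * \<bar>s\<bar>) * exp (- s\<^sup>2 / 2))\<^sup>2)
      \<le> norm (exp (2 * c\<^sup>2) * ((poly ([:2:] + monom 2 (2 * n)) s) * exp (- s\<^sup>2 / 2)))"
      by (simp add: mult.assoc mult.left_commute)
  qed
qed measurable

text \<open>Orthogonality to all Hermite functions makes all moments of \<open>u\<close> times a Gaussian vanish. The monomials are then
  replaced by indicators of intervals, one coordinate after the other.\<close>

lemma AE_zero_of_Herm_orthogonal:
  fixes u :: "real^'d::finite \<Rightarrow> complex"
  assumes um [measurable]: "u \<in> borel_measurable borel" and u2: "integrable lborel (\<lambda>x. (cmod (u x))\<^sup>2)"
    and ort: "\<And>k. (\<integral>x. u x * of_real (Herm k x) \<partial>lborel) = 0"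
  shows "AE x in lborel. u x = 0"
proof -
  define F where "F x = u x * of_real (\<Prod>i\<in>UNIV. exp (- (x $ i)\<^sup>2 / 2))" for x
  have [measurable]: "F \<in> borel_measurable borel" unfolding F_def[abs_def] by measurable
  \<comment> \<open>A square-integrable majorant for all mixed products of monomials, indicators and
    one exponential weight; its product with |u| is integrable.\<close>
  define W where "W n c x = (\<Prod>i\<in>UNIV. (1 + \<bar>x $ i\<bar> ^ n i) * exp (c * \<bar>x $ i\<bar>) * exp (- (x $ i)\<^sup>2 / 2))" for n c and x :: "real^'d"
  have [measurable]: "W n c \<in> borel_measurable borel" for n c unfolding W_def[abs_def] by measurable
  have W2: "integrable lborel (\<lambda>x. (W n c x)\<^sup>2)" for n c
  proof -
    have "integrable lborel (\<lambda>x::real^'d. \<Prod>i\<in>UNIV. complex_of_real (((1 + \<bar>x $ i\<bar> ^ n i) * exp (c * \<bar>x $ i\<bar>) * exp (- (x $ i)\<^sup>2 / 2))\<^sup>2))"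
      by (rule tensor_integral(1)[where f="\<lambda>i s. complex_of_real (((1 + \<bar>s\<bar> ^ n i) * exp (c * \<bar>s\<bar>) * exp (- s\<^sup>2 / 2))\<^sup>2)"])
        (intro integrable_of_real integrable_gaussian_weight)
    then have "integrable lborel (\<lambda>x. complex_of_real ((W n c x)\<^sup>2))"
      unfolding W_def by (simp add: prod_power_distrib)
    then show ?thesis by (simp only: complex_of_real_integrable_eq)
  qed
  have uW: "integrable lborel (\<lambda>x. cmod (u x) * W n c x)" for n c
  proof (rule Bochner_Integration.integrable_bound)
    show "integrable lborel (\<lambda>x. (cmod (u x))\<^sup>2 + (W n c x)\<^sup>2)" using u2 W2 by (rule Bochner_Integration.integrable_add)
    show "AE x in lborel. norm (cmod (u x) * W n c x) \<le> norm ((cmod (u x))\<^sup>2 + (W n c x)\<^sup>2)"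
    proof (intro AE_I2)
      fix x
      have "W n c x \<ge> 0" unfolding W_def by (intro prod_nonneg) auto
      moreover have "2 * cmod (u x) * W n c x \<le> (cmod (u x))\<^sup>2 + (W n c x)\<^sup>2" by (rule sum_squares_bound)
      moreover have "0 \<le> cmod (u x) * W n c x" using calculation by simp
      ultimately have "cmod (u x) * W n c x \<le> (cmod (u x))\<^sup>2 + (W n c x)\<^sup>2" unfolding mult.assoc by linarith
      then show "norm (cmod (u x) * W n c x) \<le> norm ((cmod (u x))\<^sup>2 + (W n c x)\<^sup>2)" using \<open>W n c x \<ge> 0\<close> by simp
    qed
  qed measurable
  \<comment> \<open>Hybrid weights: indicators in the coordinates of S, monomials in the others. The
    induction on S keeps the exponents n free, since adding j to S uses all powers of
    \<open>x $ j\<close>.\<close>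
  define G where "G S n A x = (\<Prod>i\<in>UNIV. if i \<in> S then indicator (A i) (x $ i) else (x $ i) ^ n i)" for S n A and x :: "real^'d"
  have GF: "integrable lborel (\<lambda>x. exp (c * \<bar>x $ j\<bar>) *\<^sub>R (G S n A x *\<^sub>R F x))" if [measurable]: "\<And>i. A i \<in> sets borel" for S n A c j
  proof (rule Bochner_Integration.integrable_bound[OF uW[of n "\<bar>c\<bar>"]])
    have [measurable]: "G S n A \<in> borel_measurable borel"
      unfolding G_def[abs_def] by (intro borel_measurable_prod) (auto intro!: measurable_If)
    show "(\<lambda>x. exp (c * \<bar>x $ j\<bar>) *\<^sub>R (G S n A x *\<^sub>R F x)) \<in> borel_measurable lborel" by measurable
    show "AE x in lborel. norm (exp (c * \<bar>x $ j\<bar>) *\<^sub>R (G S n A x *\<^sub>R F x)) \<le> norm (cmod (u x) * W n \<bar>c\<bar> x)"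
    proof (intro AE_I2)
      fix x
      have "\<bar>G S n A x\<bar> \<le> (\<Prod>i\<in>UNIV. 1 + \<bar>x $ i\<bar> ^ n i)"
        unfolding G_def abs_prod by (intro prod_mono) (auto simp: power_abs split: split_indicator)
      moreover have "exp (c * \<bar>x $ j\<bar>) \<le> (\<Prod>i\<in>UNIV. exp (\<bar>c\<bar> * \<bar>x $ i\<bar>))"
      proof -
        have "exp (c * \<bar>x $ j\<bar>) \<le> exp (\<bar>c\<bar> * \<bar>x $ j\<bar>)" by (simp add: mult_right_mono)
        also have "\<dots> \<le> exp (\<Sum>i\<in>UNIV. \<bar>c\<bar> * \<bar>x $ i\<bar>)" by (subst exp_le_cancel_iff, rule member_le_sum) auto
        finally show ?thesis by (simp add: exp_sum)
      qed
      ultimately have "exp (c * \<bar>x $ j\<bar>) * \<bar>G S n A x\<bar> \<le> (\<Prod>i\<in>UNIV. exp (\<bar>c\<bar> * \<bar>x $ i\<bar>)) * (\<Prod>i\<in>UNIV. 1 + \<bar>x $ i\<bar> ^ n i)"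
        by (intro mult_mono prod_nonneg) auto
      then have "exp (c * \<bar>x $ j\<bar>) * \<bar>G S n A x\<bar> * (cmod (u x) * (\<Prod>i\<in>UNIV. exp (- (x $ i)\<^sup>2 / 2)))
          \<le> (\<Prod>i\<in>UNIV. exp (\<bar>c\<bar> * \<bar>x $ i\<bar>)) * (\<Prod>i\<in>UNIV. 1 + \<bar>x $ i\<bar> ^ n i) * (cmod (u x) * (\<Prod>i\<in>UNIV. exp (- (x $ i)\<^sup>2 / 2)))"
        by (intro mult_right_mono mult_nonneg_nonneg prod_nonneg) auto
      moreover have "norm (F x) = cmod (u x) * (\<Prod>i\<in>UNIV. exp (- (x $ i)\<^sup>2 / 2))"
        unfolding F_def norm_mult norm_of_real by (intro arg_cong2[where f="(*)"] refl abs_of_nonneg prod_nonneg) auto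
      moreover have "norm (cmod (u x) * W n \<bar>c\<bar> x) = cmod (u x) * W n \<bar>c\<bar> x" unfolding W_def real_norm_def by (intro abs_of_nonneg mult_nonneg_nonneg prod_nonneg) auto
      moreover have "cmod (u x) * W n \<bar>c\<bar> x = (\<Prod>i\<in>UNIV. exp (\<bar>c\<bar> * \<bar>x $ i\<bar>)) * (\<Prod>i\<in>UNIV. 1 + \<bar>x $ i\<bar> ^ n i) * (cmod (u x) * (\<Prod>i\<in>UNIV. exp (- (x $ i)\<^sup>2 / 2)))"
        unfolding W_def prod.distrib by (simp only: mult_ac)
      ultimately show "norm (exp (c * \<bar>x $ j\<bar>) *\<^sub>R (G S n A x *\<^sub>R F x)) \<le> norm (cmod (u x) * W n \<bar>c\<bar> x)"
        by (simp only: norm_scaleR abs_exp_cancel mult.assoc)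
    qed
  qed
  have main: "(\<integral>x. G S n A x *\<^sub>R F x \<partial>lborel) = 0" if A: "\<And>i. A i \<in> sets borel" for S n A
    using finite[of S]
  proof (induction S arbitrary: n)
    case empty
    have "\<forall>i. \<exists>c. \<forall>s. s ^ n i * exp (- s\<^sup>2 / 2) = (\<Sum>k\<le>n i. c k * hermite k s)" using gaussian_monomial_span by blast
    then obtain c where c: "\<And>i s. s ^ n i * exp (- s\<^sup>2 / 2) = (\<Sum>k\<le>n i. c i k * hermite k s)" by metis
    have "G {} n A x *\<^sub>R F x = (\<Sum>k\<in>PiE UNIV (\<lambda>i. {..n i}). of_real (\<Prod>i\<in>UNIV. c i (k i)) * (u x * of_real (Herm k x)))" for x
    proof -
      have "G {} n A x *\<^sub>R F x = u x * of_real (\<Prod>i\<in>UNIV. (x $ i) ^ n i * exp (- (x $ i)\<^sup>2 / 2))"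
        by (simp add: G_def F_def prod.distrib scaleR_conv_of_real)
      also have "(\<Prod>i\<in>UNIV. (x $ i) ^ n i * exp (- (x $ i)\<^sup>2 / 2)) = (\<Sum>k\<in>PiE UNIV (\<lambda>i. {..n i}). \<Prod>i\<in>UNIV. c i (k i) * hermite (k i) (x $ i))"
        unfolding c by (rule prod_sum_PiE) auto
      finally show ?thesis by (simp add: Herm_def prod.distrib sum_distrib_left mult_ac)
    qed
    moreover have "integrable lborel (\<lambda>x. u x * of_real (Herm k x))" for k
    proof (rule Bochner_Integration.integrable_bound)
      show "integrable lborel (\<lambda>x. (cmod (u x))\<^sup>2 + (Herm k x)\<^sup>2)"
        using integrable_Herm_mult[of k k] unfolding complex_of_real_integrable_eq by (intro Bochner_Integration.integrable_add u2) (simp add: power2_eq_square)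
      show "AE x in lborel. norm (u x * of_real (Herm k x)) \<le> norm ((cmod (u x))\<^sup>2 + (Herm k x)\<^sup>2)"
      proof (intro AE_I2)
        fix x
        have "2 * cmod (u x) * \<bar>Herm k x\<bar> \<le> (cmod (u x))\<^sup>2 + \<bar>Herm k x\<bar>\<^sup>2" by (rule sum_squares_bound)
        moreover have "0 \<le> cmod (u x) * \<bar>Herm k x\<bar>" by simp
        ultimately have "cmod (u x) * \<bar>Herm k x\<bar> \<le> (cmod (u x))\<^sup>2 + \<bar>Herm k x\<bar>\<^sup>2" unfolding mult.assoc by linarith
        then show "norm (u x * of_real (Herm k x)) \<le> norm ((cmod (u x))\<^sup>2 + (Herm k x)\<^sup>2)" by (simp add: norm_mult)
      qed
    qed measurable
    ultimately show ?case by (simp add: Bochner_Integration.integral_sum ort)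
  next
    case (insert j S)
    define f where "f x = (\<Prod>i\<in>UNIV - {j}. if i \<in> S then indicator (A i) (x $ i) else (x $ i) ^ n i) *\<^sub>R F x" for x
    have split: "G T m A x = (if j \<in> T then indicator (A j) (x $ j) else (x $ j) ^ m j) * (\<Prod>i\<in>UNIV - {j}. if i \<in> T then indicator (A i) (x $ i) else (x $ i) ^ m i)" for T m x
      unfolding G_def by (subst prod.remove[of UNIV j]) auto
    have f1: "x $ j ^ m *\<^sub>R f x = G S (n(j := m)) A x *\<^sub>R F x" for m x
    proof -
      have "(\<Prod>i\<in>UNIV - {j}. if i \<in> S then indicator (A i) (x $ i) else (x $ i) ^ n i) = (\<Prod>i\<in>UNIV - {j}. if i \<in> S then indicator (A i) (x $ i) else (x $ i) ^ (n(j := m)) i)"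
        by (intro prod.cong refl) auto
      then show ?thesis unfolding f_def split using insert by simp
    qed
    have f2: "indicator (A j) (x $ j) *\<^sub>R f x = G (insert j S) n A x *\<^sub>R F x" for x
    proof -
      have "(\<Prod>i\<in>UNIV - {j}. if i \<in> S then indicator (A i) (x $ i) else (x $ i) ^ n i) = (\<Prod>i\<in>UNIV - {j}. if i \<in> insert j S then indicator (A i) (x $ i) else (x $ i) ^ n i)"
        by (intro prod.cong refl) auto
      then show ?thesis unfolding f_def split using insert by simp
    qed
    have "(\<integral>x. indicator (A j) (x $ j) *\<^sub>R f x \<partial>lborel) = 0"
    proof (rule integral_indicator_zero_of_moments)
      show "integrable lborel (\<lambda>x. exp (c * \<bar>x $ j\<bar>) *\<^sub>R f x)" for c
        using GF[OF A, of c j S "n(j := 0)"] f1[of _ 0] by simp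
      show "(\<integral>x. (x $ j) ^ m *\<^sub>R f x \<partial>lborel) = 0" for m unfolding f1 by (rule insert.IH)
    qed (use A in auto)
    then show ?case unfolding f2 .
  qed
  have "AE x in lborel. F x = 0"
  proof (rule AE_zero_of_box)
    \<comment> \<open>With the whole line in place of every interval the hybrid weight is 1.\<close>
    show "integrable lborel F" using GF[of "\<lambda>_. UNIV" 0 undefined UNIV "\<lambda>_. 0"] by (simp add: G_def)
    fix a b :: "real^'d"
    have "indicator (box a b) x = G UNIV (\<lambda>_. 0) (\<lambda>i. {a $ i<..<b $ i}) x" for x
      unfolding G_def by (auto simp: mem_box_cart indicator_def)
    then show "(\<integral>x. indicator (box a b) x *\<^sub>R F x \<partial>lborel) = 0"
      using main[of "\<lambda>i. {a $ i<..<b $ i}" UNIV "\<lambda>_. 0"] by simp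
  qed
  then show ?thesis by eventually_elim (auto simp: F_def)
qed

section \<open>Square-integrable functions\<close>

definition L2sq :: "('a::euclidean_space \<Rightarrow> complex) \<Rightarrow> real" where
  "L2sq u = (\<integral>x. (cmod (u x))\<^sup>2 \<partial>lborel)"

lemma L2norm_sq_ennreal:
  "(\<integral>\<^sup>+x. (ennreal (norm (u x)))\<^sup>2 \<partial>lborel) = (\<integral>\<^sup>+x. ennreal ((norm (u x))\<^sup>2) \<partial>lborel)"
  by (simp add: ennreal_power)

lemma L2_iff: "u \<in> L2 \<longleftrightarrow> u \<in> borel_measurable borel \<and> integrable lborel (\<lambda>x. (cmod (u x))\<^sup>2)"
proof -
  have "L2norm u < \<infinity> \<longleftrightarrow> (\<integral>\<^sup>+x. ennreal ((cmod (u x))\<^sup>2) \<partial>lborel) < \<infinity>"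
    unfolding L2norm_def L2_norm_of_def L2norm_sq_ennreal esqrt_def by (auto simp: less_top[symmetric])
  then show ?thesis unfolding L2_def by (auto simp: integrable_iff_bounded)
qed

lemma L2_measurable: "u \<in> L2 \<Longrightarrow> u \<in> borel_measurable borel" by (simp add: L2_iff)
lemma L2_integrable: "u \<in> L2 \<Longrightarrow> integrable lborel (\<lambda>x. (cmod (u x))\<^sup>2)" by (simp add: L2_iff)

lemma L2sq_nonneg [simp]: "L2sq u \<ge> 0" by (simp add: L2sq_def)

lemma L2norm_eq: "u \<in> L2 \<Longrightarrow> L2norm u = ennreal (sqrt (L2sq u))"
  unfolding L2norm_def L2_norm_of_def L2norm_sq_ennreal esqrt_def
  by (subst (1 2) nn_integral_eq_integral) (auto simp: L2_integrable L2sq_def)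

lemma L2_mult_integrable:
  assumes "u \<in> L2" "v \<in> L2"
  shows "integrable lborel (\<lambda>x. u x * v x)"
proof (rule Bochner_Integration.integrable_bound)
  show "integrable lborel (\<lambda>x. (cmod (u x))\<^sup>2 + (cmod (v x))\<^sup>2)"
    using assms by (intro Bochner_Integration.integrable_add L2_integrable)
  show "(\<lambda>x. u x * v x) \<in> borel_measurable lborel"
    using assms[THEN L2_measurable] by measurable
  show "AE x in lborel. norm (u x * v x) \<le> norm ((cmod (u x))\<^sup>2 + (cmod (v x))\<^sup>2)"
  proof (intro AE_I2)
    fix x
    have "2 * (cmod (u x) * cmod (v x)) \<le> (cmod (u x))\<^sup>2 + (cmod (v x))\<^sup>2"
      using sum_squares_bound[of "cmod (u x)" "cmod (v x)"] by simp
    moreover have "0 \<le> cmod (u x) * cmod (v x)" by simp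
    ultimately have "cmod (u x) * cmod (v x) \<le> (cmod (u x))\<^sup>2 + (cmod (v x))\<^sup>2" by linarith
    then show "norm (u x * v x) \<le> norm ((cmod (u x))\<^sup>2 + (cmod (v x))\<^sup>2)" by (simp add: norm_mult)
  qed
qed

lemma L2_cnj: "u \<in> L2 \<Longrightarrow> (\<lambda>x. cnj (u x)) \<in> L2"
  by (auto simp: L2_iff)

lemma L2_inner_integrable: "u \<in> L2 \<Longrightarrow> v \<in> L2 \<Longrightarrow> integrable lborel (\<lambda>x. u x * cnj (v x))"
  by (intro L2_mult_integrable L2_cnj)

lemma L2_lin:
  assumes "u \<in> L2" "v \<in> L2"
  shows "(\<lambda>x. a * u x + b * v x) \<in> L2"
  unfolding L2_iff
proof (intro conjI)
  show m: "(\<lambda>x. a * u x + b * v x) \<in> borel_measurable borel"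
    using assms[THEN L2_measurable] by measurable
  show "integrable lborel (\<lambda>x. (cmod (a * u x + b * v x))\<^sup>2)"
  proof (rule Bochner_Integration.integrable_bound)
    show "integrable lborel (\<lambda>x. 2 * (cmod a)\<^sup>2 * (cmod (u x))\<^sup>2 + 2 * (cmod b)\<^sup>2 * (cmod (v x))\<^sup>2)"
      using assms by (intro Bochner_Integration.integrable_add integrable_mult_right L2_integrable)
    show "AE x in lborel. norm ((cmod (a * u x + b * v x))\<^sup>2) \<le> norm (2 * (cmod a)\<^sup>2 * (cmod (u x))\<^sup>2 + 2 * (cmod b)\<^sup>2 * (cmod (v x))\<^sup>2)"
    proof (intro AE_I2)
      fix x show "norm ((cmod (a * u x + b * v x))\<^sup>2) \<le> norm (2 * (cmod a)\<^sup>2 * (cmod (u x))\<^sup>2 + 2 * (cmod b)\<^sup>2 * (cmod (v x))\<^sup>2)"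
        using norm_add_sq_le[of "a * u x" "b * v x"] by (simp add: norm_mult power_mult_distrib mult.assoc)
    qed
  qed (use m in measurable)
qed

lemma L2_zero: "(\<lambda>x. 0) \<in> L2" by (simp add: L2_iff)
lemma L2_add: "u \<in> L2 \<Longrightarrow> v \<in> L2 \<Longrightarrow> (\<lambda>x. u x + v x) \<in> L2" using L2_lin[of u v 1 1] by simp
lemma L2_diff: "u \<in> L2 \<Longrightarrow> v \<in> L2 \<Longrightarrow> (\<lambda>x. u x - v x) \<in> L2" using L2_lin[of u v 1 "-1"] by simp
lemma L2_cmult: "u \<in> L2 \<Longrightarrow> (\<lambda>x. a * u x) \<in> L2" using L2_lin[of u u a 0] by simp
lemma L2_sum: "(\<And>i. i \<in> I \<Longrightarrow> f i \<in> L2) \<Longrightarrow> (\<lambda>x. \<Sum>i\<in>I. f i x) \<in> L2"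
  by (induction I rule: infinite_finite_induct) (auto intro: L2_zero L2_add)

lemma L2sq_cong_AE:
  assumes "AE x in lborel. u x = v x" "u \<in> borel_measurable borel" "v \<in> borel_measurable borel"
  shows "L2sq u = L2sq v"
  unfolding L2sq_def using assms by (intro integral_cong_AE) (auto elim!: eventually_mono)

lemma L2_inner_lin_left:
  assumes "u \<in> L2" "v \<in> L2" "w \<in> L2"
  shows "L2_inner (\<lambda>x. a * u x + b * v x) w = a * L2_inner u w + b * L2_inner v w"
proof -
  have "L2_inner (\<lambda>x. a * u x + b * v x) w = (\<integral>x. a * (u x * cnj (w x)) + b * (v x * cnj (w x)) \<partial>lborel)"
    unfolding L2_inner_def by (intro Bochner_Integration.integral_cong refl) (simp add: algebra_simps)
  also have "\<dots> = a * L2_inner u w + b * L2_inner v w"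
    unfolding L2_inner_def using L2_inner_integrable[OF assms(1,3)] L2_inner_integrable[OF assms(2,3)] by simp
  finally show ?thesis .
qed

lemma L2_inner_cnj: "L2_inner v u = cnj (L2_inner u v)"
  unfolding L2_inner_def Bochner_Integration.integral_cnj[symmetric] by (simp add: mult.commute)

lemma L2_inner_self: "u \<in> L2 \<Longrightarrow> L2_inner u u = of_real (L2sq u)"
  unfolding L2_inner_def L2sq_def integral_complex_of_real[symmetric]
  by (intro Bochner_Integration.integral_cong refl) (simp only: complex_norm_square)

lemma L2_inner_lin_right:
  assumes "u \<in> L2" "v \<in> L2" "w \<in> L2"
  shows "L2_inner w (\<lambda>x. a * u x + b * v x) = cnj a * L2_inner w u + cnj b * L2_inner w v"
  unfolding L2_inner_cnj[of w] L2_inner_lin_left[OF assms] by (simp add: L2_inner_cnj[of _ w])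

lemma L2_inner_cong_AE:
  assumes "AE x in lborel. u x = u' x" "u \<in> L2" "u' \<in> L2" "v \<in> L2"
  shows "L2_inner u v = L2_inner u' v"
proof -
  have [measurable]: "u \<in> borel_measurable borel" "u' \<in> borel_measurable borel" "v \<in> borel_measurable borel"
    using assms(2-4) by (auto dest: L2_measurable)
  show ?thesis unfolding L2_inner_def
    by (rule integral_cong_AE) (use assms(1) in \<open>auto elim!: eventually_mono\<close>)
qed

lemma L2sq_diff_expand:
  assumes "u \<in> L2" "v \<in> L2"
  shows "L2sq (\<lambda>x. u x - v x) = L2sq u - 2 * Re (L2_inner u v) + L2sq v"
proof -
  have "complex_of_real (L2sq (\<lambda>x. u x - v x)) = L2_inner (\<lambda>x. 1 * u x + (-1) * v x) (\<lambda>x. 1 * u x + (-1) * v x)"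
    using L2_inner_self[OF L2_diff[OF assms]] by simp
  also have "\<dots> = L2_inner u u - L2_inner u v - L2_inner v u + L2_inner v v"
    unfolding L2_inner_lin_left[OF assms L2_lin[OF assms]] L2_inner_lin_right[OF assms assms(1)] L2_inner_lin_right[OF assms assms(2)]
    by simp
  also have "\<dots> = of_real (L2sq u) - (L2_inner u v + cnj (L2_inner u v)) + of_real (L2sq v)"
    unfolding L2_inner_self[OF assms(1)] L2_inner_self[OF assms(2)] L2_inner_cnj[of v u] by simp
  also have "\<dots> = of_real (L2sq u - 2 * Re (L2_inner u v) + L2sq v)"
    unfolding complex_add_cnj by simp
  finally show ?thesis by (simp only: of_real_eq_iff)
qed

lemma L2_Cauchy_Schwarz:
  assumes "u \<in> L2" "v \<in> L2"
  shows "(cmod (L2_inner u v))\<^sup>2 \<le> L2sq u * L2sq v"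
proof -
  let ?c = "L2_inner u v"
  \<comment> \<open>The squared norm of u - t <u, v> v is a nonnegative quadratic in t. The choice t
    = 1 / \<open>L2sq v\<close> is optimal; if \<open>L2sq v\<close> is 0, a large t forces <u, v> =
    0.\<close>
  have key: "0 \<le> L2sq u - 2 * t * (cmod ?c)\<^sup>2 + t\<^sup>2 * (cmod ?c)\<^sup>2 * L2sq v" for t
  proof -
    define a where "a = of_real t * ?c"
    have "L2sq (\<lambda>x. u x - a * v x) = L2sq u - 2 * Re (L2_inner u (\<lambda>x. a * v x)) + L2sq (\<lambda>x. a * v x)"
      by (intro L2sq_diff_expand L2_cmult assms)
    also have "L2_inner u (\<lambda>x. a * v x) = cnj a * ?c"
      using L2_inner_lin_right[OF assms(2) assms(2) assms(1), of a 0] by simp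
    also have "cnj a * ?c = of_real (t * (cmod ?c)\<^sup>2)"
      unfolding a_def of_real_mult complex_norm_square by simp
    also have "L2sq (\<lambda>x. a * v x) = (cmod a)\<^sup>2 * L2sq v" by (simp add: L2sq_def norm_mult power_mult_distrib)
    also have "(cmod a)\<^sup>2 = t\<^sup>2 * (cmod ?c)\<^sup>2" by (simp add: a_def norm_mult power_mult_distrib)
    finally have "L2sq (\<lambda>x. u x - a * v x) = L2sq u - 2 * t * (cmod ?c)\<^sup>2 + t\<^sup>2 * (cmod ?c)\<^sup>2 * L2sq v" by simp
    then show ?thesis using L2sq_nonneg[of "\<lambda>x. u x - a * v x"] by simp
  qed
  show ?thesis
  proof (cases "L2sq v = 0")
    case False
    then have v: "L2sq v > 0" using L2sq_nonneg[of v] by (metis less_le)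
    have "0 \<le> L2sq u - (cmod ?c)\<^sup>2 / L2sq v"
      using key[of "1 / L2sq v"] v by (simp add: power_divide power2_eq_square)
    then show ?thesis using v by (simp add: field_simps)
  next
    case True
    have "(cmod ?c)\<^sup>2 = 0"
    proof (rule ccontr)
      assume "(cmod ?c)\<^sup>2 \<noteq> 0"
      then have "2 * ((L2sq u + 1) / (2 * (cmod ?c)\<^sup>2)) * (cmod ?c)\<^sup>2 = L2sq u + 1" by simp
      then show False using key[of "(L2sq u + 1) / (2 * (cmod ?c)\<^sup>2)"] True by simp
    qed
    then show ?thesis using True by simp
  qed
qed

lemma L2sq_eq_0_iff:
  assumes "u \<in> L2" shows "L2sq u = 0 \<longleftrightarrow> (AE x in lborel. u x = 0)"
  unfolding L2sq_def using integral_nonneg_eq_0_iff_AE[OF L2_integrable[OF assms]] by simp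

section \<open>Orthonormal bases of L2: Bessel, Riesz-Fischer and Parseval\<close>

locale orthonormal_basis =
  fixes e :: "nat \<Rightarrow> 'a::euclidean_space \<Rightarrow> complex"
  assumes e_L2: "\<And>n. e n \<in> L2"
    and orthonormal: "\<And>m n. L2_inner (e m) (e n) = (if m = n then 1 else 0)"
    and total: "\<And>u. u \<in> L2 \<Longrightarrow> (\<And>n. L2_inner u (e n) = 0) \<Longrightarrow> AE x in lborel. u x = 0"
begin

definition partial :: "(nat \<Rightarrow> complex) \<Rightarrow> nat \<Rightarrow> 'a \<Rightarrow> complex" where
  "partial c N x = (\<Sum>n<N. c n * e n x)"

lemma L2_comb: "(\<lambda>x. \<Sum>n\<in>I. c n * e n x) \<in> L2"
  by (intro L2_sum L2_cmult e_L2)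

lemma partial_L2: "partial c N \<in> L2"
  unfolding partial_def[abs_def] by (rule L2_comb)

lemma inner_comb_right:
  assumes "u \<in> L2" "finite I"
  shows "L2_inner u (\<lambda>x. \<Sum>n\<in>I. c n * e n x) = (\<Sum>n\<in>I. cnj (c n) * L2_inner u (e n))"
  using assms(2)
proof induction
  case empty
  show ?case by (simp add: L2_inner_def)
next
  case (insert a I)
  have "L2_inner u (\<lambda>x. \<Sum>n\<in>insert a I. c n * e n x) = L2_inner u (\<lambda>x. c a * e a x + 1 * (\<Sum>n\<in>I. c n * e n x))"
    using insert by simp
  also have "\<dots> = cnj (c a) * L2_inner u (e a) + L2_inner u (\<lambda>x. \<Sum>n\<in>I. c n * e n x)"
    by (subst L2_inner_lin_right[OF e_L2 L2_comb assms(1)]) simp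
  finally show ?case using insert by simp
qed

lemma inner_partial: "L2_inner (partial c N) (e n) = (if n < N then c n else 0)"
proof -
  have "L2_inner (e n) (partial c N) = (\<Sum>m<N. cnj (c m) * (if n = m then 1 else 0))"
    unfolding partial_def[abs_def] by (subst inner_comb_right[OF e_L2]) (auto simp: orthonormal)
  also have "\<dots> = (\<Sum>m<N. if m = n then cnj (c n) else 0)" by (intro sum.cong refl) auto
  also have "\<dots> = (if n < N then cnj (c n) else 0)" by simp
  finally show ?thesis by (subst L2_inner_cnj) auto
qed

lemma L2sq_comb: "finite I \<Longrightarrow> L2sq (\<lambda>x. \<Sum>n\<in>I. c n * e n x) = (\<Sum>n\<in>I. (cmod (c n))\<^sup>2)"
  unfolding L2sq_def
  using integral_norm_sq_orthogonal(2)[of I lborel e "\<lambda>_. 1" c] orthonormal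
  by (simp add: L2_inner_integrable e_L2 L2_inner_def)

lemma L2sq_minus_partial:
  assumes "u \<in> L2"
  shows "L2sq (\<lambda>x. u x - partial (\<lambda>n. L2_inner u (e n)) N x) = L2sq u - (\<Sum>n<N. (cmod (L2_inner u (e n)))\<^sup>2)"
proof -
  let ?c = "\<lambda>n. L2_inner u (e n)"
  have "L2_inner u (partial ?c N) = (\<Sum>n<N. cnj (?c n) * ?c n)"
    unfolding partial_def[abs_def] by (intro inner_comb_right assms) simp
  also have "\<dots> = of_real (\<Sum>n<N. (cmod (?c n))\<^sup>2)"
    unfolding of_real_sum by (simp only: complex_norm_square mult.commute)
  finally have 1: "Re (L2_inner u (partial ?c N)) = (\<Sum>n<N. (cmod (?c n))\<^sup>2)" by simp
  have 2: "L2sq (partial ?c N) = (\<Sum>n<N. (cmod (?c n))\<^sup>2)"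
    unfolding partial_def[abs_def] by (intro L2sq_comb) simp
  show ?thesis unfolding L2sq_diff_expand[OF assms partial_L2] 1 2 by simp
qed

lemma Bessel:
  assumes "u \<in> L2" shows "summable (\<lambda>n. (cmod (L2_inner u (e n)))\<^sup>2)"
proof (rule bounded_imp_summable)
  fix N
  have "(\<Sum>n<Suc N. (cmod (L2_inner u (e n)))\<^sup>2) \<le> L2sq u"
    using L2sq_minus_partial[OF assms, of "Suc N"] L2sq_nonneg[of "\<lambda>x. u x - partial (\<lambda>n. L2_inner u (e n)) (Suc N) x"] by linarith
  then show "(\<Sum>n\<le>N. (cmod (L2_inner u (e n)))\<^sup>2) \<le> L2sq u" by (simp add: lessThan_Suc_atMost)
qed simp

text \<open>Along a fast subsequence the partial sums converge almost everywhere; Fatou's lemma then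
  shows that the pointwise limit is also the limit in norm.\<close>

lemma Riesz_Fischer:
  assumes c: "summable (\<lambda>n. (cmod (c n))\<^sup>2)"
  shows "\<exists>w\<in>L2. (\<forall>n. L2_inner w (e n) = c n) \<and> (\<lambda>n. (cmod (c n))\<^sup>2) sums L2sq w"
proof -
  define s where "s = partial c"
  have s_diff: "(\<lambda>x. s N x - s M x) = (\<lambda>x. \<Sum>n\<in>{M..<N}. c n * e n x)" if "M \<le> N" for M N
    unfolding s_def partial_def[abs_def] using that
    by (auto simp: fun_eq_iff sum_diff_nat_ivl[of 0 M N, simplified] atLeast0LessThan simp flip: atLeast0LessThan)
  have s_sq: "L2sq (\<lambda>x. s N x - s M x) = (\<Sum>n\<in>{M..<N}. (cmod (c n))\<^sup>2)" if "M \<le> N" for M N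
    unfolding s_diff[OF that] by (rule L2sq_comb) simp
  define tail where "tail M = (\<Sum>n. (cmod (c (n + M)))\<^sup>2)" for M
  have tail0: "tail \<longlonglongrightarrow> 0" unfolding tail_def[abs_def] by (rule suminf_exist_split2[OF c])
  have tail: "(\<Sum>n\<in>{M..<N}. (cmod (c n))\<^sup>2) \<le> tail M" if "M \<le> N" for M N
  proof -
    have "(\<Sum>n\<in>{M..<N}. (cmod (c n))\<^sup>2) = (\<Sum>n\<in>{0..<N - M}. (cmod (c (n + M)))\<^sup>2)"
      using sum.shift_bounds_nat_ivl[of "\<lambda>n. (cmod (c n))\<^sup>2" 0 M "N - M"] that by simp
    also have "\<dots> \<le> tail M" unfolding tail_def
      by (intro sum_le_suminf summable_ignore_initial_segment[OF c]) auto
    finally show ?thesis .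
  qed
  have "\<exists>M. \<forall>n\<ge>M. tail n \<le> (1 / 4) ^ j" for j
  proof -
    have "\<forall>\<^sub>F n in sequentially. tail n < (1 / 4) ^ j" using tail0 by (rule order_tendstoD) simp
    then show ?thesis by (auto simp: eventually_sequentially intro: less_imp_le)
  qed
  then obtain f where f: "\<And>j n. n \<ge> f j \<Longrightarrow> tail n \<le> (1 / 4) ^ j" by metis
  \<comment> \<open>Increasing, at least f j and at least j: a subsequence whose tails are
    geometrically small.\<close>
  define r where "r j = (\<Sum>i\<le>j. f i + 1)" for j
  have r_ge: "r j \<ge> f j" for j unfolding r_def by (rule order_trans[OF _ member_le_sum[of j]]) auto
  have r_mono: "r j \<le> r (Suc j)" for j unfolding r_def by simp
  define g where "g j x = s (r (Suc j)) x - s (r j) x" for j x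
  have s_L2: "s N \<in> L2" for N unfolding s_def by (rule partial_L2)
  have g_L2: "g j \<in> L2" for j unfolding g_def[abs_def] by (intro L2_diff s_L2)
  have g_sq: "L2sq (g j) \<le> (1 / 4) ^ j" for j
    unfolding g_def[abs_def] s_sq[OF r_mono] using tail[OF r_mono] f[OF r_ge] order_trans by blast
  have [measurable]: "s N \<in> borel_measurable borel" "g j \<in> borel_measurable borel" for N j
    using s_L2 g_L2 by (auto dest: L2_measurable)
  have "(\<integral>\<^sup>+x. (\<Sum>j. ennreal (2 ^ j * (cmod (g j x))\<^sup>2)) \<partial>lborel) = (\<Sum>j. \<integral>\<^sup>+x. ennreal (2 ^ j * (cmod (g j x))\<^sup>2) \<partial>lborel)"
    by (rule nn_integral_suminf) measurable
  also have "\<dots> \<le> (\<Sum>j. ennreal ((1 / 2) ^ j))"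
  proof (intro suminf_le allI)
    fix j
    have "(\<integral>\<^sup>+x. ennreal (2 ^ j * (cmod (g j x))\<^sup>2) \<partial>lborel) = ennreal (2 ^ j * L2sq (g j))"
      unfolding L2sq_def using L2_integrable[OF g_L2[of j]] by (subst nn_integral_eq_integral) auto
    also have "\<dots> \<le> ennreal (2 ^ j * (1 / 4) ^ j)" by (intro ennreal_leI mult_left_mono g_sq) auto
    also have "(2::real) ^ j * (1 / 4) ^ j = (1 / 2) ^ j" by (simp flip: power_mult_distrib)
    finally show "(\<integral>\<^sup>+x. ennreal (2 ^ j * (cmod (g j x))\<^sup>2) \<partial>lborel) \<le> ennreal ((1 / 2) ^ j)" .
  qed auto
  also have "\<dots> = ennreal (\<Sum>j. (1 / 2) ^ j)" by (intro suminf_ennreal2 summable_geometric) auto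
  also have "\<dots> < \<infinity>" by simp
  finally have "AE x in lborel. (\<Sum>j. ennreal (2 ^ j * (cmod (g j x))\<^sup>2)) \<noteq> \<infinity>"
    by (intro nn_integral_PInf_AE) auto
  then have conv: "AE x in lborel. convergent (\<lambda>j. s (r j) x)"
  proof eventually_elim
    case (elim x)
    then have "summable (\<lambda>j. 2 ^ j * (cmod (g j x))\<^sup>2)"
      by (intro summable_suminf_not_top) auto
    moreover have "summable (\<lambda>j. (1 / 2 :: real) ^ j)" by (intro summable_geometric) auto
    ultimately have "summable (\<lambda>j. 2 ^ j * (cmod (g j x))\<^sup>2 + (1 / 2) ^ j)" by (rule summable_add)
    then have "summable (\<lambda>j. g j x)"
    \<comment> \<open>From 2 |g_j| <= 2^j |g_j|^2 + 2^(-j). The weights 2^j, affordable because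
      \<open>L2sq (g j)\<close> is at most 4^(-j), turn square summability into absolute
      summability.\<close>
    proof (rule summable_comparison_test'[where N=0])
      fix j
      have "2 * cmod (g j x) * (sqrt (2 ^ j) * sqrt ((1 / 2) ^ j)) \<le> (cmod (g j x) * sqrt (2 ^ j))\<^sup>2 + (sqrt ((1 / 2) ^ j))\<^sup>2"
        using sum_squares_bound[of "cmod (g j x) * sqrt (2 ^ j)" "sqrt ((1 / 2) ^ j)"] by (simp only: mult.assoc)
      moreover have "sqrt (2 ^ j) * sqrt ((1 / 2) ^ j) = 1" by (simp flip: real_sqrt_mult power_mult_distrib)
      ultimately have "2 * cmod (g j x) \<le> 2 ^ j * (cmod (g j x))\<^sup>2 + (1 / 2) ^ j"
        by (simp add: power_mult_distrib mult.commute)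
      then show "norm (g j x) \<le> 2 ^ j * (cmod (g j x))\<^sup>2 + (1 / 2) ^ j" using norm_ge_zero[of "g j x"] by linarith
    qed
    then have "convergent (\<lambda>J. \<Sum>j<J. g j x)" by (simp add: summable_iff_convergent)
    moreover have "(\<Sum>j<J. g j x) = s (r J) x - s (r 0) x" for J
      unfolding g_def by (rule sum_lessThan_telescope)
    ultimately have "convergent (\<lambda>J. (s (r J) x - s (r 0) x) + s (r 0) x)"
      by (intro convergent_add convergent_const) simp
    then show ?case by simp
  qed
  define w where "w x = lim (\<lambda>j. s (r j) x)" for x
  have w_lim: "AE x in lborel. (\<lambda>j. s (r j) x) \<longlonglongrightarrow> w x"
    using conv by eventually_elim (simp add: w_def convergent_LIMSEQ_iff)
  have [measurable]: "w \<in> borel_measurable borel" unfolding w_def[abs_def] by measurable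
  have fatou: "(\<integral>\<^sup>+x. ennreal ((cmod (w x - s N x))\<^sup>2) \<partial>lborel) \<le> ennreal (tail N)" for N
  proof -
    have "(\<integral>\<^sup>+x. ennreal ((cmod (w x - s N x))\<^sup>2) \<partial>lborel) = (\<integral>\<^sup>+x. liminf (\<lambda>j. ennreal ((cmod (s (r j) x - s N x))\<^sup>2)) \<partial>lborel)"
    proof (rule nn_integral_cong_AE)
      show "AE x in lborel. ennreal ((cmod (w x - s N x))\<^sup>2) = liminf (\<lambda>j. ennreal ((cmod (s (r j) x - s N x))\<^sup>2))"
        using w_lim
      proof eventually_elim
        case (elim x)
        have "(\<lambda>j. ennreal ((cmod (s (r j) x - s N x))\<^sup>2)) \<longlonglongrightarrow> ennreal ((cmod (w x - s N x))\<^sup>2)"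
          by (intro tendsto_ennrealI tendsto_intros elim)
        then show ?case by (intro lim_imp_Liminf[symmetric]) auto
      qed
    qed
    also have "\<dots> \<le> liminf (\<lambda>j. \<integral>\<^sup>+x. ennreal ((cmod (s (r j) x - s N x))\<^sup>2) \<partial>lborel)"
      by (rule nn_integral_liminf) measurable
    also have "\<dots> \<le> ennreal (tail N)"
    proof -
      have "(\<integral>\<^sup>+x. ennreal ((cmod (s (r j) x - s N x))\<^sup>2) \<partial>lborel) \<le> ennreal (tail N)" if "j \<ge> N" for j
      proof -
        have "j \<le> r j" unfolding r_def by (induction j) auto
        then have "(\<integral>\<^sup>+x. ennreal ((cmod (s (r j) x - s N x))\<^sup>2) \<partial>lborel) = ennreal (\<Sum>n\<in>{N..<r j}. (cmod (c n))\<^sup>2)"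
          using that s_sq[of N "r j"] L2_integrable[OF L2_diff[OF s_L2 s_L2], of "r j" N] unfolding L2sq_def
          by (subst nn_integral_eq_integral) auto
        also have "\<dots> \<le> ennreal (tail N)" using \<open>j \<le> r j\<close> that by (intro ennreal_leI tail) auto
        finally show ?thesis .
      qed
      then have "\<forall>\<^sub>F j in sequentially. (\<integral>\<^sup>+x. ennreal ((cmod (s (r j) x - s N x))\<^sup>2) \<partial>lborel) \<le> ennreal (tail N)"
        by (auto simp: eventually_sequentially)
      then have "liminf (\<lambda>j. \<integral>\<^sup>+x. ennreal ((cmod (s (r j) x - s N x))\<^sup>2) \<partial>lborel) \<le> liminf (\<lambda>j. ennreal (tail N))"
        by (rule Liminf_mono)
      then show ?thesis by (simp add: Liminf_const)
    qed
    finally show ?thesis .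
  qed
  have tail_nn: "tail N \<ge> 0" for N unfolding tail_def by (intro suminf_nonneg summable_ignore_initial_segment[OF c]) auto
  have ws_L2: "(\<lambda>x. w x - s N x) \<in> L2" for N
    unfolding L2_iff integrable_iff_bounded
    using le_less_trans[OF fatou[of N]] by (auto intro!: borel_measurable_diff)
  have "w \<in> L2" using ws_L2[of 0] by (simp add: s_def partial_def)
  have ws_sq: "L2sq (\<lambda>x. w x - s N x) \<le> tail N" for N
  proof -
    have "ennreal (L2sq (\<lambda>x. w x - s N x)) \<le> ennreal (tail N)"
      using fatou[of N] L2_integrable[OF ws_L2[of N]] unfolding L2sq_def
      by (subst (asm) nn_integral_eq_integral) auto
    then show ?thesis using tail_nn by (simp add: ennreal_le_iff)
  qed
  have lim0: "(\<lambda>N. L2sq (\<lambda>x. w x - s N x)) \<longlonglongrightarrow> 0"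
    by (rule tendsto_sandwich[OF _ _ tendsto_const tail0]) (auto intro!: always_eventually ws_sq)
  have coef: "L2_inner w (e n) = c n" for n
  proof -
    have "(cmod (L2_inner w (e n) - c n))\<^sup>2 \<le> L2sq (\<lambda>x. w x - s N x)" if "N > n" for N
    proof -
      have "L2_inner (\<lambda>x. w x - s N x) (e n) = L2_inner w (e n) - c n"
        using L2_inner_lin_left[OF \<open>w \<in> L2\<close> s_L2[of N] e_L2[of n], of 1 "-1"] that
        by (simp add: s_def inner_partial)
      moreover have "L2sq (e n) = 1"
        using L2_inner_self[OF e_L2[of n]] orthonormal[of n n] by simp
      ultimately show ?thesis using L2_Cauchy_Schwarz[OF ws_L2[of N] e_L2[of n]] by simp
    qed
    then have "(cmod (L2_inner w (e n) - c n))\<^sup>2 \<le> 0"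
      by (intro tendsto_lowerbound[OF lim0]) (auto simp: eventually_sequentially intro!: exI[of _ "Suc n"])
    then show ?thesis by simp
  qed
  have "(\<lambda>N. L2sq w - (\<Sum>n<N. (cmod (c n))\<^sup>2)) \<longlonglongrightarrow> 0"
    using lim0 L2sq_minus_partial[OF \<open>w \<in> L2\<close>] unfolding coef s_def by simp
  then have "(\<lambda>N. L2sq w - (L2sq w - (\<Sum>n<N. (cmod (c n))\<^sup>2))) \<longlonglongrightarrow> L2sq w - 0"
    by (intro tendsto_intros)
  then have "(\<lambda>n. (cmod (c n))\<^sup>2) sums L2sq w" by (simp add: sums_def)
  then show ?thesis using \<open>w \<in> L2\<close> coef by blast
qed

lemma AE_eqI:
  assumes "u \<in> L2" "v \<in> L2" "\<And>n. L2_inner u (e n) = L2_inner v (e n)"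
  shows "AE x in lborel. u x = v x"
proof -
  have "AE x in lborel. u x - v x = 0"
    using L2_inner_lin_left[OF assms(1,2) e_L2, of 1 "-1"] assms(3) by (intro total L2_diff assms) simp
  then show ?thesis by simp
qed

text \<open>Riesz-Fischer produces a function with the coefficients of u for which the identity
  holds; totality identifies it with u.\<close>

lemma Parseval:
  assumes "u \<in> L2" shows "(\<lambda>n. (cmod (L2_inner u (e n)))\<^sup>2) sums L2sq u"
proof -
  obtain w where w: "w \<in> L2" "\<And>n. L2_inner w (e n) = L2_inner u (e n)" "(\<lambda>n. (cmod (L2_inner u (e n)))\<^sup>2) sums L2sq w"
    using Riesz_Fischer[OF Bessel[OF assms]] by auto
  have "AE x in lborel. w x = u x" using w assms by (intro AE_eqI) auto
  then have "L2sq w = L2sq u" using w assms by (intro L2sq_cong_AE) (auto dest: L2_measurable)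
  then show ?thesis using w(3) by simp
qed

lemma Parseval_inner:
  assumes "u \<in> L2" "v \<in> L2" shows "(\<lambda>n. L2_inner u (e n) * cnj (L2_inner v (e n))) sums L2_inner u v"
proof -
  have S: "(\<lambda>N. L2sq (\<lambda>x. u x - partial (\<lambda>n. L2_inner u (e n)) N x)) \<longlonglongrightarrow> 0"
    unfolding L2sq_minus_partial[OF assms(1)]
    using tendsto_diff[OF tendsto_const Parseval[OF assms(1), unfolded sums_def], of "L2sq u"] by simp
  let ?d = "\<lambda>N. L2_inner (\<lambda>x. u x - partial (\<lambda>n. L2_inner u (e n)) N x) v"
  have "(\<lambda>N. (cmod (?d N))\<^sup>2) \<longlonglongrightarrow> 0"
  proof (rule tendsto_sandwich[OF _ _ tendsto_const])
    show "(\<lambda>N. L2sq (\<lambda>x. u x - partial (\<lambda>n. L2_inner u (e n)) N x) * L2sq v) \<longlonglongrightarrow> 0"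
      using tendsto_mult_right[OF S, of "L2sq v"] by simp
  qed (auto intro!: always_eventually L2_Cauchy_Schwarz L2_diff partial_L2 assms)
  then have "(\<lambda>N. sqrt ((cmod (?d N))\<^sup>2)) \<longlonglongrightarrow> sqrt 0" by (rule tendsto_real_sqrt)
  then have "?d \<longlonglongrightarrow> 0" by (simp add: tendsto_norm_zero_iff)
  moreover have "?d N = L2_inner u v - (\<Sum>n<N. L2_inner u (e n) * cnj (L2_inner v (e n)))" for N
  proof -
    have "L2_inner (partial (\<lambda>n. L2_inner u (e n)) N) v = (\<Sum>n<N. L2_inner u (e n) * cnj (L2_inner v (e n)))"
      unfolding L2_inner_cnj[of _ v] partial_def[abs_def] by (subst inner_comb_right[OF assms(2)]) auto
    then show ?thesis using L2_inner_lin_left[OF assms(1) partial_L2 assms(2), of 1 "-1"] by simp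
  qed
  ultimately have "(\<lambda>N. L2_inner u v - (L2_inner u v - (\<Sum>n<N. L2_inner u (e n) * cnj (L2_inner v (e n))))) \<longlonglongrightarrow> L2_inner u v - 0"
    by (intro tendsto_intros) simp
  then show ?thesis by (simp add: sums_def)
qed

end

section \<open>Functional calculi\<close>

lemma L2norm_tendsto_0_iff:
  assumes "\<And>n. z n \<in> L2"
  shows "(\<lambda>n. L2norm (z n)) \<longlonglongrightarrow> 0 \<longleftrightarrow> (\<lambda>n. L2sq (z n)) \<longlonglongrightarrow> 0"
proof -
  have "(\<lambda>n. L2norm (z n)) \<longlonglongrightarrow> 0 \<longleftrightarrow> (\<lambda>n. ennreal (sqrt (L2sq (z n)))) \<longlonglongrightarrow> ennreal 0"
    using assms by (simp add: L2norm_eq)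
  also have "\<dots> \<longleftrightarrow> (\<lambda>n. sqrt (L2sq (z n))) \<longlonglongrightarrow> 0"
    by (intro tendsto_ennreal_iff) auto
  also have "\<dots> \<longleftrightarrow> (\<lambda>n. L2sq (z n)) \<longlonglongrightarrow> 0"
  proof
    assume "(\<lambda>n. sqrt (L2sq (z n))) \<longlonglongrightarrow> 0"
    from tendsto_power[OF this, of 2] show "(\<lambda>n. L2sq (z n)) \<longlonglongrightarrow> 0" by simp
  next
    assume "(\<lambda>n. L2sq (z n)) \<longlonglongrightarrow> 0"
    from tendsto_real_sqrt[OF this] show "(\<lambda>n. sqrt (L2sq (z n))) \<longlonglongrightarrow> 0" by simp
  qed
  finally show ?thesis .
qed

lemma L2norm_0_iff: "u \<in> L2 \<Longrightarrow> L2norm u = 0 \<longleftrightarrow> (AE x in lborel. u x = 0)"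
  using L2sq_eq_0_iff[of u] by (simp add: L2norm_eq)

lemma L2norm_cong_AE: "AE x in lborel. u x = v x \<Longrightarrow> L2norm u = L2norm v"
  unfolding L2norm_def L2_norm_of_def
  by (subst nn_integral_cong_AE[of "\<lambda>x. (ennreal (norm (u x)))\<^sup>2" "\<lambda>x. (ennreal (norm (v x)))\<^sup>2"]) (auto elim!: eventually_mono)

lemma L2sq_triangle:
  assumes "u \<in> L2" "v \<in> L2"
  shows "L2sq u \<le> 2 * L2sq v + 2 * L2sq (\<lambda>x. u x - v x)"
proof -
  have "L2sq u \<le> (\<integral>x. 2 * (cmod (v x))\<^sup>2 + 2 * (cmod (u x - v x))\<^sup>2 \<partial>lborel)"
    unfolding L2sq_def
  proof (intro integral_mono)
    show "(cmod (u x))\<^sup>2 \<le> 2 * (cmod (v x))\<^sup>2 + 2 * (cmod (u x - v x))\<^sup>2" for x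
      using norm_add_sq_le[of "v x" "u x - v x"] by simp
  qed (use assms in \<open>auto intro!: L2_integrable L2_diff\<close>)
  also have "\<dots> = 2 * L2sq v + 2 * L2sq (\<lambda>x. u x - v x)"
    unfolding L2sq_def using L2_integrable[OF assms(2)] L2_integrable[OF L2_diff[OF assms]] by simp
  finally show ?thesis .
qed

context
  fixes A :: "(('a::euclidean_space \<Rightarrow> complex) \<times> ('a \<Rightarrow> complex)) set" and \<Phi>
  assumes \<Phi>: "borel_functional_calculus A \<Phi>"
begin

lemmas fc1 = \<Phi>[unfolded borel_functional_calculus_def]
lemmas fc2 = fc1[THEN conjunct2]
lemmas fc3 = fc2[THEN conjunct2]
lemmas fc4 = fc3[THEN conjunct2]
lemmas fc5 = fc4[THEN conjunct2]
lemmas fc6 = fc5[THEN conjunct2]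
lemmas fc7 = fc6[THEN conjunct2]
lemmas fc8 = fc7[THEN conjunct2]
lemmas fc9 = fc8[THEN conjunct2]

lemma fc_L2: "bounded_borel f \<Longrightarrow> u \<in> L2 \<Longrightarrow> \<Phi> f u \<in> L2"
  by (rule fc1[THEN conjunct1, rule_format])

lemma fc_bound: "bounded_borel f \<Longrightarrow> u \<in> L2 \<Longrightarrow> (\<And>s. cmod (f s) \<le> K) \<Longrightarrow> L2norm (\<Phi> f u) \<le> ennreal K * L2norm u"
  by (rule fc2[THEN conjunct1, rule_format])

lemma fc_lin: "bounded_borel f \<Longrightarrow> bounded_borel g \<Longrightarrow> u \<in> L2 \<Longrightarrow>
    AE x in lborel. \<Phi> (\<lambda>s. a * f s + b * g s) u x = a * \<Phi> f u x + b * \<Phi> g u x"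
  by (rule fc4[THEN conjunct1, rule_format])

lemma fc_mult: "bounded_borel f \<Longrightarrow> bounded_borel g \<Longrightarrow> u \<in> L2 \<Longrightarrow>
    AE x in lborel. \<Phi> (\<lambda>s. f s * g s) u x = \<Phi> f (\<Phi> g u) x"
  by (rule fc5[THEN conjunct1, rule_format])

lemma fc_one: "u \<in> L2 \<Longrightarrow> AE x in lborel. \<Phi> (\<lambda>s. 1) u x = u x"
  by (rule fc6[THEN conjunct1, rule_format])

lemma fc_adj: "bounded_borel f \<Longrightarrow> u \<in> L2 \<Longrightarrow> v \<in> L2 \<Longrightarrow> L2_inner (\<Phi> f u) v = L2_inner u (\<Phi> (\<lambda>s. cnj (f s)) v)"
  by (rule fc7[THEN conjunct1, rule_format])

lemma fc_id: "(\<And>n::nat. bounded_borel (h n)) \<Longrightarrow> (\<And>s. (\<lambda>n. h n s) \<longlonglongrightarrow> complex_of_real s) \<Longrightarrow>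
    (\<And>n s. cmod (h n s) \<le> \<bar>s\<bar>) \<Longrightarrow> (u, w) \<in> A \<Longrightarrow> (\<lambda>n. L2norm (\<lambda>x. \<Phi> (h n) u x - w x)) \<longlonglongrightarrow> 0"
  by (rule fc8[THEN conjunct1, rule_format])

lemma fc_lim: "(\<And>n::nat. bounded_borel (h n)) \<Longrightarrow> bounded_borel f \<Longrightarrow> (\<And>n s. cmod (h n s) \<le> K) \<Longrightarrow>
    (\<And>s. (\<lambda>n. h n s) \<longlonglongrightarrow> f s) \<Longrightarrow> u \<in> L2 \<Longrightarrow> (\<lambda>n. L2norm (\<lambda>x. \<Phi> (h n) u x - \<Phi> f u x)) \<longlonglongrightarrow> 0"
  by (rule fc9[rule_format])

text \<open>The calculus acts on representatives, and no axiom states directly that it respects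
  equality almost everywhere; for null functions the norm bound gives it.\<close>

lemma fc_zero:
  assumes "bounded_borel f" "u \<in> L2" "AE x in lborel. u x = 0"
  shows "AE x in lborel. \<Phi> f u x = 0"
proof -
  obtain K where K: "\<And>s. cmod (f s) \<le> K" using assms(1) by (auto simp: bounded_borel_def bounded_iff)
  have "L2norm (\<Phi> f u) \<le> ennreal K * L2norm u" by (rule fc_bound[OF assms(1,2) K])
  also have "\<dots> = 0" using assms by (simp add: L2norm_0_iff)
  finally show ?thesis using L2norm_0_iff[OF fc_L2[OF assms(1,2)]] by simp
qed

text \<open>Applying the calculus to \<open>(h\<^sub>n(s) - \<mu>) / (s - \<mu>)\<close>, cut off to \<open>|s - \<mu>| > \<epsilon>\<close>, shows that \<open>u\<close> has no spectral mass
  away from \<open>\<mu>\<close>.\<close>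

lemma fc_eigenfunction:
  assumes u: "u \<in> L2" and eig: "(u, \<lambda>x. of_real \<mu> * u x) \<in> A" and f: "bounded_borel f"
  shows "AE x in lborel. \<Phi> f u x = f \<mu> * u x"
proof -
  have bbI: "bounded_borel g" if "g \<in> borel_measurable borel" "\<And>s. cmod (g s) \<le> K" for g K
    using that unfolding bounded_borel_def bounded_iff by auto
  define h where "h n s = (if \<bar>s\<bar> \<le> real n then complex_of_real s else 0)" for n s
  have [measurable]: "h n \<in> borel_measurable borel" for n unfolding h_def[abs_def] by measurable
  have h_bound: "cmod (h n s) \<le> \<bar>s\<bar>" for n s by (simp add: h_def)
  have hb: "bounded_borel (h n)" for n by (rule bbI[of _ "real n"]) (auto simp: h_def)
  have h_lim: "(\<lambda>n. h n s) \<longlonglongrightarrow> complex_of_real s" for s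
  proof (rule tendsto_eventually)
    obtain N :: nat where "\<bar>s\<bar> \<le> real N" using real_arch_simple by blast
    then show "\<forall>\<^sub>F n in sequentially. h n s = complex_of_real s"
      by (auto simp: eventually_sequentially h_def intro!: exI[of _ N])
  qed
  have one: "bounded_borel (\<lambda>s. 1)" by (rule bbI[of _ 1]) auto
  define far where "far \<epsilon> s = (if \<bar>s - \<mu>\<bar> > \<epsilon> then 1 else 0 :: complex)" for \<epsilon> s
  have [measurable]: "far \<epsilon> \<in> borel_measurable borel" for \<epsilon> unfolding far_def[abs_def] by measurable
  have farb: "bounded_borel (far \<epsilon>)" for \<epsilon> by (rule bbI[of _ 1]) (auto simp: far_def)
  have far0: "AE x in lborel. \<Phi> (far \<epsilon>) u x = 0" if \<epsilon>: "\<epsilon> > 0" for \<epsilon>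
  proof -
    define g where "g s = (if \<bar>s - \<mu>\<bar> > \<epsilon> then complex_of_real (1 / (s - \<mu>)) else 0)" for s
    have [measurable]: "g \<in> borel_measurable borel" unfolding g_def[abs_def] by measurable
    have g_bound: "cmod (g s) \<le> 1 / \<epsilon>" for s
    proof (cases "\<bar>s - \<mu>\<bar> > \<epsilon>")
      case True
      then have "1 / \<bar>s - \<mu>\<bar> \<le> 1 / \<epsilon>" using \<epsilon> by (intro divide_left_mono) auto
      then show ?thesis using True by (simp add: g_def norm_divide flip: of_real_diff)
    qed (use \<epsilon> in \<open>auto simp: g_def\<close>)
    have gb: "bounded_borel g" by (rule bbI[OF _ g_bound]) measurable
    define k where "k n s = 1 * h n s + (- of_real \<mu>) * 1" for n s
    have [measurable]: "k n \<in> borel_measurable borel" for n unfolding k_def[abs_def] by measurable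
    have k_bound: "cmod (k n s) \<le> \<bar>s\<bar> + \<bar>\<mu>\<bar>" for n s
      unfolding k_def using norm_triangle_ineq4[of "h n s" "of_real \<mu>"] h_bound[of n s] by simp
    have kb: "bounded_borel (k n)" for n
    proof (rule bbI[of _ "real n + \<bar>\<mu>\<bar>"])
      fix s
      have "cmod (h n s) \<le> real n" by (simp add: h_def)
      then show "cmod (k n s) \<le> real n + \<bar>\<mu>\<bar>"
        unfolding k_def using norm_triangle_ineq4[of "h n s" "of_real \<mu>"] by simp
    qed measurable
    have gk_bound: "cmod (g s * k n s) \<le> 1 + 2 * \<bar>\<mu>\<bar> / \<epsilon>" for n s
    proof (cases "\<bar>s - \<mu>\<bar> > \<epsilon>")
      case True
      have "cmod (g s * k n s) \<le> (1 / \<bar>s - \<mu>\<bar>) * (\<bar>s\<bar> + \<bar>\<mu>\<bar>)"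
        unfolding norm_mult using True k_bound[of n s] by (intro mult_mono) (auto simp: g_def norm_divide simp flip: of_real_diff)
      also have "\<dots> \<le> (1 / \<bar>s - \<mu>\<bar>) * (\<bar>s - \<mu>\<bar> + 2 * \<bar>\<mu>\<bar>)" by (intro mult_left_mono) auto
      also have "\<dots> = 1 + 2 * \<bar>\<mu>\<bar> / \<bar>s - \<mu>\<bar>" using True \<epsilon> by (simp add: field_simps)
      also have "\<dots> \<le> 1 + 2 * \<bar>\<mu>\<bar> / \<epsilon>" using True \<epsilon> by (intro add_left_mono divide_left_mono) auto
      finally show ?thesis .
    qed (use \<epsilon> in \<open>auto simp: g_def\<close>)
    have gkb: "bounded_borel (\<lambda>s. g s * k n s)" for n by (rule bbI[OF _ gk_bound]) measurable
    have gk_lim: "(\<lambda>n. g s * k n s) \<longlonglongrightarrow> far \<epsilon> s" for s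
    proof -
      have "(\<lambda>n. g s * k n s) \<longlonglongrightarrow> g s * (1 * of_real s + (- of_real \<mu>) * 1)"
        unfolding k_def by (intro tendsto_intros h_lim)
      also have "g s * (1 * of_real s + (- of_real \<mu>) * 1) = far \<epsilon> s"
        using \<epsilon> by (auto simp: g_def far_def field_simps simp flip: of_real_diff)
      finally show ?thesis .
    qed
    \<comment> \<open>The functions \<open>g s * k n s\<close> tend boundedly to
      \<open>far \<epsilon>\<close>, while \<open>\<Phi> (k n) u\<close> tends to the image of u
      under A minus \<mu>, which is zero. Comparing the two limits kills
      \<open>\<Phi> (far \<epsilon>) u\<close>.\<close>
    have lim1: "(\<lambda>n. L2norm (\<lambda>x. \<Phi> (\<lambda>s. g s * k n s) u x - \<Phi> (far \<epsilon>) u x)) \<longlonglongrightarrow> 0"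
      by (rule fc_lim[OF gkb farb gk_bound gk_lim u])
    have lim2: "(\<lambda>n. L2norm (\<Phi> (\<lambda>s. g s * k n s) u)) \<longlonglongrightarrow> 0"
    proof (rule tendsto_sandwich[OF _ _ tendsto_const])
      have E: "L2norm (\<Phi> (k n) u) = L2norm (\<lambda>x. \<Phi> (h n) u x - of_real \<mu> * u x)" for n
      proof (rule L2norm_cong_AE)
        show "AE x in lborel. \<Phi> (k n) u x = \<Phi> (h n) u x - of_real \<mu> * u x"
          using fc_lin[OF hb[of n] one u, of 1 "- of_real \<mu>"] fc_one[OF u]
          unfolding k_def[abs_def] by eventually_elim simp
      qed
      have "(\<lambda>n. ennreal (1 / \<epsilon>) * L2norm (\<lambda>x. \<Phi> (h n) u x - of_real \<mu> * u x)) \<longlonglongrightarrow> ennreal (1 / \<epsilon>) * 0"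
        by (intro ennreal_tendsto_cmult fc_id[OF hb h_lim h_bound eig]) auto
      then show "(\<lambda>n. ennreal (1 / \<epsilon>) * L2norm (\<lambda>x. \<Phi> (h n) u x - of_real \<mu> * u x)) \<longlonglongrightarrow> 0" by simp
      show "\<forall>\<^sub>F n in sequentially. L2norm (\<Phi> (\<lambda>s. g s * k n s) u) \<le> ennreal (1 / \<epsilon>) * L2norm (\<lambda>x. \<Phi> (h n) u x - of_real \<mu> * u x)"
      proof (intro always_eventually allI)
        fix n
        have "L2norm (\<Phi> (\<lambda>s. g s * k n s) u) = L2norm (\<Phi> g (\<Phi> (k n) u))"
          by (rule L2norm_cong_AE[OF fc_mult[OF gb kb u]])
        also have "\<dots> \<le> ennreal (1 / \<epsilon>) * L2norm (\<Phi> (k n) u)"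
          by (rule fc_bound[OF gb fc_L2[OF kb u] g_bound])
        finally show "L2norm (\<Phi> (\<lambda>s. g s * k n s) u) \<le> ennreal (1 / \<epsilon>) * L2norm (\<lambda>x. \<Phi> (h n) u x - of_real \<mu> * u x)"
          unfolding E .
      qed
    qed simp
    have *: "\<Phi> (\<lambda>s. g s * k n s) u \<in> L2" "\<Phi> (far \<epsilon>) u \<in> L2" for n by (intro fc_L2 gkb farb u)+
    have l1: "(\<lambda>n. L2sq (\<lambda>x. \<Phi> (far \<epsilon>) u x - \<Phi> (\<lambda>s. g s * k n s) u x)) \<longlonglongrightarrow> 0"
      using lim1 * by (subst (asm) L2norm_tendsto_0_iff) (auto intro: L2_diff simp: L2sq_def norm_minus_commute)
    have l2: "(\<lambda>n. L2sq (\<Phi> (\<lambda>s. g s * k n s) u)) \<longlonglongrightarrow> 0"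
      using lim2 * by (subst (asm) L2norm_tendsto_0_iff) auto
    have "(\<lambda>n. 2 * L2sq (\<Phi> (\<lambda>s. g s * k n s) u) + 2 * L2sq (\<lambda>x. \<Phi> (far \<epsilon>) u x - \<Phi> (\<lambda>s. g s * k n s) u x)) \<longlonglongrightarrow> 2 * 0 + 2 * 0"
      by (intro tendsto_intros l1 l2)
    then have "L2sq (\<Phi> (far \<epsilon>) u) \<le> 2 * 0 + 2 * 0"
      by (rule tendsto_lowerbound) (auto intro!: always_eventually L2sq_triangle *)
    then have "L2sq (\<Phi> (far \<epsilon>) u) = 0" using L2sq_nonneg[of "\<Phi> (far \<epsilon>) u"] by linarith
    then show ?thesis using L2sq_eq_0_iff[OF *(2)] by simp
  qed
  \<comment> \<open>The threshold is sent to 0 by strong continuity, leaving only the point \<mu>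
    itself.\<close>
  have far_0: "AE x in lborel. \<Phi> (far 0) u x = 0"
  proof -
    have "(\<lambda>n. L2norm (\<lambda>x. \<Phi> (far (inverse (real (Suc n)))) u x - \<Phi> (far 0) u x)) \<longlonglongrightarrow> 0"
    proof (rule fc_lim[OF farb farb _ _ u, of _ 1])
      fix s
      show "(\<lambda>n. far (inverse (real (Suc n))) s) \<longlonglongrightarrow> far 0 s"
      proof (cases "s = \<mu>")
        case False
        then have "\<forall>\<^sub>F n in sequentially. inverse (real (Suc n)) < \<bar>s - \<mu>\<bar>"
          by (intro order_tendstoD[OF LIMSEQ_inverse_real_of_nat]) auto
        then have "\<forall>\<^sub>F n in sequentially. far (inverse (real (Suc n))) s = far 0 s"
          by eventually_elim (use False in \<open>auto simp: far_def\<close>)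
        then show ?thesis by (rule tendsto_eventually)
      qed (simp add: far_def)
    qed (auto simp: far_def)
    moreover have "L2norm (\<lambda>x. \<Phi> (far (inverse (real (Suc n)))) u x - \<Phi> (far 0) u x) = L2norm (\<Phi> (far 0) u)" for n
    proof -
      have "L2norm (\<lambda>x. \<Phi> (far (inverse (real (Suc n)))) u x - \<Phi> (far 0) u x) = L2norm (\<lambda>x. - \<Phi> (far 0) u x)"
        using far0[of "inverse (real (Suc n))"] by (intro L2norm_cong_AE) auto
      then show ?thesis by (simp add: L2norm_def)
    qed
    ultimately have "L2norm (\<Phi> (far 0) u) = 0" by (simp add: LIMSEQ_const_iff)
    then show ?thesis using L2norm_0_iff[OF fc_L2[OF farb u]] by simp
  qed
  obtain K where K: "\<And>s. cmod (f s) \<le> K" using f by (auto simp: bounded_borel_def bounded_iff)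
  have [measurable]: "f \<in> borel_measurable borel" using f by (simp add: bounded_borel_def)
  define p where "p s = f s - f \<mu>" for s
  have [measurable]: "p \<in> borel_measurable borel" unfolding p_def[abs_def] by measurable
  have pb: "bounded_borel p"
  proof (rule bbI[of _ "K + K"])
    show "cmod (p s) \<le> K + K" for s
      unfolding p_def using norm_triangle_ineq4[of "f s" "f \<mu>"] K[of s] K[of \<mu>] by linarith
  qed measurable
  have pfb: "bounded_borel (\<lambda>s. p s * far 0 s)"
  proof (rule bbI[of _ "K + K"])
    show "cmod (p s * far 0 s) \<le> K + K" for s
      unfolding p_def using norm_triangle_ineq4[of "f s" "f \<mu>"] K[of s] K[of \<mu>] order_trans[OF norm_ge_zero K[of s]]
      by (auto simp: far_def norm_mult)
  qed measurable
  \<comment> \<open>Away from \<mu> the calculus annihilates u, so only the value of f at \<mu>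
    counts.\<close>
  have split: "f = (\<lambda>s. f \<mu> * 1 + 1 * (p s * far 0 s))"
    by (auto simp: p_def far_def fun_eq_iff)
  have "AE x in lborel. \<Phi> (\<lambda>s. p s * far 0 s) u x = 0"
    using fc_mult[OF pb farb u, of 0] fc_zero[OF pb fc_L2[OF farb u] far_0] by eventually_elim simp
  moreover have "AE x in lborel. \<Phi> (\<lambda>s. f \<mu> * 1 + 1 * (p s * far 0 s)) u x = f \<mu> * \<Phi> (\<lambda>s. 1) u x + 1 * \<Phi> (\<lambda>s. p s * far 0 s) u x"
    by (rule fc_lin[OF one pfb u])
  ultimately have "AE x in lborel. \<Phi> (\<lambda>s. f \<mu> * 1 + 1 * (p s * far 0 s)) u x = f \<mu> * u x"
    using fc_one[OF u] by eventually_elim simp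
  then show ?thesis using split by metis
qed

text \<open>Adjointness moves f onto the eigenfunction, where it is a number. On an eigenbasis this
  determines the calculus, whichever one a choice operator may pick.\<close>

lemma fc_coefficient:
  assumes e: "e \<in> L2" "(e, \<lambda>x. of_real \<mu> * e x) \<in> A" and f: "bounded_borel f" and u: "u \<in> L2"
  shows "L2_inner (\<Phi> f u) e = f \<mu> * L2_inner u e"
proof -
  have cf: "bounded_borel (\<lambda>s. cnj (f s))" using f by (auto simp: bounded_borel_def bounded_iff)
  have "L2_inner (\<Phi> f u) e = L2_inner u (\<Phi> (\<lambda>s. cnj (f s)) e)" by (rule fc_adj[OF f u e(1)])
  also have "\<dots> = cnj (L2_inner (\<Phi> (\<lambda>s. cnj (f s)) e) u)" by (rule L2_inner_cnj)
  also have "L2_inner (\<Phi> (\<lambda>s. cnj (f s)) e) u = L2_inner (\<lambda>x. cnj (f \<mu>) * e x) u"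
    by (intro L2_inner_cong_AE fc_eigenfunction e cf fc_L2 L2_cmult u)
  also have "\<dots> = cnj (f \<mu>) * L2_inner e u"
    using L2_inner_lin_left[OF e(1) e(1) u, of "cnj (f \<mu>)" 0] by simp
  finally show ?thesis by (simp add: L2_inner_cnj[of u e])
qed

end

context orthonormal_basis
begin

text \<open>Existence is needed because \<open>fun_of_H\<close> is defined by \<open>SOME\<close>.\<close>

lemma functional_calculus_exists:
  fixes \<mu> :: "nat \<Rightarrow> real"
  assumes A: "\<And>u w. (u, w) \<in> A \<Longrightarrow> u \<in> L2 \<and> w \<in> L2 \<and> (\<forall>n. L2_inner w (e n) = of_real (\<mu> n) * L2_inner u (e n))"
  shows "\<exists>\<Phi>. borel_functional_calculus A \<Phi>"
proof -
  \<comment> \<open>Diagonal operators: the n-th coefficient is multiplied by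
    \<open>f (\<mu> n)\<close>. Boundedness of f keeps the coefficients square summable, so
    Riesz-Fischer supplies the function.\<close>
  define \<Phi> where "\<Phi> f u = (SOME w. w \<in> L2 \<and> (\<forall>n. L2_inner w (e n) = f (\<mu> n) * L2_inner u (e n)))" for f u
  have \<Phi>: "\<Phi> f u \<in> L2" "L2_inner (\<Phi> f u) (e n) = f (\<mu> n) * L2_inner u (e n)" if f: "bounded_borel f" and u: "u \<in> L2" for f u n
  proof -
    obtain K where K: "\<And>s. cmod (f s) \<le> K" using f by (auto simp: bounded_borel_def bounded_iff)
    have "summable (\<lambda>n. K\<^sup>2 * (cmod (L2_inner u (e n)))\<^sup>2)" by (intro summable_mult Bessel u)
    then have "summable (\<lambda>n. (cmod (f (\<mu> n) * L2_inner u (e n)))\<^sup>2)"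
      by (rule summable_comparison_test'[where N=0]) (auto simp: norm_mult power_mult_distrib intro!: mult_right_mono power_mono K)
    then have "\<exists>w. w \<in> L2 \<and> (\<forall>n. L2_inner w (e n) = f (\<mu> n) * L2_inner u (e n))"
      using Riesz_Fischer[of "\<lambda>n. f (\<mu> n) * L2_inner u (e n)"] by blast
    from someI_ex[OF this] show "\<Phi> f u \<in> L2" "L2_inner (\<Phi> f u) (e n) = f (\<mu> n) * L2_inner u (e n)"
      unfolding \<Phi>_def by auto
  qed
  have lin_coef: "L2_inner (\<lambda>y. a * u y + b * v y) (e n) = a * L2_inner u (e n) + b * L2_inner v (e n)" if "u \<in> L2" "v \<in> L2" for u v a b n
    by (rule L2_inner_lin_left[OF that e_L2])
  have bb_lin: "bounded_borel (\<lambda>s. a * f s + b * g s)" if fg: "bounded_borel f" "bounded_borel g" for f g a b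
  proof -
    obtain K where K: "\<And>s. cmod (f s) \<le> K" using fg by (auto simp: bounded_borel_def bounded_iff)
    obtain K' where K': "\<And>s. cmod (g s) \<le> K'" using fg by (auto simp: bounded_borel_def bounded_iff)
    have "cmod (a * f s + b * g s) \<le> cmod a * K + cmod b * K'" for s
      by (intro order_trans[OF norm_triangle_ineq] add_mono) (auto simp: norm_mult intro!: mult_left_mono K K')
    moreover have "(\<lambda>s. a * f s + b * g s) \<in> borel_measurable borel" using fg unfolding bounded_borel_def by (auto intro!: borel_measurable_add borel_measurable_times)
    ultimately show ?thesis unfolding bounded_borel_def bounded_iff by auto
  qed
  have bb_mult: "bounded_borel (\<lambda>s. f s * g s)" if fg: "bounded_borel f" "bounded_borel g" for f g
  proof -
    obtain K where K: "\<And>s. cmod (f s) \<le> K" using fg by (auto simp: bounded_borel_def bounded_iff)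
    obtain K' where K': "\<And>s. cmod (g s) \<le> K'" using fg by (auto simp: bounded_borel_def bounded_iff)
    have "cmod (f s * g s) \<le> K * K'" for s
      unfolding norm_mult by (intro mult_mono K K' norm_ge_zero order_trans[OF norm_ge_zero K])
    moreover have "(\<lambda>s. f s * g s) \<in> borel_measurable borel" using fg unfolding bounded_borel_def by (auto intro!: borel_measurable_add borel_measurable_times)
    ultimately show ?thesis unfolding bounded_borel_def bounded_iff by auto
  qed
  have bb_cnj: "bounded_borel (\<lambda>s. cnj (f s))" if "bounded_borel f" for f
    using that by (auto simp: bounded_borel_def bounded_iff)
  have bb_one: "bounded_borel (\<lambda>s. 1)" by (auto simp: bounded_borel_def bounded_iff)
  \<comment> \<open>Covers both limit axioms: by Parseval the squared norm is a series in the
    coefficients, and dominated convergence for series (Tannery) applies.\<close>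
  have lim: "(\<lambda>n. L2norm (\<lambda>x. \<Phi> (h n) u x - w x)) \<longlonglongrightarrow> 0"
    if h: "\<And>n::nat. bounded_borel (h n)" and u: "u \<in> L2" and w: "w \<in> L2"
      and lim: "\<And>k. (\<lambda>n. h n (\<mu> k) * L2_inner u (e k)) \<longlonglongrightarrow> L2_inner w (e k)"
      and dom: "\<And>k n. cmod (h n (\<mu> k) * L2_inner u (e k) - L2_inner w (e k)) \<le> B k" and B: "summable (\<lambda>k. (B k)\<^sup>2)" for h u w B
  proof -
    have z: "(\<lambda>x. \<Phi> (h n) u x - w x) \<in> L2" for n by (intro L2_diff \<Phi> h u w)
    have coef: "L2_inner (\<lambda>x. \<Phi> (h n) u x - w x) (e k) = h n (\<mu> k) * L2_inner u (e k) - L2_inner w (e k)" for n k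
      using L2_inner_lin_left[OF \<Phi>(1)[OF h u] w e_L2, of 1 n "-1" k] \<Phi>(2)[OF h u] by simp
    have sq: "L2sq (\<lambda>x. \<Phi> (h n) u x - w x) = (\<Sum>k. (cmod (h n (\<mu> k) * L2_inner u (e k) - L2_inner w (e k)))\<^sup>2)" for n
      using Parseval[OF z[of n]] unfolding coef by (rule sums_unique)
    have "((\<lambda>n. \<Sum>k. (cmod (h n (\<mu> k) * L2_inner u (e k) - L2_inner w (e k)))\<^sup>2) \<longlongrightarrow> (\<Sum>k. 0)) sequentially"
    proof (rule conjunct2[OF conjunct2[OF tannerys_theorem[where M="\<lambda>k. (B k)\<^sup>2"]]])
      show "(\<lambda>n. (cmod (h n (\<mu> k) * L2_inner u (e k) - L2_inner w (e k)))\<^sup>2) \<longlonglongrightarrow> 0" for k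
        using tendsto_power[OF tendsto_norm[OF tendsto_diff[OF lim tendsto_const]], of k "L2_inner w (e k)" 2] by simp
      show "\<forall>\<^sub>F (k, n) in at_top \<times>\<^sub>F sequentially. norm ((cmod (h n (\<mu> k) * L2_inner u (e k) - L2_inner w (e k)))\<^sup>2) \<le> (B k)\<^sup>2"
        by (intro always_eventually) (auto intro!: power_mono dom)
    qed (use B in auto)
    then show ?thesis by (subst L2norm_tendsto_0_iff[OF z]) (simp add: sq)
  qed
  have "borel_functional_calculus A \<Phi>"
    unfolding borel_functional_calculus_def
  proof (intro conjI allI impI)
    fix f K and u :: "'a \<Rightarrow> complex" assume f: "bounded_borel f" and u: "u \<in> L2" and K: "\<forall>s. cmod (f s) \<le> K"
    have "L2sq (\<Phi> f u) \<le> K\<^sup>2 * L2sq u"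
    proof (rule sums_le)
      show "(\<lambda>n. (cmod (L2_inner (\<Phi> f u) (e n)))\<^sup>2) sums L2sq (\<Phi> f u)" by (rule Parseval[OF \<Phi>(1)[OF f u]])
      show "(\<lambda>n. K\<^sup>2 * (cmod (L2_inner u (e n)))\<^sup>2) sums (K\<^sup>2 * L2sq u)" by (rule sums_mult[OF Parseval[OF u]])
      show "(cmod (L2_inner (\<Phi> f u) (e n)))\<^sup>2 \<le> K\<^sup>2 * (cmod (L2_inner u (e n)))\<^sup>2" for n
        unfolding \<Phi>(2)[OF f u] norm_mult power_mult_distrib using K by (intro mult_right_mono power_mono) auto
    qed
    moreover have "K \<ge> 0" using K norm_ge_zero order_trans by blast
    ultimately have "sqrt (L2sq (\<Phi> f u)) \<le> K * sqrt (L2sq u)"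
      by (intro real_le_lsqrt) (auto simp: power_mult_distrib)
    then show "L2norm (\<Phi> f u) \<le> ennreal K * L2norm u"
      unfolding L2norm_eq[OF u] L2norm_eq[OF \<Phi>(1)[OF f u]] using \<open>K \<ge> 0\<close> by (simp flip: ennreal_mult)
  next
    fix f a b and u v :: "'a \<Rightarrow> complex" assume "bounded_borel f" "u \<in> L2" "v \<in> L2"
    then show "AE x in lborel. \<Phi> f (\<lambda>y. a * u y + b * v y) x = a * \<Phi> f u x + b * \<Phi> f v x"
      by (intro AE_eqI) (auto simp: \<Phi> L2_lin lin_coef algebra_simps)
  next
    fix f g a b and u :: "'a \<Rightarrow> complex" assume "bounded_borel f" "bounded_borel g" "u \<in> L2"
    then show "AE x in lborel. \<Phi> (\<lambda>s. a * f s + b * g s) u x = a * \<Phi> f u x + b * \<Phi> g u x"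
      by (intro AE_eqI) (auto simp: \<Phi> L2_lin lin_coef bb_lin algebra_simps)
  next
    fix f g and u :: "'a \<Rightarrow> complex" assume "bounded_borel f" "bounded_borel g" "u \<in> L2"
    then show "AE x in lborel. \<Phi> (\<lambda>s. f s * g s) u x = \<Phi> f (\<Phi> g u) x"
      by (intro AE_eqI) (auto simp: \<Phi> bb_mult)
  next
    fix u :: "'a \<Rightarrow> complex" assume "u \<in> L2"
    then show "AE x in lborel. \<Phi> (\<lambda>s. 1) u x = u x"
      by (intro AE_eqI) (auto simp: \<Phi> bb_one)
  next
    fix f and u v :: "'a \<Rightarrow> complex" assume f: "bounded_borel f" and u: "u \<in> L2" and v: "v \<in> L2"
    have "(\<lambda>n. L2_inner (\<Phi> f u) (e n) * cnj (L2_inner v (e n))) sums L2_inner (\<Phi> f u) v"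
      by (intro Parseval_inner \<Phi> f u v)
    moreover have "(\<lambda>n. L2_inner u (e n) * cnj (L2_inner (\<Phi> (\<lambda>s. cnj (f s)) v) (e n))) sums L2_inner u (\<Phi> (\<lambda>s. cnj (f s)) v)"
      by (intro Parseval_inner \<Phi> bb_cnj f u v)
    ultimately show "L2_inner (\<Phi> f u) v = L2_inner u (\<Phi> (\<lambda>s. cnj (f s)) v)"
      unfolding \<Phi>(2)[OF f u] \<Phi>(2)[OF bb_cnj[OF f] v] by (simp add: mult_ac sums_iff)
  next
    fix h and u w :: "'a \<Rightarrow> complex" assume h: "\<forall>n. bounded_borel (h n)" and hl: "\<forall>s. (\<lambda>n. h n s) \<longlonglongrightarrow> complex_of_real s"
      and hb: "\<forall>n s. cmod (h n s) \<le> \<bar>s\<bar>" and uw: "(u, w) \<in> A"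
    have u: "u \<in> L2" and w: "w \<in> L2" and c: "\<And>n. L2_inner w (e n) = of_real (\<mu> n) * L2_inner u (e n)" using A[OF uw] by auto
    show "(\<lambda>n. L2norm (\<lambda>x. \<Phi> (h n) u x - w x)) \<longlonglongrightarrow> 0"
    \<comment> \<open>The h_n have no common bound, but |h_n(s)| <= |s| makes the coefficients of w,
      which are square summable, a majorant.\<close>
    proof (rule lim[OF _ u w, where B="\<lambda>k. 2 * cmod (L2_inner w (e k))"])
      show "(\<lambda>n. h n (\<mu> k) * L2_inner u (e k)) \<longlonglongrightarrow> L2_inner w (e k)" for k
        unfolding c using hl by (intro tendsto_mult tendsto_const) auto
      show "cmod (h n (\<mu> k) * L2_inner u (e k) - L2_inner w (e k)) \<le> 2 * cmod (L2_inner w (e k))" for k n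
      proof -
        have "cmod (h n (\<mu> k) * L2_inner u (e k)) \<le> cmod (L2_inner w (e k))"
          unfolding c norm_mult using hb by (intro mult_right_mono) auto
        then show ?thesis using norm_triangle_ineq4[of "h n (\<mu> k) * L2_inner u (e k)" "L2_inner w (e k)"] by linarith
      qed
      show "summable (\<lambda>k. (2 * cmod (L2_inner w (e k)))\<^sup>2)"
        unfolding power_mult_distrib by (intro summable_mult Bessel w)
    qed (use h in auto)
  next
    fix h f K and u :: "'a \<Rightarrow> complex" assume h: "\<forall>n. bounded_borel (h n)" and f: "bounded_borel f" and K: "\<forall>n s. cmod (h n s) \<le> K"
      and hl: "\<forall>s. (\<lambda>n. h n s) \<longlonglongrightarrow> f s" and u: "u \<in> L2"
    have fK: "cmod (f s) \<le> K" for s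
      using hl K by (intro tendsto_upperbound[OF tendsto_norm[of "\<lambda>n. h n s" "f s" sequentially]]) (auto intro: always_eventually)
    show "(\<lambda>n. L2norm (\<lambda>x. \<Phi> (h n) u x - \<Phi> f u x)) \<longlonglongrightarrow> 0"
    proof (rule lim[OF _ u \<Phi>(1)[OF f u], where B="\<lambda>k. 2 * K * cmod (L2_inner u (e k))"])
      show "(\<lambda>n. h n (\<mu> k) * L2_inner u (e k)) \<longlonglongrightarrow> L2_inner (\<Phi> f u) (e k)" for k
        unfolding \<Phi>(2)[OF f u] using hl by (intro tendsto_mult tendsto_const) auto
      show "cmod (h n (\<mu> k) * L2_inner u (e k) - L2_inner (\<Phi> f u) (e k)) \<le> 2 * K * cmod (L2_inner u (e k))" for k n
      proof -
        have "cmod (h n (\<mu> k) - f (\<mu> k)) \<le> 2 * K"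
          using norm_triangle_ineq4[of "h n (\<mu> k)" "f (\<mu> k)"] K fK[of "\<mu> k"] by (smt (verit))
        then show ?thesis unfolding \<Phi>(2)[OF f u] left_diff_distrib[symmetric] norm_mult by (intro mult_right_mono) auto
      qed
      show "summable (\<lambda>k. (2 * K * cmod (L2_inner u (e k)))\<^sup>2)"
        unfolding power_mult_distrib by (intro summable_mult Bessel u)
    qed (use h in auto)
  qed (rule \<Phi>)
  then show ?thesis by blast
qed

end

section \<open>Smooth functions and tensor products\<close>

text \<open>Existence of n successive derivatives, with no continuity demanded of the last one.
  Counting derivatives gives closure under products and composition by induction on n.\<close>

fun ck :: "nat \<Rightarrow> (real \<Rightarrow> 'b::real_normed_vector) \<Rightarrow> bool" where
  "ck 0 f = True"
| "ck (Suc n) f = ((\<forall>x. f differentiable (at x)) \<and> ck n (\<lambda>x. vector_derivative f (at x)))"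

lemma ckI: "(\<And>x. (f has_vector_derivative f' x) (at x)) \<Longrightarrow> ck n f' \<Longrightarrow> ck (Suc n) f"
  unfolding ck.simps by (metis (no_types, lifting) differentiableI_vector ext vector_derivative_at)

lemma ckD: "ck (Suc n) f \<Longrightarrow> (f has_vector_derivative vector_derivative f (at x)) (at x)"
  by (simp add: vector_derivative_works)

lemma ck_SucD: "ck (Suc n) f \<Longrightarrow> ck n f"
  by (induction n arbitrary: f) auto

lemma ck_const: "ck n (\<lambda>x. c)"
proof (induction n arbitrary: c)
  case (Suc n)
  show ?case by (rule ckI[of _ "\<lambda>x. 0"]) (auto intro: Suc derivative_eq_intros)
qed simp

lemma ck_add: "ck n f \<Longrightarrow> ck n g \<Longrightarrow> ck n (\<lambda>x. f x + g x)"
proof (induction n arbitrary: f g)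
  case (Suc n)
  show ?case
    by (rule ckI[of _ "\<lambda>x. vector_derivative f (at x) + vector_derivative g (at x)"])
      (use Suc ckD in \<open>auto intro!: has_vector_derivative_add simp del: ck.simps\<close>, use Suc in auto)
qed simp

lemma ck_mult:
  fixes f g :: "real \<Rightarrow> 'b::real_normed_algebra"
  shows "ck n f \<Longrightarrow> ck n g \<Longrightarrow> ck n (\<lambda>x. f x * g x)"
proof (induction n arbitrary: f g)
  case (Suc n)
  show ?case
  proof (rule ckI[of _ "\<lambda>x. f x * vector_derivative g (at x) + vector_derivative f (at x) * g x"])
    show "((\<lambda>x. f x * g x) has_vector_derivative f x * vector_derivative g (at x) + vector_derivative f (at x) * g x) (at x)" for x
      by (rule has_vector_derivative_mult[OF ckD[OF Suc.prems(1)] ckD[OF Suc.prems(2)]])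
    show "ck n (\<lambda>x. f x * vector_derivative g (at x) + vector_derivative f (at x) * g x)"
      using Suc.prems ck_SucD[OF Suc.prems(1)] ck_SucD[OF Suc.prems(2)] by (intro ck_add Suc.IH) auto
  qed
qed simp

lemma ck_scaleR: "ck n g \<Longrightarrow> ck n f \<Longrightarrow> ck n (\<lambda>x. g x *\<^sub>R f x)"
proof (induction n arbitrary: f g)
  case (Suc n)
  show ?case
  proof (rule ckI[of _ "\<lambda>x. g x *\<^sub>R vector_derivative f (at x) + vector_derivative g (at x) *\<^sub>R f x"])
    show "((\<lambda>x. g x *\<^sub>R f x) has_vector_derivative g x *\<^sub>R vector_derivative f (at x) + vector_derivative g (at x) *\<^sub>R f x) (at x)" for x
      using ckD[OF Suc.prems(1), of x] ckD[OF Suc.prems(2), of x]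
      by (intro has_vector_derivative_scaleR) (auto simp: has_real_derivative_iff_has_vector_derivative)
    show "ck n (\<lambda>x. g x *\<^sub>R vector_derivative f (at x) + vector_derivative g (at x) *\<^sub>R f x)"
      using Suc.prems ck_SucD[OF Suc.prems(1)] ck_SucD[OF Suc.prems(2)] by (intro ck_add Suc.IH) auto
  qed
qed simp

lemma ck_comp:
  fixes g :: "real \<Rightarrow> real"
  shows "ck n f \<Longrightarrow> ck n g \<Longrightarrow> ck n (\<lambda>x. f (g x))"
proof (induction n arbitrary: f)
  case (Suc n)
  show ?case
  proof (rule ckI[of _ "\<lambda>x. vector_derivative g (at x) *\<^sub>R vector_derivative f (at (g x))"])
    show "((\<lambda>x. f (g x)) has_vector_derivative vector_derivative g (at x) *\<^sub>R vector_derivative f (at (g x))) (at x)" for x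
      using vector_diff_chain_at[OF ckD[OF Suc.prems(2), of x] ckD[OF Suc.prems(1), of "g x"]] by (simp add: o_def)
    show "ck n (\<lambda>x. vector_derivative g (at x) *\<^sub>R vector_derivative f (at (g x)))"
      using Suc.prems ck_SucD[OF Suc.prems(2)] by (intro ck_scaleR Suc.IH) auto
  qed
qed simp

definition smooth1 :: "(real \<Rightarrow> 'b::real_normed_vector) \<Rightarrow> bool" where
  "smooth1 f \<longleftrightarrow> (\<forall>n. ck n f)"

lemma smooth1_add: "smooth1 f \<Longrightarrow> smooth1 g \<Longrightarrow> smooth1 (\<lambda>x. f x + g x)"
  and smooth1_mult: "smooth1 f' \<Longrightarrow> smooth1 g' \<Longrightarrow> smooth1 (\<lambda>x. f' x * (g' x :: 'b::real_normed_algebra))"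
  and smooth1_comp: "smooth1 f \<Longrightarrow> smooth1 h \<Longrightarrow> smooth1 (\<lambda>x. f (h x))"
  and smooth1_const: "smooth1 (\<lambda>x. c)"
  by (auto simp: smooth1_def intro: ck_add ck_mult ck_comp ck_const)

lemma smooth1D: "smooth1 f \<Longrightarrow> (f has_vector_derivative vector_derivative f (at x)) (at x)"
  unfolding smooth1_def by (rule ckD[of 0]) blast

lemma smooth1_deriv: "smooth1 f \<Longrightarrow> smooth1 (\<lambda>x. vector_derivative f (at x))"
  unfolding smooth1_def by (metis ck.simps(2))

lemma smooth1_continuous: "smooth1 f \<Longrightarrow> continuous_on S f"
  by (meson smooth1D continuous_at_imp_continuous_on has_vector_derivative_continuous)

lemma smooth1_affine: "smooth1 (\<lambda>x::real. a * x + b)"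
  unfolding smooth1_def
proof
  fix n show "ck n (\<lambda>x::real. a * x + b)"
  proof (cases n)
    case (Suc m)
    have "((\<lambda>x. a * x + b) has_vector_derivative a) (at x)" for x
      unfolding has_real_derivative_iff_has_vector_derivative[symmetric] by (auto intro!: derivative_eq_intros)
    then show ?thesis unfolding Suc by (rule ckI) (rule ck_const)
  qed simp
qed

lemma smooth1_exp: "smooth1 (exp :: real \<Rightarrow> real)"
  unfolding smooth1_def
proof
  fix n show "ck n (exp :: real \<Rightarrow> real)"
  proof (induction n)
    case (Suc n)
    have "(exp has_vector_derivative exp x) (at x)" for x :: real
      unfolding has_real_derivative_iff_has_vector_derivative[symmetric] by (auto intro!: derivative_eq_intros)
    then show ?case by (rule ckI) (rule Suc)
  qed simp
qed

abbreviation chermite :: "nat \<Rightarrow> real \<Rightarrow> complex" where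
  "chermite n s \<equiv> complex_of_real (hermite n s)"

lemma chermite_deriv:
  "(chermite n has_vector_derivative
     of_real (sqrt (real n / 2)) * chermite (n - 1) x + (- of_real (sqrt ((real n + 1) / 2))) * chermite (Suc n) x) (at x)"
  using has_vector_derivative_of_real[OF has_real_derivative_hermite[of n x]]
  by simp

lemma smooth1_chermite: "smooth1 (chermite n)"
  unfolding smooth1_def
proof
  fix m show "ck m (chermite n)"
  proof (induction m arbitrary: n)
    case (Suc m)
    show ?case by (rule ckI[OF chermite_deriv]) (intro ck_add ck_mult ck_const Suc)
  qed simp
qed

text \<open>On the reals \<open>Basis\<close> consists of 1, so iterated directional derivatives are
  ordinary ones.\<close>

lemma smooth1_of_smooth:
  fixes f :: "real \<Rightarrow> 'b::real_normed_vector"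
  assumes "smooth f" shows "smooth1 f"
proof -
  have d: "foldr dir_deriv (replicate m 1) f differentiable (at x)" for m x
    using assms unfolding smooth_def by (metis Basis_real_def set_replicate_conv_if subset_refl empty_subsetI)
  have "ck n (foldr dir_deriv (replicate m 1) f)" for n m
  proof (induction n arbitrary: m)
    case (Suc n)
    have "vector_derivative (foldr dir_deriv (replicate m 1) f) (at x) = foldr dir_deriv (replicate (Suc m) 1) f x" for x
      using d[of m x] by (simp add: dir_deriv_def frechet_derivative_eq_vector_derivative)
    then show ?case using Suc[of "Suc m"] d by (simp del: foldr.simps replicate.simps)
  qed simp
  from this[of _ 0] show ?thesis by (simp add: smooth1_def)
qed

definition tens :: "('d::finite \<Rightarrow> real \<Rightarrow> complex) \<Rightarrow> real^'d \<Rightarrow> complex" where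
  "tens f x = (\<Prod>i\<in>UNIV. f i (x $ i))"

lemma tens_has_derivative:
  assumes "\<And>i. (f i has_vector_derivative f' i) (at (x $ i))"
  shows "(tens f has_derivative (\<lambda>y. \<Sum>i\<in>UNIV. (y $ i) *\<^sub>R f' i * (\<Prod>j\<in>UNIV - {i}. f j (x $ j)))) (at x)"
proof -
  have "((\<lambda>x. f i (x $ i)) has_derivative (\<lambda>y. (y $ i) *\<^sub>R f' i)) (at x)" for i
    using has_derivative_compose[of "\<lambda>x. x $ i" "\<lambda>x. x $ i" x UNIV "f i" "\<lambda>h. h *\<^sub>R f' i"] assms[of i]
      bounded_linear_imp_has_derivative[OF bounded_linear_vec_nth]
    unfolding has_vector_derivative_def by blast
  then show ?thesis unfolding tens_def[abs_def] by (intro has_derivative_prod)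
qed

lemma tens_differentiable: "(\<And>i. smooth1 (f i)) \<Longrightarrow> tens f differentiable (at x)"
  using tens_has_derivative[of f "\<lambda>i. vector_derivative (f i) (at (x $ i))" x] smooth1D
  unfolding differentiable_def by blast

text \<open>A partial derivative touches a single factor. Tensor products are thus closed under it,
  and smoothness in several variables is reduced to one variable.\<close>

lemma dir_deriv_tens:
  assumes "\<And>i. smooth1 (f i)"
  shows "dir_deriv (axis j 1) (tens f) = tens (f(j := (\<lambda>s. vector_derivative (f j) (at s))))"
proof
  fix x
  have "(tens f has_derivative (\<lambda>y. \<Sum>i\<in>UNIV. (y $ i) *\<^sub>R vector_derivative (f i) (at (x $ i)) * (\<Prod>j\<in>UNIV - {i}. f j (x $ j)))) (at x)"
    by (intro tens_has_derivative smooth1D assms)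
  from frechet_derivative_at[OF this, symmetric]
  have "dir_deriv (axis j 1) (tens f) x = (\<Sum>i\<in>UNIV. (axis j 1 $ i) *\<^sub>R vector_derivative (f i) (at (x $ i)) * (\<Prod>j\<in>UNIV - {i}. f j (x $ j)))"
    unfolding dir_deriv_def by simp
  also have "\<dots> = (\<Sum>i\<in>UNIV. if i = j then vector_derivative (f j) (at (x $ j)) * (\<Prod>l\<in>UNIV - {j}. f l (x $ l)) else 0)"
    by (intro sum.cong refl) (auto simp: axis_def)
  also have "\<dots> = vector_derivative (f j) (at (x $ j)) * (\<Prod>l\<in>UNIV - {j}. f l (x $ l))" by simp
  also have "\<dots> = tens (f(j := (\<lambda>s. vector_derivative (f j) (at s)))) x"
    unfolding tens_def by (subst prod.remove[of UNIV j]) (auto intro!: arg_cong2[where f="(*)"] prod.cong)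
  finally show "dir_deriv (axis j 1) (tens f) x = tens (f(j := (\<lambda>s. vector_derivative (f j) (at s)))) x" .
qed

lemma Basis_vec_axis: "(Basis :: (real^'d::finite) set) = range (\<lambda>i. axis i 1)"
  by (auto simp: Basis_vec_def)

lemma smooth_tens:
  assumes "\<And>i. smooth1 (f i)"
  shows "smooth (tens f)"
  unfolding smooth_def
proof (intro allI impI)
  fix bs :: "(real^'a) list" and x assume "set bs \<subseteq> Basis"
  then have "\<exists>g. (\<forall>i. smooth1 (g i)) \<and> foldr dir_deriv bs (tens f) = tens g"
  proof (induction bs)
    case Nil
    then show ?case using assms by auto
  next
    case (Cons b bs)
    then obtain g where g: "\<And>i. smooth1 (g i)" "foldr dir_deriv bs (tens f) = tens g" by auto
    obtain j where b: "b = axis j 1" using Cons.prems by (auto simp: Basis_vec_axis)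
    have "foldr dir_deriv (b # bs) (tens f) = tens (g(j := (\<lambda>s. vector_derivative (g j) (at s))))"
      by (simp add: g(2) b dir_deriv_tens[OF g(1)])
    moreover have "smooth1 ((g(j := (\<lambda>s. vector_derivative (g j) (at s)))) i)" for i
      using g(1) smooth1_deriv[OF g(1), of j] by simp
    ultimately show ?case by blast
  qed
  then show "foldr dir_deriv bs (tens f) differentiable (at x)" using tens_differentiable by metis
qed

lemma test_function_tens:
  assumes "\<And>i. smooth1 (f i)" and "\<And>i s. s < a $ i \<or> s > b $ i \<Longrightarrow> f i s = 0"
  shows "test_function (tens f)"
  unfolding test_function_def
proof
  show "smooth (tens f)" by (rule smooth_tens[OF assms(1)])
  have "{x. tens f x \<noteq> 0} \<subseteq> cbox a b"
    using assms(2) by (force simp: tens_def mem_box_cart not_less)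
  then show "compact (closure {x. tens f x \<noteq> 0})"
    by (meson bounded_cbox bounded_subset compact_closure)
qed

section \<open>Integration by parts\<close>

lemma integrable_indicator_cball: "integrable lborel (\<lambda>x::'a::euclidean_space. indicator (cball 0 r) x * (B::real))"
  by (intro integrable_mult_left integrable_real_indicator) (use emeasure_bounded_finite[OF bounded_cball, of "0::'a" r] in auto)

text \<open>Difference quotients have integral zero by translation invariance, and they converge to
  the derivative under a compactly supported majorant.\<close>

lemma integral_dir_deriv_eq_0:
  fixes G :: "'a::euclidean_space \<Rightarrow> complex"
  assumes diff: "\<And>x. G differentiable (at x)" and cont: "continuous_on UNIV (dir_deriv b G)"
    and supp: "\<And>x. norm x > R \<Longrightarrow> G x = 0"
  shows "(\<integral>x. dir_deriv b G x \<partial>lborel) = 0"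
proof -
  define q where "q n x = real (Suc n) *\<^sub>R (G (x + (1 / real (Suc n)) *\<^sub>R b) - G x)" for n x
  have contG: "continuous_on UNIV G" using diff
    by (meson continuous_at_imp_continuous_on differentiable_imp_continuous_within)
  have [measurable]: "G \<in> borel_measurable borel" "dir_deriv b G \<in> borel_measurable borel"
    by (intro borel_measurable_continuous_onI contG cont)+
  have "compact (dir_deriv b G ` cball 0 (R + 2 * norm b))"
    by (intro compact_continuous_image continuous_on_subset[OF cont]) auto
  \<comment> \<open>Step sizes are at most 1, so the quotients live in radius R + |b|, and the
    segments used in the mean value estimate stay in radius R + 2 |b|.\<close>
  then obtain B where B: "\<And>x. x \<in> cball 0 (R + 2 * norm b) \<Longrightarrow> norm (dir_deriv b G x) \<le> B"
    by (metis bounded_iff compact_imp_bounded imageI)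
  have "compact (G ` cball 0 R)"
    by (intro compact_continuous_image continuous_on_subset[OF contG]) auto
  then obtain B' where B': "\<And>x. x \<in> cball 0 R \<Longrightarrow> norm (G x) \<le> B'"
    by (metis bounded_iff compact_imp_bounded imageI)
  have line: "((\<lambda>t. G (x + t *\<^sub>R b)) has_vector_derivative dir_deriv b G (x + t *\<^sub>R b)) (at t within S)" for x t S
  proof -
    have "(G has_derivative frechet_derivative G (at (x + t *\<^sub>R b))) (at (x + t *\<^sub>R b))"
      using diff frechet_derivative_works by blast
    then have "((\<lambda>t. G (x + t *\<^sub>R b)) has_derivative (\<lambda>h. frechet_derivative G (at (x + t *\<^sub>R b)) (h *\<^sub>R b))) (at t within S)"
      by (intro has_derivative_compose[of "\<lambda>t. x + t *\<^sub>R b" "\<lambda>h. h *\<^sub>R b" t S G]) (auto intro!: derivative_eq_intros)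
    moreover have "frechet_derivative G (at (x + t *\<^sub>R b)) (h *\<^sub>R b) = h *\<^sub>R dir_deriv b G (x + t *\<^sub>R b)" for h
      unfolding dir_deriv_def using linear_frechet_derivative[OF diff] by (simp add: linear_cmul)
    ultimately show ?thesis by (simp add: has_vector_derivative_def)
  qed
  have intG: "integrable lborel G"
  proof (rule Bochner_Integration.integrable_bound)
    show "integrable lborel (\<lambda>x::'a. indicator (cball 0 R) x * B')"
      by (rule integrable_indicator_cball)
    show "AE x in lborel. norm (G x) \<le> norm (indicator (cball 0 R) x * B')"
      using B' supp by (intro AE_I2) (auto simp: indicator_def not_le order_trans[OF B'])
  qed measurable
  have "(\<lambda>n. \<integral>x. q n x \<partial>lborel) \<longlonglongrightarrow> (\<integral>x. dir_deriv b G x \<partial>lborel)"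
  proof (rule integral_dominated_convergence)
    show "integrable lborel (\<lambda>x::'a. indicator (cball 0 (R + norm b)) x * B)"
      by (rule integrable_indicator_cball)
    show "AE x in lborel. (\<lambda>n. q n x) \<longlonglongrightarrow> dir_deriv b G x"
    proof (intro AE_I2)
      fix x
      have "((\<lambda>t. (1 / t) *\<^sub>R (G (x + t *\<^sub>R b) - G x)) \<longlongrightarrow> dir_deriv b G x) (at 0)"
      proof -
        have "((\<lambda>h. norm (G (x + (0 + h) *\<^sub>R b) - G (x + 0 *\<^sub>R b) - h *\<^sub>R dir_deriv b G (x + 0 *\<^sub>R b)) / norm h) \<longlongrightarrow> 0) (at 0)"
          using line[of x 0 UNIV] unfolding has_vector_derivative_def has_derivative_at by blast
        then have "((\<lambda>h. norm ((1 / h) *\<^sub>R (G (x + h *\<^sub>R b) - G x) - dir_deriv b G x)) \<longlongrightarrow> 0) (at 0)"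
        proof (rule Lim_transform_eventually)
          have "norm (u - h *\<^sub>R d) / norm h = norm ((1 / h) *\<^sub>R u - d)" if "h \<noteq> 0" for u d :: complex and h :: real
          proof -
            have "(1 / h) *\<^sub>R u - d = (1 / h) *\<^sub>R (u - h *\<^sub>R d)" using that by (simp add: scaleR_right_diff_distrib)
            then show ?thesis by simp
          qed
          then show "\<forall>\<^sub>F h in at 0. norm (G (x + (0 + h) *\<^sub>R b) - G (x + 0 *\<^sub>R b) - h *\<^sub>R dir_deriv b G (x + 0 *\<^sub>R b)) / norm h
             = norm ((1 / h) *\<^sub>R (G (x + h *\<^sub>R b) - G x) - dir_deriv b G x)"
            by (auto simp: eventually_at_filter)
        qed
        then show ?thesis by (simp add: tendsto_norm_zero_iff LIM_zero_iff)
      qed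
      then have "(\<lambda>n. (1 / inverse (real (Suc n))) *\<^sub>R (G (x + inverse (real (Suc n)) *\<^sub>R b) - G x)) \<longlonglongrightarrow> dir_deriv b G x"
        by (rule filterlim_compose) (auto simp: filterlim_at simp del: of_nat_Suc intro: LIMSEQ_inverse_real_of_nat)
      then show "(\<lambda>n. q n x) \<longlonglongrightarrow> dir_deriv b G x" unfolding q_def by (simp add: inverse_eq_divide)
    qed
    show "AE x in lborel. norm (q n x) \<le> indicator (cball 0 (R + norm b)) x * B" for n
    proof (intro AE_I2)
      fix x :: 'a
      let ?t = "1 / real (Suc n)"
      show "norm (q n x) \<le> indicator (cball 0 (R + norm b)) x * B"
      proof (cases "x \<in> cball 0 (R + norm b)")
        case True
        have tb: "norm (t *\<^sub>R b) \<le> norm b" if "t \<in> {0..?t}" for t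
        proof -
          have "?t \<le> 1" by simp
          moreover have "0 \<le> t" "t \<le> ?t" using that by auto
          ultimately have "\<bar>t\<bar> \<le> 1" by linarith
          then show ?thesis by (simp add: mult_left_le_one_le)
        qed
        have "norm (G (x + ?t *\<^sub>R b) - G (x + 0 *\<^sub>R b)) \<le> B * norm (?t - 0)"
        proof (rule differentiable_bound[where S="{0..?t}" and f="\<lambda>t. G (x + t *\<^sub>R b)" and f'="\<lambda>t h. h *\<^sub>R dir_deriv b G (x + t *\<^sub>R b)"])
          fix t assume t: "t \<in> {0..?t}"
          show "((\<lambda>t. G (x + t *\<^sub>R b)) has_derivative (\<lambda>h. h *\<^sub>R dir_deriv b G (x + t *\<^sub>R b))) (at t within {0..?t})"
            using line unfolding has_vector_derivative_def .
          have "norm (x + t *\<^sub>R b) \<le> norm x + norm (t *\<^sub>R b)" by (rule norm_triangle_ineq)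
          then have "norm (dir_deriv b G (x + t *\<^sub>R b)) \<le> B" using True tb[OF t] by (intro B) auto
          then show "onorm (\<lambda>h. h *\<^sub>R dir_deriv b G (x + t *\<^sub>R b)) \<le> B"
          proof (intro onorm_le)
            fix h :: real
            show "norm (h *\<^sub>R dir_deriv b G (x + t *\<^sub>R b)) \<le> B * norm h"
              using mult_right_mono[OF \<open>norm (dir_deriv b G (x + t *\<^sub>R b)) \<le> B\<close>, of "\<bar>h\<bar>"] by (simp add: mult.commute)
          qed
        qed auto
        then have "real (Suc n) * norm (G (x + ?t *\<^sub>R b) - G x) \<le> real (Suc n) * (B * ?t)"
          by (intro mult_left_mono) auto
        moreover have "real (Suc n) * (B * ?t) = B" by simp
        moreover have "norm (q n x) = real (Suc n) * norm (G (x + ?t *\<^sub>R b) - G x)"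
          by (simp only: q_def norm_scaleR abs_of_nat)
        ultimately show ?thesis using True by simp
      next
        case False
        have "norm x \<le> norm (x + ?t *\<^sub>R b) + norm (?t *\<^sub>R b)"
          by (metis add_diff_cancel_right' norm_triangle_ineq4)
        moreover have "norm (?t *\<^sub>R b) \<le> norm b" by (simp add: field_simps)
        ultimately have "norm (x + ?t *\<^sub>R b) > R" using False by auto
        then have "G (x + ?t *\<^sub>R b) = 0" by (rule supp)
        moreover have "norm x > R" using False using norm_ge_zero[of b] by (auto simp del: norm_ge_zero)
        then have "G x = 0" by (rule supp)
        ultimately show ?thesis using False unfolding q_def by simp
      qed
    qed
  qed (auto simp: q_def)
  moreover have "(\<integral>x. q n x \<partial>lborel) = 0" for n
  proof -
    let ?c = "(1 / real (Suc n)) *\<^sub>R b"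
    have "integrable (distr lborel borel ((+) ?c)) G" using intG by (simp add: lborel_distr_plus)
    then have i: "integrable lborel (\<lambda>x. G (x + ?c))" by (subst (asm) integrable_distr_eq) (auto simp: add.commute)
    have "(\<integral>x. G x \<partial>lborel) = (\<integral>x. G x \<partial>(distr lborel borel ((+) ?c)))" by (simp add: lborel_distr_plus)
    also have "\<dots> = (\<integral>x. G (x + ?c) \<partial>lborel)" by (subst integral_distr) (auto simp: add.commute)
    finally show ?thesis unfolding q_def using i intG by simp
  qed
  ultimately show ?thesis by (simp add: LIMSEQ_const_iff)
qed


lemma dir_deriv_has: "f differentiable (at x) \<Longrightarrow> (f has_derivative frechet_derivative f (at x)) (at x)"
  using frechet_derivative_works by blast

lemma dir_deriv_mult:
  fixes f g :: "'a::euclidean_space \<Rightarrow> complex"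
  assumes "f differentiable (at x)" "g differentiable (at x)"
  shows "(\<lambda>x. f x * g x) differentiable (at x)"
    and "dir_deriv b (\<lambda>x. f x * g x) x = f x * dir_deriv b g x + dir_deriv b f x * g x"
proof -
  have D: "((\<lambda>x. f x * g x) has_derivative (\<lambda>h. f x * frechet_derivative g (at x) h + frechet_derivative f (at x) h * g x)) (at x)"
    by (intro has_derivative_mult dir_deriv_has assms)
  then show "(\<lambda>x. f x * g x) differentiable (at x)" by (auto simp: differentiable_def)
  show "dir_deriv b (\<lambda>x. f x * g x) x = f x * dir_deriv b g x + dir_deriv b f x * g x"
    unfolding dir_deriv_def frechet_derivative_at[OF D, symmetric] ..
qed

lemma smooth_differentiable: "smooth f \<Longrightarrow> f differentiable (at x)"
  unfolding smooth_def by (drule spec[of _ "[]"]) auto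

lemma smooth_continuous: "smooth f \<Longrightarrow> continuous_on S f"
  using smooth_differentiable by (meson continuous_at_imp_continuous_on differentiable_imp_continuous_within)

lemma smooth_dir_deriv:
  assumes "smooth f" "b \<in> Basis" shows "smooth (dir_deriv b f)"
  unfolding smooth_def
proof (intro allI impI)
  fix bs :: "'a list" and x assume "set bs \<subseteq> Basis"
  then have "foldr dir_deriv (bs @ [b]) f differentiable (at x)"
    using assms unfolding smooth_def by (metis Un_subset_iff empty_subsetI insert_subset list.simps(15) set_append set_empty)
  then show "foldr dir_deriv bs (dir_deriv b f) differentiable (at x)" by simp
qed

lemma test_function_smooth: "test_function \<phi> \<Longrightarrow> smooth \<phi>"
  by (simp add: test_function_def)

lemma test_function_support:
  assumes "test_function \<phi>" obtains R where "\<And>x. norm x > R \<Longrightarrow> \<phi> x = 0"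
proof -
  have "bounded (closure {x. \<phi> x \<noteq> 0})" using assms by (simp add: test_function_def compact_imp_bounded)
  then obtain R where "\<And>x. x \<in> closure {x. \<phi> x \<noteq> 0} \<Longrightarrow> norm x \<le> R" by (auto simp: bounded_iff)
  moreover have "{x. \<phi> x \<noteq> 0} \<subseteq> closure {x. \<phi> x \<noteq> 0}" by (rule closure_subset)
  ultimately show ?thesis using that[of R] by (metis (mono_tags, lifting) in_mono mem_Collect_eq not_le)
qed

lemma test_function_dir_deriv:
  assumes "test_function \<phi>" "b \<in> Basis" shows "test_function (dir_deriv b \<phi>)"
proof -
  have "{x. dir_deriv b \<phi> x \<noteq> 0} \<subseteq> closure {x. \<phi> x \<noteq> 0}"
  proof (rule ccontr)
    assume "\<not> ?thesis"
    then obtain x where x: "dir_deriv b \<phi> x \<noteq> 0" "x \<in> - closure {x. \<phi> x \<noteq> 0}" by auto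
    have "(\<phi> has_derivative (\<lambda>_. 0)) (at x)"
    proof (rule has_derivative_transform_within_open[of "\<lambda>_. 0" "\<lambda>_. 0" x UNIV "- closure {x. \<phi> x \<noteq> 0}"])
      show "0 = \<phi> y" if "y \<in> - closure {x. \<phi> x \<noteq> 0}" for y
        using that closure_subset[of "{x. \<phi> x \<noteq> 0}"] by auto
    qed (use x in auto)
    then have "dir_deriv b \<phi> x = 0" unfolding dir_deriv_def using frechet_derivative_at by metis
    then show False using x by simp
  qed
  then have "closure {x. dir_deriv b \<phi> x \<noteq> 0} \<subseteq> closure {x. \<phi> x \<noteq> 0}" by (rule closure_minimal) simp
  then have "compact (closure {x. dir_deriv b \<phi> x \<noteq> 0})"
    using assms unfolding test_function_def compact_eq_bounded_closed by (auto intro: bounded_subset)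
  then show ?thesis using smooth_dir_deriv[OF test_function_smooth[OF assms(1)] assms(2)] by (simp add: test_function_def)
qed

lemma integrable_continuous_mult_test:
  fixes f :: "'a::euclidean_space \<Rightarrow> complex"
  assumes f: "continuous_on UNIV f" and \<phi>: "test_function \<phi>"
  shows "integrable lborel (\<lambda>x. f x * \<phi> x)"
proof -
  obtain R where R: "\<And>x. norm x > R \<Longrightarrow> \<phi> x = 0" using test_function_support[OF \<phi>] by blast
  have c: "continuous_on UNIV (\<lambda>x. f x * \<phi> x)" by (intro continuous_on_mult f smooth_continuous test_function_smooth \<phi>)
  have "compact ((\<lambda>x. f x * \<phi> x) ` cball 0 R)"
    by (intro compact_continuous_image continuous_on_subset[OF c]) auto
  then obtain B where B: "\<And>x. x \<in> cball 0 R \<Longrightarrow> norm (f x * \<phi> x) \<le> B"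
    by (metis (mono_tags, lifting) bounded_iff compact_imp_bounded imageI)
  show ?thesis
  proof (rule Bochner_Integration.integrable_bound[OF integrable_indicator_cball])
    show "AE x in lborel. norm (f x * \<phi> x) \<le> norm (indicator (cball 0 R) x * B)"
    proof (intro AE_I2)
      fix x show "norm (f x * \<phi> x) \<le> norm (indicator (cball 0 R) x * B)"
        using B[of x] R[of x] by (cases "norm x \<le> R") auto
    qed
    show "(\<lambda>x. f x * \<phi> x) \<in> borel_measurable lborel" using borel_measurable_continuous_onI[OF c] by simp
  qed
qed

lemma integration_by_parts:
  fixes f :: "'a::euclidean_space \<Rightarrow> complex"
  assumes f: "smooth f" and \<phi>: "test_function \<phi>" and b: "b \<in> Basis"
  shows "(\<integral>x. f x * dir_deriv b \<phi> x \<partial>lborel) = - (\<integral>x. dir_deriv b f x * \<phi> x \<partial>lborel)"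
proof -
  have d: "f differentiable (at x)" "\<phi> differentiable (at x)" for x
    using f \<phi> by (auto intro: smooth_differentiable test_function_smooth)
  have eq: "dir_deriv b (\<lambda>x. f x * \<phi> x) = (\<lambda>x. f x * dir_deriv b \<phi> x + dir_deriv b f x * \<phi> x)"
    using dir_deriv_mult(2)[OF d] by auto
  obtain R where R: "\<And>x. norm x > R \<Longrightarrow> \<phi> x = 0" using test_function_support[OF \<phi>] by blast
  have "(\<integral>x. dir_deriv b (\<lambda>x. f x * \<phi> x) x \<partial>lborel) = 0"
  proof (rule integral_dir_deriv_eq_0)
    show "continuous_on UNIV (dir_deriv b (\<lambda>x. f x * \<phi> x))" unfolding eq
      by (intro continuous_intros smooth_continuous f smooth_dir_deriv test_function_smooth \<phi> b)
    show "f x * \<phi> x = 0" if "norm x > R" for x using R[OF that] by simp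
  qed (rule dir_deriv_mult(1)[OF d])
  moreover have "integrable lborel (\<lambda>x. f x * dir_deriv b \<phi> x)" "integrable lborel (\<lambda>x. dir_deriv b f x * \<phi> x)"
    by (intro integrable_continuous_mult_test smooth_continuous f smooth_dir_deriv \<phi> test_function_dir_deriv b)+
  ultimately show ?thesis unfolding eq by (simp add: add_eq_0_iff)
qed

text \<open>Two integrations by parts per direction; the compact support of the test function
  removes boundary terms and makes every term integrable, whatever the growth of f.\<close>

lemma integral_laplacian:
  fixes f :: "'a::euclidean_space \<Rightarrow> complex"
  assumes f: "smooth f" and \<phi>: "test_function \<phi>"
  shows "(\<integral>x. f x * (- laplacian \<phi> x + complex_of_real ((norm x)\<^sup>2) * \<phi> x) \<partial>lborel)
    = (\<integral>x. (- laplacian f x + complex_of_real ((norm x)\<^sup>2) * f x) * \<phi> x \<partial>lborel)"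
proof -
  have i1: "integrable lborel (\<lambda>x. f x * dir_deriv b (dir_deriv b \<phi>) x)" "integrable lborel (\<lambda>x. dir_deriv b (dir_deriv b f) x * \<phi> x)" if "b \<in> Basis" for b
    by (intro integrable_continuous_mult_test smooth_continuous f smooth_dir_deriv \<phi> test_function_dir_deriv that)+
  have i2: "integrable lborel (\<lambda>x. (complex_of_real ((norm x)\<^sup>2) * f x) * \<phi> x)"
    by (intro integrable_continuous_mult_test continuous_intros smooth_continuous f \<phi>)
  have e: "(\<integral>x. f x * dir_deriv b (dir_deriv b \<phi>) x \<partial>lborel) = (\<integral>x. dir_deriv b (dir_deriv b f) x * \<phi> x \<partial>lborel)" if "b \<in> Basis" for b
    using integration_by_parts[OF f test_function_dir_deriv[OF \<phi> that] that]
      integration_by_parts[OF smooth_dir_deriv[OF f that] \<phi> that] by simp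
  have "(\<integral>x. f x * (- laplacian \<phi> x + complex_of_real ((norm x)\<^sup>2) * \<phi> x) \<partial>lborel)
    = (\<integral>x. (complex_of_real ((norm x)\<^sup>2) * f x) * \<phi> x - (\<Sum>b\<in>Basis. f x * dir_deriv b (dir_deriv b \<phi>) x) \<partial>lborel)"
    unfolding laplacian_def by (intro Bochner_Integration.integral_cong refl) (simp add: algebra_simps sum_distrib_left)
  also have "\<dots> = (\<integral>x. (complex_of_real ((norm x)\<^sup>2) * f x) * \<phi> x \<partial>lborel) - (\<Sum>b\<in>Basis. (\<integral>x. f x * dir_deriv b (dir_deriv b \<phi>) x \<partial>lborel))"
    by (subst Bochner_Integration.integral_diff[OF i2]) (auto intro!: i1 Bochner_Integration.integrable_sum Bochner_Integration.integral_sum)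
  also have "\<dots> = (\<integral>x. (complex_of_real ((norm x)\<^sup>2) * f x) * \<phi> x \<partial>lborel) - (\<Sum>b\<in>Basis. (\<integral>x. dir_deriv b (dir_deriv b f) x * \<phi> x \<partial>lborel))"
    by (simp add: e)
  also have "\<dots> = (\<integral>x. (complex_of_real ((norm x)\<^sup>2) * f x) * \<phi> x - (\<Sum>b\<in>Basis. dir_deriv b (dir_deriv b f) x * \<phi> x) \<partial>lborel)"
    by (subst Bochner_Integration.integral_diff[OF i2]) (auto intro!: i1 Bochner_Integration.integrable_sum Bochner_Integration.integral_sum[symmetric])
  also have "\<dots> = (\<integral>x. (- laplacian f x + complex_of_real ((norm x)\<^sup>2) * f x) * \<phi> x \<partial>lborel)"
    unfolding laplacian_def by (intro Bochner_Integration.integral_cong refl) (simp add: algebra_simps sum_distrib_left)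
  finally show ?thesis .
qed

section \<open>Hermite functions are eigenfunctions\<close>

definition cHerm :: "('d::finite \<Rightarrow> nat) \<Rightarrow> real^'d \<Rightarrow> complex" where
  "cHerm k x = of_real (Herm k x)"

lemma cHerm_tens: "cHerm k = tens (\<lambda>i. chermite (k i))"
  by (auto simp: cHerm_def Herm_def tens_def fun_eq_iff)

definition eig :: "('d::finite \<Rightarrow> nat) \<Rightarrow> real" where
  "eig k = 2 * real (\<Sum>i\<in>UNIV. k i) + real CARD('d)"

lemma chermite_deriv1:
  "vector_derivative (chermite n) (at x) = of_real (sqrt (2 * real n)) * chermite (n - 1) x - of_real x * chermite n x"
proof -
  have "(chermite n has_vector_derivative of_real (sqrt (2 * real n) * hermite (n - 1) x - x * hermite n x)) (at x)"
    by (rule has_vector_derivative_of_real[OF hermite_deriv_aux])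
  then show ?thesis by (simp add: vector_derivative_at)
qed

text \<open>Differentiating the lowering form again produces a term in h_(n-2), which the recurrence
  trades for x h_(n-1) and h_n; the terms in h_(n-1) then cancel.\<close>

lemma chermite_deriv2:
  "vector_derivative (\<lambda>s. vector_derivative (chermite n) (at s)) (at x) = (of_real (x\<^sup>2) - of_real (2 * real n + 1)) * chermite n x"
proof -
  have D: "((\<lambda>s. sqrt (2 * real n) * hermite (n - 1) s - s * hermite n s) has_real_derivative (x\<^sup>2 - (2 * real n + 1)) * hermite n x) (at x)"
  proof -
    have "((\<lambda>s. sqrt (2 * real n) * hermite (n - 1) s - s * hermite n s) has_real_derivative
        sqrt (2 * real n) * (sqrt (2 * real (n - 1)) * hermite (n - 1 - 1) x - x * hermite (n - 1) x)
        - (1 * hermite n x + (sqrt (2 * real n) * hermite (n - 1) x - x * hermite n x) * x)) (at x)"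
      by (intro DERIV_diff DERIV_cmult DERIV_mult DERIV_ident hermite_deriv_aux)
    moreover have "sqrt (2 * real n) * (sqrt (2 * real (n - 1)) * hermite (n - 1 - 1) x) = sqrt (2 * real n) * (2 * (x * hermite (n - 1) x)) - 2 * real n * hermite n x"
    proof (cases n)
      case (Suc m)
      have "sqrt 2 * (sqrt (real m + 1) * hermite (Suc m) x) = 2 * x * hermite m x - sqrt 2 * (sqrt (real m) * hermite (m - 1) x)"
        unfolding hermite_Suc by (simp add: right_diff_distrib flip: mult.assoc)
      then have E: "sqrt (2 * real m) * hermite (m - 1) x = 2 * x * hermite m x - sqrt (2 * real n) * hermite n x"
      proof -
        have "sqrt (2 * real m) = sqrt 2 * sqrt (real m)" "sqrt (2 * real n) = sqrt 2 * sqrt (real m + 1)"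
          using Suc by (simp_all add: real_sqrt_mult[symmetric] add.commute)
        then show ?thesis using Suc \<open>sqrt 2 * (sqrt (real m + 1) * hermite (Suc m) x) = _\<close> by (simp only: mult.assoc)
      qed
      have "sqrt (2 * real n) * (sqrt (2 * real m) * hermite (m - 1) x) = sqrt (2 * real n) * (2 * (x * hermite m x)) - 2 * real n * hermite n x"
        unfolding E by (simp add: right_diff_distrib sqrt_mult_left)
      then show ?thesis using Suc by simp
    qed simp
    ultimately have "((\<lambda>s. sqrt (2 * real n) * hermite (n - 1) s - s * hermite n s) has_real_derivative
        sqrt (2 * real n) * (2 * (x * hermite (n - 1) x)) - 2 * real n * hermite n x - sqrt (2 * real n) * (x * hermite (n - 1) x)
        - (1 * hermite n x + (sqrt (2 * real n) * hermite (n - 1) x - x * hermite n x) * x)) (at x)"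
      by (simp only: right_diff_distrib)
    moreover have "sqrt (2 * real n) * (2 * (x * hermite (n - 1) x)) - 2 * real n * hermite n x - sqrt (2 * real n) * (x * hermite (n - 1) x)
        - (1 * hermite n x + (sqrt (2 * real n) * hermite (n - 1) x - x * hermite n x) * x) = (x\<^sup>2 - (2 * real n + 1)) * hermite n x"
      by (simp add: algebra_simps power2_eq_square)
    ultimately show ?thesis by (simp only:)
  qed
  have "vector_derivative (\<lambda>s. complex_of_real (sqrt (2 * real n) * hermite (n - 1) s - s * hermite n s)) (at x) = of_real ((x\<^sup>2 - (2 * real n + 1)) * hermite n x)"
    by (rule vector_derivative_at[OF has_vector_derivative_of_real[OF D]])
  then show ?thesis unfolding chermite_deriv1 by simp
qed

lemma smooth_cHerm: "smooth (cHerm k)"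
  unfolding cHerm_tens by (intro smooth_tens smooth1_chermite)

lemma sum_Basis_axis: "(\<Sum>b\<in>(Basis :: (real^'d::finite) set). g b) = (\<Sum>i\<in>UNIV. g (axis i 1))"
  unfolding Basis_vec_axis by (subst sum.reindex) (auto simp: inj_on_def axis_eq_axis)

lemma norm_sq_vec: "(norm (x::real^'d::finite))\<^sup>2 = (\<Sum>i\<in>UNIV. (x $ i)\<^sup>2)"
  by (simp add: norm_vec_def L2_set_def sum_nonneg)

lemma laplacian_tens:
  assumes "\<And>i. smooth1 (f i)"
  shows "laplacian (tens f) x = (\<Sum>i\<in>UNIV. tens (f(i := (\<lambda>s. vector_derivative (\<lambda>s. vector_derivative (f i) (at s)) (at s)))) x)"
proof -
  have "dir_deriv (axis i 1) (dir_deriv (axis i 1) (tens f)) = tens (f(i := (\<lambda>s. vector_derivative (\<lambda>s. vector_derivative (f i) (at s)) (at s))))" for i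
  proof -
    have "smooth1 ((f(i := (\<lambda>s. vector_derivative (f i) (at s)))) l)" for l
      using assms smooth1_deriv[OF assms, of i] by simp
    then show ?thesis by (simp add: dir_deriv_tens[OF assms] dir_deriv_tens)
  qed
  then show ?thesis unfolding laplacian_def sum_Basis_axis by simp
qed

lemma tens_upd: "tens (f(i := g)) x = g (x $ i) * (\<Prod>l\<in>UNIV - {i}. f l (x $ l))"
  unfolding tens_def by (subst prod.remove[of UNIV i]) (auto intro!: arg_cong2[where f="(*)"] prod.cong)

lemma laplacian_cHerm:
  "- laplacian (cHerm k) x + complex_of_real ((norm x)\<^sup>2) * cHerm k x = of_real (eig k) * cHerm k x"
proof -
  have "laplacian (cHerm k) x = (\<Sum>i\<in>UNIV. (of_real ((x $ i)\<^sup>2) - of_real (2 * real (k i) + 1)) * cHerm k x)"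
    unfolding cHerm_tens laplacian_tens[OF smooth1_chermite] chermite_deriv2
    unfolding tens_upd
  proof (intro sum.cong refl)
    fix i
    have "tens (\<lambda>i. chermite (k i)) x = chermite (k i) (x $ i) * (\<Prod>l\<in>UNIV - {i}. chermite (k l) (x $ l))"
      unfolding tens_def by (rule prod.remove) auto
    then show "(complex_of_real ((x $ i)\<^sup>2) - complex_of_real (2 * real (k i) + 1)) * chermite (k i) (x $ i) * (\<Prod>l\<in>UNIV - {i}. chermite (k l) (x $ l))
      = (complex_of_real ((x $ i)\<^sup>2) - complex_of_real (2 * real (k i) + 1)) * tens (\<lambda>i. chermite (k i)) x"
      by (simp only: mult.assoc)
  qed
  also have "\<dots> = (of_real ((norm x)\<^sup>2) - of_real (eig k)) * cHerm k x"
    unfolding norm_sq_vec eig_def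
    by (simp add: sum_distrib_right[symmetric] sum_subtractf sum.distrib sum_distrib_left[symmetric])
  finally show ?thesis by (simp add: algebra_simps)
qed

lemma cHerm_L2: "cHerm k \<in> L2"
  using integrable_Herm_mult[of k k] unfolding L2_iff cHerm_def[abs_def] complex_of_real_integrable_eq
  by (simp add: power2_eq_square)

lemma cHerm_orthonormal: "L2_inner (cHerm k) (cHerm l) = (if k = l then 1 else 0)"
  using integral_Herm_mult[of k l] unfolding L2_inner_def cHerm_def by simp

lemma cHerm_eigenfunction: "(cHerm k, \<lambda>x. of_real (eig k) * cHerm k x) \<in> harmonic_oscillator"
  unfolding harmonic_oscillator_def
  using cHerm_L2[of k] L2_cmult[OF cHerm_L2[of k]] integral_laplacian[OF smooth_cHerm[of k], unfolded laplacian_cHerm]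
  by blast

text \<open>The only cutoff available is \<open>\<eta>\<close>; composed with the exponential function it becomes constant on both sides.\<close>

definition smooth_step :: "(real \<Rightarrow> complex) \<Rightarrow> bool" where
  "smooth_step \<theta> \<longleftrightarrow> smooth1 \<theta> \<and> (\<forall>s\<le>0. \<theta> s = 1) \<and> (\<forall>s\<ge>1. \<theta> s = 0)"

text \<open>The values of \<eta> on the negative axis are unknown. The exponential avoids them: it
  sends s <= 0 into [0, 1], and exp s >= 1 + s >= 2 for s >= 1.\<close>

lemma smooth_step_exp:
  assumes "test_function \<eta>" and "\<forall>s\<in>{0..1}. \<eta> s = 1" and "\<forall>s\<ge>2. \<eta> s = 0"
  shows "smooth_step (\<lambda>s. \<eta> (exp s))"
  unfolding smooth_step_def
proof (intro conjI allI impI)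
  show "smooth1 (\<lambda>s. \<eta> (exp s))"
    by (rule smooth1_comp[OF smooth1_of_smooth[OF test_function_smooth[OF assms(1)]] smooth1_exp])
  show "\<eta> (exp s) = 1" if "s \<le> 0" for s using assms(2) that by simp
  show "\<eta> (exp s) = 0" if "s \<ge> 1" for s
  proof -
    have "2 \<le> exp s" using exp_ge_add_one_self[of s] that by linarith
    then show ?thesis using assms(3) by simp
  qed
qed

section \<open>One-dimensional cut-offs and their derivatives\<close>

lemma bounded_of_vanishing_outside:
  fixes f :: "real \<Rightarrow> complex"
  assumes "continuous_on UNIV f" "\<And>s. s < 0 \<or> s > 1 \<Longrightarrow> f s = 0"
  shows "\<exists>B. \<forall>s. cmod (f s) \<le> B"
proof -
  have "compact (f ` {0..1})" by (intro compact_continuous_image continuous_on_subset[OF assms(1)]) auto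
  then obtain B where B: "\<And>s. s \<in> {0..1} \<Longrightarrow> cmod (f s) \<le> B" by (metis bounded_iff compact_imp_bounded imageI)
  have "cmod (f s) \<le> max B 0" for s
    using B[of s] assms(2)[of s] by (cases "s \<in> {0..1}") auto
  then show ?thesis by blast
qed

lemma vector_derivative_const_on_open:
  fixes f :: "real \<Rightarrow> complex"
  assumes "open S" "x \<in> S" "\<And>s. s \<in> S \<Longrightarrow> f s = c"
  shows "vector_derivative f (at x) = 0"
proof -
  have "(f has_vector_derivative 0) (at x)"
    by (rule has_vector_derivative_transform_within_open[of "\<lambda>_. c" 0 x S]) (use assms in auto)
  then show ?thesis by (rule vector_derivative_at)
qed

lemma smooth_step_bounds:
  assumes "smooth_step \<theta>"
  defines "\<theta>1 \<equiv> \<lambda>s. vector_derivative \<theta> (at s)"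
  defines "\<theta>2 \<equiv> \<lambda>s. vector_derivative \<theta>1 (at s)"
  obtains B where "B \<ge> 1" "\<And>s. cmod (\<theta> s) \<le> B" "\<And>s. cmod (\<theta>1 s) \<le> B" "\<And>s. cmod (\<theta>2 s) \<le> B"
    "\<And>s. s < 0 \<Longrightarrow> \<theta>1 s = 0" "\<And>s. s < 0 \<Longrightarrow> \<theta>2 s = 0"
proof -
  have s: "smooth1 \<theta>" "\<And>s. s \<le> 0 \<Longrightarrow> \<theta> s = 1" "\<And>s. s \<ge> 1 \<Longrightarrow> \<theta> s = 0" using assms(1) by (auto simp: smooth_step_def)
  have s1: "smooth1 \<theta>1" unfolding \<theta>1_def by (rule smooth1_deriv[OF s(1)])
  have s2: "smooth1 \<theta>2" unfolding \<theta>2_def by (rule smooth1_deriv[OF s1])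
  have z1: "\<theta>1 x = 0" if "x < 0" for x
    unfolding \<theta>1_def by (rule vector_derivative_const_on_open[of "{..<0}" _ _ 1]) (use that s in auto)
  have z1': "\<theta>1 x = 0" if "x > 1" for x
    unfolding \<theta>1_def by (rule vector_derivative_const_on_open[of "{1<..}" _ _ 0]) (use that s in auto)
  have z2: "\<theta>2 x = 0" if "x < 0" for x
    unfolding \<theta>2_def by (rule vector_derivative_const_on_open[of "{..<0}" _ _ 0]) (use that z1 in auto)
  have z2': "\<theta>2 x = 0" if "x > 1" for x
    unfolding \<theta>2_def by (rule vector_derivative_const_on_open[of "{1<..}" _ _ 0]) (use that z1' in auto)
  obtain B1 where B1: "\<And>s. cmod (\<theta>1 s) \<le> B1"
    using bounded_of_vanishing_outside[of \<theta>1] smooth1_continuous[OF s1] z1 z1' by blast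
  obtain B2 where B2: "\<And>s. cmod (\<theta>2 s) \<le> B2"
    using bounded_of_vanishing_outside[of \<theta>2] smooth1_continuous[OF s2] z2 z2' by blast
  have "compact (\<theta> ` {0..1})" by (intro compact_continuous_image smooth1_continuous s) auto
  then obtain B0 where B0: "\<And>s. s \<in> {0..1} \<Longrightarrow> cmod (\<theta> s) \<le> B0" by (metis bounded_iff compact_imp_bounded imageI)
  have B0': "cmod (\<theta> s) \<le> max B0 1" for s
    using B0[of s] s(2)[of s] s(3)[of s] by (cases "s \<le> 0"; cases "s \<ge> 1") (auto simp: le_max_iff_disj)
  show ?thesis
    by (rule that[of "max (max B0 1) (max B1 B2)"]) (use B0' B1 B2 z1 z2 in \<open>auto simp: le_max_iff_disj\<close>)
qed

lemma vector_derivative_smooth1_mult: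
  assumes "smooth1 f" "smooth1 g"
  shows "vector_derivative (\<lambda>s. f s * g s) (at x) = f x * vector_derivative g (at x) + vector_derivative f (at x) * (g x :: complex)"
  by (intro vector_derivative_at has_vector_derivative_mult smooth1D assms)

lemma vector_derivative_affine:
  fixes f :: "real \<Rightarrow> complex"
  assumes "smooth1 f"
  shows "vector_derivative (\<lambda>s. f (a * s + b)) (at x) = a *\<^sub>R vector_derivative f (at (a * x + b))"
proof -
  have "((\<lambda>s. a * s + b) has_vector_derivative a) (at x)"
    unfolding has_real_derivative_iff_has_vector_derivative[symmetric] by (auto intro!: derivative_eq_intros)
  from vector_diff_chain_at[OF this smooth1D[OF assms]] show ?thesis
    by (intro vector_derivative_at) (simp add: o_def)
qed

section \<open>Testing against test functions\<close>

lemma locally_integrable_measurable: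
  assumes "locally_integrable g" shows "g \<in> borel_measurable borel"
proof -
  have [measurable]: "(\<lambda>x. indicator (cball 0 (real n)) x *\<^sub>R g x) \<in> borel_measurable borel" for n :: nat
    using assms[unfolded locally_integrable_def, rule_format, of "cball 0 (real n)"]
    by (auto simp: set_integrable_def dest: borel_measurable_integrable)
  show ?thesis
  proof (rule borel_measurable_LIMSEQ_metric)
    show "(\<lambda>n. indicator (cball 0 (real n)) x *\<^sub>R g x) \<longlonglongrightarrow> g x" for x
    proof (rule tendsto_eventually)
      obtain N :: nat where "norm x \<le> real N" using real_arch_simple by blast
      then show "\<forall>\<^sub>F n in sequentially. indicator (cball 0 (real n)) x *\<^sub>R g x = g x"
        by (auto simp: eventually_sequentially intro!: exI[of _ N])
    qed
  qed measurable
qed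

lemma L2_locally_integrable: "u \<in> L2 \<Longrightarrow> locally_integrable u"
  unfolding locally_integrable_def set_integrable_def
proof (intro allI impI)
  fix K :: "'a set" assume u: "u \<in> L2" and K: "compact K"
  have [measurable]: "K \<in> sets borel" using K by (simp add: borel_compact)
  have [measurable]: "u \<in> borel_measurable borel" using u by (rule L2_measurable)
  show "integrable lborel (\<lambda>x. indicator K x *\<^sub>R u x)"
  proof (rule Bochner_Integration.integrable_bound)
    show "integrable lborel (\<lambda>x. indicator K x + (cmod (u x))\<^sup>2 :: real)"
      using emeasure_compact_finite[OF K] by (intro Bochner_Integration.integrable_add L2_integrable u integrable_real_indicator) auto
    show "AE x in lborel. norm (indicator K x *\<^sub>R u x) \<le> norm (indicator K x + (cmod (u x))\<^sup>2 :: real)"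
    proof (intro AE_I2)
      fix x
      have "2 * 1 * cmod (u x) \<le> 1\<^sup>2 + (cmod (u x))\<^sup>2" by (rule sum_squares_bound)
      then have "cmod (u x) \<le> 1 + (cmod (u x))\<^sup>2" using norm_ge_zero[of "u x"] by (simp only: mult_1_right one_power2)
      then show "norm (indicator K x *\<^sub>R u x) \<le> norm (indicator K x + (cmod (u x))\<^sup>2 :: real)"
        by (auto simp: indicator_def)
    qed
  qed measurable
qed

lemma integrable_loc_mult_bounded:
  fixes g \<phi> :: "'a::euclidean_space \<Rightarrow> complex"
  assumes g: "locally_integrable g" and [measurable]: "\<phi> \<in> borel_measurable borel"
    and B: "\<And>x. cmod (\<phi> x) \<le> B" and K: "compact K" "\<And>x. x \<notin> K \<Longrightarrow> \<phi> x = 0"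
  shows "integrable lborel (\<lambda>x. g x * \<phi> x)"
proof (rule Bochner_Integration.integrable_bound)
  have [measurable]: "g \<in> borel_measurable borel" by (rule locally_integrable_measurable[OF g])
  show "integrable lborel (\<lambda>x. B *\<^sub>R (indicator K x *\<^sub>R g x))"
    using g K(1) unfolding locally_integrable_def set_integrable_def by (intro integrable_scaleR_right) auto
  show "AE x in lborel. norm (g x * \<phi> x) \<le> norm (B *\<^sub>R (indicator K x *\<^sub>R g x))"
  proof (intro AE_I2)
    fix x
    have "B \<ge> 0" using B[of x] norm_ge_zero order_trans by blast
    then show "norm (g x * \<phi> x) \<le> norm (B *\<^sub>R (indicator K x *\<^sub>R g x))"
      using K(2)[of x] mult_left_mono[OF B[of x], of "cmod (g x)"] by (cases "x \<in> K") (auto simp: norm_mult mult.commute)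
  qed
  show "(\<lambda>x. g x * \<phi> x) \<in> borel_measurable lborel" by measurable
qed

lemma test_function_bounded:
  fixes \<phi> :: "'a::euclidean_space \<Rightarrow> complex"
  assumes "test_function \<phi>"
  obtains B where "\<And>x. cmod (\<phi> x) \<le> B"
proof -
  obtain R where R: "\<And>x. norm x > R \<Longrightarrow> \<phi> x = 0" using test_function_support[OF assms] by blast
  have "compact (\<phi> ` cball 0 R)" by (intro compact_continuous_image smooth_continuous test_function_smooth assms) auto
  then obtain B where B: "\<And>x. x \<in> cball 0 R \<Longrightarrow> cmod (\<phi> x) \<le> B" by (metis bounded_iff compact_imp_bounded imageI)
  have "cmod (\<phi> x) \<le> max B 0" for x
    using B[of x] R[of x] by (cases "norm x \<le> R") auto
  then show ?thesis by (rule that)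
qed

lemma test_function_measurable: "test_function \<phi> \<Longrightarrow> \<phi> \<in> borel_measurable borel"
  by (intro borel_measurable_continuous_onI smooth_continuous test_function_smooth)

lemma integrable_loc_mult_test:
  fixes g \<phi> :: "'a::euclidean_space \<Rightarrow> complex"
  assumes g: "locally_integrable g" and \<phi>: "test_function \<phi>"
  shows "integrable lborel (\<lambda>x. g x * \<phi> x)"
proof -
  obtain R where R: "\<And>x. norm x > R \<Longrightarrow> \<phi> x = 0" using test_function_support[OF \<phi>] by blast
  obtain B where B: "\<And>x. cmod (\<phi> x) \<le> B" using test_function_bounded[OF \<phi>] by blast
  show ?thesis
    by (rule integrable_loc_mult_bounded[OF g test_function_measurable[OF \<phi>] B, of "cball 0 R"]) (auto intro: R)
qed

text \<open>Indicators of boxes are bounded limits of tensor products of one-dimensional steps,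
  which reduces the claim to \<open>AE_zero_of_box\<close>. Uniqueness of weak derivatives rests on
  this.\<close>

lemma AE_zero_of_test_functions:
  fixes g :: "real^'d::finite \<Rightarrow> complex"
  assumes \<theta>: "smooth_step \<theta>" and g: "locally_integrable g"
    and test: "\<And>\<phi>. test_function \<phi> \<Longrightarrow> (\<integral>x. g x * \<phi> x \<partial>lborel) = 0"
  shows "AE x in lborel. g x = 0"
proof -
  have s: "smooth1 \<theta>" "\<And>s. s \<le> 0 \<Longrightarrow> \<theta> s = 1" "\<And>s. s \<ge> 1 \<Longrightarrow> \<theta> s = 0" using \<theta> by (auto simp: smooth_step_def)
  obtain B where B: "B \<ge> 1" "\<And>s. cmod (\<theta> s) \<le> B" using smooth_step_bounds[OF \<theta>] by metis
  have [measurable]: "g \<in> borel_measurable borel" by (rule locally_integrable_measurable[OF g])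
  have box: "(\<integral>x. g x * indicator (box a b) x \<partial>lborel) = 0" for a b :: "real^'d"
  proof -
    \<comment> \<open>Equal to 1 from \<open>a $ i\<close> + 1 / (n + 1) to \<open>b $ i\<close> - 1
      / (n + 1), if these are in order, and to 0 outside the interval, so that all supports lie in
      the same closed box.\<close>
    define f where "f n i s = \<theta> (real (Suc n) * s + (1 - real (Suc n) * b $ i)) * (1 + (-1) * \<theta> (real (Suc n) * s + (- real (Suc n) * a $ i)))" for n i s
    have f_smooth: "smooth1 (f n i)" for n i
      unfolding f_def[abs_def] by (intro smooth1_mult smooth1_add smooth1_const smooth1_comp[OF s(1)] smooth1_affine)
    have fa: "f n i s = 0" if "s \<le> a $ i" for n i s
    proof -
      have "real (Suc n) * s \<le> real (Suc n) * a $ i" using that by (intro mult_left_mono) auto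
      then show ?thesis unfolding f_def by (subst s(2)[of "real (Suc n) * s + (- real (Suc n) * a $ i)"]) (auto simp del: of_nat_Suc)
    qed
    have fb: "f n i s = 0" if "s \<ge> b $ i" for n i s
    proof -
      have "real (Suc n) * b $ i \<le> real (Suc n) * s" using that by (intro mult_left_mono) auto
      then show ?thesis unfolding f_def by (subst s(3)[of "real (Suc n) * s + (1 - real (Suc n) * b $ i)"]) (auto simp del: of_nat_Suc)
    qed
    have f_bound: "cmod (f n i s) \<le> B * (1 + B)" for n i s
      unfolding f_def norm_mult
      by (intro mult_mono B(2) order_trans[OF norm_triangle_ineq] add_mono) (use B in \<open>auto simp: norm_mult\<close>)
    have f_lim: "(\<lambda>n. f n i s) \<longlonglongrightarrow> indicator {a $ i<..<b $ i} s" for i s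
    proof (cases "a $ i < s \<and> s < b $ i")
      case True
      have "\<forall>\<^sub>F n in sequentially. inverse (real (Suc n)) < min (b $ i - s) (s - a $ i)"
        by (intro order_tendstoD[OF LIMSEQ_inverse_real_of_nat]) (use True in auto)
      then have "\<forall>\<^sub>F n in sequentially. f n i s = indicator {a $ i<..<b $ i} s"
      proof eventually_elim
        case (elim n)
        have "1 < real (Suc n) * (b $ i - s)" "1 < real (Suc n) * (s - a $ i)"
          using elim by (auto simp: inverse_eq_divide divide_less_eq mult.commute simp del: of_nat_Suc)
        then have "real (Suc n) * s + (1 - real (Suc n) * b $ i) \<le> 0" "real (Suc n) * s + (- real (Suc n) * a $ i) \<ge> 1"
          by (auto simp: algebra_simps)
        then show ?case unfolding f_def using True by (simp add: s(2,3) del: of_nat_Suc)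
      qed
      then show ?thesis by (rule tendsto_eventually)
    next
      case False
      then have "f n i s = 0" for n using fa[of s i n] fb[of i s n] by force
      then show ?thesis using False by simp
    qed
    have supp: "tens (f n) x = 0" if "x \<notin> cbox a b" for n x
    proof -
      obtain i where "x $ i < a $ i \<or> x $ i > b $ i" using \<open>x \<notin> cbox a b\<close> by (auto simp: mem_box_cart not_le)
      then have "f n i (x $ i) = 0" using fa[of "x $ i" i n] fb[of i "x $ i" n] by auto
      then show ?thesis unfolding tens_def by (intro prod_zero) auto
    qed
    have tf: "test_function (tens (f n))" for n
      by (rule test_function_tens[of _ a b]) (auto simp: f_smooth intro: fa fb)
    have tb: "cmod (tens (f n) x) \<le> (B * (1 + B)) ^ CARD('d)" for n x
      unfolding tens_def prod_norm[symmetric] by (rule order_trans[OF prod_mono[of _ _ "\<lambda>_. B * (1 + B)"]]) (auto simp: f_bound)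
    have "(\<lambda>n. \<integral>x. g x * tens (f n) x \<partial>lborel) \<longlonglongrightarrow> (\<integral>x. g x * indicator (box a b) x \<partial>lborel)"
    proof (rule integral_dominated_convergence)
      show "integrable lborel (\<lambda>x. norm ((B * (1 + B)) ^ CARD('d) *\<^sub>R (indicator (cbox a b) x *\<^sub>R g x)))"
        using g unfolding locally_integrable_def set_integrable_def by (intro integrable_norm integrable_scaleR_right) auto
      show "AE x in lborel. (\<lambda>n. g x * tens (f n) x) \<longlonglongrightarrow> g x * indicator (box a b) x"
      proof (intro AE_I2 tendsto_mult tendsto_const)
        fix x :: "real^'d"
        have "(\<lambda>n. tens (f n) x) \<longlonglongrightarrow> (\<Prod>i\<in>UNIV. indicator {a $ i<..<b $ i} (x $ i))"
          unfolding tens_def by (intro tendsto_prod f_lim)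
        also have "(\<Prod>i\<in>UNIV. indicator {a $ i<..<b $ i} (x $ i)) = (indicator (box a b) x :: complex)"
          by (auto simp: indicator_def mem_box_cart)
        finally show "(\<lambda>n. tens (f n) x) \<longlonglongrightarrow> indicator (box a b) x" .
      qed
      show "AE x in lborel. norm (g x * tens (f n) x) \<le> norm ((B * (1 + B)) ^ CARD('d) *\<^sub>R (indicator (cbox a b) x *\<^sub>R g x))" for n
      proof (intro AE_I2)
        fix x
        have "B * (1 + B) \<ge> 0" using B by simp
        then show "norm (g x * tens (f n) x) \<le> norm ((B * (1 + B)) ^ CARD('d) *\<^sub>R (indicator (cbox a b) x *\<^sub>R g x))"
          using supp[of x n] mult_left_mono[OF tb[of n x], of "cmod (g x)"]
          by (cases "x \<in> cbox a b") (auto simp: norm_mult mult.commute)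
      qed
      show "(\<lambda>x. g x * tens (f n) x) \<in> borel_measurable lborel" for n using test_function_measurable[OF tf[of n]] by measurable
      show "(\<lambda>x. g x * indicator (box a b) x) \<in> borel_measurable lborel" by measurable
    qed
    then show ?thesis using test[OF tf] by (simp add: LIMSEQ_const_iff)
  qed
  \<comment> \<open>g is only locally integrable, so it is restricted to bounded boxes that exhaust
    the space.\<close>
  have ball: "AE x in lborel. indicator (box (- (real n *\<^sub>R One)) (real n *\<^sub>R One)) x *\<^sub>R g x = 0" for n :: nat
  proof (rule AE_zero_of_box)
    let ?b = "box (- (real n *\<^sub>R One)) (real n *\<^sub>R One) :: (real^'d) set"
    have "set_integrable lborel (cbox (- (real n *\<^sub>R One)) (real n *\<^sub>R One)) g" using g by (auto simp: locally_integrable_def)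
    then have "set_integrable lborel ?b g" by (rule set_integrable_subset) (auto intro!: box_subset_cbox[THEN subsetD])
    then show "integrable lborel (\<lambda>x. indicator ?b x *\<^sub>R g x)" by (simp add: set_integrable_def)
    fix a b :: "real^'d"
    obtain c d where cd: "box a b \<inter> ?b = box c d" by (rule that[OF box_Int_box])
    have "indicator (box a b) x *\<^sub>R (indicator ?b x *\<^sub>R g x) = g x * indicator (box c d) x" for x
      unfolding cd[symmetric] by (auto simp: indicator_def)
    then show "(\<integral>x. indicator (box a b) x *\<^sub>R (indicator ?b x *\<^sub>R g x) \<partial>lborel) = 0" using box[of c d] by simp
  qed
  have "AE x in lborel. \<forall>n::nat. indicator (box (- (real n *\<^sub>R One)) (real n *\<^sub>R One)) x *\<^sub>R g x = 0"
    unfolding AE_all_countable using ball by blast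
  then show ?thesis
  proof eventually_elim
    case (elim x)
    have "x \<in> (\<Union>n::nat. box (- (real n *\<^sub>R One)) (real n *\<^sub>R One))" unfolding UN_box_eq_UNIV by simp
    then obtain n :: nat where "x \<in> box (- (real n *\<^sub>R One)) (real n *\<^sub>R One)" by blast
    then show ?case using elim[rule_format, of n] by simp
  qed
qed

section \<open>The graph of the harmonic oscillator\<close>

lemma poly_le_exp: "\<exists>K\<ge>0. \<forall>s::real. \<bar>poly p s\<bar> \<le> K * exp \<bar>s\<bar>"
proof -
  have pw: "\<bar>s\<bar> ^ n \<le> fact n * exp \<bar>s\<bar>" for n and s :: real
  proof -
    have "(\<Sum>k\<in>{n}. \<bar>s\<bar> ^ k /\<^sub>R fact k) \<le> exp \<bar>s\<bar>"
      unfolding exp_def by (intro sum_le_suminf summable_exp_generic) auto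
    then show ?thesis by (simp add: field_simps)
  qed
  have "\<bar>poly p s\<bar> \<le> (\<Sum>i\<le>degree p. \<bar>coeff p i\<bar> * fact i) * exp \<bar>s\<bar>" for s
  proof -
    have "\<bar>poly p s\<bar> \<le> (\<Sum>i\<le>degree p. \<bar>coeff p i * s ^ i\<bar>)" unfolding poly_altdef by (rule sum_abs)
    also have "\<dots> \<le> (\<Sum>i\<le>degree p. \<bar>coeff p i\<bar> * (fact i * exp \<bar>s\<bar>))"
      by (intro sum_mono) (auto simp: abs_mult power_abs intro!: mult_left_mono pw)
    finally show ?thesis by (simp add: sum_distrib_right mult.assoc)
  qed
  then show ?thesis by (intro exI[of _ "\<Sum>i\<le>degree p. \<bar>coeff p i\<bar> * fact i"]) (auto intro!: sum_nonneg)
qed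

text \<open>One weight, in which exp |s| absorbs all polynomials, serves for every Hermite function
  and its derivatives in the dominated convergence below.\<close>

lemma hermite_weight:
  "\<exists>K\<ge>0. \<forall>s. \<bar>poly q s * hermite n s\<bar> \<le> K * (exp \<bar>s\<bar> * exp (- s\<^sup>2 / 2))"
proof -
  obtain p where p: "\<And>x. hermite n x = poly p x * exp (- x\<^sup>2 / 2)" using hermite_poly by blast
  obtain K where K: "K \<ge> 0" "\<And>s. \<bar>poly (q * p) s\<bar> \<le> K * exp \<bar>s\<bar>" using poly_le_exp by blast
  have "\<bar>poly q s * hermite n s\<bar> \<le> K * (exp \<bar>s\<bar> * exp (- s\<^sup>2 / 2))" for s
  proof -
    have "\<bar>poly q s * hermite n s\<bar> = \<bar>poly (q * p) s\<bar> * exp (- s\<^sup>2 / 2)" by (simp add: p abs_mult)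
    also have "\<dots> \<le> K * exp \<bar>s\<bar> * exp (- s\<^sup>2 / 2)" by (intro mult_right_mono K) auto
    finally show ?thesis by simp
  qed
  then show ?thesis using K by blast
qed

text \<open>The graph is defined by compactly supported test functions, and Hermite functions are
  not among them. They are cut off at radius R; the terms with derivatives of the cut-off disappear
  in the limit under a square-integrable majorant.\<close>

lemma harmonic_oscillator_coefficient:
  fixes u w :: "real^'d::finite \<Rightarrow> complex"
  assumes \<theta>: "smooth_step \<theta>" and uw: "(u, w) \<in> harmonic_oscillator"
  shows "L2_inner w (cHerm k) = of_real (eig k) * L2_inner u (cHerm k)"
proof -
  have u: "u \<in> L2" and w: "w \<in> L2" using uw by (auto simp: harmonic_oscillator_def)
  have [measurable]: "u \<in> borel_measurable borel" "w \<in> borel_measurable borel" using u w by (auto dest: L2_measurable)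
  define \<theta>1 where "\<theta>1 = (\<lambda>s. vector_derivative \<theta> (at s))"
  define \<theta>2 where "\<theta>2 = (\<lambda>s. vector_derivative \<theta>1 (at s))"
  obtain B where B: "B \<ge> 1" "\<And>s. cmod (\<theta> s) \<le> B" "\<And>s. cmod (\<theta>1 s) \<le> B" "\<And>s. cmod (\<theta>2 s) \<le> B"
    and z: "\<And>s. s < 0 \<Longrightarrow> \<theta>1 s = 0" "\<And>s. s < 0 \<Longrightarrow> \<theta>2 s = 0"
  proof (rule smooth_step_bounds[OF \<theta>])
    fix B assume p: "1 \<le> B" "\<And>s. cmod (\<theta> s) \<le> B" "\<And>s. cmod (vector_derivative \<theta> (at s)) \<le> B"
      "\<And>s. cmod (vector_derivative (\<lambda>s. vector_derivative \<theta> (at s)) (at s)) \<le> B"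
      "\<And>s. s < 0 \<Longrightarrow> vector_derivative \<theta> (at s) = 0" "\<And>s. s < 0 \<Longrightarrow> vector_derivative (\<lambda>s. vector_derivative \<theta> (at s)) (at s) = 0"
    show thesis by (rule that[of B]) (use p in \<open>simp_all add: \<theta>1_def \<theta>2_def\<close>)
  qed
  have s: "smooth1 \<theta>" "\<And>s. s \<le> 0 \<Longrightarrow> \<theta> s = 1" "\<And>s. s \<ge> 1 \<Longrightarrow> \<theta> s = 0" using \<theta> by (auto simp: smooth_step_def)
  have s1: "smooth1 \<theta>1" unfolding \<theta>1_def by (rule smooth1_deriv[OF s(1)])
  \<comment> \<open>For R >= 0 equal to 1 on |s| <= R and to 0 on |s| >= R + 1; \<open>cut1\<close>
    and \<open>cut2\<close> are its first two derivatives.\<close>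
  define cut where "cut R s = \<theta> (1 * s + (- R)) * \<theta> ((-1) * s + (- R))" for R s :: real
  define cut1 where "cut1 R s = - \<theta> (1 * s + (- R)) * \<theta>1 ((-1) * s + (- R)) + \<theta>1 (1 * s + (- R)) * \<theta> ((-1) * s + (- R))" for R s :: real
  define cut2 where "cut2 R s = \<theta> (1 * s + (- R)) * \<theta>2 ((-1) * s + (- R)) - 2 * (\<theta>1 (1 * s + (- R)) * \<theta>1 ((-1) * s + (- R))) + \<theta>2 (1 * s + (- R)) * \<theta> ((-1) * s + (- R))" for R s :: real
  have aff: "smooth1 (\<lambda>s. f (a * s + b))" if "smooth1 f" for f :: "real \<Rightarrow> complex" and a b
    using smooth1_comp[OF that smooth1_affine[of a b]] .
  have cut_smooth: "smooth1 (cut R)" for R unfolding cut_def[abs_def] by (intro smooth1_mult aff s)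
  have d\<theta>: "vector_derivative (\<lambda>s. \<theta> (a * s + b)) (at x) = a *\<^sub>R \<theta>1 (a * x + b)" for a b x
    unfolding \<theta>1_def by (rule vector_derivative_affine[OF s(1)])
  have d\<theta>1: "vector_derivative (\<lambda>s. \<theta>1 (a * s + b)) (at x) = a *\<^sub>R \<theta>2 (a * x + b)" for a b x
    unfolding \<theta>2_def by (rule vector_derivative_affine[OF s1])
  have cut_d1: "(\<lambda>s. vector_derivative (cut R) (at s)) = cut1 R" for R
  proof
    fix x
    show "vector_derivative (cut R) (at x) = cut1 R x"
      unfolding cut_def[abs_def] cut1_def vector_derivative_smooth1_mult[OF aff[OF s(1), of 1 "- R"] aff[OF s(1), of "-1" "- R"]] d\<theta> by simp
  qed
  have cut_d2: "vector_derivative (cut1 R) (at x) = cut2 R x" for R x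
  proof -
    have "(cut1 R has_vector_derivative ((- \<theta> (1 * x + (- R))) * ((-1) *\<^sub>R \<theta>2 ((-1) * x + (- R))) + (- (1 *\<^sub>R \<theta>1 (1 * x + (- R)))) * \<theta>1 ((-1) * x + (- R)))
       + (\<theta>1 (1 * x + (- R)) * ((-1) *\<^sub>R \<theta>1 ((-1) * x + (- R))) + (1 *\<^sub>R \<theta>2 (1 * x + (- R))) * \<theta> ((-1) * x + (- R)))) (at x)"
      unfolding cut1_def[abs_def] d\<theta>[symmetric] d\<theta>1[symmetric]
      by (intro has_vector_derivative_add has_vector_derivative_mult has_vector_derivative_minus smooth1D aff s s1)
    then show ?thesis unfolding cut2_def by (simp add: vector_derivative_at)
  qed
  have cut_bounds: "cmod (cut R s) \<le> 4 * B\<^sup>2" "cmod (cut1 R s) \<le> 4 * B\<^sup>2" "cmod (cut2 R s) \<le> 4 * B\<^sup>2" for R s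
  proof -
    have m: "cmod (x * y) \<le> B\<^sup>2" if "cmod x \<le> B" "cmod y \<le> B" for x y :: complex
      unfolding norm_mult power2_eq_square by (intro mult_mono that) (use B in auto)
    have B2: "B\<^sup>2 \<ge> 0" by simp
    show "cmod (cut R s) \<le> 4 * B\<^sup>2" unfolding cut_def using B2 by (intro order_trans[OF m[OF B(2) B(2)]]) linarith
    have "cmod (cut1 R s) \<le> cmod (- \<theta> (1 * s + (- R)) * \<theta>1 ((-1) * s + (- R))) + cmod (\<theta>1 (1 * s + (- R)) * \<theta> ((-1) * s + (- R)))"
      unfolding cut1_def by (rule norm_triangle_ineq)
    also have "\<dots> \<le> B\<^sup>2 + B\<^sup>2" by (intro add_mono m) (use B in auto)
    finally show "cmod (cut1 R s) \<le> 4 * B\<^sup>2" using B2 by linarith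
    have "cmod (cut2 R s) \<le> cmod (\<theta> (1 * s + (- R)) * \<theta>2 ((-1) * s + (- R))) + cmod (2 * (\<theta>1 (1 * s + (- R)) * \<theta>1 ((-1) * s + (- R)))) + cmod (\<theta>2 (1 * s + (- R)) * \<theta> ((-1) * s + (- R)))"
      unfolding cut2_def by (intro order_trans[OF norm_triangle_ineq] add_right_mono norm_triangle_ineq4)
    also have "\<dots> \<le> B\<^sup>2 + 2 * B\<^sup>2 + B\<^sup>2"
      unfolding norm_mult[of 2] by (intro add_mono m mult_mono) (use B in auto)
    finally show "cmod (cut2 R s) \<le> 4 * B\<^sup>2" by simp
  qed
  have cut_lim: "cut R s = 1" "cut1 R s = 0" "cut2 R s = 0" if "R > \<bar>s\<bar>" for R s
    using that by (auto simp: cut_def cut1_def cut2_def s(2) z)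
  define h1 where "h1 n s = of_real (sqrt (2 * real n)) * chermite (n - 1) s - of_real s * chermite n s" for n s
  define h2 where "h2 n s = (of_real (s\<^sup>2) - of_real (2 * real n + 1)) * chermite n s" for n s
  define f where "f R i s = cut R s * chermite (k i) s" for R i s
  define f2 where "f2 R i s = cut2 R s * chermite (k i) s + 2 * (cut1 R s * h1 (k i) s) + cut R s * h2 (k i) s" for R i s
  have f_smooth: "smooth1 (f R i)" for R i unfolding f_def[abs_def] by (intro smooth1_mult cut_smooth smooth1_chermite)
  have f_d2: "vector_derivative (\<lambda>s. vector_derivative (f R i) (at s)) (at x) = f2 R i x" for R i x
  proof -
    have d1: "(\<lambda>s. vector_derivative (f R i) (at s)) = (\<lambda>s. cut R s * h1 (k i) s + cut1 R s * chermite (k i) s)"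
      unfolding f_def[abs_def] h1_def
      using cut_d1[of R] by (subst vector_derivative_smooth1_mult[OF cut_smooth smooth1_chermite]) (auto simp: chermite_deriv1 fun_eq_iff)
    have h1': "(h1 (k i) has_vector_derivative h2 (k i) x) (at x)"
    proof -
      have "h1 (k i) = (\<lambda>s. vector_derivative (chermite (k i)) (at s))" unfolding h1_def chermite_deriv1 ..
      then show ?thesis using smooth1D[OF smooth1_deriv[OF smooth1_chermite[of "k i"]], of x]
        unfolding h2_def chermite_deriv2[symmetric] by simp
    qed
    have cut': "(cut R has_vector_derivative cut1 R x) (at x)" using smooth1D[OF cut_smooth[of R], of x] cut_d1[of R] by (metis)
    have cut1': "(cut1 R has_vector_derivative cut2 R x) (at x)"
      using smooth1D[OF smooth1_deriv[OF cut_smooth[of R]], of x] unfolding cut_d1 cut_d2 .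
    have c': "(chermite (k i) has_vector_derivative h1 (k i) x) (at x)"
      using smooth1D[OF smooth1_chermite[of "k i"], of x] unfolding chermite_deriv1 h1_def .
    have "((\<lambda>s. cut R s * h1 (k i) s + cut1 R s * chermite (k i) s) has_vector_derivative
        (cut R x * h2 (k i) x + cut1 R x * h1 (k i) x) + (cut1 R x * h1 (k i) x + cut2 R x * chermite (k i) x)) (at x)"
      by (intro has_vector_derivative_add has_vector_derivative_mult h1' cut' cut1' c')
    then show ?thesis unfolding d1 f2_def by (simp add: vector_derivative_at algebra_simps)
  qed
  define \<omega> where "\<omega> s = exp \<bar>s\<bar> * exp (- s\<^sup>2 / 2)" for s :: real
  have \<omega>: "\<omega> s \<ge> 0" for s by (simp add: \<omega>_def)
  have "\<exists>C\<ge>0. \<forall>R i s. cmod (f R i s) \<le> C * \<omega> s \<and> cmod (f2 R i s) \<le> C * \<omega> s \<and> cmod (of_real (s\<^sup>2) * f R i s) \<le> C * \<omega> s"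
  proof -
    have "\<exists>C\<ge>0. \<forall>R s. cmod (f R i s) \<le> C * \<omega> s \<and> cmod (f2 R i s) \<le> C * \<omega> s \<and> cmod (of_real (s\<^sup>2) * f R i s) \<le> C * \<omega> s" for i
    proof -
      obtain K0 where K0: "K0 \<ge> 0" "\<And>s. \<bar>hermite (k i) s\<bar> \<le> K0 * \<omega> s"
        using hermite_weight[of 1 "k i"] unfolding \<omega>_def by auto
      obtain K1 where K1: "K1 \<ge> 0" "\<And>s. \<bar>hermite (k i - 1) s\<bar> \<le> K1 * \<omega> s"
        using hermite_weight[of 1 "k i - 1"] unfolding \<omega>_def by auto
      obtain K2 where K2: "K2 \<ge> 0" "\<And>s. \<bar>s * hermite (k i) s\<bar> \<le> K2 * \<omega> s"
        using hermite_weight[of "[:0, 1:]" "k i"] unfolding \<omega>_def by auto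
      obtain K3 where K3: "K3 \<ge> 0" "\<And>s. \<bar>s\<^sup>2 * hermite (k i) s\<bar> \<le> K3 * \<omega> s"
        using hermite_weight[of "[:0, 0, 1:]" "k i"] unfolding \<omega>_def by (auto simp: power2_eq_square)
      define L1 where "L1 = sqrt (2 * real (k i)) * K1 + K2"
      define L2 where "L2 = K3 + (2 * real (k i) + 1) * K0"
      have b1: "cmod (h1 (k i) s) \<le> L1 * \<omega> s" for s
      proof -
        have "cmod (h1 (k i) s) \<le> sqrt (2 * real (k i)) * \<bar>hermite (k i - 1) s\<bar> + \<bar>s * hermite (k i) s\<bar>"
          unfolding h1_def by (rule order_trans[OF norm_triangle_ineq4]) (simp add: norm_mult abs_mult)
        also have "\<dots> \<le> sqrt (2 * real (k i)) * (K1 * \<omega> s) + K2 * \<omega> s"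
          by (intro add_mono mult_left_mono K1 K2) auto
        finally show ?thesis by (simp add: L1_def algebra_simps)
      qed
      have b2: "cmod (h2 (k i) s) \<le> L2 * \<omega> s" for s
      proof -
        have "cmod (h2 (k i) s) = \<bar>s\<^sup>2 * hermite (k i) s - (2 * real (k i) + 1) * hermite (k i) s\<bar>"
          unfolding h2_def left_diff_distrib[symmetric] norm_mult abs_mult of_real_diff[symmetric] norm_of_real ..
        also have "\<dots> \<le> \<bar>s\<^sup>2 * hermite (k i) s\<bar> + (2 * real (k i) + 1) * \<bar>hermite (k i) s\<bar>"
          by (rule order_trans[OF abs_triangle_ineq4]) (simp add: abs_mult)
        also have "\<dots> \<le> K3 * \<omega> s + (2 * real (k i) + 1) * (K0 * \<omega> s)"
          by (intro add_mono mult_left_mono K0 K3) auto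
        finally show ?thesis by (simp add: L2_def algebra_simps)
      qed
      have L: "L1 \<ge> 0" "L2 \<ge> 0" unfolding L1_def L2_def using K0 K1 K2 K3 by auto
      define C where "C = 4 * B\<^sup>2 * (K0 + 2 * L1 + L2 + K3)"
      have "cmod (f R i s) \<le> C * \<omega> s" for R s
      proof -
        have "cmod (f R i s) \<le> 4 * B\<^sup>2 * (K0 * \<omega> s)"
          unfolding f_def norm_mult norm_of_real by (intro mult_mono cut_bounds K0) auto
        also have "\<dots> \<le> 4 * B\<^sup>2 * ((K0 + 2 * L1 + L2 + K3) * \<omega> s)"
          using L K3(1) \<omega>[of s] by (intro mult_left_mono mult_right_mono) auto
        finally show ?thesis by (simp add: C_def mult.assoc)
      qed
      moreover have "cmod (of_real (s\<^sup>2) * f R i s) \<le> C * \<omega> s" for R s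
      proof -
        have "cmod (of_real (s\<^sup>2) * f R i s) = cmod (cut R s) * \<bar>s\<^sup>2 * hermite (k i) s\<bar>"
          unfolding f_def norm_mult norm_of_real by (simp add: abs_mult)
        also have "\<dots> \<le> 4 * B\<^sup>2 * (K3 * \<omega> s)" by (intro mult_mono cut_bounds K3) auto
        also have "\<dots> \<le> 4 * B\<^sup>2 * ((K0 + 2 * L1 + L2 + K3) * \<omega> s)"
          using L K0(1) \<omega>[of s] by (intro mult_left_mono mult_right_mono) auto
        finally show ?thesis by (simp add: C_def mult.assoc)
      qed
      moreover have "cmod (f2 R i s) \<le> C * \<omega> s" for R s
      proof -
        have "cmod (f2 R i s) \<le> cmod (cut2 R s * chermite (k i) s) + cmod (2 * (cut1 R s * h1 (k i) s)) + cmod (cut R s * h2 (k i) s)"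
          unfolding f2_def by (intro order_trans[OF norm_triangle_ineq] add_right_mono norm_triangle_ineq)
        also have "\<dots> \<le> 4 * B\<^sup>2 * (K0 * \<omega> s) + 2 * (4 * B\<^sup>2 * (L1 * \<omega> s)) + 4 * B\<^sup>2 * (L2 * \<omega> s)"
          unfolding norm_mult norm_of_real by (intro add_mono mult_mono cut_bounds K0 b1 b2) auto
        also have "\<dots> = 4 * B\<^sup>2 * ((K0 + 2 * L1 + L2) * \<omega> s)" by (simp add: algebra_simps)
        also have "\<dots> \<le> 4 * B\<^sup>2 * ((K0 + 2 * L1 + L2 + K3) * \<omega> s)"
          using K3(1) \<omega>[of s] by (intro mult_left_mono mult_right_mono) auto
        finally show ?thesis by (simp add: C_def mult.assoc)
      qed
      moreover have "C \<ge> 0" unfolding C_def using L K0 K3 by simp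
      ultimately show ?thesis by blast
    qed
    then obtain C where C: "\<And>i. C i \<ge> 0" "\<And>i R s. cmod (f R i s) \<le> C i * \<omega> s" "\<And>i R s. cmod (f2 R i s) \<le> C i * \<omega> s" "\<And>i R s. cmod (of_real (s\<^sup>2) * f R i s) \<le> C i * \<omega> s"
      by metis
    have M: "C i * \<omega> s \<le> (\<Sum>i\<in>UNIV. C i) * \<omega> s" for i s
      by (intro mult_right_mono \<omega> member_le_sum) (auto simp: C)
    show ?thesis
      by (intro exI[of _ "\<Sum>i\<in>UNIV. C i"] conjI allI sum_nonneg C(1) order_trans[OF C(2) M] order_trans[OF C(3) M] order_trans[OF C(4) M])
  qed
  then obtain C where C: "C \<ge> 0" "\<And>R i s. cmod (f R i s) \<le> C * \<omega> s" "\<And>R i s. cmod (f2 R i s) \<le> C * \<omega> s" "\<And>R i s. cmod (of_real (s\<^sup>2) * f R i s) \<le> C * \<omega> s"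
    by blast
  \<comment> \<open>A majorant uniform in R. Its square integrability is what allows pairing with
    arbitrary u and w in L2.\<close>
  define W where "W x = complex_of_real (\<Prod>i\<in>UNIV. C * \<omega> (x $ i))" for x :: "real^'d"
  have W_nn: "(\<Prod>i\<in>UNIV. C * \<omega> (x $ i)) \<ge> 0" for x :: "real^'d" using C(1) \<omega> by (intro prod_nonneg) auto
  have WL2: "W \<in> L2"
    unfolding L2_iff
  proof
    have [measurable]: "\<omega> \<in> borel_measurable borel" unfolding \<omega>_def[abs_def] by measurable
    show "W \<in> borel_measurable borel" unfolding W_def[abs_def] by measurable
    have "integrable lborel (\<lambda>s. complex_of_real ((C * \<omega> s)\<^sup>2))"
    proof -
      have "integrable lborel (\<lambda>s. C\<^sup>2 / 4 * (((1 + \<bar>s\<bar> ^ 0) * exp (1 * \<bar>s\<bar>) * exp (- s\<^sup>2 / 2))\<^sup>2))"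
        by (intro integrable_mult_right integrable_gaussian_weight)
      moreover have "C\<^sup>2 / 4 * (((1 + \<bar>s\<bar> ^ 0) * exp (1 * \<bar>s\<bar>) * exp (- s\<^sup>2 / 2))\<^sup>2) = (C * \<omega> s)\<^sup>2" for s
        by (simp add: \<omega>_def power_mult_distrib)
      ultimately show ?thesis by (simp only: complex_of_real_integrable_eq)
    qed
    then have "integrable lborel (\<lambda>x::real^'d. \<Prod>i\<in>UNIV. complex_of_real ((C * \<omega> (x $ i))\<^sup>2))"
      by (rule tensor_integral(1))
    moreover have "(\<Prod>i\<in>UNIV. complex_of_real ((C * \<omega> (x $ i))\<^sup>2)) = complex_of_real ((cmod (W x))\<^sup>2)" for x :: "real^'d"
      unfolding W_def norm_of_real power2_abs by (simp add: prod_power_distrib)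
    ultimately show "integrable lborel (\<lambda>x. (cmod (W x))\<^sup>2)" by (simp only: complex_of_real_integrable_eq)
  qed
  define \<phi> where "\<phi> n = tens (f (real n))" for n :: nat
  have tf: "test_function (\<phi> n)" for n
    unfolding \<phi>_def
  proof (rule test_function_tens[OF f_smooth, of "\<chi> i. - (real n + 1)" "\<chi> i. real n + 1"])
    show "f (real n) i s = 0" if "s < (\<chi> i. - (real n + 1)) $ i \<or> s > (\<chi> i. real n + 1) $ i" for i s
      using that by (auto simp: f_def cut_def s(3))
  qed
  define H where "H n x = - laplacian (\<phi> n) x + complex_of_real ((norm x)\<^sup>2) * \<phi> n x" for n x
  have lap: "laplacian (\<phi> n) x = (\<Sum>i\<in>UNIV. f2 (real n) i (x $ i) * (\<Prod>l\<in>UNIV - {i}. f (real n) l (x $ l)))" for n x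
    unfolding \<phi>_def laplacian_tens[OF f_smooth] f_d2 tens_upd ..
  have nsq: "complex_of_real ((norm x)\<^sup>2) * \<phi> n x = (\<Sum>i\<in>UNIV. (of_real ((x $ i)\<^sup>2) * f (real n) i (x $ i)) * (\<Prod>l\<in>UNIV - {i}. f (real n) l (x $ l)))" for n x
  proof -
    have "\<phi> n x = f (real n) i (x $ i) * (\<Prod>l\<in>UNIV - {i}. f (real n) l (x $ l))" for i
      unfolding \<phi>_def tens_def by (rule prod.remove) auto
    then have P: "of_real ((x $ i)\<^sup>2) * \<phi> n x = (of_real ((x $ i)\<^sup>2) * f (real n) i (x $ i)) * (\<Prod>l\<in>UNIV - {i}. f (real n) l (x $ l))" for i
      by (metis mult.assoc)
    show ?thesis unfolding norm_sq_vec of_real_sum sum_distrib_right by (rule sum.cong[OF refl P])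
  qed
  have prodW: "cmod a * (\<Prod>l\<in>UNIV - {i}. cmod (f (real n) l (x $ l))) \<le> cmod (W x)" if "cmod a \<le> C * \<omega> (x $ i)" for a i n x
  proof -
    have "cmod a * (\<Prod>l\<in>UNIV - {i}. cmod (f (real n) l (x $ l))) \<le> C * \<omega> (x $ i) * (\<Prod>l\<in>UNIV - {i}. C * \<omega> (x $ l))"
      using C \<omega> by (intro mult_mono that prod_mono prod_nonneg) auto
    also have "\<dots> = (\<Prod>l\<in>UNIV. C * \<omega> (x $ l))" by (rule prod.remove[symmetric]) auto
    also have "\<dots> = cmod (W x)" unfolding W_def norm_of_real using W_nn[of x] by simp
    finally show ?thesis .
  qed
  have \<phi>W: "cmod (\<phi> n x) \<le> cmod (W x)" for n x
  proof -
    \<comment> \<open>An arbitrary coordinate is singled out so that \<open>prodW\<close>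
      applies.\<close>
    have "\<phi> n x = f (real n) undefined (x $ undefined) * (\<Prod>l\<in>UNIV - {undefined}. f (real n) l (x $ l))"
      unfolding \<phi>_def tens_def by (rule prod.remove) auto
    then show ?thesis using prodW[OF C(2)] by (simp add: norm_mult flip: prod_norm)
  qed
  \<comment> \<open>The 2 d terms are d from the Laplacian and d from |x|^2.\<close>
  have HW: "cmod (H n x) \<le> 2 * real CARD('d) * cmod (W x)" for n x
  proof -
    have "cmod (H n x) \<le> cmod (laplacian (\<phi> n) x) + cmod (complex_of_real ((norm x)\<^sup>2) * \<phi> n x)"
      unfolding H_def by (rule order_trans[OF norm_triangle_ineq]) simp
    also have "\<dots> \<le> (\<Sum>i\<in>(UNIV::'d set). cmod (W x)) + (\<Sum>i\<in>(UNIV::'d set). cmod (W x))"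
      unfolding lap nsq by (intro add_mono sum_norm_le) (auto simp only: norm_mult[of _ "prod _ _"] prod_norm[symmetric] intro!: prodW C)
    finally show ?thesis by simp
  qed
  have big: "\<forall>\<^sub>F n in sequentially. \<forall>i. real n > \<bar>x $ i\<bar>" for x :: "real^'d"
  proof -
    obtain N :: nat where N: "norm x < real N" using reals_Archimedean2 by blast
    have "\<bar>x $ i\<bar> < real n" if "n \<ge> N" for n i
      using component_le_norm_cart[of x i] N that by (meson le_less_trans less_le_trans of_nat_mono)
    then show ?thesis by (auto simp: eventually_sequentially)
  qed
  have \<phi>_lim: "(\<lambda>n. \<phi> n x) \<longlonglongrightarrow> cHerm k x" for x
  proof (rule tendsto_eventually)
    show "\<forall>\<^sub>F n in sequentially. \<phi> n x = cHerm k x"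
      using big[of x] by eventually_elim (auto simp: \<phi>_def cHerm_tens tens_def f_def cut_lim)
  qed
  have H_lim: "(\<lambda>n. H n x) \<longlonglongrightarrow> of_real (eig k) * cHerm k x" for x
  proof (rule tendsto_eventually)
    have cl: "laplacian (cHerm k) x = (\<Sum>i\<in>UNIV. h2 (k i) (x $ i) * (\<Prod>l\<in>UNIV - {i}. chermite (k l) (x $ l)))"
      unfolding cHerm_tens laplacian_tens[OF smooth1_chermite] chermite_deriv2 tens_upd h2_def ..
    show "\<forall>\<^sub>F n in sequentially. H n x = of_real (eig k) * cHerm k x"
      using big[of x]
    proof eventually_elim
      case (elim n)
      have "laplacian (\<phi> n) x = laplacian (cHerm k) x"
        unfolding lap cl using elim by (intro sum.cong refl) (simp add: f_def f2_def cut_lim)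
      moreover have "\<phi> n x = cHerm k x" using elim by (auto simp: \<phi>_def cHerm_tens tens_def f_def cut_lim)
      ultimately show ?case unfolding H_def using laplacian_cHerm[of k x] by simp
    qed
  qed
  have [measurable]: "\<phi> n \<in> borel_measurable borel" for n by (rule test_function_measurable[OF tf])
  have [measurable]: "laplacian (\<phi> n) \<in> borel_measurable borel" for n
    unfolding laplacian_def[abs_def]
    by (intro borel_measurable_sum test_function_measurable test_function_dir_deriv tf)
  have [measurable]: "H n \<in> borel_measurable borel" for n
    unfolding H_def[abs_def] by measurable
  have [measurable]: "cHerm k \<in> borel_measurable borel" using L2_measurable[OF cHerm_L2] .
  have lim1: "(\<lambda>n. \<integral>x. w x * \<phi> n x \<partial>lborel) \<longlonglongrightarrow> (\<integral>x. w x * cHerm k x \<partial>lborel)"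
  proof (rule integral_dominated_convergence)
    show "integrable lborel (\<lambda>x. norm (w x * W x))" by (intro integrable_norm L2_mult_integrable w WL2)
  qed (auto intro!: AE_I2 tendsto_mult \<phi>_lim mult_left_mono \<phi>W simp: norm_mult)
  have lim2: "(\<lambda>n. \<integral>x. u x * H n x \<partial>lborel) \<longlonglongrightarrow> (\<integral>x. u x * (of_real (eig k) * cHerm k x) \<partial>lborel)"
  proof (rule integral_dominated_convergence)
    show "integrable lborel (\<lambda>x. 2 * real CARD('d) * norm (u x * W x))" by (intro integrable_mult_right integrable_norm L2_mult_integrable u WL2)
    show "AE x in lborel. norm (u x * H n x) \<le> 2 * real CARD('d) * norm (u x * W x)" for n
    proof (intro AE_I2)
      fix x show "norm (u x * H n x) \<le> 2 * real CARD('d) * norm (u x * W x)"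
        using mult_left_mono[OF HW[of n x], of "cmod (u x)"] by (simp add: norm_mult mult_ac)
    qed
  qed (auto intro!: AE_I2 tendsto_mult H_lim)
  have "(\<integral>x. u x * H n x \<partial>lborel) = (\<integral>x. w x * \<phi> n x \<partial>lborel)" for n
    using uw tf[of n] unfolding harmonic_oscillator_def H_def by blast
  then have "(\<integral>x. u x * (of_real (eig k) * cHerm k x) \<partial>lborel) = (\<integral>x. w x * cHerm k x \<partial>lborel)"
    using LIMSEQ_unique[OF lim1] lim2 by simp
  moreover have "(\<integral>x. u x * (of_real (eig k) * cHerm k x) \<partial>lborel) = of_real (eig k) * (\<integral>x. u x * cHerm k x \<partial>lborel)"
    by (subst integral_mult_right_zero[symmetric]) (simp add: mult_ac)
  \<comment> \<open>The test pairing has no conjugation and the inner product has one; they agree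
    because Hermite functions are real.\<close>
  ultimately show ?thesis by (simp add: L2_inner_def cHerm_def)
qed

section \<open>Completeness and the functional calculus of the harmonic oscillator\<close>

lemma cHerm_total:
  assumes "u \<in> L2" "\<And>k. L2_inner u (cHerm k) = 0"
  shows "AE x in lborel. u x = 0"
  using assms by (intro AE_zero_of_Herm_orthogonal) (auto simp: L2_iff L2_inner_def cHerm_def)

lemma AE_eq_of_coefficients:
  assumes "u \<in> L2" "v \<in> L2" "\<And>k. L2_inner u (cHerm k) = L2_inner v (cHerm k)"
  shows "AE x in lborel. u x = v x"
proof -
  have "AE x in lborel. u x - v x = 0"
    using L2_inner_lin_left[OF assms(1,2) cHerm_L2, of 1 "-1"] assms(3) by (intro cHerm_total L2_diff assms) simp
  then show ?thesis by simp
qed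

text \<open>The choice in \<open>fun_of_H\<close> has a witness, because the Hermite functions form
  an orthonormal basis that diagonalizes every pair in the graph.\<close>

lemma fun_of_H_calculus:
  assumes "smooth_step \<theta>"
  shows "borel_functional_calculus (harmonic_oscillator :: ((real^'d::finite \<Rightarrow> complex) \<times> _) set) fun_of_H"
proof -
  obtain \<iota> :: "nat \<Rightarrow> 'd \<Rightarrow> nat" where \<iota>: "bij \<iota>" using exists_bij_index by blast
  interpret orthonormal_basis "\<lambda>n. cHerm (\<iota> n)"
  proof
    show "L2_inner (cHerm (\<iota> m)) (cHerm (\<iota> n)) = (if m = n then 1 else 0)" for m n
      using \<iota> by (auto simp: cHerm_orthonormal bij_def inj_eq)
    fix u assume u: "u \<in> L2" "\<And>n. L2_inner u (cHerm (\<iota> n)) = 0"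
    have "L2_inner u (cHerm k) = 0" for k using u(2)[of "inv \<iota> k"] \<iota> by (simp add: bij_is_surj surj_f_inv_f)
    then show "AE x in lborel. u x = 0" using u by (intro cHerm_total)
  qed (rule cHerm_L2)
  have "\<exists>\<Phi>. borel_functional_calculus (harmonic_oscillator :: ((real^'d \<Rightarrow> complex) \<times> _) set) \<Phi>"
  proof (rule functional_calculus_exists[of _ "\<lambda>n. eig (\<iota> n)"], intro conjI allI)
    fix u w assume uw: "(u, w) \<in> (harmonic_oscillator :: ((real^'d \<Rightarrow> complex) \<times> _) set)"
    then show "u \<in> L2" "w \<in> L2" by (auto simp: harmonic_oscillator_def)
    show "L2_inner w (cHerm (\<iota> n)) = of_real (eig (\<iota> n)) * L2_inner u (cHerm (\<iota> n))" for n
      by (rule harmonic_oscillator_coefficient[OF assms uw])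
  qed
  then show ?thesis unfolding fun_of_H_def by (rule someI_ex)
qed

lemma fun_of_H_coefficient:
  assumes "smooth_step \<theta>" "bounded_borel f" "u \<in> L2"
  shows "fun_of_H f u \<in> L2" "L2_inner (fun_of_H f u) (cHerm k) = f (eig k) * L2_inner u (cHerm k)"
  using fc_L2[OF fun_of_H_calculus[OF assms(1)] assms(2,3)]
    fc_coefficient[OF fun_of_H_calculus[OF assms(1)] cHerm_L2 cHerm_eigenfunction assms(2,3)] by auto

section \<open>Finite Hermite sums\<close>

text \<open>A finite Hermite sum is represented by its coefficients \<open>c\<close>: \<open>hs c\<close> is the function, \<open>csq c\<close> its squared norm.\<close>

definition supp :: "(('d \<Rightarrow> nat) \<Rightarrow> complex) \<Rightarrow> ('d \<Rightarrow> nat) set" where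
  "supp c = {k. c k \<noteq> 0}"

text \<open>A pairing with an arbitrary family F: ladder operators on coefficients can be transposed
  to operations on F, whatever F is.\<close>

definition ev :: "(('d \<Rightarrow> nat) \<Rightarrow> complex) \<Rightarrow> (('d \<Rightarrow> nat) \<Rightarrow> complex) \<Rightarrow> complex" where
  "ev F c = (\<Sum>k\<in>supp c. c k * F k)"

definition hs :: "(('d::finite \<Rightarrow> nat) \<Rightarrow> complex) \<Rightarrow> real^'d \<Rightarrow> complex" where
  "hs c x = ev (\<lambda>k. cHerm k x) c"

definition csq :: "(('d \<Rightarrow> nat) \<Rightarrow> complex) \<Rightarrow> real" where
  "csq c = (\<Sum>k\<in>supp c. (cmod (c k))\<^sup>2)"

lemma ev_superset: "finite K \<Longrightarrow> supp c \<subseteq> K \<Longrightarrow> ev F c = (\<Sum>k\<in>K. c k * F k)"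
  unfolding ev_def by (intro sum.mono_neutral_left) (auto simp: supp_def)

lemma csq_superset: "finite K \<Longrightarrow> supp c \<subseteq> K \<Longrightarrow> csq c = (\<Sum>k\<in>K. (cmod (c k))\<^sup>2)"
  unfolding csq_def by (intro sum.mono_neutral_left) (auto simp: supp_def)

lemma csq_nonneg [simp]: "csq c \<ge> 0" unfolding csq_def by (intro sum_nonneg) auto

lemma ev_sum:
  assumes "finite I" "\<And>i. i \<in> I \<Longrightarrow> finite (supp (c i))"
  shows "ev F (\<lambda>k. \<Sum>i\<in>I. a i * c i k) = (\<Sum>i\<in>I. a i * ev F (c i))"
    and "finite (supp (\<lambda>k. \<Sum>i\<in>I. a i * c i k))"
proof -
  let ?K = "\<Union>i\<in>I. supp (c i)"
  have fin: "finite ?K" using assms by auto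
  have sub: "supp (\<lambda>k. \<Sum>i\<in>I. a i * c i k) \<subseteq> ?K" by (auto simp: supp_def intro!: sum.neutral)
  show "finite (supp (\<lambda>k. \<Sum>i\<in>I. a i * c i k))" by (rule finite_subset[OF sub fin])
  have "ev F (\<lambda>k. \<Sum>i\<in>I. a i * c i k) = (\<Sum>k\<in>?K. (\<Sum>i\<in>I. a i * c i k) * F k)" by (rule ev_superset[OF fin sub])
  also have "\<dots> = (\<Sum>i\<in>I. a i * (\<Sum>k\<in>?K. c i k * F k))"
    unfolding sum_distrib_right sum_distrib_left by (subst sum.swap) (simp add: mult.assoc)
  also have "\<dots> = (\<Sum>i\<in>I. a i * ev F (c i))"
    by (intro sum.cong refl arg_cong2[where f="(*)"] ev_superset[OF fin, symmetric]) auto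
  finally show "ev F (\<lambda>k. \<Sum>i\<in>I. a i * c i k) = (\<Sum>i\<in>I. a i * ev F (c i))" .
qed

lemma ev_add_scaled:
  assumes "finite (supp c)" "finite (supp d)"
  shows "ev F (\<lambda>k. c k + s * d k) = ev F c + s * ev F d" "finite (supp (\<lambda>k. c k + s * d k))"
  using ev_sum(1)[of "{False, True}" "\<lambda>b. if b then d else c" F "\<lambda>b. if b then s else 1"]
    ev_sum(2)[of "{False, True}" "\<lambda>b. if b then d else c" "\<lambda>b. if b then s else 1"] assms by auto

definition inc :: "'d \<Rightarrow> ('d \<Rightarrow> nat) \<Rightarrow> 'd \<Rightarrow> nat" where "inc i k = k(i := Suc (k i))"
definition dec :: "'d \<Rightarrow> ('d \<Rightarrow> nat) \<Rightarrow> 'd \<Rightarrow> nat" where "dec i k = k(i := k i - 1)"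

lemma dec_inc [simp]: "dec i (inc i k) = k" by (simp add: dec_def inc_def)
lemma inc_dec: "k i > 0 \<Longrightarrow> inc i (dec i k) = k" by (auto simp: dec_def inc_def)
lemma inc_apply [simp]: "inc i k i = Suc (k i)" by (simp add: inc_def)
lemma dec_apply [simp]: "dec i k i = k i - 1" by (simp add: dec_def)
lemma inj_inc: "inj_on (inc i) A"
  by (rule inj_on_inverseI[of A "dec i"]) auto
lemma inj_dec: "(\<And>k. k \<in> A \<Longrightarrow> k i > 0) \<Longrightarrow> inj_on (dec i) A"
  by (rule inj_on_inverseI[of A "inc i"]) (auto intro: inc_dec)

text \<open>\<open>Xc 1 i\<close> is multiplication by \<open>x\<^sub>i\<close> and \<open>Xc (-1) i\<close> is the partial derivative.\<close>

definition dnc :: "'d \<Rightarrow> (('d \<Rightarrow> nat) \<Rightarrow> complex) \<Rightarrow> ('d \<Rightarrow> nat) \<Rightarrow> complex" where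
  "dnc i c k = of_real (sqrt ((real (k i) + 1) / 2)) * c (inc i k)"
definition upc :: "'d \<Rightarrow> (('d \<Rightarrow> nat) \<Rightarrow> complex) \<Rightarrow> ('d \<Rightarrow> nat) \<Rightarrow> complex" where
  "upc i c k = (if k i = 0 then 0 else of_real (sqrt (real (k i) / 2)) * c (dec i k))"
definition Xc :: "complex \<Rightarrow> 'd \<Rightarrow> (('d \<Rightarrow> nat) \<Rightarrow> complex) \<Rightarrow> ('d \<Rightarrow> nat) \<Rightarrow> complex" where
  "Xc s i c k = dnc i c k + s * upc i c k"

lemma supp_upc: "supp (upc i c) \<subseteq> inc i ` supp c"
proof
  fix k assume "k \<in> supp (upc i c)"
  then have "k i > 0" "dec i k \<in> supp c" by (auto simp: supp_def upc_def split: if_splits)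
  then show "k \<in> inc i ` supp c" by (intro image_eqI[of _ _ "dec i k"]) (auto simp: inc_dec)
qed

lemma supp_dnc: "supp (dnc i c) \<subseteq> dec i ` {l \<in> supp c. l i > 0}"
proof
  fix k assume "k \<in> supp (dnc i c)"
  then have "inc i k \<in> {l \<in> supp c. l i > 0}" by (auto simp: supp_def dnc_def)
  then show "k \<in> dec i ` {l \<in> supp c. l i > 0}" by (rule image_eqI[rotated]) simp
qed

lemma finite_supp_ops:
  assumes "finite (supp c)"
  shows "finite (supp (dnc i c))" "finite (supp (upc i c))" "finite (supp (Xc s i c))"
proof -
  show 1: "finite (supp (dnc i c))" by (rule finite_subset[OF supp_dnc]) (use assms in auto)
  show 2: "finite (supp (upc i c))" by (rule finite_subset[OF supp_upc]) (use assms in auto)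
  show "finite (supp (Xc s i c))" using ev_add_scaled(2)[OF 1 2] unfolding Xc_def[abs_def] .
qed

lemma ev_upc:
  assumes "finite (supp c)"
  shows "ev F (upc i c) = ev (\<lambda>l. of_real (sqrt ((real (l i) + 1) / 2)) * F (inc i l)) c"
proof -
  have "ev F (upc i c) = (\<Sum>k\<in>inc i ` supp c. upc i c k * F k)"
    by (rule ev_superset[OF _ supp_upc]) (use assms in auto)
  also have "\<dots> = (\<Sum>l\<in>supp c. upc i c (inc i l) * F (inc i l))"
    by (subst sum.reindex[OF inj_inc]) simp
  finally show ?thesis unfolding ev_def by (simp add: upc_def mult_ac add.commute)
qed

lemma ev_dnc:
  assumes "finite (supp c)"
  shows "ev F (dnc i c) = ev (\<lambda>l. of_real (sqrt (real (l i) / 2)) * F (dec i l)) c"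
proof -
  have "ev F (dnc i c) = (\<Sum>k\<in>dec i ` {l \<in> supp c. l i > 0}. dnc i c k * F k)"
    by (rule ev_superset[OF _ supp_dnc]) (use assms in auto)
  also have "\<dots> = (\<Sum>l\<in>{l \<in> supp c. l i > 0}. dnc i c (dec i l) * F (dec i l))"
    by (subst sum.reindex[OF inj_dec]) auto
  also have "\<dots> = (\<Sum>l\<in>{l \<in> supp c. l i > 0}. c l * (of_real (sqrt (real (l i) / 2)) * F (dec i l)))"
    by (intro sum.cong refl) (auto simp: dnc_def inc_dec of_nat_diff)
  also have "\<dots> = ev (\<lambda>l. of_real (sqrt (real (l i) / 2)) * F (dec i l)) c"
    unfolding ev_def using assms by (intro sum.mono_neutral_left) auto
  finally show ?thesis .
qed

text \<open>Raising multiplies the coefficient at l by sqrt ((l_i + 1) / 2), and distinct indices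
  stay distinct. Degrees of order N^2 therefore cost a factor of order N in the norm.\<close>

lemma csq_upc:
  assumes "finite (supp c)" "\<And>k. k \<in> supp c \<Longrightarrow> real (k i) \<le> b"
  shows "csq (upc i c) \<le> (b + 1) / 2 * csq c"
proof -
  have "csq (upc i c) = (\<Sum>k\<in>inc i ` supp c. (cmod (upc i c k))\<^sup>2)"
    by (rule csq_superset[OF _ supp_upc]) (use assms in auto)
  also have "\<dots> = (\<Sum>l\<in>supp c. (cmod (upc i c (inc i l)))\<^sup>2)"
    by (subst sum.reindex[OF inj_inc]) simp
  also have "\<dots> \<le> (\<Sum>l\<in>supp c. (b + 1) / 2 * (cmod (c l))\<^sup>2)"
    using assms(2) by (intro sum_mono) (auto simp: upc_def norm_mult power_mult_distrib intro!: mult_right_mono)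
  finally show ?thesis unfolding csq_def by (simp add: sum_distrib_left)
qed

lemma csq_dnc:
  assumes "finite (supp c)" "\<And>k. k \<in> supp c \<Longrightarrow> real (k i) \<le> b" "b \<ge> 0"
  shows "csq (dnc i c) \<le> b / 2 * csq c"
proof -
  have "csq (dnc i c) = (\<Sum>k\<in>dec i ` {l \<in> supp c. l i > 0}. (cmod (dnc i c k))\<^sup>2)"
    by (rule csq_superset[OF _ supp_dnc]) (use assms in auto)
  also have "\<dots> = (\<Sum>l\<in>{l \<in> supp c. l i > 0}. (cmod (dnc i c (dec i l)))\<^sup>2)"
    by (subst sum.reindex[OF inj_dec]) auto
  also have "\<dots> \<le> (\<Sum>l\<in>{l \<in> supp c. l i > 0}. b / 2 * (cmod (c l))\<^sup>2)"
    using assms(2) by (intro sum_mono) (auto simp: dnc_def inc_dec norm_mult power_mult_distrib of_nat_diff intro!: mult_right_mono)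
  also have "\<dots> \<le> (\<Sum>l\<in>supp c. b / 2 * (cmod (c l))\<^sup>2)"
    using assms by (intro sum_mono2) auto
  finally show ?thesis unfolding csq_def by (simp add: sum_distrib_left)
qed

lemma ev_Xc:
  assumes "finite (supp c)"
  shows "ev F (Xc s i c) = ev (\<lambda>l. of_real (sqrt (real (l i) / 2)) * F (dec i l) + s * (of_real (sqrt ((real (l i) + 1) / 2)) * F (inc i l))) c"
  unfolding Xc_def[abs_def] ev_add_scaled(1)[OF finite_supp_ops(1,2)[OF assms]] ev_upc[OF assms] ev_dnc[OF assms]
  by (simp add: ev_def sum_distrib_left sum.distrib[symmetric] algebra_simps)

lemma cHerm_split: "cHerm k x = chermite (k i) (x $ i) * (\<Prod>l\<in>UNIV - {i}. chermite (k l) (x $ l))"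
  unfolding cHerm_tens tens_def by (rule prod.remove) auto

lemma cHerm_upd: "cHerm (k(i := n)) x = chermite n (x $ i) * (\<Prod>l\<in>UNIV - {i}. chermite (k l) (x $ l))"
  unfolding cHerm_split[of _ _ i] by (auto intro!: arg_cong2[where f="(*)"] prod.cong)

lemma cHerm_mult_x:
  "of_real (x $ i) * cHerm k x = of_real (sqrt (real (k i) / 2)) * cHerm (dec i k) x + 1 * (of_real (sqrt ((real (k i) + 1) / 2)) * cHerm (inc i k) x)"
proof -
  have "complex_of_real (x $ i * hermite (k i) (x $ i)) = of_real (sqrt (real (k i) / 2)) * chermite (k i - 1) (x $ i) + of_real (sqrt ((real (k i) + 1) / 2)) * chermite (Suc (k i)) (x $ i)"
    unfolding hermite_times_x by simp
  then have E: "complex_of_real (x $ i) * chermite (k i) (x $ i) = of_real (sqrt (real (k i) / 2)) * chermite (k i - 1) (x $ i) + of_real (sqrt ((real (k i) + 1) / 2)) * chermite (Suc (k i)) (x $ i)"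
    by (simp only: of_real_mult)
  show ?thesis unfolding dec_def inc_def cHerm_upd cHerm_split[of k x i] mult.assoc[symmetric] E
    by (simp add: algebra_simps)
qed

lemma dir_deriv_cHerm:
  "dir_deriv (axis i 1) (cHerm k) x = of_real (sqrt (real (k i) / 2)) * cHerm (dec i k) x + (-1) * (of_real (sqrt ((real (k i) + 1) / 2)) * cHerm (inc i k) x)"
  unfolding cHerm_tens dir_deriv_tens[OF smooth1_chermite] tens_upd vector_derivative_at[OF chermite_deriv]
  unfolding cHerm_tens[symmetric] dec_def inc_def cHerm_upd
  by (simp add: algebra_simps)

lemma hs_mult_x: "finite (supp c) \<Longrightarrow> of_real (x $ i) * hs c x = hs (Xc 1 i c) x"
  unfolding hs_def ev_Xc cHerm_mult_x[symmetric] by (simp add: ev_def sum_distrib_left mult_ac)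

lemma hs_L2: "hs c \<in> L2"
  unfolding hs_def[abs_def] ev_def by (intro L2_sum L2_cmult cHerm_L2)

lemma hs_inner: "finite (supp c) \<Longrightarrow> L2_inner (hs c) (cHerm k) = c k"
proof -
  assume fin: "finite (supp c)"
  have "L2_inner (\<lambda>x. \<Sum>l\<in>I. c l * cHerm l x) (cHerm k) = (if k \<in> I then c k else 0)" if "finite I" for I
    using that
  proof induction
    case empty show ?case by (simp add: L2_inner_def)
  next
    case (insert a I)
    have "L2_inner (\<lambda>x. \<Sum>l\<in>insert a I. c l * cHerm l x) (cHerm k) = L2_inner (\<lambda>x. c a * cHerm a x + 1 * (\<Sum>l\<in>I. c l * cHerm l x)) (cHerm k)"
      using insert by simp
    also have "\<dots> = c a * L2_inner (cHerm a) (cHerm k) + 1 * L2_inner (\<lambda>x. \<Sum>l\<in>I. c l * cHerm l x) (cHerm k)"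
      by (rule L2_inner_lin_left[OF cHerm_L2 _ cHerm_L2]) (intro L2_sum L2_cmult cHerm_L2)
    finally show ?case using insert by (auto simp: cHerm_orthonormal)
  qed
  from this[OF fin] show ?thesis unfolding hs_def[abs_def] ev_def by (simp add: supp_def)
qed

lemma L2sq_hs: "finite (supp c) \<Longrightarrow> L2sq (hs c) = csq c"
proof -
  assume fin: "finite (supp c)"
  have "(\<integral>x. (cmod (\<Sum>k\<in>supp c. c k * cHerm k x))\<^sup>2 \<partial>lborel) = (\<Sum>k\<in>supp c. 1 * (cmod (c k))\<^sup>2)"
  proof (rule integral_norm_sq_orthogonal(2)[OF fin])
    show "(\<integral>x. cHerm i x * cnj (cHerm j x) \<partial>lborel) = (if i = j then complex_of_real 1 else 0)" for i j
      using cHerm_orthonormal[of i j] by (simp add: L2_inner_def)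
  qed (intro L2_inner_integrable cHerm_L2)
  then show ?thesis unfolding L2sq_def hs_def ev_def csq_def by simp
qed

lemma hs_weak_partial:
  assumes c: "finite (supp c)"
  shows "has_weak_partial i (hs c) (hs (Xc (-1) i c))"
  unfolding has_weak_partial_def
proof (intro conjI allI impI)
  show "locally_integrable (hs c)" "locally_integrable (hs (Xc (-1) i c))" by (intro L2_locally_integrable hs_L2)+
  fix \<phi> :: "real^'a \<Rightarrow> complex" assume \<phi>: "test_function \<phi>"
  have b: "axis i 1 \<in> (Basis :: (real^'a) set)" by (simp add: axis_in_Basis_iff)
  have i1: "integrable lborel (\<lambda>x. cHerm k x * dir_deriv (axis i 1) \<phi> x)" for k
    by (intro integrable_continuous_mult_test smooth_continuous smooth_cHerm test_function_dir_deriv \<phi> b)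
  have i2: "integrable lborel (\<lambda>x. dir_deriv (axis i 1) (cHerm k) x * \<phi> x)" for k
    by (intro integrable_continuous_mult_test smooth_continuous smooth_cHerm smooth_dir_deriv \<phi> b)
  have "(\<integral>x. hs c x * dir_deriv (axis i 1) \<phi> x \<partial>lborel) = (\<integral>x. (\<Sum>k\<in>supp c. c k * (cHerm k x * dir_deriv (axis i 1) \<phi> x)) \<partial>lborel)"
    unfolding hs_def ev_def by (simp add: sum_distrib_right mult.assoc)
  also have "\<dots> = (\<Sum>k\<in>supp c. c k * (\<integral>x. cHerm k x * dir_deriv (axis i 1) \<phi> x \<partial>lborel))"
    by (subst Bochner_Integration.integral_sum) (auto intro!: integrable_mult_right i1)
  also have "\<dots> = (\<Sum>k\<in>supp c. c k * - (\<integral>x. dir_deriv (axis i 1) (cHerm k) x * \<phi> x \<partial>lborel))"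
    by (subst integration_by_parts[OF smooth_cHerm \<phi> b]) simp
  also have "\<dots> = - (\<Sum>k\<in>supp c. c k * (\<integral>x. dir_deriv (axis i 1) (cHerm k) x * \<phi> x \<partial>lborel))"
    by (simp add: sum_negf)
  also have "(\<Sum>k\<in>supp c. c k * (\<integral>x. dir_deriv (axis i 1) (cHerm k) x * \<phi> x \<partial>lborel)) = (\<integral>x. (\<Sum>k\<in>supp c. c k * (dir_deriv (axis i 1) (cHerm k) x * \<phi> x)) \<partial>lborel)"
    by (subst Bochner_Integration.integral_sum) (auto intro!: integrable_mult_right i2)
  also have "\<dots> = (\<integral>x. hs (Xc (-1) i c) x * \<phi> x \<partial>lborel)"
    unfolding hs_def ev_Xc[OF c] dir_deriv_cHerm[symmetric] by (simp add: ev_def sum_distrib_right mult.assoc)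
  finally show "(\<integral>x. hs c x * dir_deriv (axis i 1) \<phi> x \<partial>lborel) = - (\<integral>x. hs (Xc (-1) i c) x * \<phi> x \<partial>lborel)" .
qed

section \<open>Weak derivatives and the operators P\<close>

text \<open>The choice in \<open>weak_partial\<close> has a witness in the classical derivative, and
  two weak derivatives differ by a function that all test functions annihilate. The input f is only
  almost everywhere a Hermite sum, as is the case after the first application.\<close>

lemma weak_partial_hs:
  assumes \<theta>: "smooth_step \<theta>" and f: "locally_integrable f" "AE x in lborel. f x = hs c x" and c: "finite (supp c)"
  shows "locally_integrable (weak_partial i f)" "AE x in lborel. weak_partial i f x = hs (Xc (-1) i c) x"
proof -
  let ?g = "hs (Xc (-1) i c)"
  have b: "axis i 1 \<in> (Basis :: (real^'a) set)" by (simp add: axis_in_Basis_iff)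
  have fm [measurable]: "f \<in> borel_measurable borel" by (rule locally_integrable_measurable[OF f(1)])
  have [measurable]: "hs c \<in> borel_measurable borel" using L2_measurable[OF hs_L2] .
  have hw: "has_weak_partial i f ?g"
    unfolding has_weak_partial_def
  proof (intro conjI allI impI f)
    show "locally_integrable ?g" by (intro L2_locally_integrable hs_L2)
    fix \<phi> :: "real^'a \<Rightarrow> complex" assume \<phi>: "test_function \<phi>"
    have [measurable]: "dir_deriv (axis i 1) \<phi> \<in> borel_measurable borel" by (intro test_function_measurable test_function_dir_deriv \<phi> b)
    have "(\<integral>x. f x * dir_deriv (axis i 1) \<phi> x \<partial>lborel) = (\<integral>x. hs c x * dir_deriv (axis i 1) \<phi> x \<partial>lborel)"
      by (rule integral_cong_AE) (use f(2) in \<open>auto elim!: eventually_mono\<close>)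
    also have "\<dots> = - (\<integral>x. ?g x * \<phi> x \<partial>lborel)" using hs_weak_partial[OF c] \<phi> unfolding has_weak_partial_def by blast
    finally show "(\<integral>x. f x * dir_deriv (axis i 1) \<phi> x \<partial>lborel) = - (\<integral>x. ?g x * \<phi> x \<partial>lborel)" .
  qed
  have wp: "has_weak_partial i f (weak_partial i f)" unfolding weak_partial_def by (rule someI[of "has_weak_partial i f", OF hw])
  show li: "locally_integrable (weak_partial i f)" using wp by (simp add: has_weak_partial_def)
  have lg: "locally_integrable ?g" using hw by (simp add: has_weak_partial_def)
  have "AE x in lborel. weak_partial i f x - ?g x = 0"
  proof (rule AE_zero_of_test_functions[OF \<theta>])
    show "locally_integrable (\<lambda>x. weak_partial i f x - ?g x)"
      using li lg unfolding locally_integrable_def by (auto intro: set_integral_diff)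
    fix \<phi> :: "real^'a \<Rightarrow> complex" assume \<phi>: "test_function \<phi>"
    have "(\<integral>x. weak_partial i f x * \<phi> x \<partial>lborel) = (\<integral>x. ?g x * \<phi> x \<partial>lborel)"
      using hw wp \<phi> unfolding has_weak_partial_def by (metis neg_equal_iff_equal)
    then show "(\<integral>x. (weak_partial i f x - ?g x) * \<phi> x \<partial>lborel) = 0"
      using integrable_loc_mult_test[OF li \<phi>] integrable_loc_mult_test[OF lg \<phi>] by (simp add: left_diff_distrib)
  qed
  then show "AE x in lborel. weak_partial i f x = ?g x" by simp
qed

lemma locally_integrable_mult_coord:
  fixes f :: "real^'d::finite \<Rightarrow> complex"
  assumes f: "locally_integrable f"
  shows "locally_integrable (\<lambda>x. of_real (x $ i) * f x)"
  unfolding locally_integrable_def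
proof (intro allI impI)
  fix K :: "(real^'d) set" assume K: "compact K"
  have [measurable]: "f \<in> borel_measurable borel" "K \<in> sets borel" using f K by (auto intro: locally_integrable_measurable borel_compact)
  obtain R where R: "\<And>x. x \<in> K \<Longrightarrow> norm x \<le> R" using compact_imp_bounded[OF K] by (auto simp: bounded_iff)
  show "set_integrable lborel K (\<lambda>x. of_real (x $ i) * f x)"
    unfolding set_integrable_def
  proof (rule Bochner_Integration.integrable_bound)
    show "integrable lborel (\<lambda>x. R *\<^sub>R (indicator K x *\<^sub>R f x))"
      using f K unfolding locally_integrable_def set_integrable_def by (intro integrable_scaleR_right) auto
    show "AE x in lborel. norm (indicator K x *\<^sub>R (of_real (x $ i) * f x)) \<le> norm (R *\<^sub>R (indicator K x *\<^sub>R f x))"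
    proof (intro AE_I2)
      fix x
      show "norm (indicator K x *\<^sub>R (of_real (x $ i) * f x)) \<le> norm (R *\<^sub>R (indicator K x *\<^sub>R f x))"
      proof (cases "x \<in> K")
        case True
        have "\<bar>x $ i\<bar> \<le> R" using component_le_norm_cart[of x i] R[OF True] by linarith
        then show ?thesis using True by (auto simp: norm_mult intro!: mult_right_mono)
      qed simp
    qed
    show "(\<lambda>x. indicator K x *\<^sub>R (of_real (x $ i) * f x)) \<in> borel_measurable lborel" by measurable
  qed
qed

lemma locally_integrable_sum:
  fixes f :: "'i \<Rightarrow> 'a::euclidean_space \<Rightarrow> complex"
  assumes "\<And>i. i \<in> I \<Longrightarrow> locally_integrable (f i)"
  shows "locally_integrable (\<lambda>x. \<Sum>i\<in>I. f i x)"
  using assms unfolding locally_integrable_def set_integrable_def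
  by (auto simp: scaleR_sum_right)

text \<open>The counterparts of \<open>sv_field\<close>, \<open>P1\<close>, \<open>P2\<close> and \<open>P\<close> for coefficients. A scalar is treated as having the same component
  in every direction.\<close>

datatype 'd coeffs = CScalar "('d \<Rightarrow> nat) \<Rightarrow> complex" | CVector "'d \<Rightarrow> ('d \<Rightarrow> nat) \<Rightarrow> complex"

fun cstep :: "complex \<Rightarrow> 'd::finite coeffs \<Rightarrow> 'd coeffs" where
  "cstep s (CScalar c) = CVector (\<lambda>i. Xc s i c)"
| "cstep s (CVector C) = CScalar (\<lambda>k. \<Sum>i\<in>UNIV. Xc s i (C i) k)"

definition Pc :: "nat list \<Rightarrow> (('d::finite \<Rightarrow> nat) \<Rightarrow> complex) \<Rightarrow> 'd coeffs" where
  "Pc \<alpha> c = foldr (\<lambda>j. cstep (if j = 1 then -1 else 1)) \<alpha> (CScalar c)"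

fun fcomp :: "'d::finite sv_field \<Rightarrow> 'd \<Rightarrow> real^'d \<Rightarrow> complex" where
  "fcomp (Scalar f) i x = f x"
| "fcomp (Vector F) i x = F x $ i"

lemma fcomp_eq [simp]: "fcomp (Scalar f) i = f" "fcomp (Vector F) i = (\<lambda>x. F x $ i)"
  by auto

fun ccomp :: "'d coeffs \<Rightarrow> 'd \<Rightarrow> ('d \<Rightarrow> nat) \<Rightarrow> complex" where
  "ccomp (CScalar c) i = c"
| "ccomp (CVector C) i = C i"

fun same_kind :: "'d::finite sv_field \<Rightarrow> 'd coeffs \<Rightarrow> bool" where
  "same_kind (Scalar f) (CScalar c) = True"
| "same_kind (Vector f) (CVector c) = True"
| "same_kind _ _ = False"

text \<open>The invariant carried through a word of operators. Local integrability belongs to it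
  because weak derivatives are characterized only for such functions.\<close>

definition represents :: "'d::finite sv_field \<Rightarrow> 'd coeffs \<Rightarrow> bool" where
  "represents F C \<longleftrightarrow> same_kind F C \<and> (\<forall>i. finite (supp (ccomp C i)) \<and> locally_integrable (fcomp F i) \<and>
     (AE x in lborel. fcomp F i x = hs (ccomp C i) x))"

lemma hs_sum: "(\<And>i. i \<in> I \<Longrightarrow> finite (supp (c i))) \<Longrightarrow> finite I \<Longrightarrow> hs (\<lambda>k. \<Sum>i\<in>I. c i k) x = (\<Sum>i\<in>I. hs (c i) x)"
  and finite_supp_sum: "(\<And>i. i \<in> I \<Longrightarrow> finite (supp (c i))) \<Longrightarrow> finite I \<Longrightarrow> finite (supp (\<lambda>k. \<Sum>i\<in>I. c i k))"
  using ev_sum(1)[of I c "\<lambda>k. cHerm k x" "\<lambda>_. 1"] ev_sum(2)[of I c "\<lambda>_. 1"] by (auto simp: hs_def)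

lemma represents_step:
  fixes F :: "'d::finite sv_field"
  assumes \<theta>: "smooth_step \<theta>" and FC: "represents F C"
  shows "represents (P1 F) (cstep (-1) C)" "represents (P2 F) (cstep 1 C)"
proof -
  have fin: "finite (supp (ccomp C i))" and li: "locally_integrable (fcomp F i)" and ae: "AE x in lborel. fcomp F i x = hs (ccomp C i) x" for i
    using FC by (auto simp: represents_def)
  have xl: "locally_integrable (\<lambda>x. of_real (x $ i) * fcomp F i x)" for i by (rule locally_integrable_mult_coord[OF li])
  have xa: "AE x in lborel. of_real (x $ i) * fcomp F i x = hs (Xc 1 i (ccomp C i)) x" for i
    using ae[of i] by eventually_elim (simp add: hs_mult_x[OF fin, symmetric])
  have wl: "locally_integrable (weak_partial i (fcomp F i))" for i by (rule weak_partial_hs(1)[OF \<theta> li ae fin])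
  have wa: "AE x in lborel. weak_partial i (fcomp F i) x = hs (Xc (-1) i (ccomp C i)) x" for i by (rule weak_partial_hs(2)[OF \<theta> li ae fin])
  show "represents (P1 F) (cstep (-1) C)"
  proof (cases F)
    case (Scalar f)
    then obtain c where C: "C = CScalar c" using FC by (cases C) (auto simp: represents_def)
    have f: "fcomp F i = f" for i using Scalar by auto
    show ?thesis unfolding represents_def
      using fin wl wa by (auto simp: Scalar C finite_supp_ops f[unfolded Scalar])
  next
    case (Vector f)
    then obtain c where C: "C = CVector c" using FC by (cases C) (auto simp: represents_def)
    have f: "fcomp F i = (\<lambda>y. f y $ i)" for i using Vector by auto
    have "AE x in lborel. \<forall>i\<in>UNIV. weak_partial i (\<lambda>y. f y $ i) x = hs (Xc (-1) i (c i)) x"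
      using wa unfolding f by (subst AE_finite_all) (auto simp: C)
    then have "AE x in lborel. (\<Sum>i\<in>UNIV. weak_partial i (\<lambda>y. f y $ i) x) = hs (\<lambda>k. \<Sum>i\<in>UNIV. Xc (-1) i (c i) k) x"
    proof eventually_elim
      case (elim x)
      then show ?case using fin by (simp add: hs_sum finite_supp_ops C)
    qed
    then show ?thesis unfolding represents_def
      using fin wl unfolding f by (auto simp: Vector C finite_supp_ops intro!: locally_integrable_sum finite_supp_sum)
  qed
  show "represents (P2 F) (cstep 1 C)"
  proof (cases F)
    case (Scalar f)
    then obtain c where C: "C = CScalar c" using FC by (cases C) (auto simp: represents_def)
    have f: "fcomp F i = f" for i using Scalar by auto
    show ?thesis unfolding represents_def
      using fin xl xa by (auto simp: Scalar C finite_supp_ops f[unfolded Scalar])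
  next
    case (Vector f)
    then obtain c where C: "C = CVector c" using FC by (cases C) (auto simp: represents_def)
    have f: "fcomp F i = (\<lambda>y. f y $ i)" for i using Vector by auto
    have "AE x in lborel. \<forall>i\<in>UNIV. of_real (x $ i) * f x $ i = hs (Xc 1 i (c i)) x"
      using xa unfolding f by (subst AE_finite_all) (auto simp: C)
    then have "AE x in lborel. (\<Sum>i\<in>UNIV. of_real (x $ i) * f x $ i) = hs (\<lambda>k. \<Sum>i\<in>UNIV. Xc 1 i (c i) k) x"
    proof eventually_elim
      case (elim x)
      then show ?case using fin by (simp add: hs_sum finite_supp_ops C)
    qed
    then show ?thesis unfolding represents_def
      using fin xl unfolding f by (auto simp: Vector C finite_supp_ops intro!: locally_integrable_sum finite_supp_sum)
  qed
qed

lemma represents_P: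
  assumes \<theta>: "smooth_step \<theta>" and c: "finite (supp c)" and u: "u \<in> L2" "AE x in lborel. u x = hs c x"
  shows "represents (P \<alpha> u) (Pc \<alpha> c)"
proof (induction \<alpha>)
  case Nil
  have "fcomp (Scalar u) i = u" for i by auto
  then show ?case using c u by (simp add: P_def Pc_def represents_def L2_locally_integrable)
next
  case (Cons j \<alpha>)
  then show ?case using represents_step[OF \<theta> Cons] by (simp add: P_def Pc_def)
qed

section \<open>Propagation\<close>

definition evol :: "real \<Rightarrow> (('d::finite \<Rightarrow> nat) \<Rightarrow> complex) \<Rightarrow> ('d \<Rightarrow> nat) \<Rightarrow> complex" where
  "evol t c k = exp (\<i> * of_real (t * eig k)) * c k"

lemma supp_evol [simp]: "supp (evol t c) = supp c" by (simp add: supp_def evol_def)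

lemma eig_inc: "eig (inc i k) = eig k + 2"
proof -
  have "(\<Sum>j\<in>UNIV. inc i k j) = Suc (\<Sum>j\<in>UNIV. k j)"
    unfolding inc_def by (simp add: sum.remove[of UNIV i])
  then show ?thesis by (simp add: eig_def)
qed

text \<open>Where the coefficient is nonzero, the localization forces psi (eig k / N^2) = 1. If the
  ratio is at most 1/4, both terms of psi are 1, and if it is at least 2, both are 0; the spectrum
  lies strictly in between, and only finitely many indices remain.\<close>

lemma localized_datum:
  fixes u :: "real^'d::finite \<Rightarrow> complex"
  assumes \<eta>: "test_function \<eta>" "\<forall>s\<in>{0..1}. \<eta> s = 1" "\<forall>s\<ge>2. \<eta> s = 0"
    and N: "N > 0" and u: "u \<in> L2" and loc: "AE x in lborel. Delta_loc \<eta> N u x = u x"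
  defines "c \<equiv> \<lambda>k. L2_inner u (cHerm k)"
  shows "k \<in> supp c \<Longrightarrow> N\<^sup>2 / 4 < eig k \<and> eig k < 2 * N\<^sup>2"
    and "finite (supp c)" and "L2norm u = ennreal (sqrt (csq c))"
    and "exp_itH t u \<in> L2" and "AE x in lborel. exp_itH t u x = hs (evol t c) x"
proof -
  have \<theta>: "smooth_step (\<lambda>s. \<eta> (exp s))" by (rule smooth_step_exp[OF \<eta>])
  have N2: "N\<^sup>2 > 0" using N by simp
  obtain B where B: "\<And>s. cmod (\<eta> s) \<le> B" using test_function_bounded[OF \<eta>(1)] by blast
  have [measurable]: "\<eta> \<in> borel_measurable borel" by (rule test_function_measurable[OF \<eta>(1)])
  have "bounded_borel (\<lambda>s. psi \<eta> (s / N\<^sup>2))"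
    unfolding bounded_borel_def bounded_iff
  proof
    show "(\<lambda>s. psi \<eta> (s / N\<^sup>2)) \<in> borel_measurable borel" unfolding psi_def by measurable
    have "cmod (psi \<eta> (s / N\<^sup>2)) \<le> B + B" for s
      unfolding psi_def by (intro order_trans[OF norm_triangle_ineq4] add_mono B)
    then show "\<exists>a. \<forall>x\<in>range (\<lambda>s. psi \<eta> (s / N\<^sup>2)). cmod x \<le> a" by auto
  qed
  note D = fun_of_H_coefficient[OF \<theta> this u]
  have psi1: "psi \<eta> (eig k / N\<^sup>2) * c k = c k" for k
  proof -
    have "L2_inner (Delta_loc \<eta> N u) (cHerm k) = L2_inner u (cHerm k)"
      using D(1) u loc unfolding Delta_loc_def by (intro L2_inner_cong_AE cHerm_L2)
    then show ?thesis using D(2)[of k] unfolding Delta_loc_def c_def by simp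
  qed
  show rng: "N\<^sup>2 / 4 < eig k \<and> eig k < 2 * N\<^sup>2" if "k \<in> supp c" for k
  proof -
    have "c k \<noteq> 0" using that by (simp add: supp_def)
    then have p: "psi \<eta> (eig k / N\<^sup>2) = 1" using psi1[of k] by simp
    have e0: "eig k / N\<^sup>2 \<ge> 0" unfolding eig_def using N2 by (intro divide_nonneg_nonneg add_nonneg_nonneg) (auto intro!: sum_nonneg)
    have "eig k / N\<^sup>2 > 1 / 4"
    proof (rule ccontr)
      assume "\<not> ?thesis"
      then have "eig k / N\<^sup>2 \<in> {0..1}" "4 * (eig k / N\<^sup>2) \<in> {0..1}" using e0 unfolding atLeastAtMost_iff by linarith+
      then have "\<eta> (eig k / N\<^sup>2) = 1" "\<eta> (4 * (eig k / N\<^sup>2)) = 1" using \<eta>(2) by blast+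
      then show False using p by (simp add: psi_def)
    qed
    moreover have "eig k / N\<^sup>2 < 2"
    proof (rule ccontr)
      assume "\<not> ?thesis"
      then have "\<eta> (eig k / N\<^sup>2) = 0" "\<eta> (4 * (eig k / N\<^sup>2)) = 0" using \<eta>(3) by auto
      then show False using p by (simp add: psi_def)
    qed
    ultimately show ?thesis using N2 by (auto simp: field_simps)
  qed
  \<comment> \<open>Each k_i is at most N^2, since 2 k_i <= eig k < 2 N^2.\<close>
  have sub: "supp c \<subseteq> PiE UNIV (\<lambda>_. {..nat \<lfloor>N\<^sup>2\<rfloor>})"
  proof
    fix k assume "k \<in> supp c"
    from rng[OF this] have "2 * real (\<Sum>i\<in>UNIV. k i) < 2 * N\<^sup>2" unfolding eig_def by linarith
    moreover have "real (k i) \<le> real (\<Sum>i\<in>UNIV. k i)" for i by (intro of_nat_mono member_le_sum) auto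
    ultimately have "real (k i) \<le> N\<^sup>2" for i by (smt (verit))
    then have "k i \<le> nat \<lfloor>N\<^sup>2\<rfloor>" for i by (intro le_nat_floor)
    then show "k \<in> PiE UNIV (\<lambda>_. {..nat \<lfloor>N\<^sup>2\<rfloor>})" by (auto simp: PiE_UNIV_domain)
  qed
  show fin: "finite (supp c)" by (rule finite_subset[OF sub finite_PiE]) auto
  have "AE x in lborel. u x = hs c x"
    by (intro AE_eq_of_coefficients u hs_L2) (simp only: hs_inner[OF fin], simp only: c_def)
  then have "L2sq u = L2sq (hs c)" using u hs_L2[of c] by (intro L2sq_cong_AE) (auto dest: L2_measurable)
  then show "L2norm u = ennreal (sqrt (csq c))" using L2norm_eq[OF u] L2sq_hs[OF fin] by simp
  have be: "bounded_borel (\<lambda>s. exp (\<i> * complex_of_real (t * s)))"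
    unfolding bounded_borel_def bounded_iff
  proof
    show "(\<lambda>s. exp (\<i> * complex_of_real (t * s))) \<in> borel_measurable borel"
      by (intro borel_measurable_continuous_onI continuous_intros)
    show "\<exists>a. \<forall>x\<in>range (\<lambda>s. exp (\<i> * complex_of_real (t * s))). cmod x \<le> a" by auto
  qed
  note X = fun_of_H_coefficient[OF \<theta> be u]
  show X1: "exp_itH t u \<in> L2" using X(1) unfolding exp_itH_def .
  have "finite (supp (evol t c))" using fin by simp
  then show "AE x in lborel. exp_itH t u x = hs (evol t c) x"
    using X(2) unfolding exp_itH_def[symmetric]
    by (intro AE_eq_of_coefficients X1 hs_L2) (simp add: hs_inner evol_def c_def)
qed

section \<open>Orthogonality in time\<close>

lemma L2sq_sum:
  fixes \<psi> :: "'i \<Rightarrow> 'a::euclidean_space \<Rightarrow> complex"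
  assumes "\<And>a. a \<in> A \<Longrightarrow> \<psi> a \<in> L2"
  shows "complex_of_real (L2sq (\<lambda>x. \<Sum>a\<in>A. \<alpha> a * \<psi> a x)) = (\<Sum>a\<in>A. \<Sum>b\<in>A. \<alpha> a * cnj (\<alpha> b) * L2_inner (\<psi> a) (\<psi> b))"
proof -
  have eq: "complex_of_real ((cmod (\<Sum>a\<in>A. \<alpha> a * \<psi> a x))\<^sup>2)
     = (\<Sum>a\<in>A. \<Sum>b\<in>A. \<alpha> a * cnj (\<alpha> b) * (\<psi> a x * cnj (\<psi> b x)))" for x
    by (simp only: complex_norm_square cnj_sum complex_cnj_mult sum_product) (simp add: algebra_simps)
  have "complex_of_real (L2sq (\<lambda>x. \<Sum>a\<in>A. \<alpha> a * \<psi> a x)) = (\<integral>x. (\<Sum>a\<in>A. \<Sum>b\<in>A. \<alpha> a * cnj (\<alpha> b) * (\<psi> a x * cnj (\<psi> b x))) \<partial>lborel)"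
    unfolding L2sq_def integral_complex_of_real[symmetric] eq ..
  also have "\<dots> = (\<Sum>a\<in>A. \<Sum>b\<in>A. \<alpha> a * cnj (\<alpha> b) * L2_inner (\<psi> a) (\<psi> b))"
    unfolding L2_inner_def
    by (intro has_bochner_integral_integral_eq has_bochner_integral_sum has_bochner_integral_mult_right)
      (auto simp: has_bochner_integral_iff intro: L2_inner_integrable assms)
  finally show ?thesis .
qed

text \<open>The even frequencies make pi a common period.\<close>

lemma integral_exp_period:
  fixes n :: int
  shows "has_bochner_integral lborel (\<lambda>t. indicator {0..real m * pi} t *\<^sub>R exp (\<i> * of_real (2 * t * of_int n))) (if n = 0 then of_real (real m * pi) else 0)"
proof -
  have le: "0 \<le> real m * pi" by simp
  have cont: "continuous_on {0..real m * pi} (\<lambda>t. exp (\<i> * complex_of_real (2 * t * of_int n)))" by (intro continuous_intros)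
  show ?thesis
  proof (cases "n = 0")
    case True
    have "has_bochner_integral lborel (\<lambda>t. indicator {0..real m * pi} t *\<^sub>R exp (\<i> * of_real (2 * t * of_int n)))
        (complex_of_real (real m * pi) - complex_of_real 0)"
      by (rule has_bochner_integral_FTC_Icc[OF le _ cont]) (auto simp: True intro!: derivative_eq_intros)
    then show ?thesis using True by simp
  next
    case False
    let ?c = "\<i> * complex_of_real (2 * of_int n)"
    have c0: "?c \<noteq> 0" using False by simp
    have D: "((\<lambda>t. exp (?c * complex_of_real t) / ?c) has_vector_derivative exp (\<i> * of_real (2 * t * of_int n))) (at t within {0..real m * pi})" for t
    proof -
      have "((\<lambda>z. exp (?c * z) / ?c) has_field_derivative exp (?c * of_real t)) (at (complex_of_real t))"
        using c0 by (auto intro!: derivative_eq_intros)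
      from has_vector_derivative_real_field[OF this] show ?thesis by (simp add: mult_ac)
    qed
    have "has_bochner_integral lborel (\<lambda>t. indicator {0..real m * pi} t *\<^sub>R exp (\<i> * of_real (2 * t * of_int n)))
        (exp (?c * complex_of_real (real m * pi)) / ?c - exp (?c * complex_of_real 0) / ?c)"
      by (rule has_bochner_integral_FTC_Icc[OF le D cont])
    moreover have "exp (?c * complex_of_real (real m * pi)) = 1"
    proof -
      have "?c * complex_of_real (real m * pi) = complex_of_real (2 * real_of_int (int m * n) * pi) * \<i>" by simp
      then show ?thesis using exp_integer_2pi[of "real_of_int (int m * n)"] by (simp only: Ints_of_int)
    qed
    ultimately show ?thesis using False by simp
  qed
qed

text \<open>All frequencies of a product of two solutions differ by even integers, so over a multiple of \<open>\<pi>\<close> only pairs of equal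
  total energy interact.\<close>

lemma time_orthogonality:
  fixes \<psi> :: "'i \<Rightarrow> 'a::euclidean_space \<Rightarrow> complex" and \<theta> :: "'i \<Rightarrow> nat" and \<rho> :: real
  assumes A: "finite A" and \<psi>: "\<And>a. a \<in> A \<Longrightarrow> \<psi> a \<in> L2"
  defines "g \<equiv> \<lambda>t. L2sq (\<lambda>x. \<Sum>a\<in>A. exp (\<i> * of_real (t * (2 * real (\<theta> a) + \<rho>))) * \<psi> a x)"
  shows "g \<in> borel_measurable borel"
    and "(\<integral>\<^sup>+t. ennreal (g t) * indicator {0..real m * pi} t \<partial>lborel)
      = ennreal (real m * pi * (\<Sum>L\<in>\<theta> ` A. L2sq (\<lambda>x. \<Sum>a\<in>{a \<in> A. \<theta> a = L}. \<psi> a x)))"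
proof -
  define G where "G a b = L2_inner (\<psi> a) (\<psi> b)" for a b
  have g: "complex_of_real (g t) = (\<Sum>a\<in>A. \<Sum>b\<in>A. exp (\<i> * of_real (2 * t * of_int (int (\<theta> a) - int (\<theta> b)))) * G a b)" for t
  proof -
    have "complex_of_real (g t) = (\<Sum>a\<in>A. \<Sum>b\<in>A. exp (\<i> * of_real (t * (2 * real (\<theta> a) + \<rho>))) * cnj (exp (\<i> * of_real (t * (2 * real (\<theta> b) + \<rho>)))) * G a b)"
      unfolding g_def G_def by (rule L2sq_sum[OF \<psi>])
    \<comment> \<open>The common offset \<rho> cancels against the conjugate, leaving an even
      integer frequency.\<close>
    moreover have "exp (\<i> * of_real (t * (2 * real p + \<rho>))) * cnj (exp (\<i> * of_real (t * (2 * real q + \<rho>)))) = exp (\<i> * of_real (2 * t * of_int (int p - int q)))" for p q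
      by (simp add: exp_cnj algebra_simps flip: exp_add exp_diff)
    ultimately show ?thesis by simp
  qed
  have "(\<lambda>t. Re (complex_of_real (g t))) \<in> borel_measurable borel"
    unfolding g by (intro borel_measurable_continuous_onI continuous_intros)
  then show gm: "g \<in> borel_measurable borel" by simp
  have "has_bochner_integral lborel (\<lambda>t. \<Sum>a\<in>A. \<Sum>b\<in>A. (indicator {0..real m * pi} t *\<^sub>R exp (\<i> * of_real (2 * t * of_int (int (\<theta> a) - int (\<theta> b))))) * G a b)
     (\<Sum>a\<in>A. \<Sum>b\<in>A. (if int (\<theta> a) - int (\<theta> b) = 0 then of_real (real m * pi) else 0) * G a b)"
    by (intro has_bochner_integral_sum has_bochner_integral_mult_left integral_exp_period)
  moreover have "(\<Sum>a\<in>A. \<Sum>b\<in>A. (indicator {0..real m * pi} t *\<^sub>R exp (\<i> * of_real (2 * t * of_int (int (\<theta> a) - int (\<theta> b))))) * G a b)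
     = complex_of_real (g t * indicator {0..real m * pi} t)" for t
    unfolding of_real_mult g sum_distrib_right by (intro sum.cong refl) (auto simp: indicator_def)
  moreover have "(\<Sum>a\<in>A. \<Sum>b\<in>A. (if int (\<theta> a) - int (\<theta> b) = 0 then of_real (real m * pi) else 0) * G a b)
     = complex_of_real (real m * pi * (\<Sum>L\<in>\<theta> ` A. L2sq (\<lambda>x. \<Sum>a\<in>{a \<in> A. \<theta> a = L}. \<psi> a x)))"
  proof -
    have "complex_of_real (L2sq (\<lambda>x. \<Sum>a\<in>{a \<in> A. \<theta> a = L}. \<psi> a x)) = (\<Sum>a\<in>{a \<in> A. \<theta> a = L}. \<Sum>b\<in>A. if \<theta> a = \<theta> b then G a b else 0)" for L
    proof -
      have "complex_of_real (L2sq (\<lambda>x. \<Sum>a\<in>{a \<in> A. \<theta> a = L}. 1 * \<psi> a x)) = (\<Sum>a\<in>{a \<in> A. \<theta> a = L}. \<Sum>b\<in>{a \<in> A. \<theta> a = L}. 1 * cnj 1 * G a b)"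
        unfolding G_def by (rule L2sq_sum) (use \<psi> in auto)
      also have "\<dots> = (\<Sum>a\<in>{a \<in> A. \<theta> a = L}. \<Sum>b\<in>A. if \<theta> a = \<theta> b then G a b else 0)"
      proof (rule sum.cong[OF refl])
        fix a assume "a \<in> {a \<in> A. \<theta> a = L}"
        then show "(\<Sum>b\<in>{a \<in> A. \<theta> a = L}. 1 * cnj 1 * G a b) = (\<Sum>b\<in>A. if \<theta> a = \<theta> b then G a b else 0)"
          using A by (intro sum.mono_neutral_cong_left) auto
      qed
      finally show ?thesis by simp
    qed
    then have "complex_of_real (\<Sum>L\<in>\<theta> ` A. L2sq (\<lambda>x. \<Sum>a\<in>{a \<in> A. \<theta> a = L}. \<psi> a x)) = (\<Sum>L\<in>\<theta> ` A. \<Sum>a\<in>{a \<in> A. \<theta> a = L}. \<Sum>b\<in>A. if \<theta> a = \<theta> b then G a b else 0)"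
      by simp
    also have "\<dots> = (\<Sum>a\<in>A. \<Sum>b\<in>A. if \<theta> a = \<theta> b then G a b else 0)"
      using sum.group[of A "\<theta> ` A" \<theta> "\<lambda>a. \<Sum>b\<in>A. if \<theta> a = \<theta> b then G a b else 0"] A by simp
    finally have S: "complex_of_real (\<Sum>L\<in>\<theta> ` A. L2sq (\<lambda>x. \<Sum>a\<in>{a \<in> A. \<theta> a = L}. \<psi> a x)) = (\<Sum>a\<in>A. \<Sum>b\<in>A. if \<theta> a = \<theta> b then G a b else 0)" .
    have "(if int (\<theta> a) - int (\<theta> b) = 0 then of_real (real m * pi) else 0) * G a b = of_real (real m * pi) * (if \<theta> a = \<theta> b then G a b else 0)" for a b
      by simp
    then have "(\<Sum>a\<in>A. \<Sum>b\<in>A. (if int (\<theta> a) - int (\<theta> b) = 0 then of_real (real m * pi) else 0) * G a b)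
      = of_real (real m * pi) * (\<Sum>a\<in>A. \<Sum>b\<in>A. if \<theta> a = \<theta> b then G a b else 0)"
      by (simp only: sum_distrib_left)
    then show ?thesis by (simp only: S[symmetric] of_real_mult)
  qed
  ultimately have "has_bochner_integral lborel (\<lambda>t. complex_of_real (g t * indicator {0..real m * pi} t)) (complex_of_real (real m * pi * (\<Sum>L\<in>\<theta> ` A. L2sq (\<lambda>x. \<Sum>a\<in>{a \<in> A. \<theta> a = L}. \<psi> a x))))"
    by simp
  from has_bochner_integral_bounded_linear[OF bounded_linear_Re this]
  have hb: "has_bochner_integral lborel (\<lambda>t. g t * indicator {0..real m * pi} t) (real m * pi * (\<Sum>L\<in>\<theta> ` A. L2sq (\<lambda>x. \<Sum>a\<in>{a \<in> A. \<theta> a = L}. \<psi> a x)))"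
    by (simp only: Re_complex_of_real)
  have g0: "g t \<ge> 0" for t unfolding g_def by simp
  have "(\<integral>\<^sup>+t. ennreal (g t) * indicator {0..real m * pi} t \<partial>lborel) = (\<integral>\<^sup>+t. ennreal (g t * indicator {0..real m * pi} t) \<partial>lborel)"
    by (intro nn_integral_cong) (auto split: split_indicator)
  also have "\<dots> = ennreal (real m * pi * (\<Sum>L\<in>\<theta> ` A. L2sq (\<lambda>x. \<Sum>a\<in>{a \<in> A. \<theta> a = L}. \<psi> a x)))"
    using hb g0 by (subst nn_integral_eq_integral) (auto simp: has_bochner_integral_iff)
  finally show "(\<integral>\<^sup>+t. ennreal (g t) * indicator {0..real m * pi} t \<partial>lborel)
      = ennreal (real m * pi * (\<Sum>L\<in>\<theta> ` A. L2sq (\<lambda>x. \<Sum>a\<in>{a \<in> A. \<theta> a = L}. \<psi> a x)))" .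
qed

section \<open>Products of Hermite functions at a fixed energy\<close>

text \<open>Telescoping: with a = sqrt (K + 2) and b = sqrt (K + 1), 1 = (a - b) (a + b) <= 2 a (a -
  b).\<close>

lemma sum_inverse_sqrt: "(\<Sum>a\<le>K. 1 / sqrt (real a + 1)) \<le> 2 * sqrt (real K + 1)"
proof (induction K)
  case (Suc K)
  have "1 / sqrt (real K + 2) \<le> 2 * sqrt (real K + 2) - 2 * sqrt (real K + 1)"
  proof -
    let ?a = "sqrt (real K + 2)" and ?b = "sqrt (real K + 1)"
    have ab: "?b \<le> ?a" "?a > 0" "?b > 0" by auto
    have "(?a - ?b) * (?a + ?b) = 1" by (simp add: algebra_simps)
    moreover have "(?a - ?b) * (?a + ?b) \<le> (?a - ?b) * (2 * ?a)" using ab by (intro mult_left_mono) auto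
    ultimately have "1 \<le> (2 * ?a - 2 * ?b) * ?a" by (simp add: algebra_simps)
    then show ?thesis using ab by (simp add: divide_le_eq)
  qed
  then show ?case using Suc by (simp add: add.commute)
qed simp

definition deg :: "('d::finite \<Rightarrow> nat) \<Rightarrow> nat" where "deg k = (\<Sum>i\<in>UNIV. k i)"

lemma deg_upd: "deg (k(j := n)) = deg (k(j := 0)) + n"
  by (simp add: deg_def sum.remove[of UNIV j])

lemma le_deg: "k i \<le> deg k" unfolding deg_def by (rule member_le_sum) auto

text \<open>An index of degree K has a coordinate of at least K / d, whose factor is at most sqrt d
  / sqrt (K + 1). The other d - 1 coordinates determine the index and are summed freely, each giving
  at most 2 sqrt (K + 1). One power cancels, which leaves the exponent d - 2; the factor d counts
  the choices of the large coordinate.\<close>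

lemma sum_Herm_zero_sq:
  assumes d: "CARD('d::finite) \<ge> 2"
  shows "(\<Sum>n\<in>{n :: 'd \<Rightarrow> nat. deg n = K}. (Herm n 0)\<^sup>2)
    \<le> real CARD('d) * sqrt (real CARD('d)) * 2 ^ (CARD('d) - 1) * sqrt (real K + 1) ^ (CARD('d) - 2)"
proof -
  let ?d = "real CARD('d)"
  let ?N = "{n :: 'd \<Rightarrow> nat. deg n = K}"
  have d0: "?d > 0" by simp
  define F where "F j n = sqrt ?d / sqrt (real K + 1) * (\<Prod>i\<in>UNIV - {j}. 1 / sqrt (real (n i) + 1))" for j :: 'd and n :: "'d \<Rightarrow> nat"
  have F0: "F j n \<ge> 0" for j n unfolding F_def by (intro mult_nonneg_nonneg prod_nonneg) auto
  have le: "(Herm n 0)\<^sup>2 \<le> (\<Sum>j\<in>UNIV. F j n)" if n: "n \<in> ?N" for n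
  proof -
    have "\<exists>j. real K \<le> ?d * real (n j)"
    proof (rule ccontr)
      assume "\<not> ?thesis"
      then have lt: "?d * real (n j) < real K" for j by (auto simp: not_le)
      have "(\<Sum>j\<in>UNIV. ?d * real (n j)) < (\<Sum>j\<in>(UNIV::'d set). real K)" by (intro sum_strict_mono lt) auto
      moreover have "(\<Sum>j\<in>UNIV. ?d * real (n j)) = ?d * real K" using n by (simp add: deg_def flip: sum_distrib_left of_nat_sum)
      ultimately show False by simp
    qed
    then obtain j where j: "real K \<le> ?d * real (n j)" by blast
    have "(Herm n 0)\<^sup>2 = (\<Prod>i\<in>UNIV. (hermite (n i) 0)\<^sup>2)" by (simp add: Herm_def prod_power_distrib)
    also have "\<dots> \<le> (\<Prod>i\<in>UNIV. 1 / sqrt (real (n i) + 1))" by (intro prod_mono) (auto intro: hermite_0_sq_le)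
    also have "\<dots> = 1 / sqrt (real (n j) + 1) * (\<Prod>i\<in>UNIV - {j}. 1 / sqrt (real (n i) + 1))" by (rule prod.remove) auto
    also have "\<dots> \<le> F j n" unfolding F_def
    proof (intro mult_right_mono prod_nonneg)
      have "1 \<le> ?d" using d by simp
      from add_mono[OF j this] have "real K + 1 \<le> ?d * (real (n j) + 1)" by (simp only: distrib_left mult_1_right)
      then have "sqrt (real K + 1) \<le> sqrt ?d * sqrt (real (n j) + 1)" by (simp flip: real_sqrt_mult)
      then show "1 / sqrt (real (n j) + 1) \<le> sqrt ?d / sqrt (real K + 1)" by (simp add: field_simps)
    qed auto
    also have "\<dots> \<le> (\<Sum>j\<in>UNIV. F j n)" using F0 by (intro member_le_sum) auto
    finally show ?thesis .
  qed
  have sumF: "(\<Sum>n\<in>?N. F j n) \<le> sqrt ?d / sqrt (real K + 1) * (2 * sqrt (real K + 1)) ^ (CARD('d) - 1)" for j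
  proof -
    have inj: "inj_on (\<lambda>n. restrict n (UNIV - {j})) ?N"
    proof (rule inj_onI)
      fix n n' :: "'d \<Rightarrow> nat" assume nn: "n \<in> ?N" "n' \<in> ?N" and r: "restrict n (UNIV - {j}) = restrict n' (UNIV - {j})"
      have e: "n i = n' i" if "i \<noteq> j" for i using fun_cong[OF r, of i] that by simp
      have "deg n = n j + (\<Sum>i\<in>UNIV - {j}. n i)" "deg n' = n' j + (\<Sum>i\<in>UNIV - {j}. n' i)" unfolding deg_def by (auto intro!: sum.remove)
      moreover have "(\<Sum>i\<in>UNIV - {j}. n i) = (\<Sum>i\<in>UNIV - {j}. n' i)" using e by (intro sum.cong) auto
      ultimately have "n j = n' j" using nn by simp
      then show "n = n'" using e by (metis ext)
    qed
    have "(\<Sum>n\<in>?N. \<Prod>i\<in>UNIV - {j}. 1 / sqrt (real (n i) + 1))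
      = (\<Sum>n\<in>?N. \<Prod>i\<in>UNIV - {j}. 1 / sqrt (real (restrict n (UNIV - {j}) i) + 1))" by (intro sum.cong prod.cong) auto
    also have "\<dots> = (\<Sum>m\<in>(\<lambda>n. restrict n (UNIV - {j})) ` ?N. \<Prod>i\<in>UNIV - {j}. 1 / sqrt (real (m i) + 1))"
      using sum.reindex[OF inj, of "\<lambda>m. \<Prod>i\<in>UNIV - {j}. 1 / sqrt (real (m i) + 1)"] by simp
    also have "\<dots> \<le> (\<Sum>m\<in>PiE (UNIV - {j}) (\<lambda>_. {..K}). \<Prod>i\<in>UNIV - {j}. 1 / sqrt (real (m i) + 1))"
    proof (rule sum_mono2)
      show "(\<lambda>n. restrict n (UNIV - {j})) ` ?N \<subseteq> PiE (UNIV - {j}) (\<lambda>_. {..K})" using le_deg by (auto intro!: restrict_PiE_iff[THEN iffD2])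
    qed (auto intro!: finite_PiE prod_nonneg)
    also have "\<dots> = (\<Prod>i\<in>UNIV - {j}. \<Sum>a\<le>K. 1 / sqrt (real a + 1))" by (rule prod_sum_PiE[symmetric]) auto
    also have "\<dots> = (\<Sum>a\<le>K. 1 / sqrt (real a + 1)) ^ (CARD('d) - 1)" by (simp add: card_Diff_singleton)
    also have "\<dots> \<le> (2 * sqrt (real K + 1)) ^ (CARD('d) - 1)" by (intro power_mono sum_inverse_sqrt sum_nonneg) auto
    finally show ?thesis unfolding F_def sum_distrib_left[symmetric] by (intro mult_left_mono) auto
  qed
  have "(\<Sum>n\<in>?N. (Herm n 0)\<^sup>2) \<le> (\<Sum>n\<in>?N. \<Sum>j\<in>UNIV. F j n)" by (intro sum_mono le)
  also have "\<dots> = (\<Sum>j\<in>UNIV. \<Sum>n\<in>?N. F j n)" by (rule sum.swap)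
  also have "\<dots> \<le> (\<Sum>j\<in>(UNIV::'d set). sqrt ?d / sqrt (real K + 1) * (2 * sqrt (real K + 1)) ^ (CARD('d) - 1))" by (intro sum_mono sumF)
  also have "\<dots> = ?d * sqrt ?d * 2 ^ (CARD('d) - 1) * sqrt (real K + 1) ^ (CARD('d) - 2)"
  proof -
    have "CARD('d) - 1 = Suc (CARD('d) - 2)" using d by simp
    then have "sqrt (real K + 1) ^ (CARD('d) - 1) = sqrt (real K + 1) * sqrt (real K + 1) ^ (CARD('d) - 2)" by simp
    then show ?thesis by (simp add: power_mult_distrib)
  qed
  finally show ?thesis .
qed

section \<open>Rotation of products in d dimensions\<close>

definition rotd :: "('d::finite \<Rightarrow> nat) \<times> ('d \<Rightarrow> nat) \<Rightarrow> ('d \<Rightarrow> nat \<times> nat) \<Rightarrow> real" where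
  "rotd kl p = (\<Prod>i\<in>UNIV. rot (fst kl i) (snd kl i) (fst (p i)) (snd (p i)))"

lemma rotd_orthonormal:
  fixes k l k' l' :: "'d::finite \<Rightarrow> nat"
  assumes "deg k + deg l < K" "deg k' + deg l' < K"
  shows "(\<Sum>p\<in>PiE UNIV (\<lambda>_. {..K} \<times> {..K}). rotd (k, l) p * rotd (k', l') p) = (if (k, l) = (k', l') then 1 else 0)"
proof -
  have lt: "k i + l i < K" "k' i + l' i < K" for i
    using assms le_deg[of k i] le_deg[of l i] le_deg[of k' i] le_deg[of l' i] by auto
  have "(\<Sum>p\<in>PiE UNIV (\<lambda>_. {..K} \<times> {..K}). rotd (k, l) p * rotd (k', l') p)
     = (\<Sum>p\<in>PiE UNIV (\<lambda>_. {..K} \<times> {..K}). \<Prod>i\<in>UNIV. (\<lambda>(m, n). rot (k i) (l i) m n * rot (k' i) (l' i) m n) (p i))"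
    by (simp add: rotd_def prod.distrib case_prod_beta)
  also have "\<dots> = (\<Prod>i\<in>UNIV. \<Sum>(m, n)\<in>{..K} \<times> {..K}. rot (k i) (l i) m n * rot (k' i) (l' i) m n)"
    by (rule prod_sum_PiE[symmetric]) auto
  also have "\<dots> = (\<Prod>i\<in>UNIV. if k i = k' i \<and> l i = l' i then 1 else 0)"
    by (intro prod.cong refl rot_orthonormal lt)
  also have "\<dots> = (if (k, l) = (k', l') then 1 else 0)" by (auto simp: fun_eq_iff)
  finally show ?thesis .
qed

lemma Herm_rotation:
  fixes k l :: "'d::finite \<Rightarrow> nat"
  assumes "deg k + deg l < K"
  shows "Herm k x * Herm l x = (\<Sum>p\<in>PiE UNIV (\<lambda>_. {..K} \<times> {..K}). rotd (k, l) p * (Herm (fst \<circ> p) (sqrt 2 *\<^sub>R x) * Herm (snd \<circ> p) 0))"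
proof -
  have lt: "k i + l i < K" for i using assms le_deg[of k i] le_deg[of l i] by auto
  have s: "(s + s) / sqrt 2 = sqrt 2 * s" for s :: real by (simp add: field_simps)
  have "Herm k x * Herm l x = (\<Prod>i\<in>UNIV. hermite (k i) (x $ i) * hermite (l i) (x $ i))" by (simp add: Herm_def prod.distrib)
  also have "\<dots> = (\<Prod>i\<in>UNIV. \<Sum>(m, n)\<in>{..K}\<times>{..K}. rot (k i) (l i) m n * (hermite m (sqrt 2 * x $ i) * hermite n 0))"
    using hermite_rotation[OF lt, of _ "x $ _" "x $ _"] s by (intro prod.cong refl) simp
  also have "\<dots> = (\<Sum>p\<in>PiE UNIV (\<lambda>_. {..K} \<times> {..K}). \<Prod>i\<in>UNIV. (\<lambda>(m, n). rot (k i) (l i) m n * (hermite m (sqrt 2 * x $ i) * hermite n 0)) (p i))"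
    by (rule prod_sum_PiE) auto
  also have "\<dots> = (\<Sum>p\<in>PiE UNIV (\<lambda>_. {..K} \<times> {..K}). rotd (k, l) p * (Herm (fst \<circ> p) (sqrt 2 *\<^sub>R x) * Herm (snd \<circ> p) 0))"
    by (simp add: rotd_def Herm_def prod.distrib case_prod_beta)
  finally show ?thesis .
qed

lemma integral_Herm_scaled:
  "integrable lborel (\<lambda>x::real^'d::finite. complex_of_real (Herm m (sqrt 2 *\<^sub>R x) * Herm n (sqrt 2 *\<^sub>R x)))"
  "(\<integral>x. complex_of_real (Herm m (sqrt 2 *\<^sub>R x) * Herm n (sqrt 2 *\<^sub>R x)) \<partial>(lborel::(real^'d) measure)) = (if m = n then of_real ((1 / sqrt 2) ^ CARD('d)) else 0)"
proof -
  let ?f = "\<lambda>i s. complex_of_real (hermite (m i) (sqrt 2 * s) * hermite (n i) (sqrt 2 * s))"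
  have i: "integrable lborel (?f i)" for i by (intro integrable_of_real integral_hermite_scaled)
  have e: "complex_of_real (Herm m (sqrt 2 *\<^sub>R x) * Herm n (sqrt 2 *\<^sub>R x)) = (\<Prod>i\<in>UNIV. ?f i (x $ i))" for x :: "real^'d"
    by (simp add: Herm_def prod.distrib)
  show "integrable lborel (\<lambda>x::real^'d. complex_of_real (Herm m (sqrt 2 *\<^sub>R x) * Herm n (sqrt 2 *\<^sub>R x)))"
    unfolding e by (rule tensor_integral(1)[OF i])
  have "(\<integral>x. complex_of_real (Herm m (sqrt 2 *\<^sub>R x) * Herm n (sqrt 2 *\<^sub>R x)) \<partial>(lborel::(real^'d) measure)) = (\<Prod>i\<in>UNIV. if m i = n i then complex_of_real (1 / sqrt 2) else 0)"
    unfolding e tensor_integral(2)[OF i] integral_complex_of_real integral_hermite_scaled(2) by (intro prod.cong refl) simp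
  also have "\<dots> = (if m = n then of_real ((1 / sqrt 2) ^ CARD('d)) else 0)"
  proof (cases "m = n")
    case False
    then obtain i where "m i \<noteq> n i" by auto
    then have "(\<Prod>i\<in>UNIV. if m i = n i then complex_of_real (1 / sqrt 2) else 0) = 0" by (intro prod_zero) auto
    then show ?thesis using False by simp
  qed simp
  finally show "(\<integral>x. complex_of_real (Herm m (sqrt 2 *\<^sub>R x) * Herm n (sqrt 2 *\<^sub>R x)) \<partial>(lborel::(real^'d) measure)) = (if m = n then of_real ((1 / sqrt 2) ^ CARD('d)) else 0)" .
qed

text \<open>After the rotation the first factors are orthogonal in x and the second ones are
  evaluated at 0. For fixed m only n of degree L - deg m contribute, so Cauchy-Schwarz over n costs
  \<open>sum_Herm_zero_sq\<close>; orthonormality of the rotation does the rest.\<close>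

lemma L2sq_products_le:
  fixes w :: "('d::finite \<Rightarrow> nat) \<times> ('d \<Rightarrow> nat) \<Rightarrow> complex"
  assumes d: "CARD('d) \<ge> 2" and A: "finite A" and AL: "\<And>k l. (k, l) \<in> A \<Longrightarrow> deg k + deg l = L"
  shows "L2sq (\<lambda>x. \<Sum>a\<in>A. w a * (cHerm (fst a) x * cHerm (snd a) x))
    \<le> real CARD('d) * sqrt (real CARD('d)) * 2 ^ (CARD('d) - 1) * sqrt (real L + 1) ^ (CARD('d) - 2) * (\<Sum>a\<in>A. (cmod (w a))\<^sup>2)"
proof -
  let ?B = "PiE UNIV (\<lambda>_. {..Suc L}) :: ('d \<Rightarrow> nat) set"
  let ?BB = "PiE UNIV (\<lambda>_. {..Suc L} \<times> {..Suc L}) :: ('d \<Rightarrow> nat \<times> nat) set"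
  let ?C = "real CARD('d) * sqrt (real CARD('d)) * 2 ^ (CARD('d) - 1) * sqrt (real L + 1) ^ (CARD('d) - 2)"
  have finB: "finite ?B" by (intro finite_PiE) auto
  define v where "v p = (\<Sum>a\<in>A. w a * of_real (rotd a p))" for p
  define pr where "pr mn = (\<lambda>i. (fst mn i, snd mn i))" for mn :: "('d \<Rightarrow> nat) \<times> ('d \<Rightarrow> nat)"
  have bij: "bij_betw pr (?B \<times> ?B) ?BB"
    by (rule bij_betwI[where g="\<lambda>p. (fst \<circ> p, snd \<circ> p)"]) (auto simp: pr_def PiE_UNIV_domain mem_Times_iff Pi_iff)
  have vsq: "(\<Sum>p\<in>?BB. (cmod (v p))\<^sup>2) = (\<Sum>a\<in>A. (cmod (w a))\<^sup>2)"
    unfolding v_def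
  proof (rule sum_norm_sq_orthonormal[OF A])
    fix a b assume "a \<in> A" "b \<in> A"
    then show "(\<Sum>p\<in>?BB. rotd a p * rotd b p) = (if a = b then 1 else 0)"
      using AL[of "fst a" "snd a"] AL[of "fst b" "snd b"] rotd_orthonormal[of "fst a" "snd a" "Suc L" "fst b" "snd b"] by simp
  qed
  have vsupp: "v (pr (m, n)) = 0" if "deg m + deg n \<noteq> L" for m n
    unfolding v_def
  proof (rule sum.neutral, rule ballI)
    fix a assume a: "a \<in> A"
    have "\<exists>i. m i + n i \<noteq> fst a i + snd a i"
    proof (rule ccontr)
      assume "\<not> ?thesis"
      then have "deg m + deg n = deg (fst a) + deg (snd a)" by (simp add: deg_def flip: sum.distrib)
      then show False using AL[of "fst a" "snd a"] a that by simp
    qed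
    then obtain i where "m i + n i \<noteq> fst a i + snd a i" by blast
    then have "rotd a (pr (m, n)) = 0" unfolding rotd_def pr_def by (intro prod_zero) (auto intro!: bexI[of _ i] rot_supp)
    then show "w a * of_real (rotd a (pr (m, n))) = 0" by simp
  qed
  define \<gamma> where "\<gamma> m = (\<Sum>n\<in>?B. v (pr (m, n)) * of_real (Herm n 0))" for m
  have F: "(\<Sum>a\<in>A. w a * (cHerm (fst a) x * cHerm (snd a) x)) = (\<Sum>m\<in>?B. \<gamma> m * of_real (Herm m (sqrt 2 *\<^sub>R x)))" for x
  proof -
    have "(\<Sum>a\<in>A. w a * (cHerm (fst a) x * cHerm (snd a) x))
      = (\<Sum>a\<in>A. w a * of_real (\<Sum>p\<in>?BB. rotd a p * (Herm (fst \<circ> p) (sqrt 2 *\<^sub>R x) * Herm (snd \<circ> p) 0)))"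
    proof (intro sum.cong refl arg_cong2[where f="(*)"])
      fix a assume "a \<in> A"
      then have "deg (fst a) + deg (snd a) < Suc L" using AL[of "fst a" "snd a"] by simp
      from Herm_rotation[OF this, of x]
      show "cHerm (fst a) x * cHerm (snd a) x = of_real (\<Sum>p\<in>?BB. rotd a p * (Herm (fst \<circ> p) (sqrt 2 *\<^sub>R x) * Herm (snd \<circ> p) 0))"
        unfolding cHerm_def of_real_mult[symmetric] by simp
    qed
    also have "\<dots> = (\<Sum>p\<in>?BB. v p * of_real (Herm (fst \<circ> p) (sqrt 2 *\<^sub>R x) * Herm (snd \<circ> p) 0))"
      unfolding v_def of_real_sum sum_distrib_left sum_distrib_right by (subst sum.swap) (simp add: mult.assoc)
    also have "\<dots> = (\<Sum>mn\<in>?B \<times> ?B. v (pr mn) * of_real (Herm (fst \<circ> pr mn) (sqrt 2 *\<^sub>R x) * Herm (snd \<circ> pr mn) 0))"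
      by (rule sum.reindex_bij_betw[OF bij, symmetric])
    also have "\<dots> = (\<Sum>m\<in>?B. \<Sum>n\<in>?B. v (pr (m, n)) * of_real (Herm m (sqrt 2 *\<^sub>R x) * Herm n 0))"
      by (subst sum.cartesian_product) (auto intro!: sum.cong simp: pr_def o_def)
    also have "\<dots> = (\<Sum>m\<in>?B. \<gamma> m * of_real (Herm m (sqrt 2 *\<^sub>R x)))"
      unfolding \<gamma>_def sum_distrib_right by (intro sum.cong refl) (simp add: mult_ac)
    finally show ?thesis .
  qed
  have "L2sq (\<lambda>x. \<Sum>a\<in>A. w a * (cHerm (fst a) x * cHerm (snd a) x)) = (\<Sum>m\<in>?B. (1 / sqrt 2) ^ CARD('d) * (cmod (\<gamma> m))\<^sup>2)"
    unfolding L2sq_def F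
    by (rule integral_norm_sq_orthogonal(2)[OF finB])
      (use integral_Herm_scaled in \<open>simp_all only: complex_cnj_complex_of_real of_real_mult[symmetric]\<close>)
  also have "\<dots> \<le> (\<Sum>m\<in>?B. 1 * (\<Sum>n\<in>?B. (cmod (v (pr (m, n))))\<^sup>2) * ?C)"
  proof (intro sum_mono)
    fix m :: "'d \<Rightarrow> nat"
    have "(cmod (\<gamma> m))\<^sup>2 \<le> (\<Sum>n\<in>?B. (cmod (v (pr (m, n))))\<^sup>2) * ?C"
    proof (cases "deg m \<le> L")
      case True
      let ?N = "{n :: 'd \<Rightarrow> nat. deg n = L - deg m}"
      have "n i \<le> Suc L" if "deg n = L - deg m" for n :: "'d \<Rightarrow> nat" and i using le_deg[of n i] that by simp
      then have NB: "?N \<subseteq> ?B" by (auto simp: PiE_UNIV_domain)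
      have "\<gamma> m = (\<Sum>n\<in>?N. v (pr (m, n)) * of_real (Herm n 0))"
        unfolding \<gamma>_def using NB finB True by (intro sum.mono_neutral_right) (auto intro!: vsupp)
      then have "cmod (\<gamma> m) \<le> (\<Sum>n\<in>?N. cmod (v (pr (m, n))) * \<bar>Herm n 0\<bar>)"
        using norm_sum[of "\<lambda>n. v (pr (m, n)) * of_real (Herm n 0)" ?N] by (simp add: norm_mult)
      then have "(cmod (\<gamma> m))\<^sup>2 \<le> (\<Sum>n\<in>?N. cmod (v (pr (m, n))) * \<bar>Herm n 0\<bar>)\<^sup>2" by (intro power_mono) auto
      also have "\<dots> \<le> (\<Sum>n\<in>?N. (cmod (v (pr (m, n))))\<^sup>2) * (\<Sum>n\<in>?N. \<bar>Herm n 0\<bar>\<^sup>2)" by (rule Cauchy_Schwarz_ineq_sum)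
      also have "\<dots> \<le> (\<Sum>n\<in>?B. (cmod (v (pr (m, n))))\<^sup>2) * ?C"
      proof (intro mult_mono sum_mono2 NB finB sum_nonneg)
        have "(\<Sum>n\<in>?N. \<bar>Herm n 0\<bar>\<^sup>2) \<le> real CARD('d) * sqrt (real CARD('d)) * 2 ^ (CARD('d) - 1) * sqrt (real (L - deg m) + 1) ^ (CARD('d) - 2)"
          using sum_Herm_zero_sq[OF d, of "L - deg m"] by simp
        also have "\<dots> \<le> ?C" using True by (intro mult_left_mono power_mono) (auto simp: of_nat_diff)
        finally show "(\<Sum>n\<in>?N. \<bar>Herm n 0\<bar>\<^sup>2) \<le> ?C" .
      qed auto
      finally show ?thesis .
    next
      case False
      then have "\<gamma> m = 0" unfolding \<gamma>_def by (intro sum.neutral) (auto simp: vsupp)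
      then show ?thesis by (simp add: sum_nonneg)
    qed
    moreover have "(1 / sqrt 2 :: real) ^ CARD('d) \<le> 1" by (intro power_le_one) auto
    ultimately show "(1 / sqrt 2) ^ CARD('d) * (cmod (\<gamma> m))\<^sup>2 \<le> 1 * (\<Sum>n\<in>?B. (cmod (v (pr (m, n))))\<^sup>2) * ?C"
      unfolding mult.assoc[of 1] by (intro mult_mono) (auto intro!: sum_nonneg mult_nonneg_nonneg)
  qed
  also have "\<dots> = (\<Sum>mn\<in>?B \<times> ?B. (cmod (v (pr mn)))\<^sup>2) * ?C"
  proof -
    have "(\<Sum>m\<in>?B. 1 * (\<Sum>n\<in>?B. f (m, n)) * C) = (\<Sum>mn\<in>?B \<times> ?B. f mn) * C" for f and C :: real
      by (simp add: sum.cartesian_product flip: sum_distrib_right)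
    then show ?thesis .
  qed
  also have "(\<Sum>mn\<in>?B \<times> ?B. (cmod (v (pr mn)))\<^sup>2) = (\<Sum>p\<in>?BB. (cmod (v p))\<^sup>2)"
    by (rule sum.reindex_bij_betw[OF bij])
  finally show ?thesis unfolding vsq by (simp add: mult.commute)
qed


section \<open>The transversal estimate\<close>

definition Hrest :: "'d::finite \<Rightarrow> ('d \<Rightarrow> nat) \<Rightarrow> real^'d \<Rightarrow> real" where
  "Hrest j k x = (\<Prod>i\<in>UNIV - {j}. hermite (k i) (x $ i))"

lemma cHerm_Hrest: "cHerm k x = of_real (Hrest j k x) * chermite (k j) (x $ j)"
  unfolding cHerm_split[of k x j] Hrest_def by simp

lemma Hrest_upd [simp]: "Hrest j (k(j := n)) = Hrest j k"
  unfolding Hrest_def by (auto simp: fun_eq_iff intro!: prod.cong)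

text \<open>Orthogonality in the directions other than j. Indices are normalized to k j = 0, since
  \<open>Hrest j\<close> does not see this coordinate and distinct indices must give orthogonal
  functions.\<close>

lemma L2sq_Hrest:
  fixes \<phi> :: "('d::finite \<Rightarrow> nat) \<Rightarrow> real \<Rightarrow> complex"
  assumes I: "finite I" "\<And>k. k \<in> I \<Longrightarrow> k j = 0" and \<phi>: "\<And>k. k \<in> I \<Longrightarrow> \<phi> k \<in> L2"
  shows "L2sq (\<lambda>x. \<Sum>k\<in>I. of_real (Hrest j k x) * \<phi> k (x $ j)) = (\<Sum>k\<in>I. L2sq (\<phi> k))"
proof -
  let ?\<Phi> = "\<lambda>k x. complex_of_real (Hrest j k x) * \<phi> k (x $ j)"
  let ?f = "\<lambda>k l i s. if i = j then \<phi> k s * cnj (\<phi> l s) else complex_of_real (hermite (k i) s * hermite (l i) s)"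
  have fi: "integrable lborel (?f k l i)" if "k \<in> I" "l \<in> I" for k l i
    using that L2_inner_integrable[OF \<phi> \<phi>] integrable_of_real[OF integrable_hermite_mult] by (cases "i = j") auto
  have eq: "?\<Phi> k x * cnj (?\<Phi> l x) = (\<Prod>i\<in>UNIV. ?f k l i (x $ i))" for k l x
    by (subst prod.remove[of UNIV j]) (auto simp: Hrest_def prod.distrib mult_ac)
  have i: "integrable lborel (\<lambda>x. ?\<Phi> k x * cnj (?\<Phi> l x))" if "k \<in> I" "l \<in> I" for k l
    unfolding eq by (rule tensor_integral(1)[OF fi[OF that]])
  have orth: "(\<integral>x. ?\<Phi> k x * cnj (?\<Phi> l x) \<partial>lborel) = (if k = l then of_real (L2sq (\<phi> k)) else 0)" if kl: "k \<in> I" "l \<in> I" for k l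
  proof -
    have "(\<integral>x. ?\<Phi> k x * cnj (?\<Phi> l x) \<partial>lborel) = (\<Prod>i\<in>UNIV. \<integral>s. ?f k l i s \<partial>lborel)"
      unfolding eq by (rule tensor_integral(2)[OF fi[OF kl]])
    also have "\<dots> = L2_inner (\<phi> k) (\<phi> l) * (\<Prod>i\<in>UNIV - {j}. if k i = l i then 1 else 0)"
    proof -
      have "(\<integral>s. complex_of_real (hermite m s * hermite n s) \<partial>lborel) = (if m = n then 1 else 0)" for m n
        unfolding integral_complex_of_real using hmul_eq[of m n] by (simp add: hmul_def)
      then show ?thesis by (subst prod.remove[of UNIV j]) (auto simp: L2_inner_def simp del: of_real_mult intro!: prod.cong)
    qed
    also have "\<dots> = (if k = l then of_real (L2sq (\<phi> k)) else 0)"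
    proof (cases "k = l")
      case True then show ?thesis using L2_inner_self[OF \<phi>[OF kl(1)]] by simp
    next
      case False
      then obtain i where i: "k i \<noteq> l i" by auto
      then have "i \<noteq> j" using I(2)[OF kl(1)] I(2)[OF kl(2)] by auto
      then have "(\<Prod>i\<in>UNIV - {j}. if k i = l i then 1 else (0::complex)) = 0" using i by (intro prod_zero) auto
      then show ?thesis using False by simp
    qed
    finally show ?thesis .
  qed
  show ?thesis
    unfolding L2sq_def[of "\<lambda>x. \<Sum>k\<in>I. _ k x"] using integral_norm_sq_orthogonal(2)[OF I(1) i orth, of "\<lambda>_. 1"] by simp
qed

text \<open>Fixing the other coordinates of k and the total energy leaves products of two Hermite
  functions of \<open>x $ j\<close> with fixed degree sum at least \<kappa> and second degree at
  most b0. This is the situation of \<open>trace_sq_le\<close>.\<close>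

lemma L2sq_transversal_le:
  fixes w :: "('d::finite \<Rightarrow> nat) \<times> nat \<Rightarrow> complex"
  assumes A: "finite A" and AL: "\<And>k b. (k, b) \<in> A \<Longrightarrow> deg k + b = L"
    and Ak: "\<And>k b. (k, b) \<in> A \<Longrightarrow> k j \<ge> \<kappa>" and Ab: "\<And>k b. (k, b) \<in> A \<Longrightarrow> b \<le> b0"
    and \<kappa>: "32 * b0 \<le> \<kappa>" "\<kappa> > 0"
  shows "L2sq (\<lambda>x. \<Sum>a\<in>A. w a * (cHerm (fst a) x * chermite (snd a) (x $ j)))
    \<le> 48 / sqrt (real \<kappa>) * (\<Sum>a\<in>A. (cmod (w a))\<^sup>2)"
proof -
  define W where "W a = (if a \<in> A then w a else 0)" for a
  \<comment> \<open>Coordinate j is forgotten; at total energy L it is recovered as L minus the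
    other degrees minus b.\<close>
  define red where "red a = ((fst a)(j := 0), snd a)" for a :: "('d \<Rightarrow> nat) \<times> nat"
  define unred where "unred q = ((fst q)(j := L - deg (fst q) - snd q), snd q)" for q :: "('d \<Rightarrow> nat) \<times> nat"
  define I where "I = (\<lambda>a. (fst a)(j := 0)) ` A"
  have I: "finite I" "\<And>k. k \<in> I \<Longrightarrow> k j = 0" using A by (auto simp: I_def)
  define S where "S = Sigma I (\<lambda>k. {..L - deg k})"
  have fa: "fst a j = L - deg ((fst a)(j := 0)) - snd a" "deg ((fst a)(j := 0)) + snd a \<le> L" "fst a j + snd a = L - deg ((fst a)(j := 0))" if "a \<in> A" for a
    using AL[of "fst a" "snd a"] that deg_upd[of "fst a" j "fst a j"] by auto
  have br: "unred (red a) = a" if "a \<in> A" for a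
    unfolding unred_def red_def fst_conv snd_conv fun_upd_upd fa(1)[OF that, symmetric] by simp
  have inj: "inj_on red A" by (rule inj_on_inverseI[of A unred]) (rule br)
  have sub: "red ` A \<subseteq> S" using fa(2) by (force simp: red_def S_def I_def)
  have finS: "finite S" unfolding S_def using I by auto
  have zero: "W (unred q) = 0" if q: "q \<in> S - red ` A" for q
  proof (rule ccontr)
    assume "\<not> ?thesis"
    then have b: "unred q \<in> A" by (auto simp: W_def split: if_splits)
    have "fst q j = 0" using q I(2) by (auto simp: S_def)
    then have "red (unred q) = q" by (auto simp: red_def unred_def prod_eq_iff fun_eq_iff)
    then show False using b q by (metis DiffE imageI)
  qed
  \<comment> \<open>Stated for every summand that vanishes with the weight, since it serves both the
    functions and the squared moduli.\<close>
  have sumS: "(\<Sum>a\<in>A. g (w a) a) = (\<Sum>k\<in>I. \<Sum>b\<le>L - deg k. g (W (unred (k, b))) (unred (k, b)))" if g0: "\<And>a. g 0 a = 0" for g :: "complex \<Rightarrow> _ \<Rightarrow> 'z::comm_monoid_add"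
  proof -
    have "(\<Sum>a\<in>A. g (w a) a) = (\<Sum>a\<in>A. g (W (unred (red a))) (unred (red a)))" by (intro sum.cong refl) (auto simp: br W_def)
    also have "\<dots> = (\<Sum>q\<in>red ` A. g (W (unred q)) (unred q))" using sum.reindex[OF inj, of "\<lambda>q. g (W (unred q)) (unred q)"] by simp
    also have "\<dots> = (\<Sum>q\<in>S. g (W (unred q)) (unred q))" using zero g0 by (intro sum.mono_neutral_left[OF finS sub]) auto
    also have "\<dots> = (\<Sum>k\<in>I. \<Sum>b\<le>L - deg k. g (W (unred (k, b))) (unred (k, b)))"
      unfolding S_def using I(1) by (subst sum.Sigma) auto
    finally show ?thesis .
  qed
  define \<phi> where "\<phi> k s = (\<Sum>b\<le>L - deg k. W (unred (k, b)) * of_real (hermite (L - deg k - b) s * hermite b s))" for k s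
  have \<phi>L2: "\<phi> k \<in> L2" for k
    unfolding L2_iff
  proof
    show "integrable lborel (\<lambda>s. (cmod (\<phi> k s))\<^sup>2)" unfolding \<phi>_def by (rule integral_hermite_products(1))
    show "\<phi> k \<in> borel_measurable borel" unfolding \<phi>_def[abs_def] by measurable
  qed
  have F: "(\<Sum>a\<in>A. w a * (cHerm (fst a) x * chermite (snd a) (x $ j))) = (\<Sum>k\<in>I. of_real (Hrest j k x) * \<phi> k (x $ j))" for x
  proof -
    have "(\<Sum>a\<in>A. w a * (cHerm (fst a) x * chermite (snd a) (x $ j))) = (\<Sum>k\<in>I. \<Sum>b\<le>L - deg k. W (unred (k, b)) * (cHerm (fst (unred (k, b))) x * chermite (snd (unred (k, b))) (x $ j)))"
      by (rule sumS) simp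
    also have "\<dots> = (\<Sum>k\<in>I. of_real (Hrest j k x) * \<phi> k (x $ j))"
      unfolding \<phi>_def sum_distrib_left cHerm_Hrest[of _ x j]
      by (intro sum.cong refl) (simp add: unred_def mult_ac)
    finally show ?thesis .
  qed
  have "L2sq (\<lambda>x. \<Sum>a\<in>A. w a * (cHerm (fst a) x * chermite (snd a) (x $ j))) = (\<Sum>k\<in>I. L2sq (\<phi> k))"
    unfolding F by (rule L2sq_Hrest[OF I \<phi>L2])
  also have "\<dots> \<le> (\<Sum>k\<in>I. 48 / sqrt (real \<kappa>) * (\<Sum>b\<le>L - deg k. (cmod (W (unred (k, b))))\<^sup>2))"
  proof (rule sum_mono)
    fix k assume "k \<in> I"
    then obtain a where a: "a \<in> A" "k = (fst a)(j := 0)" by (auto simp: I_def)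
    then have \<kappa>L: "\<kappa> \<le> L - deg k" using fa[OF a(1)] Ak[of "fst a" "snd a"] by simp
    have "trace_sq (L - deg k) (\<lambda>b. W (unred (k, b))) \<le> 48 / sqrt (real (L - deg k)) * (\<Sum>b\<le>L - deg k. (cmod (W (unred (k, b))))\<^sup>2)"
    proof (rule trace_sq_le[of b0])
      show "W (unred (k, b)) = 0" if "b > b0" for b
        using Ab[of "fst (unred (k, b))" b] that by (auto simp: W_def unred_def)
      show "32 * b0 \<le> L - deg k" "L - deg k > 0" using \<kappa> \<kappa>L by auto
    qed
    also have "\<dots> \<le> 48 / sqrt (real \<kappa>) * (\<Sum>b\<le>L - deg k. (cmod (W (unred (k, b))))\<^sup>2)"
      using \<kappa>L \<kappa> by (intro mult_right_mono divide_left_mono sum_nonneg) auto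
    finally have *: "trace_sq (L - deg k) (\<lambda>b. W (unred (k, b))) \<le> 48 / sqrt (real \<kappa>) * (\<Sum>b\<le>L - deg k. (cmod (W (unred (k, b))))\<^sup>2)" .
    have t0: "trace_sq (L - deg k) (\<lambda>b. W (unred (k, b))) \<ge> 0" unfolding trace_sq_def by (intro sum_nonneg) auto
    have "L2sq (\<phi> k) = trace_sq (L - deg k) (\<lambda>b. W (unred (k, b))) / sqrt 2"
      unfolding L2sq_def \<phi>_def by (rule integral_hermite_products(2))
    also have "\<dots> \<le> trace_sq (L - deg k) (\<lambda>b. W (unred (k, b))) / 1" using t0 by (intro divide_left_mono) auto
    finally show "L2sq (\<phi> k) \<le> 48 / sqrt (real \<kappa>) * (\<Sum>b\<le>L - deg k. (cmod (W (unred (k, b))))\<^sup>2)" using * by simp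
  qed
  also have "\<dots> = 48 / sqrt (real \<kappa>) * (\<Sum>a\<in>A. (cmod (w a))\<^sup>2)"
    unfolding sum_distrib_left[symmetric] by (subst sumS[of "\<lambda>z _. (cmod z)\<^sup>2"]) auto
  finally show ?thesis .
qed

text \<open>The sum over a box of indices factorizes over the coordinates; coordinate j is pinned to
  0 and contributes 1.\<close>

lemma sum_Hrest_sq_le:
  fixes x :: "real^'d::finite"
  shows "(\<Sum>l\<in>PiE UNIV (\<lambda>i. if i = j then {0} else {..b0}). (Hrest j l x)\<^sup>2) \<le> sqrt (2 * (real b0 + 1)) ^ (CARD('d) - 1)"
proof -
  let ?f = "\<lambda>i a. if i = j then 1 else (hermite a (x $ i))\<^sup>2"
  have "(\<Sum>l\<in>PiE UNIV (\<lambda>i. if i = j then {0} else {..b0}). (Hrest j l x)\<^sup>2) = (\<Sum>l\<in>PiE UNIV (\<lambda>i. if i = j then {0} else {..b0}). \<Prod>i\<in>UNIV. ?f i (l i))"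
    by (intro sum.cong refl, subst prod.remove[of UNIV j]) (auto simp: Hrest_def prod_power_distrib)
  also have "\<dots> = (\<Prod>i\<in>UNIV. \<Sum>a\<in>(if i = j then {0} else {..b0}). ?f i a)"
    by (rule prod_sum_PiE[symmetric]) auto
  also have "\<dots> = (\<Prod>i\<in>UNIV - {j}. \<Sum>a\<le>b0. (hermite a (x $ i))\<^sup>2)"
    by (subst prod.remove[of UNIV j]) (auto intro!: prod.cong)
  also have "\<dots> \<le> (\<Prod>i\<in>UNIV - {j}. sqrt (2 * (real b0 + 1)))"
    by (intro prod_mono conjI sum_nonneg sum_hermite_sq_le) auto
  also have "\<dots> = sqrt (2 * (real b0 + 1)) ^ (CARD('d) - 1)" by simp
  finally show ?thesis .
qed

section \<open>Space-time estimates for finite Hermite sums\<close>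

lemma cHerm_bounded: "\<exists>B. \<forall>x. cmod (cHerm k x) \<le> B"
proof -
  obtain B where B: "\<And>n x. \<bar>hermite n x\<bar> \<le> B n" using bounded_hermite by metis
  have "cmod (cHerm k x) \<le> (\<Prod>i\<in>UNIV. B (k i))" for x
    unfolding cHerm_def Herm_def norm_of_real abs_prod by (intro prod_mono) (auto intro: B)
  then show ?thesis by blast
qed

lemma L2_mult_bounded:
  assumes u: "u \<in> L2" and [measurable]: "f \<in> borel_measurable borel" and B: "\<And>x. cmod (f x) \<le> B"
  shows "(\<lambda>x. u x * f x) \<in> L2"
  unfolding L2_iff
proof
  have [measurable]: "u \<in> borel_measurable borel" by (rule L2_measurable[OF u])
  show m: "(\<lambda>x. u x * f x) \<in> borel_measurable borel" by measurable
  show "integrable lborel (\<lambda>x. (cmod (u x * f x))\<^sup>2)"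
  proof (rule Bochner_Integration.integrable_bound)
    show "integrable lborel (\<lambda>x. B\<^sup>2 * (cmod (u x))\<^sup>2)" by (intro integrable_mult_right L2_integrable u)
    show "AE x in lborel. norm ((cmod (u x * f x))\<^sup>2) \<le> norm (B\<^sup>2 * (cmod (u x))\<^sup>2)"
      using B by (intro AE_I2) (auto simp: norm_mult power_mult_distrib mult.commute[of "B\<^sup>2"] intro!: mult_left_mono power_mono)
    show "(\<lambda>x. (cmod (u x * f x))\<^sup>2) \<in> borel_measurable lborel" using m by measurable
  qed
qed

lemma cHerm_mult_L2: "(\<lambda>x. cHerm k x * cHerm l x) \<in> L2"
proof -
  obtain B where "\<And>x. cmod (cHerm l x) \<le> B" using cHerm_bounded by blast
  then show ?thesis by (intro L2_mult_bounded cHerm_L2 L2_measurable[OF cHerm_L2])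
qed

lemma cHerm_mult_chermite_L2: "(\<lambda>x. cHerm k x * chermite b (x $ j)) \<in> L2"
proof -
  obtain B where "\<And>x. \<bar>hermite b x\<bar> \<le> B" using bounded_hermite by blast
  then show ?thesis by (intro L2_mult_bounded[where B=B] cHerm_L2) (auto, measurable)
qed

text \<open>The squared space-time norm over [0, m pi], where time orthogonality is exact; [0, T] is
  embedded there at the end.\<close>

definition bilinear :: "nat \<Rightarrow> (('d::finite \<Rightarrow> nat) \<Rightarrow> complex) \<Rightarrow> (('d \<Rightarrow> nat) \<Rightarrow> complex) \<Rightarrow> ennreal" where
  "bilinear m c e = (\<integral>\<^sup>+t. (\<integral>\<^sup>+x. ennreal ((cmod (hs (evol t c) x * hs (evol t e) x))\<^sup>2) \<partial>lborel) * indicator {0..real m * pi} t \<partial>lborel)"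

lemma nn_integral_L2sq: "u \<in> L2 \<Longrightarrow> (\<integral>\<^sup>+x. ennreal ((cmod (u x))\<^sup>2) \<partial>lborel) = ennreal (L2sq u)"
  unfolding L2sq_def by (intro nn_integral_eq_integral) (auto simp: L2_integrable)

lemma eig_deg: "eig k = 2 * real (deg k) + real CARD('d)" for k :: "'d::finite \<Rightarrow> nat"
  by (simp add: eig_def deg_def)

lemma hs_evol: "hs (evol t c) x = (\<Sum>k\<in>supp c. exp (\<i> * of_real (t * eig k)) * c k * cHerm k x)"
  by (simp add: hs_def ev_def) (simp add: evol_def)

lemma sum_fibres_le:
  fixes f :: "'i \<Rightarrow> real" and G :: "'l \<Rightarrow> real"
  assumes "finite A" "\<And>L. L \<in> \<theta> ` A \<Longrightarrow> G L \<le> C * (\<Sum>a\<in>{a \<in> A. \<theta> a = L}. f a)"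
  shows "(\<Sum>L\<in>\<theta> ` A. G L) \<le> C * (\<Sum>a\<in>A. f a)"
proof -
  have "(\<Sum>L\<in>\<theta> ` A. G L) \<le> (\<Sum>L\<in>\<theta> ` A. C * (\<Sum>a\<in>{a \<in> A. \<theta> a = L}. f a))" by (intro sum_mono assms)
  also have "\<dots> = C * (\<Sum>a\<in>A. f a)"
    using sum.group[of A "\<theta> ` A" \<theta> f] assms(1) by (simp flip: sum_distrib_left)
  finally show ?thesis .
qed

lemma sum_product_sq: "(\<Sum>a\<in>S \<times> T. (cmod (c (fst a) * e (snd a)))\<^sup>2) = (\<Sum>k\<in>S. (cmod (c k))\<^sup>2) * (\<Sum>l\<in>T. (cmod (e l))\<^sup>2)"
  by (simp add: sum_product sum.cartesian_product case_prod_beta norm_mult power_mult_distrib)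

text \<open>\<open>time_orthogonality\<close> splits the norm by total energy, and each energy shell
  is bounded by \<open>L2sq_products_le\<close>, whose constant increases with the energy.\<close>

lemma bilinear_strichartz:
  fixes c e :: "('d::finite \<Rightarrow> nat) \<Rightarrow> complex"
  assumes d: "CARD('d) \<ge> 2" and fin: "finite (supp c)" "finite (supp e)"
    and L: "\<And>k l. k \<in> supp c \<Longrightarrow> l \<in> supp e \<Longrightarrow> deg k + deg l \<le> L"
  shows "bilinear m c e \<le> ennreal (real m * pi * (real CARD('d) * sqrt (real CARD('d)) * 2 ^ (CARD('d) - 1) * sqrt (real L + 1) ^ (CARD('d) - 2)) * (csq c * csq e))"
proof -
  let ?A = "supp c \<times> supp e"
  let ?C = "\<lambda>L. real CARD('d) * sqrt (real CARD('d)) * 2 ^ (CARD('d) - 1) * sqrt (real L + 1) ^ (CARD('d) - 2)"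
  let ?\<theta> = "\<lambda>a. deg (fst a) + deg (snd a)"
  let ?\<psi> = "\<lambda>a x. c (fst a) * e (snd a) * (cHerm (fst a) x * cHerm (snd a) x)"
  have A: "finite ?A" using fin by auto
  have \<psi>: "?\<psi> a \<in> L2" for a by (intro L2_cmult cHerm_mult_L2)
  have prod: "hs (evol t c) x * hs (evol t e) x = (\<Sum>a\<in>?A. exp (\<i> * of_real (t * (2 * real (?\<theta> a) + 2 * real CARD('d)))) * ?\<psi> a x)" for t x
    unfolding hs_evol sum_product sum.cartesian_product
    by (intro sum.cong refl) (auto simp: eig_deg algebra_simps exp_add[symmetric] simp flip: exp_add)
  have "bilinear m c e = (\<integral>\<^sup>+t. ennreal (L2sq (\<lambda>x. \<Sum>a\<in>?A. exp (\<i> * of_real (t * (2 * real (?\<theta> a) + 2 * real CARD('d)))) * ?\<psi> a x)) * indicator {0..real m * pi} t \<partial>lborel)"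
    unfolding bilinear_def prod by (subst nn_integral_L2sq) (auto intro!: L2_sum L2_cmult cHerm_mult_L2 simp: mult.assoc[of "exp _"])
  also have "\<dots> = ennreal (real m * pi * (\<Sum>L\<in>?\<theta> ` ?A. L2sq (\<lambda>x. \<Sum>a\<in>{a \<in> ?A. ?\<theta> a = L}. ?\<psi> a x)))"
    by (rule time_orthogonality(2)[OF A \<psi>])
  also have "\<dots> \<le> ennreal (real m * pi * (?C L * (\<Sum>a\<in>?A. (cmod (c (fst a) * e (snd a)))\<^sup>2)))"
  proof (intro ennreal_leI mult_left_mono sum_fibres_le A)
    fix L' assume L': "L' \<in> ?\<theta> ` ?A"
    then have "L' \<le> L" using L by auto
    have "L2sq (\<lambda>x. \<Sum>a\<in>{a \<in> ?A. ?\<theta> a = L'}. ?\<psi> a x) \<le> ?C L' * (\<Sum>a\<in>{a \<in> ?A. ?\<theta> a = L'}. (cmod (c (fst a) * e (snd a)))\<^sup>2)"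
      by (rule L2sq_products_le[OF d]) (use A in auto)
    also have "\<dots> \<le> ?C L * (\<Sum>a\<in>{a \<in> ?A. ?\<theta> a = L'}. (cmod (c (fst a) * e (snd a)))\<^sup>2)"
      using \<open>L' \<le> L\<close> by (intro mult_right_mono mult_left_mono power_mono sum_nonneg) auto
    finally show "L2sq (\<lambda>x. \<Sum>a\<in>{a \<in> ?A. ?\<theta> a = L'}. ?\<psi> a x) \<le> ?C L * (\<Sum>a\<in>{a \<in> ?A. ?\<theta> a = L'}. (cmod (c (fst a) * e (snd a)))\<^sup>2)" .
  qed simp
  also have "\<dots> = ennreal (real m * pi * ?C L * (csq c * csq e))"
    unfolding sum_product_sq csq_def by (simp only: mult.assoc)
  finally show ?thesis .
qed

text \<open>In the coordinate \<open>j\<close> the first factor oscillates much faster than the second, which gains \<open>\<kappa> powr (-1/2)\<close>; in each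
  other coordinate the second factor is bounded pointwise by \<open>sum_hermite_sq_le\<close>.\<close>

lemma bilinear_transversal:
  fixes c e :: "('d::finite \<Rightarrow> nat) \<Rightarrow> complex" and j :: 'd
  assumes fin: "finite (supp c)" "finite (supp e)"
    and c: "\<And>k. k \<in> supp c \<Longrightarrow> k j \<ge> \<kappa>" and e: "\<And>l i. l \<in> supp e \<Longrightarrow> l i \<le> b0"
    and \<kappa>: "32 * b0 \<le> \<kappa>" "\<kappa> > 0"
  shows "bilinear m c e \<le> ennreal (sqrt (2 * (real b0 + 1)) ^ (CARD('d) - 1) * (real m * pi * (48 / sqrt (real \<kappa>))) * (csq c * csq e))"
proof -
  let ?J = "PiE UNIV (\<lambda>i. if i = j then {0} else {..b0}) :: ('d \<Rightarrow> nat) set"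
  let ?\<beta> = "sqrt (2 * (real b0 + 1)) ^ (CARD('d) - 1)"
  let ?A = "supp c \<times> {..b0}"
  let ?\<theta> = "\<lambda>a::('d \<Rightarrow> nat) \<times> nat. deg (fst a) + snd a"
  have J: "finite ?J" by (intro finite_PiE) auto
  have Jj: "l j = 0" if "l \<in> ?J" for l using that by (auto simp: PiE_iff split: if_splits)
  have A: "finite ?A" using fin by auto
  define \<psi> where "\<psi> l a x = c (fst a) * e (l(j := snd a)) * (cHerm (fst a) x * chermite (snd a) (x $ j))" for l a x
  \<comment> \<open>For a fixed transversal index l the energy is 2 (deg k + b) plus this offset, so
    time orthogonality applies to each l separately.\<close>
  define \<rho> where "\<rho> l = 2 * real (deg l) + 2 * real CARD('d)" for l :: "'d \<Rightarrow> nat"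
  define g where "g l t x = (\<Sum>a\<in>?A. exp (\<i> * of_real (t * (2 * real (?\<theta> a) + \<rho> l))) * \<psi> l a x)" for l t x
  have \<psi>: "\<psi> l a \<in> L2" for l a unfolding \<psi>_def[abs_def] by (intro L2_cmult cHerm_mult_chermite_L2)
  have gL2: "g l t \<in> L2" for l t unfolding g_def[abs_def] by (intro L2_sum L2_cmult \<psi>)
  \<comment> \<open>The part of the second factor with transversal index l, stripped of
    \<open>Hrest j l\<close>: a function of \<open>x $ j\<close> alone.\<close>
  define V where "V l t s = (\<Sum>b\<le>b0. exp (\<i> * of_real (t * eig (l(j := b)))) * e (l(j := b)) * chermite b s)" for l :: "'d \<Rightarrow> nat" and t s
  have UV: "hs (evol t c) x * V l t (x $ j) = g l t x" if l: "l \<in> ?J" for l :: "'d \<Rightarrow> nat" and t x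
  proof -
    have "eig k + eig (l(j := b)) = 2 * real (deg k + b) + \<rho> l" for k :: "'d \<Rightarrow> nat" and b
      using deg_upd[of l j b] Jj[OF l] by (simp add: eig_deg \<rho>_def fun_upd_idem)
    then have E: "exp (\<i> * of_real (t * eig k)) * exp (\<i> * of_real (t * eig (l(j := b)))) = exp (\<i> * of_real (t * (2 * real (deg k + b) + \<rho> l)))" for k :: "'d \<Rightarrow> nat" and b
      by (simp only: exp_add[symmetric] distrib_left[symmetric] of_real_add[symmetric])
    show ?thesis
      unfolding hs_evol V_def g_def \<psi>_def sum_product sum.cartesian_product
      by (intro sum.cong refl) (auto simp: E[symmetric] mult_ac simp del: of_nat_add of_real_mult of_real_add)
  qed
  have bij: "bij_betw (\<lambda>(l, b). l(j := b)) (?J \<times> {..b0}) (PiE UNIV (\<lambda>_. {..b0}))"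
  proof (rule bij_betwI[where g="\<lambda>l. (l(j := 0), l j)"])
    show "(\<lambda>(l, b). l(j := b)) \<in> ?J \<times> {..b0} \<rightarrow> PiE UNIV (\<lambda>_. {..b0})" by (auto simp: PiE_iff split: if_splits)
    show "(\<lambda>l. (l(j := 0), l j)) \<in> PiE UNIV (\<lambda>_. {..b0}) \<rightarrow> ?J \<times> {..b0}" by (auto simp: PiE_iff)
    fix q assume q: "q \<in> ?J \<times> {..b0}"
    then have "(fst q) j = 0" using Jj by auto
    then show "(((case q of (l, b) \<Rightarrow> l(j := b))(j := 0)), (case q of (l, b) \<Rightarrow> l(j := b)) j) = q"
      by (cases q) (auto simp: fun_upd_idem)
  qed auto
  have Vsum: "hs (evol t e) x = (\<Sum>l\<in>?J. of_real (Hrest j l x) * V l t (x $ j))" for t x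
  proof -
    let ?F = "\<lambda>l. exp (\<i> * of_real (t * eig l)) * e l * cHerm l x"
    have "hs (evol t e) x = (\<Sum>l\<in>supp e. ?F l)" by (rule hs_evol)
    also have "\<dots> = (\<Sum>l\<in>PiE UNIV (\<lambda>_. {..b0}). ?F l)"
      using e by (intro sum.mono_neutral_left finite_PiE) (auto simp: PiE_UNIV_domain supp_def)
    also have "\<dots> = (\<Sum>q\<in>?J \<times> {..b0}. ?F (case q of (l, b) \<Rightarrow> l(j := b)))"
      by (rule sum.reindex_bij_betw[OF bij, symmetric])
    also have "\<dots> = (\<Sum>l\<in>?J. \<Sum>b\<le>b0. ?F (l(j := b)))"
      by (simp add: sum.cartesian_product case_prod_beta)
    also have "\<dots> = (\<Sum>l\<in>?J. of_real (Hrest j l x) * V l t (x $ j))"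
      unfolding V_def sum_distrib_left cHerm_Hrest[of _ x j] by (intro sum.cong refl) (simp add: mult_ac)
    finally show ?thesis .
  qed
  \<comment> \<open>Cauchy-Schwarz over l at each point, so the transversal Hermite factors enter
    only through their pointwise sum of squares.\<close>
  have pt: "(cmod (hs (evol t c) x * hs (evol t e) x))\<^sup>2 \<le> ?\<beta> * (\<Sum>l\<in>?J. (cmod (g l t x))\<^sup>2)" for t x
  proof -
    have "hs (evol t c) x * hs (evol t e) x = (\<Sum>l\<in>?J. of_real (Hrest j l x) * g l t x)"
      unfolding Vsum sum_distrib_left by (intro sum.cong refl) (simp add: UV[symmetric] mult_ac)
    then have "cmod (hs (evol t c) x * hs (evol t e) x) \<le> (\<Sum>l\<in>?J. \<bar>Hrest j l x\<bar> * cmod (g l t x))"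
      using norm_sum[of "\<lambda>l. of_real (Hrest j l x) * g l t x" ?J] by (simp add: norm_mult)
    then have "(cmod (hs (evol t c) x * hs (evol t e) x))\<^sup>2 \<le> (\<Sum>l\<in>?J. \<bar>Hrest j l x\<bar> * cmod (g l t x))\<^sup>2" by (intro power_mono) auto
    also have "\<dots> \<le> (\<Sum>l\<in>?J. \<bar>Hrest j l x\<bar>\<^sup>2) * (\<Sum>l\<in>?J. (cmod (g l t x))\<^sup>2)" by (rule Cauchy_Schwarz_ineq_sum)
    also have "\<dots> \<le> ?\<beta> * (\<Sum>l\<in>?J. (cmod (g l t x))\<^sup>2)"
      using sum_Hrest_sq_le[of j x b0] by (intro mult_right_mono sum_nonneg) auto
    finally show ?thesis .
  qed
  have [measurable]: "g l t \<in> borel_measurable borel" for l t by (rule L2_measurable[OF gL2])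
  have inner: "(\<integral>\<^sup>+x. ennreal ((cmod (hs (evol t c) x * hs (evol t e) x))\<^sup>2) \<partial>lborel) \<le> (\<Sum>l\<in>?J. ennreal ?\<beta> * ennreal (L2sq (g l t)))" for t
  proof -
    have "(\<integral>\<^sup>+x. ennreal ((cmod (hs (evol t c) x * hs (evol t e) x))\<^sup>2) \<partial>lborel) \<le> (\<integral>\<^sup>+x. (\<Sum>l\<in>?J. ennreal ?\<beta> * ennreal ((cmod (g l t x))\<^sup>2)) \<partial>lborel)"
    proof (rule nn_integral_mono)
      fix x
      have "ennreal ((cmod (hs (evol t c) x * hs (evol t e) x))\<^sup>2) \<le> ennreal (?\<beta> * (\<Sum>l\<in>?J. (cmod (g l t x))\<^sup>2))" by (rule ennreal_leI[OF pt])
      also have "\<dots> = (\<Sum>l\<in>?J. ennreal ?\<beta> * ennreal ((cmod (g l t x))\<^sup>2))"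
        by (subst ennreal_mult) (auto simp: sum_nonneg sum_distrib_left simp flip: sum_ennreal)
      finally show "ennreal ((cmod (hs (evol t c) x * hs (evol t e) x))\<^sup>2) \<le> (\<Sum>l\<in>?J. ennreal ?\<beta> * ennreal ((cmod (g l t x))\<^sup>2))" .
    qed
    also have "\<dots> = (\<Sum>l\<in>?J. ennreal ?\<beta> * ennreal (L2sq (g l t)))"
      by (subst nn_integral_sum) (auto simp: nn_integral_cmult nn_integral_L2sq[OF gL2])
    finally show ?thesis .
  qed
  have gm: "(\<lambda>t. L2sq (g l t)) \<in> borel_measurable borel" for l
    unfolding g_def by (rule time_orthogonality(1)[OF A \<psi>])
  have gt: "(\<integral>\<^sup>+t. ennreal (L2sq (g l t)) * indicator {0..real m * pi} t \<partial>lborel) \<le> ennreal (real m * pi * (48 / sqrt (real \<kappa>) * (\<Sum>a\<in>?A. (cmod (c (fst a) * e (l(j := snd a))))\<^sup>2)))" for l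
  proof -
    have "(\<integral>\<^sup>+t. ennreal (L2sq (g l t)) * indicator {0..real m * pi} t \<partial>lborel) = ennreal (real m * pi * (\<Sum>L\<in>?\<theta> ` ?A. L2sq (\<lambda>x. \<Sum>a\<in>{a \<in> ?A. ?\<theta> a = L}. \<psi> l a x)))"
      unfolding g_def by (rule time_orthogonality(2)[OF A \<psi>])
    also have "\<dots> \<le> ennreal (real m * pi * (48 / sqrt (real \<kappa>) * (\<Sum>a\<in>?A. (cmod (c (fst a) * e (l(j := snd a))))\<^sup>2)))"
    proof (intro ennreal_leI mult_left_mono sum_fibres_le A)
      fix L
      show "L2sq (\<lambda>x. \<Sum>a\<in>{a \<in> ?A. ?\<theta> a = L}. \<psi> l a x) \<le> 48 / sqrt (real \<kappa>) * (\<Sum>a\<in>{a \<in> ?A. ?\<theta> a = L}. (cmod (c (fst a) * e (l(j := snd a))))\<^sup>2)"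
        unfolding \<psi>_def by (rule L2sq_transversal_le[where L=L and ?b0.0=b0]) (use A c \<kappa> in auto)
    qed simp
    finally show ?thesis .
  qed
  have "bilinear m c e \<le> (\<integral>\<^sup>+t. (\<Sum>l\<in>?J. ennreal ?\<beta> * (ennreal (L2sq (g l t)) * indicator {0..real m * pi} t)) \<partial>lborel)"
    unfolding bilinear_def
  proof (rule nn_integral_mono)
    fix t
    show "(\<integral>\<^sup>+x. ennreal ((cmod (hs (evol t c) x * hs (evol t e) x))\<^sup>2) \<partial>lborel) * indicator {0..real m * pi} t \<le> (\<Sum>l\<in>?J. ennreal ?\<beta> * (ennreal (L2sq (g l t)) * indicator {0..real m * pi} t))"
      using mult_right_mono[OF inner[of t], of "indicator {0..real m * pi} t"] by (simp add: sum_distrib_right mult.assoc)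
  qed
  also have "\<dots> = (\<Sum>l\<in>?J. ennreal ?\<beta> * (\<integral>\<^sup>+t. ennreal (L2sq (g l t)) * indicator {0..real m * pi} t \<partial>lborel))"
    using gm by (subst nn_integral_sum) (auto intro!: sum.cong nn_integral_cmult)
  also have "\<dots> \<le> (\<Sum>l\<in>?J. ennreal ?\<beta> * ennreal (real m * pi * (48 / sqrt (real \<kappa>) * (\<Sum>a\<in>?A. (cmod (c (fst a) * e (l(j := snd a))))\<^sup>2))))"
    by (intro sum_mono mult_left_mono gt) auto
  also have "\<dots> = ennreal (\<Sum>l\<in>?J. ?\<beta> * (real m * pi * (48 / sqrt (real \<kappa>) * (\<Sum>a\<in>?A. (cmod (c (fst a) * e (l(j := snd a))))\<^sup>2))))"
  proof -
    have "(\<Sum>l\<in>?J. ennreal ?\<beta> * ennreal (q l)) = ennreal (\<Sum>l\<in>?J. ?\<beta> * q l)" if "\<And>l. q l \<ge> 0" for q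
      using that by (simp add: sum_ennreal[symmetric] ennreal_mult)
    then show ?thesis by this (intro mult_nonneg_nonneg sum_nonneg divide_nonneg_nonneg; simp)
  qed
  also have "(\<Sum>l\<in>?J. ?\<beta> * (real m * pi * (48 / sqrt (real \<kappa>) * (\<Sum>a\<in>?A. (cmod (c (fst a) * e (l(j := snd a))))\<^sup>2))))
    = ?\<beta> * (real m * pi * (48 / sqrt (real \<kappa>))) * (csq c * csq e)"
  proof -
    have "(\<Sum>l\<in>?J. \<Sum>a\<in>?A. (cmod (c (fst a) * e (l(j := snd a))))\<^sup>2) = csq c * (\<Sum>l\<in>?J. \<Sum>b\<le>b0. (cmod (e (l(j := b))))\<^sup>2)"
      unfolding csq_def sum_distrib_left
      by (intro sum.cong refl) (subst sum_product_sq[of c "\<lambda>b. e (_(j := b))"], simp add: sum_distrib_left)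
    also have "(\<Sum>l\<in>?J. \<Sum>b\<le>b0. (cmod (e (l(j := b))))\<^sup>2) = csq e"
    proof -
      have "csq e = (\<Sum>l\<in>PiE UNIV (\<lambda>_. {..b0}). (cmod (e l))\<^sup>2)"
        using e by (intro csq_superset finite_PiE) (auto simp: PiE_UNIV_domain)
      also have "\<dots> = (\<Sum>q\<in>?J \<times> {..b0}. (cmod (e (case q of (l, b) \<Rightarrow> l(j := b))))\<^sup>2)"
        by (rule sum.reindex_bij_betw[OF bij, symmetric])
      finally show ?thesis by (simp add: sum.cartesian_product case_prod_beta)
    qed
    finally have S: "(\<Sum>l\<in>?J. \<Sum>a\<in>?A. (cmod (c (fst a) * e (l(j := snd a))))\<^sup>2) = csq c * csq e" .
    show ?thesis unfolding S[symmetric] by (simp only: sum_distrib_left mult.assoc)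
  qed
  finally show ?thesis .
qed

section \<open>The operators P along the evolution\<close>

lemma supp_zero [simp]: "supp (\<lambda>_. 0) = {}" "csq (\<lambda>_. 0) = 0"
  by (auto simp: supp_def csq_def)

lemma deg_inc: "deg (inc i k) = Suc (deg k)"
  using eig_inc[of i k] unfolding eig_deg by simp

lemma eig_dec: "k i > 0 \<Longrightarrow> eig k = eig (dec i k) + 2"
  by (metis eig_inc inc_dec)

lemma deg_dec: "k i > 0 \<Longrightarrow> deg k = Suc (deg (dec i k))"
  by (metis deg_inc inc_dec)

text \<open>Lowering changes the energy by 2 at every index, so the commutation phase does not
  depend on k.\<close>

lemma dnc_evol: "dnc i (evol t c) k = exp (\<i> * of_real (2 * t)) * evol t (dnc i c) k"
  by (simp add: dnc_def evol_def eig_inc ring_distribs exp_add mult_ac)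

lemma upc_evol: "upc i (evol t c) k = exp (- \<i> * of_real (2 * t)) * evol t (upc i c) k"
proof (cases "k i > 0")
  case True
  have "exp (- \<i> * of_real (2 * t)) * exp (\<i> * of_real (t * eig k)) = exp (\<i> * of_real (t * eig (dec i k)))"
    unfolding exp_add[symmetric] eig_dec[of k, OF True] by (simp add: algebra_simps)
  then show ?thesis using True by (simp add: upc_def evol_def mult_ac)
qed (simp add: upc_def evol_def)

text \<open>Creation and annihilation operators commute with the evolution up to a phase, so \<open>P \<alpha>\<close> of a solution is a sum of
  phases times solutions with data in \<open>descendant\<close>.\<close>

definition descendant :: "real \<Rightarrow> nat \<Rightarrow> (('d::finite \<Rightarrow> nat) \<Rightarrow> complex) \<Rightarrow> (('d \<Rightarrow> nat) \<Rightarrow> complex) \<Rightarrow> bool" where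
  "descendant b n c c' \<longleftrightarrow> finite (supp c') \<and> csq c' \<le> (b + real n + 1) ^ n * csq c
     \<and> (\<forall>k\<in>supp c'. \<exists>l\<in>supp c. deg k \<le> deg l + n \<and> deg l \<le> deg k + n)"

lemma descendant_step:
  assumes b: "\<And>k. k \<in> supp c \<Longrightarrow> real (deg k) \<le> b" "b \<ge> 0" and c': "descendant b n c c'"
  shows "descendant b (Suc n) c (dnc i c')" "descendant b (Suc n) c (upc i c')"
proof -
  have fin: "finite (supp c')" and le: "csq c' \<le> (b + real n + 1) ^ n * csq c"
    and sh: "\<And>k. k \<in> supp c' \<Longrightarrow> \<exists>l\<in>supp c. deg k \<le> deg l + n \<and> deg l \<le> deg k + n"
    using c' by (auto simp: descendant_def)
  \<comment> \<open>After n operators a degree has grown by at most n; hence b + n in the cost of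
    the next one.\<close>
  have bd: "real (k i) \<le> b + n" if k: "k \<in> supp c'" for k
  proof -
    obtain l where l: "l \<in> supp c" "deg k \<le> deg l + n" using sh[OF k] by blast
    have "real (k i) \<le> real (deg l + n)" using le_deg[of k i] l(2) by (intro of_nat_mono) linarith
    then show ?thesis using b(1)[OF l(1)] by simp
  qed
  have up: "(b + n + 1) * csq c' \<le> (b + real (Suc n) + 1) ^ Suc n * csq c"
  proof -
    have "(b + n + 1) * csq c' \<le> (b + n + 1) * ((b + real n + 1) ^ n * csq c)" using b(2) by (intro mult_left_mono le) auto
    also have "\<dots> = (b + real n + 1) ^ Suc n * csq c" by simp
    also have "\<dots> \<le> (b + real (Suc n) + 1) ^ Suc n * csq c" using b(2) by (intro mult_right_mono power_mono) auto
    finally show ?thesis .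
  qed
  have half: "s * csq c' \<le> (b + n + 1) * csq c'" if "s \<le> b + n + 1" for s using that by (intro mult_right_mono) auto
  show "descendant b (Suc n) c (dnc i c')"
    unfolding descendant_def
  proof (intro conjI ballI)
    show "finite (supp (dnc i c'))" by (rule finite_supp_ops[OF fin])
    have "csq (dnc i c') \<le> (b + n) / 2 * csq c'" using b(2) by (intro csq_dnc fin bd) auto
    also have "\<dots> \<le> (b + n + 1) * csq c'" using b(2) by (intro half) (auto simp: field_simps)
    finally show "csq (dnc i c') \<le> (b + real (Suc n) + 1) ^ Suc n * csq c" using up by linarith
    fix k assume "k \<in> supp (dnc i c')"
    then obtain l where l: "l \<in> supp c'" "l i > 0" "k = dec i l" using supp_dnc by fastforce
    obtain l' where "l' \<in> supp c" "deg l \<le> deg l' + n" "deg l' \<le> deg l + n" using sh[OF l(1)] by blast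
    then show "\<exists>l\<in>supp c. deg k \<le> deg l + Suc n \<and> deg l \<le> deg k + Suc n"
      using deg_dec[of l i, OF l(2)] l(3) by (intro bexI[of _ l']) auto
  qed
  show "descendant b (Suc n) c (upc i c')"
    unfolding descendant_def
  proof (intro conjI ballI)
    show "finite (supp (upc i c'))" by (rule finite_supp_ops[OF fin])
    have "csq (upc i c') \<le> (b + n + 1) / 2 * csq c'" by (intro csq_upc fin bd) auto
    also have "\<dots> \<le> (b + n + 1) * csq c'" using b(2) by (intro half) (auto simp: field_simps)
    finally show "csq (upc i c') \<le> (b + real (Suc n) + 1) ^ Suc n * csq c" using up by linarith
    fix k assume "k \<in> supp (upc i c')"
    then obtain l where l: "l \<in> supp c'" "k = inc i l" using supp_upc by fastforce
    obtain l' where "l' \<in> supp c" "deg l \<le> deg l' + n" "deg l' \<le> deg l + n" using sh[OF l(1)] by blast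
    then show "\<exists>l\<in>supp c. deg k \<le> deg l + Suc n \<and> deg l \<le> deg k + Suc n"
      using deg_inc[of i l] l(2) by (intro bexI[of _ l']) auto
  qed
qed

text \<open>The bound on the length allows a factor 2 d per operator: 2 for lowering and raising, d
  for the sum over components in a contraction.\<close>

definition expansion :: "real \<Rightarrow> nat \<Rightarrow> (('d::finite \<Rightarrow> nat) \<Rightarrow> complex) \<Rightarrow> (real \<Rightarrow> ('d \<Rightarrow> nat) \<Rightarrow> complex)
    \<Rightarrow> ((real \<Rightarrow> complex) \<times> (('d \<Rightarrow> nat) \<Rightarrow> complex)) list \<Rightarrow> bool" where
  "expansion b n c C L \<longleftrightarrow> length L \<le> (2 * CARD('d)) ^ n
     \<and> (\<forall>(\<omega>, c')\<in>set L. (\<forall>t. cmod (\<omega> t) \<le> 1) \<and> descendant b n c c')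
     \<and> (\<forall>t k. C t k = (\<Sum>(\<omega>, c')\<leftarrow>L. \<omega> t * evol t c' k))"

definition ladder where
  "ladder s i L = concat (map (\<lambda>(\<omega>, c'). [(\<lambda>t. exp (\<i> * of_real (2 * t)) * \<omega> t, dnc i c'), (\<lambda>t. s * exp (- \<i> * of_real (2 * t)) * \<omega> t, upc i c')]) L)"

lemma length_ladder [simp]: "length (ladder s i L) = 2 * length L"
  by (induction L) (auto simp: ladder_def)

lemma sum_list_ladder:
  fixes L :: "((real \<Rightarrow> complex) \<times> (('d::finite \<Rightarrow> nat) \<Rightarrow> complex)) list"
  shows "(\<Sum>(\<omega>, c')\<leftarrow>ladder s i L. \<omega> t * evol t c' k) = Xc s i (\<lambda>k. \<Sum>(\<omega>, c')\<leftarrow>L. \<omega> t * evol t c' k) k"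
proof (induction L)
  case Nil then show ?case by (simp add: ladder_def Xc_def dnc_def upc_def)
next
  case (Cons a L)
  obtain \<omega> c' where a: "a = (\<omega>, c')" by (cases a)
  have "Xc s i (\<lambda>k. \<omega> t * evol t c' k + f k) k = \<omega> t * (dnc i (evol t c') k + s * upc i (evol t c') k) + Xc s i f k" for f :: "('d \<Rightarrow> nat) \<Rightarrow> complex"
    by (simp add: Xc_def dnc_def upc_def algebra_simps)
  from this[of "\<lambda>k. \<Sum>(\<omega>, c')\<leftarrow>L. \<omega> t * evol t c' k"] show ?case
    using Cons unfolding dnc_evol upc_evol a list.map sum_list.Cons case_prod_conv by (simp add: ladder_def algebra_simps)
qed

lemma ladder_terms:
  assumes b: "\<And>k. k \<in> supp c \<Longrightarrow> real (deg k) \<le> b" "b \<ge> 0" and s: "cmod s \<le> 1"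
    and L: "\<forall>(\<omega>, c')\<in>set L. (\<forall>t. cmod (\<omega> t) \<le> 1) \<and> descendant b n c c'"
  shows "\<forall>(\<omega>, c')\<in>set (ladder s i L). (\<forall>t. cmod (\<omega> t) \<le> 1) \<and> descendant b (Suc n) c c'"
proof -
  have 1: "cmod (exp (\<i> * of_real r)) = 1" "cmod (exp (- \<i> * of_real r)) = 1" for r by auto
  show ?thesis
    using L s mult_mono[OF s, of "cmod _" 1] unfolding ladder_def
    by (auto simp: norm_mult 1 intro!: descendant_step[OF b] mult_le_one)
qed

definition is_scalar :: "'d coeffs \<Rightarrow> bool" where "is_scalar C \<longleftrightarrow> (\<exists>c. C = CScalar c)"

text \<open>Each operator switches between scalars and vectors, so parity decides whether the next
  one is of gradient or of divergence type.\<close>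

lemma is_scalar_Pc:
  fixes c :: "('d::finite \<Rightarrow> nat) \<Rightarrow> complex"
  shows "is_scalar (Pc \<alpha> c) \<longleftrightarrow> even (length \<alpha>)"
proof (induction \<alpha>)
  case (Cons a \<alpha>)
  have "is_scalar (cstep s C) \<longleftrightarrow> \<not> is_scalar C" for s and C :: "'d coeffs" by (cases C) (auto simp: is_scalar_def)
  then show ?case using Cons by (simp add: Pc_def)
qed (simp add: Pc_def is_scalar_def)

lemma Pc_expansion:
  fixes c :: "('d::finite \<Rightarrow> nat) \<Rightarrow> complex"
  assumes c: "finite (supp c)" and b: "\<And>k. k \<in> supp c \<Longrightarrow> real (deg k) \<le> b" "b \<ge> 0"
  shows "\<exists>L. expansion b (length \<alpha>) c (\<lambda>t. ccomp (Pc \<alpha> (evol t c)) i) L"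
proof (induction \<alpha> arbitrary: i)
  case Nil
  have "expansion b 0 c (\<lambda>t. ccomp (Pc [] (evol t c)) i) [(\<lambda>_. 1, c)]"
    using c by (auto simp: expansion_def Pc_def descendant_def)
  then show ?case by auto
next
  case (Cons a \<alpha>)
  let ?s = "if a = 1 then -1 else 1 :: complex"
  let ?n = "length \<alpha>"
  obtain L where L: "\<And>i. expansion b ?n c (\<lambda>t. ccomp (Pc \<alpha> (evol t c)) i) (L i)" using Cons by metis
  have len: "length (L i) \<le> (2 * CARD('d)) ^ ?n" for i using L by (auto simp: expansion_def)
  have terms: "\<forall>(\<omega>, c')\<in>set (ladder ?s i (L i)). (\<forall>t. cmod (\<omega> t) \<le> 1) \<and> descendant b (Suc ?n) c c'" for i
    using L[of i] by (intro ladder_terms b) (auto simp: expansion_def)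
  have val: "Xc ?s i (ccomp (Pc \<alpha> (evol t c)) i) k = (\<Sum>(\<omega>, c')\<leftarrow>ladder ?s i (L i). \<omega> t * evol t c' k)" for i t k
  proof -
    have "ccomp (Pc \<alpha> (evol t c)) i = (\<lambda>k. \<Sum>(\<omega>, c')\<leftarrow>L i. \<omega> t * evol t c' k)" using L[of i] by (auto simp: expansion_def)
    then show ?thesis by (simp only: sum_list_ladder)
  qed
  show ?case
  \<comment> \<open>For even length the operator makes a vector out of a scalar, and component i
    needs one ladder. For odd length it contracts a vector, and the ladders of all components are
    concatenated.\<close>
  proof (cases "even ?n")
    case True
    have "ccomp (Pc (a # \<alpha>) (evol t c)) i = Xc ?s i (ccomp (Pc \<alpha> (evol t c)) i)" for t
      using True is_scalar_Pc[of \<alpha> "evol t c"] by (auto simp: is_scalar_def Pc_def)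
    then have "expansion b (length (a # \<alpha>)) c (\<lambda>t. ccomp (Pc (a # \<alpha>) (evol t c)) i) (ladder ?s i (L i))"
      unfolding expansion_def
    proof (intro conjI allI)
      show "length (ladder ?s i (L i)) \<le> (2 * CARD('d)) ^ length (a # \<alpha>)"
        using mult_mono[OF _ len[of i], of 2 "2 * CARD('d)"] by (simp add: Suc_le_eq)
    qed (use terms[of i] in \<open>simp_all only: val length_Cons\<close>)
    then show ?thesis by blast
  next
    case False
    obtain js :: "'d list" where js: "set js = UNIV" "distinct js" using finite_distinct_list[of "UNIV :: 'd set"] by auto
    have ljs: "length js = CARD('d)" using distinct_card[OF js(2)] js(1) by simp
    let ?L = "concat (map (\<lambda>i. ladder ?s i (L i)) js)"
    have eq: "ccomp (Pc (a # \<alpha>) (evol t c)) i k = (\<Sum>i\<in>UNIV. Xc ?s i (ccomp (Pc \<alpha> (evol t c)) i) k)" for t k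
    proof -
      obtain D where "Pc \<alpha> (evol t c) = CVector D"
        using False is_scalar_Pc[of \<alpha> "evol t c"] by (cases "Pc \<alpha> (evol t c)") (auto simp: is_scalar_def)
      then show ?thesis by (simp add: Pc_def)
    qed
    have "sum_list (map f (concat (map g js))) = (\<Sum>i\<leftarrow>js. sum_list (map f (g i)))" for f :: "(real \<Rightarrow> complex) \<times> (('d \<Rightarrow> nat) \<Rightarrow> complex) \<Rightarrow> complex" and g and js :: "'d list"
      by (induction js) auto
    then have "(\<Sum>(\<omega>, c')\<leftarrow>?L. \<omega> t * evol t c' k) = ccomp (Pc (a # \<alpha>) (evol t c)) i k" for t k
      unfolding eq val using sum_list_distinct_conv_sum_set[OF js(2), of "\<lambda>i. \<Sum>(\<omega>, c')\<leftarrow>ladder ?s i (L i). \<omega> t * evol t c' k"] js(1) by simp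
    moreover have "length ?L \<le> (2 * CARD('d)) ^ Suc ?n"
    proof -
      have "length (concat (map (\<lambda>i. ladder ?s i (L i)) js)) \<le> length js * (2 * (2 * CARD('d)) ^ ?n)" for js
      proof (induction js)
        case (Cons j js) then show ?case using len[of j] by simp
      qed simp
      from this[of js] show ?thesis by (simp add: ljs mult_ac)
    qed
    moreover have "\<forall>(\<omega>, c')\<in>set ?L. (\<forall>t. cmod (\<omega> t) \<le> 1) \<and> descendant b (Suc ?n) c c'" using terms by fastforce
    ultimately have "expansion b (length (a # \<alpha>)) c (\<lambda>t. ccomp (Pc (a # \<alpha>) (evol t c)) i) ?L"
      unfolding expansion_def by simp
    then show ?thesis by blast
  qed
qed

text \<open>The lists are padded with zero terms to a common length, so that sums over components
  and terms have fixed index sets.\<close>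

lemma Pc_terms:
  fixes c :: "('d::finite \<Rightarrow> nat) \<Rightarrow> complex"
  assumes c: "finite (supp c)" and b: "\<And>k. k \<in> supp c \<Longrightarrow> real (deg k) \<le> b" "b \<ge> 0"
  obtains \<omega> c' where "\<And>i p t. cmod (\<omega> i p t) \<le> 1" "\<And>i p. descendant b (length \<alpha>) c (c' i p)"
    "\<And>t i x. hs (ccomp (Pc \<alpha> (evol t c)) i) x = (\<Sum>p<(2 * CARD('d)) ^ length \<alpha>. \<omega> i p t * hs (evol t (c' i p)) x)"
proof -
  let ?n = "length \<alpha>" let ?D = "(2 * CARD('d)) ^ ?n"
  obtain L where L: "\<And>i. expansion b ?n c (\<lambda>t. ccomp (Pc \<alpha> (evol t c)) i) (L i)" using Pc_expansion[OF assms] by metis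
  define \<omega> where "\<omega> i p = (if p < length (L i) then fst (L i ! p) else (\<lambda>_. 0))" for i p
  define c' where "c' i p = (if p < length (L i) then snd (L i ! p) else (\<lambda>_. 0))" for i p
  have trm: "(\<forall>t. cmod (fst a t) \<le> 1) \<and> descendant b ?n c (snd a)" if "a \<in> set (L i)" for a i
    using L[of i] that by (cases a) (auto simp: expansion_def)
  have 1: "cmod (\<omega> i p t) \<le> 1" for i p t using trm[of "L i ! p" i] by (auto simp: \<omega>_def)
  have 2: "descendant b ?n c (c' i p)" for i p
    using trm[of "L i ! p" i] b(2) unfolding c'_def by (auto simp: descendant_def)
  have 3: "hs (ccomp (Pc \<alpha> (evol t c)) i) x = (\<Sum>p<?D. \<omega> i p t * hs (evol t (c' i p)) x)" for t i x
  proof -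
    have "ccomp (Pc \<alpha> (evol t c)) i k = (\<Sum>p<?D. \<omega> i p t * evol t (c' i p) k)" for k
    proof -
      have "ccomp (Pc \<alpha> (evol t c)) i k = (\<Sum>(\<omega>, c')\<leftarrow>L i. \<omega> t * evol t c' k)" using L[of i] by (auto simp: expansion_def)
      also have "\<dots> = (\<Sum>p<length (L i). \<omega> i p t * evol t (c' i p) k)"
        by (subst sum_list_sum_nth) (auto simp: \<omega>_def c'_def case_prod_beta atLeast0LessThan intro!: sum.cong)
      also have "\<dots> = (\<Sum>p<?D. \<omega> i p t * evol t (c' i p) k)"
        using L[of i] by (intro sum.mono_neutral_left) (auto simp: expansion_def \<omega>_def)
      finally show ?thesis .
    qed
    then have "ccomp (Pc \<alpha> (evol t c)) i = (\<lambda>k. \<Sum>p<?D. \<omega> i p t * evol t (c' i p) k)" by auto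
    moreover have "finite (supp (evol t (c' i p)))" for p using 2[of i p] by (simp add: descendant_def)
    ultimately show ?thesis unfolding hs_def by (simp add: ev_sum(1))
  qed
  show thesis by (rule that[OF 1 2 3])
qed

section \<open>The bilinear estimate for spectrally localized Hermite sums\<close>

lemma measurable_hs_product [measurable]:
  fixes c e :: "('d::finite \<Rightarrow> nat) \<Rightarrow> complex"
  shows "(\<lambda>(t, x). ennreal ((cmod (hs (evol t c) x * hs (evol t e) x))\<^sup>2)) \<in> borel_measurable (lborel \<Otimes>\<^sub>M (lborel :: (real^'d) measure))"
proof -
  have [measurable]: "cHerm k \<in> borel_measurable lborel" for k :: "'d \<Rightarrow> nat" using L2_measurable[OF cHerm_L2] by simp
  have "(\<lambda>t. exp (\<i> * of_real (t * eig k))) \<in> borel_measurable borel" for k :: "'d \<Rightarrow> nat"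
    by (intro borel_measurable_continuous_onI continuous_intros)
  then have [measurable]: "(\<lambda>t. exp (\<i> * of_real (t * eig k))) \<in> borel_measurable lborel" for k :: "'d \<Rightarrow> nat" by simp
  show ?thesis unfolding hs_evol by measurable
qed

lemma bilinear_sums_le:
  fixes F :: "real \<Rightarrow> real^'d::finite \<Rightarrow> ennreal"
  assumes I: "finite I" "\<And>i. i \<in> I \<Longrightarrow> bilinear m (c i) (e i) \<le> ennreal (B i)" "\<And>i. i \<in> I \<Longrightarrow> B i \<ge> 0"
    and F: "\<And>t x. F t x \<le> (\<Sum>i\<in>I. ennreal K * ennreal ((cmod (hs (evol t (c i)) x * hs (evol t (e i)) x))\<^sup>2))" and K: "K \<ge> 0"
  shows "(\<integral>\<^sup>+t. (\<integral>\<^sup>+x. F t x \<partial>lborel) * indicator {0..real m * pi} t \<partial>lborel) \<le> ennreal (\<Sum>i\<in>I. K * B i)"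
proof -
  let ?g = "\<lambda>i t x. ennreal ((cmod (hs (evol t (c i)) x * hs (evol t (e i)) x))\<^sup>2)"
  have [measurable]: "(\<lambda>(t, x). ?g i t x) \<in> borel_measurable (lborel \<Otimes>\<^sub>M lborel)" for i by (rule measurable_hs_product)
  have [measurable]: "hs a \<in> borel_measurable borel" for a :: "('d \<Rightarrow> nat) \<Rightarrow> complex" by (rule L2_measurable[OF hs_L2])
  have [measurable]: "?g i t \<in> borel_measurable lborel" for i t by measurable
  have [measurable]: "(\<lambda>t. \<integral>\<^sup>+x. ?g i t x \<partial>lborel) \<in> borel_measurable lborel" for i by measurable
  have inner: "(\<integral>\<^sup>+x. F t x \<partial>lborel) \<le> (\<Sum>i\<in>I. ennreal K * (\<integral>\<^sup>+x. ?g i t x \<partial>lborel))" for t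
  proof -
    have "(\<integral>\<^sup>+x. F t x \<partial>lborel) \<le> (\<integral>\<^sup>+x. (\<Sum>i\<in>I. ennreal K * ?g i t x) \<partial>lborel)" by (intro nn_integral_mono F)
    also have "\<dots> = (\<Sum>i\<in>I. ennreal K * (\<integral>\<^sup>+x. ?g i t x \<partial>lborel))"
      by (subst nn_integral_sum) (auto intro!: sum.cong nn_integral_cmult simp del: measurable_lborel1)
    finally show ?thesis .
  qed
  have "(\<integral>\<^sup>+t. (\<integral>\<^sup>+x. F t x \<partial>lborel) * indicator {0..real m * pi} t \<partial>lborel)
    \<le> (\<integral>\<^sup>+t. (\<Sum>i\<in>I. ennreal K * ((\<integral>\<^sup>+x. ?g i t x \<partial>lborel) * indicator {0..real m * pi} t)) \<partial>lborel)"
  proof (rule nn_integral_mono)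
    fix t
    show "(\<integral>\<^sup>+x. F t x \<partial>lborel) * indicator {0..real m * pi} t \<le> (\<Sum>i\<in>I. ennreal K * ((\<integral>\<^sup>+x. ?g i t x \<partial>lborel) * indicator {0..real m * pi} t))"
      using mult_right_mono[OF inner[of t], of "indicator {0..real m * pi} t"] by (simp add: sum_distrib_right mult.assoc)
  qed
  also have "\<dots> = (\<Sum>i\<in>I. ennreal K * bilinear m (c i) (e i))"
    unfolding bilinear_def by (subst nn_integral_sum) (auto intro!: sum.cong nn_integral_cmult)
  also have "\<dots> \<le> (\<Sum>i\<in>I. ennreal K * ennreal (B i))" by (intro sum_mono mult_left_mono I) auto
  also have "\<dots> = ennreal (\<Sum>i\<in>I. K * B i)"
    using I(3) K by (subst sum_ennreal[symmetric]) (auto simp: ennreal_mult intro!: sum.cong)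
  finally show ?thesis .
qed

lemma cmod_sum_sq_le: "(cmod (\<Sum>i\<in>I. z i))\<^sup>2 \<le> real (card I) * (\<Sum>i\<in>I. (cmod (z i))\<^sup>2)"
proof -
  have "(cmod (\<Sum>i\<in>I. z i))\<^sup>2 \<le> (\<Sum>i\<in>I. cmod (z i))\<^sup>2" by (intro power_mono norm_sum) auto
  also have "\<dots> \<le> (\<Sum>i\<in>I. (cmod (z i))\<^sup>2) * real (card I)" by (rule sum_squared_le_sum_of_squares)
  finally show ?thesis by (simp add: mult.commute)
qed

text \<open>Pigeonhole: a degree above d (\<kappa> - 1) forces some coordinate to be at least
  \<kappa>. The first factor is split into d pieces according to such a coordinate; one factor d
  comes from Cauchy-Schwarz, the other from the number of pieces.\<close>

lemma bilinear_separated: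
  fixes c e :: "('d::finite \<Rightarrow> nat) \<Rightarrow> complex"
  assumes fin: "finite (supp c)" "finite (supp e)"
    and c: "\<And>k. k \<in> supp c \<Longrightarrow> CARD('d) * (\<kappa> - 1) < deg k" and e: "\<And>l. l \<in> supp e \<Longrightarrow> deg l \<le> b0"
    and \<kappa>: "32 * b0 \<le> \<kappa>" "\<kappa> > 0"
  shows "bilinear m c e \<le> ennreal (real CARD('d) * (real CARD('d) * (sqrt (2 * (real b0 + 1)) ^ (CARD('d) - 1) * (real m * pi * (48 / sqrt (real \<kappa>))) * (csq c * csq e))))"
proof -
  let ?B = "sqrt (2 * (real b0 + 1)) ^ (CARD('d) - 1) * (real m * pi * (48 / sqrt (real \<kappa>)))"
  have "\<exists>j. \<kappa> \<le> k j" if "k \<in> supp c" for k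
  proof (rule ccontr)
    assume "\<not> ?thesis"
    then have "k j \<le> \<kappa> - 1" for j by (metis Suc_pred' \<kappa>(2) less_Suc_eq_le not_le)
    then have "(\<Sum>j\<in>UNIV. k j) \<le> (\<Sum>j\<in>(UNIV::'d set). \<kappa> - 1)" by (intro sum_mono) auto
    then show False using c[OF that] by (simp add: deg_def)
  qed
  then obtain sel where sel: "\<And>k. k \<in> supp c \<Longrightarrow> \<kappa> \<le> k (sel k)" by metis
  define cj where "cj j k = (if sel k = j then c k else 0)" for j k
  have sub: "supp (cj j) \<subseteq> supp c" for j by (auto simp: supp_def cj_def)
  have finj: "finite (supp (cj j))" for j by (rule finite_subset[OF sub fin(1)])
  have le: "csq (cj j) \<le> csq c" for j
    unfolding csq_superset[OF fin(1) sub] csq_def[of c] by (intro sum_mono) (auto simp: cj_def)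
  have hs: "hs (evol t c) x = (\<Sum>j\<in>UNIV. hs (evol t (cj j)) x)" for t x
  proof -
    have "evol t c = (\<lambda>k. \<Sum>j\<in>UNIV. evol t (cj j) k)" by (auto simp: evol_def cj_def sum_distrib_left[symmetric])
    then show ?thesis using finj by (simp add: hs_sum)
  qed
  have "bilinear m c e \<le> ennreal (\<Sum>j\<in>(UNIV::'d set). real CARD('d) * (?B * (csq c * csq e)))"
    unfolding bilinear_def
  proof (rule bilinear_sums_le[where c=cj and e="\<lambda>_. e"])
    fix j :: 'd
    have "bilinear m (cj j) e \<le> ennreal (?B * (csq (cj j) * csq e))"
    proof (rule bilinear_transversal[OF finj fin(2)])
      show "\<kappa> \<le> k j" if "k \<in> supp (cj j)" for k
        using that sel[of k] by (auto simp: supp_def cj_def split: if_splits)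
      show "l i \<le> b0" if "l \<in> supp e" for l i using e[OF that] le_deg[of l i] by linarith
    qed (use \<kappa> in auto)
    also have "\<dots> \<le> ennreal (?B * (csq c * csq e))"
      by (intro ennreal_leI mult_left_mono mult_right_mono le) auto
    finally show "bilinear m (cj j) e \<le> ennreal (?B * (csq c * csq e))" .
    show "0 \<le> ?B * (csq c * csq e)" by (intro mult_nonneg_nonneg divide_nonneg_nonneg) auto
  next
    fix t x
    have "(cmod (hs (evol t c) x * hs (evol t e) x))\<^sup>2 \<le> real CARD('d) * (\<Sum>j\<in>(UNIV::'d set). (cmod (hs (evol t (cj j)) x * hs (evol t e) x))\<^sup>2)"
      unfolding hs sum_distrib_right by (rule cmod_sum_sq_le)
    then have "ennreal ((cmod (hs (evol t c) x * hs (evol t e) x))\<^sup>2) \<le> ennreal (\<Sum>j\<in>(UNIV::'d set). real CARD('d) * (cmod (hs (evol t (cj j)) x * hs (evol t e) x))\<^sup>2)"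
      by (intro ennreal_leI) (simp only: sum_distrib_left)
    also have "\<dots> = (\<Sum>j\<in>(UNIV::'d set). ennreal (real CARD('d)) * ennreal ((cmod (hs (evol t (cj j)) x * hs (evol t e) x))\<^sup>2))"
      by (simp flip: ennreal_mult)
    finally show "ennreal ((cmod (hs (evol t c) x * hs (evol t e) x))\<^sup>2) \<le> (\<Sum>j\<in>(UNIV::'d set). ennreal (real CARD('d)) * ennreal ((cmod (hs (evol t (cj j)) x * hs (evol t e) x))\<^sup>2))" .
  qed auto
  then show ?thesis by simp
qed

text \<open>The slack \<nu> absorbs the shifts of degree made by \<open>P\<close> and the offset
  between degree and eigenvalue. For N <= \<Gamma> M, the power N^(d-2) = N^(d-1) / N is at most
  \<Gamma>^(d-1) M^(d-1) / N. Otherwise the separated bound applies with b0 of order M^2 and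
  \<kappa> of order N^2, which gives M^(d-1) / N directly.\<close>

lemma bilinear_estimate:
  assumes d: "CARD('d::finite) \<ge> 2"
  shows "\<exists>C>0. \<forall>N\<ge>1. \<forall>M\<ge>1. M \<le> N \<longrightarrow> (\<forall>c e :: ('d \<Rightarrow> nat) \<Rightarrow> complex.
    finite (supp c) \<longrightarrow> finite (supp e) \<longrightarrow> (\<forall>k\<in>supp c. N\<^sup>2 / 8 \<le> real (deg k) + real \<nu> \<and> real (deg k) \<le> N\<^sup>2 + real \<nu>) \<longrightarrow>
    (\<forall>l\<in>supp e. real (deg l) \<le> M\<^sup>2 + real \<nu>) \<longrightarrow>
    bilinear m c e \<le> ennreal (C * (M ^ (CARD('d) - 1) / N) * (csq c * csq e)))"
proof -
  define D where "D = real CARD('d)"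
  define n where "n = CARD('d) - 1"
  have D1: "D \<ge> 1" unfolding D_def by simp
  \<comment> \<open>\<open>\<Gamma> M < N\<close> is what the separation \<open>32 b0 \<le> \<kappa>\<close> with \<open>b0 \<approx> M\<^sup>2\<close>, \<open>\<kappa> \<approx> N\<^sup>2 / (16 d)\<close> requires.\<close>
  define \<Gamma> where "\<Gamma> = sqrt (512 * D * (1 + real \<nu>))"
  have \<Gamma>2: "\<Gamma>\<^sup>2 = 512 * D * (1 + real \<nu>)" unfolding \<Gamma>_def using D1 by simp
  have \<Gamma>0: "\<Gamma> > 0" unfolding \<Gamma>_def using D1 by simp
  define C1 where "C1 = real m * pi * (D * sqrt D * 2 ^ n) * (sqrt (3 + 2 * real \<nu>) ^ (n - 1) * \<Gamma> ^ n)"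
  define C2 where "C2 = D * D * (sqrt (2 * (2 + real \<nu>)) ^ n * (real m * pi * (48 * sqrt (16 * D))))"
  have C0: "C1 \<ge> 0" "C2 \<ge> 0" unfolding C1_def C2_def using D1 \<Gamma>0 by auto
  have main: "bilinear m c e \<le> ennreal ((C1 + C2 + 1) * (M ^ n / N) * (csq c * csq e))"
    if NM: "1 \<le> N" "1 \<le> M" "M \<le> N" and fin: "finite (supp c)" "finite (supp e)"
      and c: "\<And>k. k \<in> supp c \<Longrightarrow> N\<^sup>2 / 8 \<le> real (deg k) + real \<nu> \<and> real (deg k) \<le> N\<^sup>2 + real \<nu>"
      and e: "\<And>l. l \<in> supp e \<Longrightarrow> real (deg l) \<le> M\<^sup>2 + real \<nu>"
    for N M and c e :: "('d \<Rightarrow> nat) \<Rightarrow> complex"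
  proof -
    have N0: "N > 0" "M > 0" using NM by auto
    have N2: "N\<^sup>2 \<ge> 1" "M\<^sup>2 \<ge> 1" "M\<^sup>2 \<le> N\<^sup>2" using NM by (auto intro: one_le_power power_mono)
    have fac: "A * (csq c * csq e) \<le> (C1 + C2 + 1) * (M ^ n / N) * (csq c * csq e)" if "A \<le> C * (M ^ n / N)" "C = C1 \<or> C = C2" for A C
    proof (rule mult_right_mono)
      have "C * (M ^ n / N) \<le> (C1 + C2 + 1) * (M ^ n / N)" using that(2) C0 N0 by (intro mult_right_mono) auto
      then show "A \<le> (C1 + C2 + 1) * (M ^ n / N)" using that(1) by linarith
    qed auto
    show ?thesis
    proof (cases "N \<le> \<Gamma> * M")
      case True
      define L where "L = nat \<lfloor>N\<^sup>2 + M\<^sup>2 + 2 * real \<nu>\<rfloor>"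
      have L: "real L \<le> N\<^sup>2 + M\<^sup>2 + 2 * real \<nu>" unfolding L_def by (simp add: of_nat_floor)
      have "bilinear m c e \<le> ennreal (real m * pi * (real CARD('d) * sqrt (real CARD('d)) * 2 ^ (CARD('d) - 1) * sqrt (real L + 1) ^ (CARD('d) - 2)) * (csq c * csq e))"
      proof (rule bilinear_strichartz[OF d fin])
        fix k l assume "k \<in> supp c" "l \<in> supp e"
        then have "real (deg k + deg l) \<le> N\<^sup>2 + M\<^sup>2 + 2 * real \<nu>" using c[of k] e[of l] by simp
        then show "deg k + deg l \<le> L" unfolding L_def by (rule le_nat_floor)
      qed
      also have "\<dots> \<le> ennreal ((C1 + C2 + 1) * (M ^ n / N) * (csq c * csq e))"
      proof (intro ennreal_leI fac[of _ C1])
        have "real L + 1 \<le> 3 * N\<^sup>2 + 2 * real \<nu> * 1" using L N2 by linarith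
        also have "\<dots> \<le> 3 * N\<^sup>2 + 2 * real \<nu> * N\<^sup>2" using N2 by (intro add_left_mono mult_left_mono) auto
        finally have "sqrt (real L + 1) \<le> sqrt ((3 + 2 * real \<nu>) * N\<^sup>2)" by (simp add: algebra_simps)
        then have "sqrt (real L + 1) ^ (n - 1) \<le> (sqrt (3 + 2 * real \<nu>) * N) ^ (n - 1)" using N0 by (intro power_mono) (auto simp: real_sqrt_mult)
        also have "\<dots> = sqrt (3 + 2 * real \<nu>) ^ (n - 1) * (N ^ n / N)"
          using d N0 by (cases n) (auto simp: power_mult_distrib n_def)
        also have "\<dots> \<le> sqrt (3 + 2 * real \<nu>) ^ (n - 1) * ((\<Gamma> * M) ^ n / N)"
          using True N0 by (intro mult_left_mono divide_right_mono power_mono) auto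
        finally have le: "sqrt (real L + 1) ^ (n - 1) \<le> sqrt (3 + 2 * real \<nu>) ^ (n - 1) * \<Gamma> ^ n * (M ^ n / N)" by (simp add: power_mult_distrib)
        have "real m * pi * (D * sqrt D * 2 ^ n * sqrt (real L + 1) ^ (n - 1)) \<le> real m * pi * (D * sqrt D * 2 ^ n * (sqrt (3 + 2 * real \<nu>) ^ (n - 1) * \<Gamma> ^ n * (M ^ n / N)))"
          using D1 by (intro mult_left_mono le) auto
        moreover have "CARD('d) - 2 = n - 1" unfolding n_def by simp
        ultimately show "real m * pi * (real CARD('d) * sqrt (real CARD('d)) * 2 ^ (CARD('d) - 1) * sqrt (real L + 1) ^ (CARD('d) - 2)) \<le> C1 * (M ^ n / N)"
          unfolding C1_def D_def n_def by (simp add: mult_ac)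
      qed simp
      finally show ?thesis .
    next
      case False
      then have "(\<Gamma> * M)\<^sup>2 \<le> N\<^sup>2" using \<Gamma>0 N0 by (intro power_mono) auto
      then have G: "512 * D * (1 + real \<nu>) * M\<^sup>2 \<le> N\<^sup>2" by (simp only: power_mult_distrib \<Gamma>2)
      \<comment> \<open>Degrees are at least N^2 / 8 - \<nu>, hence at least N^2 / 16 once N^2 >= 16
        \<nu>; division by d gives the threshold for one coordinate.\<close>
      define \<kappa> where "\<kappa> = nat \<lceil>N\<^sup>2 / (16 * D)\<rceil>"
      define b0 where "b0 = nat \<lfloor>M\<^sup>2 + real \<nu>\<rfloor>"
      have \<kappa>: "N\<^sup>2 / (16 * D) \<le> real \<kappa>" unfolding \<kappa>_def by (rule real_nat_ceiling_ge)
      have b0: "real b0 \<le> M\<^sup>2 + real \<nu>" unfolding b0_def by (simp add: of_nat_floor)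
      have nu: "M\<^sup>2 + real \<nu> \<le> (1 + real \<nu>) * M\<^sup>2" using N2 mult_left_mono[of 1 "M\<^sup>2" "real \<nu>"] by (simp add: algebra_simps)
      have k0: "real \<kappa> > 0" using \<kappa> N0 D1 by (smt (verit) divide_pos_pos zero_less_power)
      have "512 * D * real b0 \<le> 512 * D * ((1 + real \<nu>) * M\<^sup>2)" using b0 nu D1 by (intro mult_left_mono) auto
      then have "512 * D * real b0 \<le> N\<^sup>2" using G by (simp only: mult.assoc)
      then have "32 * real b0 \<le> N\<^sup>2 / (16 * D)" using D1 by (simp add: le_divide_eq mult_ac)
      then have "32 * real b0 \<le> real \<kappa>" using \<kappa> by linarith
      then have kb: "32 * b0 \<le> \<kappa>" by linarith
      have "16 * real \<nu> \<le> N\<^sup>2"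
      proof -
        have "512 * 1 * (1 + real \<nu>) * 1 \<le> 512 * D * (1 + real \<nu>) * M\<^sup>2" using D1 N2 by (intro mult_mono) auto
        then have "512 * (1 + real \<nu>) \<le> N\<^sup>2" using G by simp
        moreover have "16 * real \<nu> \<le> 512 * (1 + real \<nu>)" by simp
        ultimately show ?thesis by (rule order_trans[rotated])
      qed
      then have ck: "CARD('d) * (\<kappa> - 1) < deg k" if "k \<in> supp c" for k
      proof -
        \<comment> \<open>Rounding up adds less than 1, which the \<kappa> - 1 in the pigeonhole
          condition takes up.\<close>
        have "real \<kappa> < N\<^sup>2 / (16 * D) + 1" using k0 unfolding \<kappa>_def by linarith
        then have "D * (real \<kappa> - 1) < D * (N\<^sup>2 / (16 * D))" using D1 by (intro mult_strict_left_mono) auto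
        also have "\<dots> = N\<^sup>2 / 16" using D1 by simp
        also have "\<dots> \<le> real (deg k)" using c[OF that] \<open>16 * real \<nu> \<le> N\<^sup>2\<close> by linarith
        finally have "real (CARD('d) * (\<kappa> - 1)) < real (deg k)" using k0 by (simp add: D_def of_nat_diff)
        then show ?thesis by (simp only: of_nat_less_iff)
      qed
      have eb: "deg l \<le> b0" if "l \<in> supp e" for l unfolding b0_def by (rule le_nat_floor[OF e[OF that]])
      have "bilinear m c e \<le> ennreal (D * (D * (sqrt (2 * (real b0 + 1)) ^ n * (real m * pi * (48 / sqrt (real \<kappa>))) * (csq c * csq e))))"
        unfolding D_def n_def by (rule bilinear_separated[OF fin ck eb kb]) (use k0 in auto)
      also have "\<dots> = ennreal (D * D * (sqrt (2 * (real b0 + 1)) ^ n * (real m * pi * (48 / sqrt (real \<kappa>)))) * (csq c * csq e))" by (simp add: mult_ac)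
      also have "\<dots> \<le> ennreal ((C1 + C2 + 1) * (M ^ n / N) * (csq c * csq e))"
      proof (intro ennreal_leI fac[of _ C2])
        have "2 * (real b0 + 1) \<le> 2 * (2 + real \<nu>) * M\<^sup>2" using b0 nu N2 by (simp add: algebra_simps)
        then have "sqrt (2 * (real b0 + 1)) \<le> sqrt (2 * (2 + real \<nu>) * M\<^sup>2)" by simp
        then have "sqrt (2 * (real b0 + 1)) ^ n \<le> (sqrt (2 * (2 + real \<nu>)) * M) ^ n"
          using N0 by (intro power_mono) (auto simp: real_sqrt_mult)
        then have s1: "sqrt (2 * (real b0 + 1)) ^ n \<le> sqrt (2 * (2 + real \<nu>)) ^ n * M ^ n" by (simp only: power_mult_distrib)
        have "sqrt (N\<^sup>2 / (16 * D)) \<le> sqrt (real \<kappa>)" using \<kappa> by simp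
        then have "N / sqrt (16 * D) \<le> sqrt (real \<kappa>)" using N0 by (simp add: real_sqrt_divide)
        then have "48 / sqrt (real \<kappa>) \<le> 48 / (N / sqrt (16 * D))" using N0 D1 k0 by (intro divide_left_mono) auto
        then have s2: "48 / sqrt (real \<kappa>) \<le> 48 * sqrt (16 * D) / N" by simp
        have "sqrt (2 * (real b0 + 1)) ^ n * (real m * pi * (48 / sqrt (real \<kappa>))) \<le> (sqrt (2 * (2 + real \<nu>)) ^ n * M ^ n) * (real m * pi * (48 * sqrt (16 * D) / N))"
          using N0 D1 by (intro mult_mono s1 mult_left_mono s2) auto
        then have "D * D * (sqrt (2 * (real b0 + 1)) ^ n * (real m * pi * (48 / sqrt (real \<kappa>)))) \<le> D * D * ((sqrt (2 * (2 + real \<nu>)) ^ n * M ^ n) * (real m * pi * (48 * sqrt (16 * D) / N)))"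
          using D1 by (intro mult_left_mono) auto
        also have "\<dots> = C2 * (M ^ n / N)" unfolding C2_def by simp
        finally show "D * D * (sqrt (2 * (real b0 + 1)) ^ n * (real m * pi * (48 / sqrt (real \<kappa>)))) \<le> C2 * (M ^ n / N)" .
      qed simp
      finally show ?thesis .
    qed
  qed
  show ?thesis using main C0 unfolding n_def by (intro exI[of _ "C1 + C2 + 1"]) auto
qed

section \<open>The space-time norm of a product\<close>

lemma esqrt_sq: "(esqrt a)\<^sup>2 = a"
proof (cases a)
  case (real r) then show ?thesis by (simp add: esqrt_def ennreal_power)
qed (simp add: esqrt_def power2_eq_square ennreal_top_mult)

lemma esqrt_le:
  assumes "a \<le> ennreal y" "y \<ge> 0"
  shows "esqrt a \<le> ennreal (sqrt y)"
proof (cases a)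
  case (real r) then show ?thesis using assms by (auto simp: esqrt_def intro!: ennreal_leI)
qed (use assms in \<open>auto simp: top_unique\<close>)

fun field_sq :: "'d::finite sv_field \<Rightarrow> real^'d \<Rightarrow> real" where
  "field_sq (Scalar f) x = (norm (f x))\<^sup>2"
| "field_sq (Vector F) x = (norm (F x))\<^sup>2"

lemma field_L2norm_sq: "(field_L2norm F)\<^sup>2 = (\<integral>\<^sup>+x. ennreal (field_sq F x) \<partial>lborel)"
  by (cases F) (simp_all add: L2norm_def L2_norm_of_def esqrt_sq ennreal_power)

lemma norm_vec_sq: "(norm (v :: complex^'d))\<^sup>2 = (\<Sum>i\<in>UNIV. (cmod (v $ i))\<^sup>2)"
  by (simp add: norm_vec_def L2_set_def sum_nonneg)

text \<open>One double sum over components covers all four kinds of product; a scalar has the same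
  component in every direction, so the sum merely overcounts.\<close>

lemma field_sq_mult_le:
  fixes F G :: "'d::finite sv_field"
  shows "field_sq (field_mult F G) x \<le> (\<Sum>i\<in>UNIV. \<Sum>j\<in>UNIV. (cmod (fcomp F i x * fcomp G j x))\<^sup>2)"
proof -
  have one: "y \<le> (\<Sum>i\<in>(UNIV::'d set). y)" if "y \<ge> 0" for y :: real
    using member_le_sum[of "undefined::'d" "UNIV::'d set" "\<lambda>_. y"] that by simp
  show ?thesis
  proof (cases F; cases G)
    fix f g assume "F = Scalar f" "G = Scalar g"
    then show ?thesis using order_trans[OF one one, of "(cmod (f x * g x))\<^sup>2"] by (simp add: sum_nonneg del: sum_constant)
  next
    fix f g assume "F = Scalar f" "G = Vector g"
    then show ?thesis using one[of "\<Sum>j\<in>UNIV. (cmod (f x * g x $ j))\<^sup>2"] by (simp add: norm_vec_sq sum_nonneg del: sum_constant)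
  next
    fix f g assume FG: "F = Vector f" "G = Scalar g"
    have "(\<Sum>i\<in>UNIV. (cmod (f x $ i * g x))\<^sup>2) \<le> (\<Sum>i\<in>UNIV. \<Sum>j\<in>(UNIV::'d set). (cmod (f x $ i * g x))\<^sup>2)"
      by (intro sum_mono one) auto
    then show ?thesis using FG by (simp add: norm_vec_sq mult.commute del: sum_constant)
  next
    fix f g assume FG: "F = Vector f" "G = Vector g"
    have "(cmod (\<Sum>i\<in>UNIV. f x $ i * g x $ i))\<^sup>2 \<le> (\<Sum>i\<in>UNIV. cmod (f x $ i) * cmod (g x $ i))\<^sup>2"
      by (intro power_mono order_trans[OF norm_sum]) (auto simp: norm_mult)
    also have "\<dots> \<le> (\<Sum>i\<in>UNIV. (cmod (f x $ i))\<^sup>2) * (\<Sum>j\<in>UNIV. (cmod (g x $ j))\<^sup>2)" by (rule Cauchy_Schwarz_ineq_sum)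
    also have "\<dots> = (\<Sum>i\<in>UNIV. \<Sum>j\<in>UNIV. (cmod (f x $ i * g x $ j))\<^sup>2)" by (simp add: sum_product norm_mult power_mult_distrib)
    finally show ?thesis using FG by simp
  qed
qed

lemma field_L2norm_mult_le:
  assumes F: "\<And>i. AE x in lborel. fcomp F i x = f i x" and G: "\<And>i. AE x in lborel. fcomp G i x = g i x"
  shows "(field_L2norm (field_mult F G))\<^sup>2 \<le> (\<integral>\<^sup>+x. ennreal (\<Sum>i\<in>UNIV. \<Sum>j\<in>UNIV. (cmod (f i x * g j x))\<^sup>2) \<partial>lborel)"
proof -
  have "AE x in lborel. \<forall>i\<in>UNIV. fcomp F i x = f i x" "AE x in lborel. \<forall>i\<in>UNIV. fcomp G i x = g i x"
    by (subst AE_finite_all; use F G in simp)+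
  then have "AE x in lborel. ennreal (field_sq (field_mult F G) x) \<le> ennreal (\<Sum>i\<in>UNIV. \<Sum>j\<in>UNIV. (cmod (f i x * g j x))\<^sup>2)"
  proof eventually_elim
    case (elim x) then show ?case using field_sq_mult_le[of F G x] by (intro ennreal_leI) simp
  qed
  then show ?thesis unfolding field_L2norm_sq by (rule nn_integral_mono_AE)
qed

lemma cmod_sum_product_sq_le:
  fixes a b :: "nat \<Rightarrow> complex"
  assumes "\<And>p. cmod (\<omega> p) \<le> 1" "\<And>q. cmod (\<xi> q) \<le> 1"
  shows "(cmod ((\<Sum>p<n. \<omega> p * a p) * (\<Sum>q<l. \<xi> q * b q)))\<^sup>2 \<le> real (n * l) * (\<Sum>p<n. \<Sum>q<l. (cmod (a p * b q))\<^sup>2)"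
proof -
  have "(\<Sum>p<n. \<omega> p * a p) * (\<Sum>q<l. \<xi> q * b q) = (\<Sum>r\<in>{..<n} \<times> {..<l}. (\<omega> (fst r) * \<xi> (snd r)) * (a (fst r) * b (snd r)))"
    unfolding sum_product sum.cartesian_product by (intro sum.cong refl) (auto simp: mult_ac)
  then have "(cmod ((\<Sum>p<n. \<omega> p * a p) * (\<Sum>q<l. \<xi> q * b q)))\<^sup>2 \<le> real (n * l) * (\<Sum>r\<in>{..<n} \<times> {..<l}. (cmod ((\<omega> (fst r) * \<xi> (snd r)) * (a (fst r) * b (snd r))))\<^sup>2)"
    using cmod_sum_sq_le[of "\<lambda>r. (\<omega> (fst r) * \<xi> (snd r)) * (a (fst r) * b (snd r))" "{..<n} \<times> {..<l}"] by simp
  also have "\<dots> \<le> real (n * l) * (\<Sum>r\<in>{..<n} \<times> {..<l}. (cmod (a (fst r) * b (snd r)))\<^sup>2)"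
  proof (intro mult_left_mono sum_mono power_mono)
    fix r
    have "cmod (\<omega> (fst r) * \<xi> (snd r)) \<le> 1" unfolding norm_mult by (intro mult_le_one assms) auto
    then show "cmod (\<omega> (fst r) * \<xi> (snd r) * (a (fst r) * b (snd r))) \<le> cmod (a (fst r) * b (snd r))"
      using mult_right_mono[of "cmod (\<omega> (fst r) * \<xi> (snd r))" 1 "cmod (a (fst r) * b (snd r))"] by (simp add: norm_mult)
  qed auto
  finally show ?thesis by (simp add: sum.cartesian_product case_prod_beta)
qed

lemma sum_Times: "(\<Sum>a\<in>A \<times> B. h (fst a) (snd a)) = (\<Sum>x\<in>A. \<Sum>y\<in>B. h x y)"
  by (simp add: sum.cartesian_product case_prod_beta)

lemma sum_Times_Times:
  "(\<Sum>a\<in>(A \<times> B) \<times> (C \<times> D). h (fst (fst a)) (snd (fst a)) (fst (snd a)) (snd (snd a))) = (\<Sum>x\<in>A. \<Sum>y\<in>B. \<Sum>z\<in>C. \<Sum>w\<in>D. h x y z w)"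
  by (simp only: sum_Times[of "\<lambda>a b. h (fst a) (snd a) (fst b) (snd b)"] sum_Times[of "\<lambda>x y. \<Sum>z\<in>C. \<Sum>w\<in>D. h x y z w"] sum_Times[of "h _ _"])

text \<open>For b = r = N^2 >= 1 the growth factor becomes a constant times N^(2 n), the square of
  the N^n in the claim.\<close>

lemma descendant_le:
  assumes "descendant b n c c'" "b + 1 \<le> 2 * r" "0 \<le> b" "1 \<le> r"
  shows "csq c' \<le> (real n + 2) ^ n * r ^ n * csq c"
proof -
  have "csq c' \<le> (b + real n + 1) ^ n * csq c" using assms(1) by (simp add: descendant_def)
  also have "\<dots> \<le> ((real n + 2) * r) ^ n * csq c"
    using assms(2-4) mult_left_mono[OF assms(4), of "real n"] by (intro mult_right_mono power_mono) (auto simp: algebra_simps)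
  finally show ?thesis by (simp add: power_mult_distrib)
qed

theorem corollary3p1:
  fixes \<eta> :: "real \<Rightarrow> complex" and T :: real and \<alpha> \<beta> :: "nat list" and k\<^sub>1 k\<^sub>2 :: nat
  assumes "CARD('d::finite) \<ge> 2"
    and "test_function \<eta>" and "\<forall>s\<in>{0..1}. \<eta> s = 1" and "\<forall>s\<ge>2. \<eta> s = 0"
    and "T > 0"
    and "multi_index \<alpha>" and "length \<alpha> = k\<^sub>1"
    and "multi_index \<beta>" and "length \<beta> = k\<^sub>2"
  shows "\<exists>C::real. C > 0 \<and>
    (\<forall>N\<in>dyadic. \<forall>M\<in>dyadic. 1 \<le> M \<longrightarrow> M \<le> N \<longrightarrow>
      (\<forall>u\<in>(L2 :: (real^'d \<Rightarrow> complex) set). \<forall>v\<in>(L2 :: (real^'d \<Rightarrow> complex) set).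
        (AE x in lborel. Delta_loc \<eta> N u x = u x) \<longrightarrow>
        (AE x in lborel. Delta_loc \<eta> M v x = v x) \<longrightarrow>
        L2t_L2x_norm T
          (\<lambda>t. field_mult (P \<alpha> (exp_itH t u)) (P \<beta> (exp_itH t v)))
        \<le> ennreal (C * N ^ k\<^sub>1 * M ^ k\<^sub>2 * (M powr ((real CARD('d) - 1) / 2) / N powr (1 / 2)))
            * L2norm u * L2norm v))"
proof -
  note \<eta> = assms(2-4)
  define n where "n = CARD('d) - 1"
  \<comment> \<open>The orders account for the shifts of degree by the operators, d for the offset
    between eigenvalue and degree.\<close>
  define \<nu> where "\<nu> = k\<^sub>1 + k\<^sub>2 + CARD('d)"
  define D\<^sub>1 D\<^sub>2 where D_def: "D\<^sub>1 = (2 * CARD('d)) ^ k\<^sub>1" "D\<^sub>2 = (2 * CARD('d)) ^ k\<^sub>2"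
  \<comment> \<open>[0, T] is enlarged to a multiple of pi, at the price of a constant depending on
    T.\<close>
  obtain m where "T / pi \<le> real m" using real_arch_simple by blast
  then have m: "T \<le> real m * pi" by (simp add: pos_divide_le_eq)
  from bilinear_estimate[OF assms(1), of \<nu> m, folded n_def]
  obtain C where C: "C > 0" and "\<forall>N\<ge>1. \<forall>M\<ge>1. M \<le> N \<longrightarrow> (\<forall>c e :: ('d \<Rightarrow> nat) \<Rightarrow> complex.
      finite (supp c) \<longrightarrow> finite (supp e) \<longrightarrow> (\<forall>k\<in>supp c. N\<^sup>2 / 8 \<le> real (deg k) + real \<nu> \<and> real (deg k) \<le> N\<^sup>2 + real \<nu>) \<longrightarrow>
      (\<forall>l\<in>supp e. real (deg l) \<le> M\<^sup>2 + real \<nu>) \<longrightarrow>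
      bilinear m c e \<le> ennreal (C * (M ^ n / N) * (csq c * csq e)))"
    by (elim exE conjE)
  note est = this(2)[rule_format]
  \<comment> \<open>The number of pairs of terms over all pairs of components, times the
    Cauchy-Schwarz factor for products of two expansions, times the constant for a single pair of
    terms.\<close>
  define A where "A = real (CARD('d) * D\<^sub>1 * (CARD('d) * D\<^sub>2)) * (real (D\<^sub>1 * D\<^sub>2) * (C * ((real k\<^sub>1 + 2) ^ k\<^sub>1 * (real k\<^sub>2 + 2) ^ k\<^sub>2)))"
  have A: "A > 0" unfolding A_def D_def using C by (intro mult_pos_pos zero_less_power) auto
  have main: "L2t_L2x_norm T (\<lambda>t. field_mult (P \<alpha> (exp_itH t u)) (P \<beta> (exp_itH t v)))
      \<le> ennreal (sqrt A * N ^ k\<^sub>1 * M ^ k\<^sub>2 * (M powr ((real CARD('d) - 1) / 2) / N powr (1 / 2))) * L2norm u * L2norm v"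
    if NM: "1 \<le> M" "M \<le> N" and u: "u \<in> L2" "AE x in lborel. Delta_loc \<eta> N u x = u x"
      and v: "v \<in> L2" "AE x in lborel. Delta_loc \<eta> M v x = v x"
    for N M and u v :: "real^'d \<Rightarrow> complex"
  proof -
    have N: "N > 0" "M > 0" "1 \<le> N" using NM by auto
    have N2: "1 \<le> N\<^sup>2" "1 \<le> M\<^sup>2" using N NM by (auto intro: one_le_power)
    define c where "c = (\<lambda>k. L2_inner u (cHerm k))"
    define e where "e = (\<lambda>k. L2_inner v (cHerm k))"
    note cu = localized_datum[OF \<eta> N(1) u, folded c_def] and ev = localized_datum[OF \<eta> N(2) v, folded e_def]
    \<comment> \<open>From N^2 / 4 < 2 deg k + d < 2 N^2.\<close>
    have degc: "N\<^sup>2 / 8 \<le> real (deg k) + real CARD('d)" "real (deg k) \<le> N\<^sup>2" if "k \<in> supp c" for k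
      using cu(1)[OF that] unfolding eig_deg by (linarith, linarith)
    have dege: "real (deg k) \<le> M\<^sup>2" if "k \<in> supp e" for k
      using ev(1)[OF that] unfolding eig_deg by linarith
    obtain \<omega> c' where \<omega>: "\<And>i p t. cmod (\<omega> i p t) \<le> 1" and c': "\<And>i p. descendant (N\<^sup>2) k\<^sub>1 c (c' i p)"
      and hc: "\<And>t i x. hs (ccomp (Pc \<alpha> (evol t c)) i) x = (\<Sum>p<D\<^sub>1. \<omega> i p t * hs (evol t (c' i p)) x)"
      by (rule Pc_terms[OF cu(2) degc(2) zero_le_power2, of \<alpha>, unfolded assms(7), folded D_def]) (assumption, blast)
    obtain \<xi> e' where \<xi>: "\<And>i p t. cmod (\<xi> i p t) \<le> 1" and e': "\<And>i p. descendant (M\<^sup>2) k\<^sub>2 e (e' i p)"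
      and he: "\<And>t i x. hs (ccomp (Pc \<beta> (evol t e)) i) x = (\<Sum>p<D\<^sub>2. \<xi> i p t * hs (evol t (e' i p)) x)"
      by (rule Pc_terms[OF ev(2) dege zero_le_power2, of \<beta>, unfolded assms(9), folded D_def]) (assumption, blast)
    have finc: "finite (supp (c' i p))" and fine: "finite (supp (e' i p))" for i p
      using c'[of i p] e'[of i p] by (auto simp: descendant_def)
    define B where "B = C * (M ^ n / N) * (((real k\<^sub>1 + 2) ^ k\<^sub>1 * (N\<^sup>2) ^ k\<^sub>1 * csq c) * ((real k\<^sub>2 + 2) ^ k\<^sub>2 * (M\<^sup>2) ^ k\<^sub>2 * csq e))"
    have B0: "B \<ge> 0" unfolding B_def using C N by (intro mult_nonneg_nonneg divide_nonneg_nonneg) auto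
    have bil: "bilinear m (c' i p) (e' j q) \<le> ennreal B" for i p j q
    proof -
      have "bilinear m (c' i p) (e' j q) \<le> ennreal (C * (M ^ n / N) * (csq (c' i p) * csq (e' j q)))"
      proof (rule est[OF N(3) NM finc fine])
        fix k assume "k \<in> supp (c' i p)"
        then obtain l where l: "l \<in> supp c" "deg k \<le> deg l + k\<^sub>1" "deg l \<le> deg k + k\<^sub>1" using c'[of i p] unfolding descendant_def by blast
        from l(2,3) have "real (deg k) \<le> real (deg l) + real k\<^sub>1" "real (deg l) \<le> real (deg k) + real k\<^sub>1" by linarith+
        then show "N\<^sup>2 / 8 \<le> real (deg k) + real \<nu> \<and> real (deg k) \<le> N\<^sup>2 + real \<nu>"
          using degc[OF l(1)] unfolding \<nu>_def of_nat_add by linarith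
      next
        fix k assume "k \<in> supp (e' j q)"
        then obtain l where l: "l \<in> supp e" "deg k \<le> deg l + k\<^sub>2" using e'[of j q] unfolding descendant_def by blast
        from l(2) have "real (deg k) \<le> real (deg l) + real k\<^sub>2" by linarith
        then show "real (deg k) \<le> M\<^sup>2 + real \<nu>" using dege[OF l(1)] unfolding \<nu>_def of_nat_add by linarith
      qed
      also have "\<dots> \<le> ennreal B"
        unfolding B_def using C N N2
        by (intro ennreal_leI mult_left_mono mult_mono descendant_le[OF c'] descendant_le[OF e']) auto
      finally show ?thesis .
    qed
    let ?I = "((UNIV :: 'd set) \<times> {..<D\<^sub>1}) \<times> ((UNIV :: 'd set) \<times> {..<D\<^sub>2})"
    let ?f = "\<lambda>t i x. hs (ccomp (Pc \<alpha> (evol t c)) i) x" and ?g = "\<lambda>t j x. hs (ccomp (Pc \<beta> (evol t e)) j) x"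
    let ?h = "\<lambda>t a x. hs (evol t (c' (fst (fst a)) (snd (fst a)))) x * hs (evol t (e' (fst (snd a)) (snd (snd a)))) x"
    have pt: "ennreal (\<Sum>i\<in>UNIV. \<Sum>j\<in>UNIV. (cmod (?f t i x * ?g t j x))\<^sup>2) \<le> (\<Sum>a\<in>?I. ennreal (real (D\<^sub>1 * D\<^sub>2)) * ennreal ((cmod (?h t a x))\<^sup>2))" for t x
    proof -
      have "(\<Sum>i\<in>UNIV. \<Sum>j\<in>UNIV. (cmod (?f t i x * ?g t j x))\<^sup>2)
        \<le> (\<Sum>i\<in>UNIV. \<Sum>j\<in>UNIV. real (D\<^sub>1 * D\<^sub>2) * (\<Sum>p<D\<^sub>1. \<Sum>q<D\<^sub>2. (cmod (hs (evol t (c' i p)) x * hs (evol t (e' j q)) x))\<^sup>2))"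
        unfolding hc he by (intro sum_mono cmod_sum_product_sq_le \<omega> \<xi>)
      also have "\<dots> = real (D\<^sub>1 * D\<^sub>2) * (\<Sum>i\<in>UNIV. \<Sum>p<D\<^sub>1. \<Sum>j\<in>UNIV. \<Sum>q<D\<^sub>2. (cmod (hs (evol t (c' i p)) x * hs (evol t (e' j q)) x))\<^sup>2)"
        unfolding sum_distrib_left[symmetric] by (subst (2) sum.swap) simp
      also have "\<dots> = (\<Sum>a\<in>?I. real (D\<^sub>1 * D\<^sub>2) * (cmod (?h t a x))\<^sup>2)"
        unfolding sum_distrib_left[symmetric]
        by (simp only: sum_Times_Times[of "\<lambda>i p j q. (cmod (hs (evol t (c' i p)) x * hs (evol t (e' j q)) x))\<^sup>2"])
      finally have "ennreal (\<Sum>i\<in>UNIV. \<Sum>j\<in>UNIV. (cmod (?f t i x * ?g t j x))\<^sup>2) \<le> ennreal (\<Sum>a\<in>?I. real (D\<^sub>1 * D\<^sub>2) * (cmod (?h t a x))\<^sup>2)" by (rule ennreal_leI)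
      also have "\<dots> = (\<Sum>a\<in>?I. ennreal (real (D\<^sub>1 * D\<^sub>2) * (cmod (?h t a x))\<^sup>2))" by (rule sum_ennreal[symmetric]) simp
      finally show ?thesis by (simp only: ennreal_mult' zero_le_power2 of_nat_0_le_iff)
    qed
    have "(\<integral>\<^sup>+t. (field_L2norm (field_mult (P \<alpha> (exp_itH t u)) (P \<beta> (exp_itH t v))))\<^sup>2 \<partial>restrict_space lborel {0..T})
      = (\<integral>\<^sup>+t. (field_L2norm (field_mult (P \<alpha> (exp_itH t u)) (P \<beta> (exp_itH t v))))\<^sup>2 * indicator {0..T} t \<partial>lborel)"
      by (rule nn_integral_restrict_space) auto
    also have "\<dots> \<le> (\<integral>\<^sup>+t. (\<integral>\<^sup>+x. ennreal (\<Sum>i\<in>UNIV. \<Sum>j\<in>UNIV. (cmod (?f t i x * ?g t j x))\<^sup>2) \<partial>lborel) * indicator {0..real m * pi} t \<partial>lborel)"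
    proof (intro nn_integral_mono mult_mono)
      fix t
      have \<theta>: "smooth_step (\<lambda>s. \<eta> (exp s))" by (rule smooth_step_exp[OF \<eta>])
      have "represents (P \<alpha> (exp_itH t u)) (Pc \<alpha> (evol t c))" "represents (P \<beta> (exp_itH t v)) (Pc \<beta> (evol t e))"
        by (rule represents_P[OF \<theta>]; simp add: cu ev)+
      then show "(field_L2norm (field_mult (P \<alpha> (exp_itH t u)) (P \<beta> (exp_itH t v))))\<^sup>2 \<le> (\<integral>\<^sup>+x. ennreal (\<Sum>i\<in>UNIV. \<Sum>j\<in>UNIV. (cmod (?f t i x * ?g t j x))\<^sup>2) \<partial>lborel)"
        by (intro field_L2norm_mult_le) (auto simp: represents_def)
      show "indicator {0..T} t \<le> (indicator {0..real m * pi} t :: ennreal)" using m by (auto split: split_indicator)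
    qed auto
    also have "\<dots> \<le> ennreal (\<Sum>a\<in>?I. real (D\<^sub>1 * D\<^sub>2) * B)"
      by (rule bilinear_sums_le[OF _ bil B0 pt]) auto
    finally have le: "L2t_L2x_norm T (\<lambda>t. field_mult (P \<alpha> (exp_itH t u)) (P \<beta> (exp_itH t v))) \<le> ennreal (sqrt (\<Sum>a\<in>?I. real (D\<^sub>1 * D\<^sub>2) * B))"
      unfolding L2t_L2x_norm_def L2_norm_of_def using B0 by (intro esqrt_le sum_nonneg mult_nonneg_nonneg) auto
    have "(\<Sum>a\<in>?I. real (D\<^sub>1 * D\<^sub>2) * B) = A * (N ^ k\<^sub>1)\<^sup>2 * (M ^ k\<^sub>2)\<^sup>2 * (M ^ n / N) * csq c * csq e"
      unfolding A_def B_def by (simp add: power_mult[symmetric] mult_ac)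
    then have sq: "sqrt (\<Sum>a\<in>?I. real (D\<^sub>1 * D\<^sub>2) * B) = sqrt A * N ^ k\<^sub>1 * M ^ k\<^sub>2 * (sqrt (M ^ n) / sqrt N) * sqrt (csq c) * sqrt (csq e)"
      using N by (simp only: real_sqrt_mult real_sqrt_divide real_sqrt_abs) simp
    \<comment> \<open>Taking the root of the squared estimate turns M^(d-1) / N into the powers of
      the claim.\<close>
    have "M powr ((real CARD('d) - 1) / 2) = (M powr real n) powr (1 / 2)"
      using assms(1) by (simp add: powr_powr n_def of_nat_diff)
    then have "M powr ((real CARD('d) - 1) / 2) / N powr (1 / 2) = sqrt (M ^ n) / sqrt N"
      using N by (simp add: powr_realpow powr_half_sqrt)
    then have "ennreal (sqrt A * N ^ k\<^sub>1 * M ^ k\<^sub>2 * (M powr ((real CARD('d) - 1) / 2) / N powr (1 / 2))) * L2norm u * L2norm v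
      = ennreal (sqrt (\<Sum>a\<in>?I. real (D\<^sub>1 * D\<^sub>2) * B))"
      unfolding sq cu(3) ev(3) using A N by (simp flip: ennreal_mult)
    then show ?thesis using le by simp
  qed
  show ?thesis using main A by (intro exI[of _ "sqrt A"]) auto
qed

end
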